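(* Let $\Omega\subset\mathbb R^d$ ($d\ge1$) be a bounded Lipschitz domain, $T>0$, $\Omega_T=\Omega\times(0,T)$, and let $g\in L^2(0,T;H^1(\Omega,\gamma_d))\cap C([0,T];H)$ with $\partial_tg\in L^2(0,T;V^* )$. Consider the Ornstein--Uhlenbeck problem $$\partial_tu-\operatorname{div}_{\gamma_d}Du=0\ \text{ in }\Omega_T\quad(\operatorname{div}_{\gamma_d}Du=\Delta u-x\cdot Du),\qquad u=g\ \text{ on }(\partial\Omega\times(0,T))\cup(\Omega\times\{0\}).$$ Then this problem has a unique variational solution and a unique energy weak solution, and the two coincide. Moreover, every distributional weak solution is automatically an energy weak solution. Thus the distributional, energy weak, and variational formulations are equivalent in their respective natural classes.
   Context: All functions are real-valued. $\gamma_d$ is the standard Gaussian measure on $\mathbb R^d$, $d\gamma_d(x)=(2\pi)^{-d/2}e^{-|x|^2/2}dx$; $D$ is the weak spatial gradient. $H^1(\Omega,\gamma_d)$ is the set of $u\in L^2(\Omega,\gamma_d)$ with distributional gradient in $L^2(\Omega,\gamma_d)$. Set $V:=H^1_0(\Omega,\gamma_d)$ (closure of $C_c^\infty(\Omega)$ in $H^1(\Omega,\gamma_d)$), $H:=L^2(\Omega,\gamma_d)$, $V^*$ the dual of $V$, with $V\hookrightarrow H\equiv H^*\hookrightarrow V^*$; $\langle\cdot,\cdot\rangle_V$ is the pairing of $V^*$ with $V$. Time derivatives are in the sense of $V^*$-valued distributions. $L^2(0,T;H^1_g(\Omega,\gamma_d))$ denotes the set of $w\in L^2(0,T;H^1(\Omega,\gamma_d))$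 with $w(t)-g(t)\in V$ for a.e. $t$. All three notions of solution concern functions $u\in L^2(0,T;H^1_g(\Omega,\gamma_d))\cap C([0,T];H)$ with $u(\cdot,0)=g(\cdot,0)$ in $H$ (the spatial energy class). Distributional weak solution: $u$ in this class with $$\int_{\Omega_T}u\,\partial_t\varphi\,d\gamma_d\,dt-\int_{\Omega_T}Du\cdot D\varphi\,d\gamma_d\,dt=0\quad\text{for every }\varphi\in C_c^\infty(\Omega_T).$$ Energy weak solution: $u$ in this class with, in addition, $\partial_tu\in L^2(0,T;V^* )$ and $$\int_0^T\langle\partial_tu,\phi\rangle_V\,dt+\int_0^T\!\!\int_\Omega Du\cdot D\phi\,d\gamma_d\,dt=0\quad\text{for every }\phi\in L^2(0,T;V).$$ Variational solution: $u$ in this class such that for every $\tau\in(0,T]$ and every $v\in L^2(0,\tau;H^1_g(\Omega,\gamma_d))$ with $\partial_tv\in L^2(0,\tau;V^* )$, $$\int_0^\tau\langle\partial_tv,v-u\rangle_V\,dt+\tfrac12\int_0^\tau\!\!\int_\Omega(|Dv|^2-|Du|^2)\,d\gamma_d\,dt\ge\tfrac12\|(v-u)(\cdot,\tau)\|_H^2-\tfrac12\|v(\cdot,0)-g(\cdot,0)\|_H^2.$$ (Such $v$ has a representative in $C([0,\tau];H)$, which gives meaning to the endpoint values.) *)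

theory Defs
  imports "HOL-Analysis.Analysis"
begin

text \<open>
  Elements of \<open>L\<^sup>2\<close> and Sobolev spaces are represented by functions, not by equivalence classes.
  Every notion below is invariant under changes on null sets, and equality in
  \<open>H = L\<^sup>2(\<Omega>,\<gamma>)\<close> is equality almost everywhere in \<open>\<Omega>\<close>. Values outside \<open>\<Omega>\<close> are irrelevant.
  A function on \<open>\<Omega> \<times> (0,T)\<close> in a Bochner class is a curve \<open>u :: real \<Rightarrow> 'a \<Rightarrow> real\<close>,
  with \<open>u t\<close> a function of the space variable.
\<close>

subsection \<open>Domains and test functions\<close>

text \<open>
  Near each boundary point, in suitable orthonormal coordinates whose last axis is \<open>e\<close>,
  the set is the part of a ball above the graph of a Lipschitz function \<open>\<eta>\<close> on the hyperplane
  orthogonal to \<open>e\<close>.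
\<close>
definition lipschitz_domain :: "'a::euclidean_space set \<Rightarrow> bool" where
  "lipschitz_domain \<Omega> \<longleftrightarrow> open \<Omega> \<and> connected \<Omega> \<and> \<Omega> \<noteq> {} \<and>
     (\<forall>p\<in>frontier \<Omega>. \<exists>e r L \<eta>. norm e = 1 \<and> 0 < r \<and> L-lipschitz_on {y. y \<bullet> e = 0} \<eta> \<and>
        \<Omega> \<inter> ball p r = {x \<in> ball p r. \<eta> (x - (x \<bullet> e) *\<^sub>R e) < x \<bullet> e})"

primrec Ck :: "nat \<Rightarrow> ('b::euclidean_space \<Rightarrow> real) \<Rightarrow> bool" where
  "Ck 0 f \<longleftrightarrow> continuous_on UNIV f"
| "Ck (Suc k) f \<longleftrightarrow> (\<forall>x. f differentiable (at x)) \<and>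
     (\<forall>i\<in>Basis. Ck k (\<lambda>x. frechet_derivative f (at x) i))"

definition test_functions :: "'b::euclidean_space set \<Rightarrow> ('b \<Rightarrow> real) set" where
  "test_functions U = {\<phi>. (\<forall>k. Ck k \<phi>) \<and>
     compact (closure {x. \<phi> x \<noteq> 0}) \<and> closure {x. \<phi> x \<noteq> 0} \<subseteq> U}"

subsection \<open>Gaussian Lebesgue and Sobolev spaces\<close>

definition gaussian :: "'a::euclidean_space measure" where
  "gaussian = density lebesgue
     (\<lambda>x. ennreal ((2 * pi) powr (- real DIM('a) / 2) * exp (- (norm x)\<^sup>2 / 2)))"

definition gaussian_on :: "'a::euclidean_space set \<Rightarrow> 'a measure" where
  "gaussian_on \<Omega> = restrict_space gaussian \<Omega>"

definition L2_space :: "'a measure \<Rightarrow> ('a \<Rightarrow> 'b::euclidean_space) set" where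
  "L2_space M = {f \<in> borel_measurable M. integrable M (\<lambda>x. (norm (f x))\<^sup>2)}"

definition L2_norm :: "'a measure \<Rightarrow> ('a \<Rightarrow> 'b::euclidean_space) \<Rightarrow> real" where
  "L2_norm M f = sqrt (\<integral>x. (norm (f x))\<^sup>2 \<partial>M)"

definition locally_integrable :: "'a::euclidean_space set \<Rightarrow> ('a \<Rightarrow> 'b::euclidean_space) \<Rightarrow> bool" where
  "locally_integrable \<Omega> f \<longleftrightarrow> (\<forall>K. compact K \<and> K \<subseteq> \<Omega> \<longrightarrow> set_integrable lebesgue K f)"

text \<open>The distributional gradient is taken with respect to Lebesgue measure.\<close>
definition is_weak_gradient :: "'a::euclidean_space set \<Rightarrow> ('a \<Rightarrow> real) \<Rightarrow> ('a \<Rightarrow> 'a) \<Rightarrow> bool" where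
  "is_weak_gradient \<Omega> u G \<longleftrightarrow> locally_integrable \<Omega> u \<and> locally_integrable \<Omega> G \<and>
     (\<forall>\<phi>\<in>test_functions \<Omega>. \<forall>i\<in>Basis.
        (\<integral>x. u x * frechet_derivative \<phi> (at x) i \<partial>lebesgue_on \<Omega>)
          = - (\<integral>x. (G x \<bullet> i) * \<phi> x \<partial>lebesgue_on \<Omega>))"

text \<open>A weak gradient is determined up to null sets; one is chosen.\<close>
definition weak_gradient :: "'a::euclidean_space set \<Rightarrow> ('a \<Rightarrow> real) \<Rightarrow> 'a \<Rightarrow> 'a" where
  "weak_gradient \<Omega> u = (SOME G. is_weak_gradient \<Omega> u G)"

definition H1_space :: "'a::euclidean_space set \<Rightarrow> ('a \<Rightarrow> real) set" where
  "H1_space \<Omega> = {u \<in> L2_space (gaussian_on \<Omega>).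
     \<exists>G \<in> L2_space (gaussian_on \<Omega>). is_weak_gradient \<Omega> u G}"

definition H1_norm :: "'a::euclidean_space set \<Rightarrow> ('a \<Rightarrow> real) \<Rightarrow> real" where
  "H1_norm \<Omega> u = sqrt ((L2_norm (gaussian_on \<Omega>) u)\<^sup>2 +
     (L2_norm (gaussian_on \<Omega>) (weak_gradient \<Omega> u))\<^sup>2)"

text \<open>The space \<open>V\<close>: the closure of the test functions in \<open>H\<^sup>1\<close>.\<close>
definition H10_space :: "'a::euclidean_space set \<Rightarrow> ('a \<Rightarrow> real) set" where
  "H10_space \<Omega> = {u \<in> H1_space \<Omega>. \<forall>\<epsilon>>0. \<exists>\<phi>\<in>test_functions \<Omega>. H1_norm \<Omega> (u - \<phi>) < \<epsilon>}"

text \<open>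
  Functionals in \<open>V\<^sup>*\<close> are defined on all functions, but only their values on \<open>V\<close> matter.
  Boundedness forces them to agree on functions that are equal almost everywhere.
\<close>
definition dual_space :: "'a::euclidean_space set \<Rightarrow> (('a \<Rightarrow> real) \<Rightarrow> real) set" where
  "dual_space \<Omega> = {\<xi>.
     (\<forall>v\<in>H10_space \<Omega>. \<forall>w\<in>H10_space \<Omega>. \<xi> (\<lambda>x. v x + w x) = \<xi> v + \<xi> w) \<and>
     (\<forall>c. \<forall>v\<in>H10_space \<Omega>. \<xi> (\<lambda>x. c * v x) = c * \<xi> v) \<and>
     (\<exists>C. \<forall>v\<in>H10_space \<Omega>. \<bar>\<xi> v\<bar> \<le> C * H1_norm \<Omega> v)}"

definition dual_norm :: "'a::euclidean_space set \<Rightarrow> (('a \<Rightarrow> real) \<Rightarrow> real) \<Rightarrow> real" where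
  "dual_norm \<Omega> \<xi> = (SUP v\<in>{v \<in> H10_space \<Omega>. H1_norm \<Omega> v \<le> 1}. \<bar>\<xi> v\<bar>)"

subsection \<open>Bochner spaces and time derivatives\<close>

text \<open>
  \<open>X\<close> is a space of representatives with seminorm \<open>N\<close>, and the subtraction of curves
  is pointwise subtraction of functions.
\<close>
definition strongly_measurable ::
  "real measure \<Rightarrow> 'b::minus set \<Rightarrow> ('b \<Rightarrow> real) \<Rightarrow> (real \<Rightarrow> 'b) \<Rightarrow> bool" where
  "strongly_measurable M X N f \<longleftrightarrow>
     (\<exists>s :: nat \<Rightarrow> real \<Rightarrow> 'b. (\<forall>n. simple_function M (s n) \<and> s n ` space M \<subseteq> X) \<and>
        (AE t in M. f t \<in> X \<and> (\<lambda>n. N (f t - s n t)) \<longlonglongrightarrow> 0))"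

definition bochner_L2 :: "real \<Rightarrow> 'b::minus set \<Rightarrow> ('b \<Rightarrow> real) \<Rightarrow> (real \<Rightarrow> 'b) set" where
  "bochner_L2 T X N = {f. strongly_measurable (lebesgue_on {0<..<T}) X N f \<and>
     integrable (lebesgue_on {0<..<T}) (\<lambda>t. (N (f t))\<^sup>2)}"

definition L2_H1 :: "'a::euclidean_space set \<Rightarrow> real \<Rightarrow> (real \<Rightarrow> 'a \<Rightarrow> real) set" where
  "L2_H1 \<Omega> T = bochner_L2 T (H1_space \<Omega>) (H1_norm \<Omega>)"

definition L2_V :: "'a::euclidean_space set \<Rightarrow> real \<Rightarrow> (real \<Rightarrow> 'a \<Rightarrow> real) set" where
  "L2_V \<Omega> T = bochner_L2 T (H10_space \<Omega>) (H1_norm \<Omega>)"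

definition L2_Vdual :: "'a::euclidean_space set \<Rightarrow> real \<Rightarrow> (real \<Rightarrow> ('a \<Rightarrow> real) \<Rightarrow> real) set" where
  "L2_Vdual \<Omega> T = bochner_L2 T (dual_space \<Omega>) (dual_norm \<Omega>)"

definition L2_H1g ::
  "'a::euclidean_space set \<Rightarrow> real \<Rightarrow> (real \<Rightarrow> 'a \<Rightarrow> real) \<Rightarrow> (real \<Rightarrow> 'a \<Rightarrow> real) set" where
  "L2_H1g \<Omega> T g = {w \<in> L2_H1 \<Omega> T. AE t in lebesgue_on {0<..<T}. w t - g t \<in> H10_space \<Omega>}"

definition C_H :: "'a::euclidean_space set \<Rightarrow> real \<Rightarrow> (real \<Rightarrow> 'a \<Rightarrow> real) set" where
  "C_H \<Omega> T = {u. \<forall>t\<in>{0..T}. u t \<in> L2_space (gaussian_on \<Omega>) \<and>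
     ((\<lambda>s. L2_norm (gaussian_on \<Omega>) (u s - u t)) \<longlongrightarrow> 0) (at t within {0..T})}"

text \<open>Equality in \<open>C([0,T];H)\<close>.\<close>
definition eq_C_H ::
  "'a::euclidean_space set \<Rightarrow> real \<Rightarrow> (real \<Rightarrow> 'a \<Rightarrow> real) \<Rightarrow> (real \<Rightarrow> 'a \<Rightarrow> real) \<Rightarrow> bool" where
  "eq_C_H \<Omega> T u w \<longleftrightarrow> (\<forall>t\<in>{0..T}. AE x in gaussian_on \<Omega>. u t x = w t x)"

text \<open>
  \<open>\<xi>\<close> lies in \<open>L\<^sup>2(0,T;V\<^sup>*)\<close> and is the derivative of \<open>u\<close> in the sense of \<open>V\<^sup>*\<close>-valued
  distributions on \<open>(0,T)\<close>. The identity \<open>\<integral> \<phi>' u dt = - \<integral> \<phi> \<xi> dt\<close> between Bochner integrals in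
  \<open>V\<^sup>*\<close>, where \<open>u t \<in> H\<close> acts on \<open>V\<close> through the inner product of \<open>H\<close>, is evaluated on each
  \<open>v \<in> V\<close>; evaluation at \<open>v\<close> commutes with the Bochner integral.
\<close>
definition has_time_derivative ::
  "'a::euclidean_space set \<Rightarrow> real \<Rightarrow> (real \<Rightarrow> 'a \<Rightarrow> real) \<Rightarrow>
     (real \<Rightarrow> ('a \<Rightarrow> real) \<Rightarrow> real) \<Rightarrow> bool" where
  "has_time_derivative \<Omega> T u \<xi> \<longleftrightarrow> \<xi> \<in> L2_Vdual \<Omega> T \<and>
     (\<forall>\<phi>\<in>test_functions {0<..<T}. \<forall>v\<in>H10_space \<Omega>.
        (\<integral>t. deriv \<phi> t * (\<integral>x. u t x * v x \<partial>gaussian_on \<Omega>) \<partial>lebesgue_on {0<..<T})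
          = - (\<integral>t. \<phi> t * \<xi> t v \<partial>lebesgue_on {0<..<T}))"

subsection \<open>Notions of solution\<close>

definition energy_class ::
  "'a::euclidean_space set \<Rightarrow> real \<Rightarrow> (real \<Rightarrow> 'a \<Rightarrow> real) \<Rightarrow> (real \<Rightarrow> 'a \<Rightarrow> real) set" where
  "energy_class \<Omega> T g = {u \<in> L2_H1g \<Omega> T g \<inter> C_H \<Omega> T.
     AE x in gaussian_on \<Omega>. u 0 x = g 0 x}"

definition spatial_gradient :: "('a::euclidean_space \<times> real \<Rightarrow> real) \<Rightarrow> 'a \<Rightarrow> real \<Rightarrow> 'a" where
  "spatial_gradient \<phi> x t = (\<Sum>i\<in>Basis. frechet_derivative \<phi> (at (x, t)) (i, 0) *\<^sub>R i)"

text \<open>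
  Integrals over \<open>\<Omega> \<times> (0,T)\<close> are iterated integrals, the form that makes sense for
  Bochner classes, whose representatives need not be jointly measurable.
\<close>
definition distributional_weak_solution ::
  "'a::euclidean_space set \<Rightarrow> real \<Rightarrow> (real \<Rightarrow> 'a \<Rightarrow> real) \<Rightarrow> (real \<Rightarrow> 'a \<Rightarrow> real) \<Rightarrow> bool" where
  "distributional_weak_solution \<Omega> T g u \<longleftrightarrow> u \<in> energy_class \<Omega> T g \<and>
     (\<forall>\<phi>\<in>test_functions (\<Omega> \<times> {0<..<T}).
        (\<integral>t. (\<integral>x. u t x * frechet_derivative \<phi> (at (x, t)) (0, 1) \<partial>gaussian_on \<Omega>)
            \<partial>lebesgue_on {0<..<T})
        - (\<integral>t. (\<integral>x. weak_gradient \<Omega> (u t) x \<bullet> spatial_gradient \<phi> x t \<partial>gaussian_on \<Omega>)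
            \<partial>lebesgue_on {0<..<T}) = 0)"

definition energy_weak_solution ::
  "'a::euclidean_space set \<Rightarrow> real \<Rightarrow> (real \<Rightarrow> 'a \<Rightarrow> real) \<Rightarrow> (real \<Rightarrow> 'a \<Rightarrow> real) \<Rightarrow> bool" where
  "energy_weak_solution \<Omega> T g u \<longleftrightarrow> u \<in> energy_class \<Omega> T g \<and>
     (\<exists>\<xi>. has_time_derivative \<Omega> T u \<xi> \<and>
       (\<forall>\<phi>\<in>L2_V \<Omega> T.
          (\<integral>t. \<xi> t (\<phi> t) \<partial>lebesgue_on {0<..<T})
          + (\<integral>t. (\<integral>x. weak_gradient \<Omega> (u t) x \<bullet> weak_gradient \<Omega> (\<phi> t) x \<partial>gaussian_on \<Omega>)
              \<partial>lebesgue_on {0<..<T}) = 0))"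

text \<open>
  A comparison map \<open>v \<in> L\<^sup>2(0,\<tau>;H\<^sup>1\<^sub>g)\<close> with \<open>\<xi> = \<partial>\<^sub>t v \<in> L\<^sup>2(0,\<tau>;V\<^sup>*)\<close> agrees almost everywhere in
  time with an element of \<open>C([0,\<tau>];H)\<close>. Here \<open>v\<close> is that continuous representative, so that
  \<open>v 0\<close> and \<open>v \<tau>\<close> are the endpoint values; the integrals do not depend on the representative.
\<close>
definition variational_solution ::
  "'a::euclidean_space set \<Rightarrow> real \<Rightarrow> (real \<Rightarrow> 'a \<Rightarrow> real) \<Rightarrow> (real \<Rightarrow> 'a \<Rightarrow> real) \<Rightarrow> bool" where
  "variational_solution \<Omega> T g u \<longleftrightarrow> u \<in> energy_class \<Omega> T g \<and>
     (\<forall>\<tau>\<in>{0<..T}. \<forall>v\<in>L2_H1g \<Omega> \<tau> g \<inter> C_H \<Omega> \<tau>. \<forall>\<xi>. has_time_derivative \<Omega> \<tau> v \<xi> \<longrightarrow>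
        (\<integral>t. \<xi> t (v t - u t) \<partial>lebesgue_on {0<..<\<tau>})
        + 1 / 2 * (\<integral>t. (\<integral>x. (norm (weak_gradient \<Omega> (v t) x))\<^sup>2
                             - (norm (weak_gradient \<Omega> (u t) x))\<^sup>2 \<partial>gaussian_on \<Omega>)
                    \<partial>lebesgue_on {0<..<\<tau>})
        \<ge> 1 / 2 * (L2_norm (gaussian_on \<Omega>) (v \<tau> - u \<tau>))\<^sup>2
          - 1 / 2 * (L2_norm (gaussian_on \<Omega>) (v 0 - g 0))\<^sup>2)"

end

theory Submission
  imports Defs "HOL-Library.Function_Algebras"
begin

text \<open>
  All three formulations are equivalent to the integrated identity
  \<open>(u(t) - u(s), v) = - \<integral>\<^sub>s\<^sup>t (Du, Dv)\<close> for all \<open>v \<in> V\<close>. A distributional solution satisfies it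
  by testing with products of functions of time and of space; conversely, a discrete product rule
  along fine partitions of \<open>[0,T]\<close> recovers all test functions.

  If \<open>u\<close> satisfies it and \<open>v\<close> is a comparison map, the energy identity for \<open>v - u \<in> L\<^sup>2(0,\<tau>;V)\<close>
  gives the variational inequality with the surplus \<open>\<integral> |D(v - u)|\<^sup>2 / 2\<close>. Testing the inequality of a
  variational solution with an energy solution identifies the two, so that uniqueness follows from
  existence.

  For existence, consider \<open>z' + B z = f\<close> in \<open>V\<^sup>*\<close> with \<open>B\<close> the Riesz isomorphism of \<open>V\<close>. The
  right-hand sides of solutions with \<open>z' \<in> L\<^sup>2(0,T;V)\<close> are dense by an orthogonality argument, and
  the a priori estimate makes the solutions converge. The energy identity passes to the limit,
  and by uniqueness for the homogeneous problem it holds for every element of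
  \<open>L\<^sup>2(0,T;V) \<inter> C([0,T];H)\<close> with derivative in \<open>L\<^sup>2(0,T;V\<^sup>*)\<close>.
\<close>

text \<open>Functions stand for their classes, so every norm is a seminorm and limits are unique
  only up to null elements. Hilbert space theory is therefore built for a semi-inner product on a
  carrier set. Pointwise scaling turns curves into vectors too, and the Bochner spaces become
  instances of the same theory. Dual-valued curves need no integral of their own: the Riesz map
  sends them to curves in \<open>V\<close>, and primitives are defined by testing. The obstacle is
  the energy identity. The product rule needs the derivative of one factor to act on a space into
  which the other factor is continuous. A curve that is continuous into \<open>H\<close> but whose
  derivative lies only in the dual of \<open>V\<close> violates this. Solutions with derivative in
  \<open>V\<close> satisfy the requirement, and every other curve is reached from them by density,
  the estimate and uniqueness. The uniqueness step must then do without the identity; it works in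
  the weaker norm obtained by applying the inverse of the operator. The operator behind the inner
  product of H1 is z - div Dz, not - div Dz. An exponential factor in time removes the extra
  zero-order term.\<close>

instantiation "fun" :: (type, real_vector) real_vector
begin

definition scaleR_fun :: "real \<Rightarrow> ('a \<Rightarrow> 'b) \<Rightarrow> 'a \<Rightarrow> 'b" where
  "scaleR_fun c f = (\<lambda>x. c *\<^sub>R f x)"
instance
  by standard (auto simp: scaleR_fun_def fun_eq_iff algebra_simps)
end

lemma scaleR_fun_apply [simp]: "(c *\<^sub>R f) x = c *\<^sub>R f x"
  by (simp add: scaleR_fun_def)

text \<open>The discriminant criterion. The degenerate case \<open>c = 0\<close> must be included
  because a nonzero vector may have seminorm zero.\<close>

lemma quadratic_nonneg_imp:
  fixes a b c :: real
  assumes q: "\<And>t. 0 \<le> a + 2 * t * b + t\<^sup>2 * c" and "0 \<le> c"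
  shows "b\<^sup>2 \<le> a * c"
proof (cases "c = 0")
  case True
  have "b = 0"
  proof (rule ccontr)
    assume "b \<noteq> 0"
    \<comment> \<open>At this \<open>t\<close> the affine function \<open>a + 2 * t * b\<close>
      takes the value -1.\<close>
    then show False using q[of "-(a + 1) / (2 * b)"] True by (simp add: field_simps)
  qed
  then show ?thesis using True by simp
next
  case False
  then have "0 < c" using assms by simp
  then show ?thesis using q[of "- b / c"]
    by (simp add: field_simps power2_eq_square)
qed

subsection \<open>Semi-inner product spaces of representatives\<close>

text \<open>Definiteness is left out because functions that agree almost everywhere are different
  elements. The carrier \<open>S\<close> is needed because the type contains functions on which
  \<open>ip\<close> means nothing, so every law is relative to \<open>S\<close>.\<close>

locale semi_inner =
  fixes S :: "'v::real_vector set" and ip :: "'v \<Rightarrow> 'v \<Rightarrow> real"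
  assumes subspace: "subspace S"
    and ip_sym: "x \<in> S \<Longrightarrow> y \<in> S \<Longrightarrow> ip x y = ip y x"
    and ip_add_left: "x \<in> S \<Longrightarrow> y \<in> S \<Longrightarrow> z \<in> S \<Longrightarrow> ip (x + y) z = ip x z + ip y z"
    and ip_scale_left: "x \<in> S \<Longrightarrow> y \<in> S \<Longrightarrow> ip (c *\<^sub>R x) y = c * ip x y"
    and ip_nonneg: "x \<in> S \<Longrightarrow> 0 \<le> ip x x"
begin

definition nm :: "'v \<Rightarrow> real" where "nm x = sqrt (ip x x)"

lemma add_mem: "x \<in> S \<Longrightarrow> y \<in> S \<Longrightarrow> x + y \<in> S"
  and scale_mem: "x \<in> S \<Longrightarrow> c *\<^sub>R x \<in> S"
  and zero_mem: "0 \<in> S"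
  and diff_mem: "x \<in> S \<Longrightarrow> y \<in> S \<Longrightarrow> x - y \<in> S"
  and minus_mem: "x \<in> S \<Longrightarrow> - x \<in> S"
  using subspace by (auto simp: subspace_add subspace_scale subspace_0 subspace_diff subspace_neg)

lemmas mem_intros = add_mem scale_mem zero_mem diff_mem minus_mem

lemma ip_minus_left: "x \<in> S \<Longrightarrow> y \<in> S \<Longrightarrow> ip (- x) y = - ip x y"
  using ip_scale_left[of x y "-1"] by simp

lemma ip_diff_left: "x \<in> S \<Longrightarrow> y \<in> S \<Longrightarrow> z \<in> S \<Longrightarrow> ip (x - y) z = ip x z - ip y z"
  using ip_add_left[of x "- y" z] ip_minus_left[of y z] by (simp add: minus_mem)

lemma ip_zero_left: "x \<in> S \<Longrightarrow> ip 0 x = 0"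
  using ip_scale_left[of x x 0] by simp

lemma ip_add_right: "x \<in> S \<Longrightarrow> y \<in> S \<Longrightarrow> z \<in> S \<Longrightarrow> ip z (x + y) = ip z x + ip z y"
  by (metis add_mem ip_add_left ip_sym)

lemma ip_scale_right: "x \<in> S \<Longrightarrow> y \<in> S \<Longrightarrow> ip y (c *\<^sub>R x) = c * ip y x"
  by (metis scale_mem ip_scale_left ip_sym)

lemma ip_diff_right: "x \<in> S \<Longrightarrow> y \<in> S \<Longrightarrow> z \<in> S \<Longrightarrow> ip z (x - y) = ip z x - ip z y"
  by (metis diff_mem ip_diff_left ip_sym)

lemma ip_minus_right: "x \<in> S \<Longrightarrow> y \<in> S \<Longrightarrow> ip y (- x) = - ip y x"
  by (metis minus_mem ip_minus_left ip_sym)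

lemma ip_zero_right: "x \<in> S \<Longrightarrow> ip x 0 = 0"
  by (metis zero_mem ip_zero_left ip_sym)

lemmas ip_simps = ip_add_left ip_scale_left ip_minus_left ip_diff_left ip_zero_left
  ip_add_right ip_scale_right ip_minus_right ip_diff_right ip_zero_right

lemma nm_nonneg: "x \<in> S \<Longrightarrow> 0 \<le> nm x"
  by (simp add: nm_def ip_nonneg)

lemma nm_sq: "x \<in> S \<Longrightarrow> (nm x)\<^sup>2 = ip x x"
  by (simp add: nm_def ip_nonneg)

lemma nm_zero: "nm 0 = 0"
  by (simp add: nm_def ip_zero_left zero_mem)

lemma nm_scale: "x \<in> S \<Longrightarrow> nm (c *\<^sub>R x) = \<bar>c\<bar> * nm x"
  by (simp add: nm_def ip_simps scale_mem real_sqrt_mult flip: mult.assoc)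

lemma ip_sum_expand:
  "x \<in> S \<Longrightarrow> y \<in> S \<Longrightarrow> ip (x + y) (x + y) = ip x x + 2 * ip x y + ip y y"
  by (simp add: ip_simps mem_intros ip_sym)

lemma ip_diff_expand:
  "x \<in> S \<Longrightarrow> y \<in> S \<Longrightarrow> ip (x - y) (x - y) = ip x x - 2 * ip x y + ip y y"
  by (simp add: ip_simps mem_intros ip_sym)

lemma cauchy_schwarz:
  assumes "x \<in> S" "y \<in> S"
  shows "\<bar>ip x y\<bar> \<le> nm x * nm y"
proof -
  have "(ip x y)\<^sup>2 \<le> ip x x * ip y y"
  proof (rule quadratic_nonneg_imp)
    fix t
    have "0 \<le> ip (x + t *\<^sub>R y) (x + t *\<^sub>R y)" using assms by (intro ip_nonneg mem_intros)
    also have "\<dots> = ip x x + 2 * t * ip x y + t\<^sup>2 * ip y y"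
      using assms ip_sym[of x y] by (simp add: ip_sum_expand ip_simps mem_intros power2_eq_square algebra_simps)
    finally show "0 \<le> ip x x + 2 * t * ip x y + t\<^sup>2 * ip y y" .
  qed (simp add: ip_nonneg assms)
  then show ?thesis using real_sqrt_le_mono unfolding nm_def
    by (simp flip: real_sqrt_mult) (metis real_sqrt_abs real_sqrt_le_mono)
qed

lemma cauchy_schwarz': "x \<in> S \<Longrightarrow> y \<in> S \<Longrightarrow> ip x y \<le> nm x * nm y"
  using cauchy_schwarz by fastforce

lemma nm_triangle:
  assumes "x \<in> S" "y \<in> S"
  shows "nm (x + y) \<le> nm x + nm y"
proof (rule power2_le_imp_le)
  show "(nm (x + y))\<^sup>2 \<le> (nm x + nm y)\<^sup>2"
    using assms cauchy_schwarz'[OF assms] by (simp add: nm_sq mem_intros ip_sum_expand power2_sum)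
qed (use assms in \<open>simp add: nm_nonneg\<close>)

lemma nm_minus: "x \<in> S \<Longrightarrow> nm (- x) = nm x"
  using nm_scale[of x "-1"] by simp

lemma nm_commute: "x \<in> S \<Longrightarrow> y \<in> S \<Longrightarrow> nm (x - y) = nm (y - x)"
  using nm_minus[of "x - y"] by (simp add: mem_intros)

lemma nm_triangle_diff: "x \<in> S \<Longrightarrow> y \<in> S \<Longrightarrow> nm (x - y) \<le> nm x + nm y"
  using nm_triangle[of x "- y"] nm_minus[of y] by (simp add: mem_intros)

lemma nm_triangle3: "x \<in> S \<Longrightarrow> y \<in> S \<Longrightarrow> z \<in> S \<Longrightarrow> nm (x - z) \<le> nm (x - y) + nm (y - z)"
  using nm_triangle[of "x - y" "y - z"] by (simp add: mem_intros)

lemma nm_abs_diff: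
  assumes "x \<in> S" "y \<in> S"
  shows "\<bar>nm x - nm y\<bar> \<le> nm (x - y)"
  using nm_triangle[of "x - y" y] nm_triangle[of "y - x" x] nm_commute[of x y] assms
  by (simp add: mem_intros abs_le_iff)

lemma ip_null: "x \<in> S \<Longrightarrow> y \<in> S \<Longrightarrow> nm x = 0 \<Longrightarrow> ip x y = 0"
  using cauchy_schwarz[of x y] by simp

lemma ip_tendsto:
  assumes "\<And>n. X n \<in> S" "x \<in> S" "(\<lambda>n. nm (X n - x)) \<longlonglongrightarrow> 0"
    and "\<And>n. Y n \<in> S" "y \<in> S" "(\<lambda>n. nm (Y n - y)) \<longlonglongrightarrow> 0"
  shows "(\<lambda>n. ip (X n) (Y n)) \<longlonglongrightarrow> ip x y"
proof (rule LIM_zero_cancel, rule Lim_null_comparison)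
  show "(\<lambda>n. nm (X n - x) * nm (Y n - y) + nm x * nm (Y n - y) + nm (X n - x) * nm y) \<longlonglongrightarrow> 0"
    using assms(3,6) by (auto intro!: tendsto_eq_intros)
  have "\<bar>ip (X n) (Y n) - ip x y\<bar> \<le>
      nm (X n - x) * nm (Y n - y) + nm x * nm (Y n - y) + nm (X n - x) * nm y" for n
  proof -
    have "ip (X n) (Y n) - ip x y = ip (X n - x) (Y n - y) + ip x (Y n - y) + ip (X n - x) y"
      using assms by (simp add: ip_simps mem_intros)
    then show ?thesis
      using cauchy_schwarz[of "X n - x" "Y n - y"] cauchy_schwarz[of x "Y n - y"]
        cauchy_schwarz[of "X n - x" y] assms by (simp add: mem_intros)
  qed
  then show "\<forall>\<^sub>F n in sequentially. norm (ip (X n) (Y n) - ip x y) \<le>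
      nm (X n - x) * nm (Y n - y) + nm x * nm (Y n - y) + nm (X n - x) * nm y" by simp
qed

lemma nm_tendsto:
  assumes "\<And>n. X n \<in> S" "x \<in> S" "(\<lambda>n. nm (X n - x)) \<longlonglongrightarrow> 0"
  shows "(\<lambda>n. nm (X n)) \<longlonglongrightarrow> nm x"
  unfolding nm_def by (intro tendsto_real_sqrt ip_tendsto assms)

text \<open>The ratio 1/8 is chosen for the completeness proofs: squared increments are then at most
  \<open>(1/64)^n\<close>, which survives multiplication by the weight \<open>2^n\<close>.\<close>

lemma rapid_bound:
  assumes X: "\<And>n. X n \<in> S" and r: "\<And>n. nm (X (Suc n) - X n) \<le> (1/8)^n" and "n \<le> m"
  shows "nm (X m - X n) \<le> 2 * (1/8)^n"
proof -
  \<comment> \<open>The subtracted term closes the induction: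
    \<open>2 * (1/8)^j - 2 * (1/8)^(j+1)\<close> is 7/4 of \<open>(1/8)^j\<close>, more than one
    increment.\<close>
  have "nm (X (n + k) - X n) \<le> 2 * (1/8)^n - 2 * (1/8)^(n + k)" for k
  proof (induction k)
    case 0
    then show ?case by (simp add: nm_zero)
  next
    case (Suc k)
    have "nm (X (n + Suc k) - X n) \<le> nm (X (Suc (n + k)) - X (n + k)) + nm (X (n + k) - X n)"
      using nm_triangle3[of "X (Suc (n + k))" "X (n + k)" "X n"] X by simp
    also have "\<dots> \<le> (1/8)^(n + k) + (2 * (1/8)^n - 2 * (1/8)^(n + k))"
      using Suc r[of "n + k"] by linarith
    also have "\<dots> \<le> 2 * (1/8)^n - 2 * (1/8)^(n + Suc k)" by simp
    finally show ?case .
  qed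
  from this[of "m - n"] have "nm (X m - X n) \<le> 2 * (1/8)^n - 2 * (1/8)^m" using \<open>n \<le> m\<close> by simp
  moreover have "(0::real) \<le> 2 * (1/8)^m" by simp
  ultimately show ?thesis by linarith
qed

end

locale semi_hilbert = semi_inner +
  assumes complete: "(\<And>n. X n \<in> S) \<Longrightarrow> (\<And>e. 0 < e \<Longrightarrow> \<exists>M. \<forall>m\<ge>M. \<forall>n\<ge>M. nm (X m - X n) < e) \<Longrightarrow>
    \<exists>x\<in>S. (\<lambda>n. nm (X n - x)) \<longlonglongrightarrow> 0"

text \<open>A Cauchy sequence converges as soon as a subsequence does, so completeness has to be
  checked only for sequences with geometrically small increments.\<close>

lemma (in semi_inner) semi_hilbertI:
  assumes rapid: "\<And>X. (\<And>n. X n \<in> S) \<Longrightarrow> (\<And>n. nm (X (Suc n) - X n) \<le> (1/8)^n) \<Longrightarrow>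
    \<exists>x\<in>S. (\<lambda>n. nm (X n - x)) \<longlonglongrightarrow> 0"
  shows "semi_hilbert S ip"
proof
  fix X :: "nat \<Rightarrow> 'v"
  assume X: "\<And>n. X n \<in> S" and c: "\<And>e. 0 < e \<Longrightarrow> \<exists>M. \<forall>m\<ge>M. \<forall>n\<ge>M. nm (X m - X n) < e"
  have "\<forall>k. \<exists>M. \<forall>m\<ge>M. \<forall>n\<ge>M. nm (X m - X n) < (1/8)^k" using c by simp
  then obtain N where N: "\<And>k m n. m \<ge> N k \<Longrightarrow> n \<ge> N k \<Longrightarrow> nm (X m - X n) < (1/8)^k" by metis
  \<comment> \<open>Partial sums dominate \<open>N k\<close> at both indices \<open>k\<close> and
    \<open>k + 1\<close>, which is all that the increment bound needs.\<close>
  define r where "r k = (\<Sum>i\<le>k. N i)" for k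
  have r: "r k \<ge> N k" for k unfolding r_def by (cases k) auto
  have "r (Suc k) \<ge> N k" for k using r[of k] unfolding r_def by simp
  then have "nm (X (r (Suc k)) - X (r k)) \<le> (1/8)^k" for k using N[of k] r[of k] by (meson less_imp_le)
  then obtain x where x: "x \<in> S" "(\<lambda>n. nm (X (r n) - x)) \<longlonglongrightarrow> 0"
    using rapid[of "\<lambda>k. X (r k)"] X by blast
  have "(\<lambda>n. nm (X n - x)) \<longlonglongrightarrow> 0"
  proof (rule LIMSEQ_I)
    fix e :: real assume "0 < e"
    then have "\<forall>\<^sub>F k in sequentially. nm (X (r k) - x) < e / 2"
      using order_tendstoD(2)[OF x(2)] half_gt_zero by blast
    moreover have "(\<lambda>k. (1/8::real)^k) \<longlonglongrightarrow> 0" by (rule LIMSEQ_realpow_zero) auto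
    then have "\<forall>\<^sub>F k in sequentially. (1/8::real)^k < e / 2"
      using order_tendstoD(2) \<open>0 < e\<close> by (metis half_gt_zero)
    ultimately have "\<forall>\<^sub>F k in sequentially. nm (X (r k) - x) < e / 2 \<and> (1/8::real)^k < e / 2"
      by eventually_elim auto
    then obtain k where k: "nm (X (r k) - x) < e / 2" "(1/8::real)^k < e / 2"
      by (metis (mono_tags, lifting) eventually_sequentially order_refl)
    have "norm (nm (X n - x) - 0) < e" if "n \<ge> N k" for n
      using nm_triangle3[of "X n" "X (r k)" x] N[OF that r] k X x(1)
        nm_nonneg[of "X n - x"] by (simp add: mem_intros)
    then show "\<exists>no. \<forall>n\<ge>no. norm (nm (X n - x) - 0) < e" by blast
  qed
  then show "\<exists>x\<in>S. (\<lambda>n. nm (X n - x)) \<longlonglongrightarrow> 0" using x(1) by blast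
qed

context semi_hilbert
begin

text \<open>
  Minimising \<open>ip v v - 2 * l v\<close> over \<open>K\<close> (which need not be closed) gives both the Riesz
  representation theorem and the density criterion below.
\<close>
lemma quadratic_minimization:
  assumes K: "K \<subseteq> S" "subspace K"
    and add: "\<And>x y. x \<in> K \<Longrightarrow> y \<in> K \<Longrightarrow> l (x + y) = l x + l y"
    and scale: "\<And>c x. x \<in> K \<Longrightarrow> l (c *\<^sub>R x) = c * l x"
    and bd: "\<And>x. x \<in> K \<Longrightarrow> \<bar>l x\<bar> \<le> C * nm x"
  obtains r X where "r \<in> S" "\<And>n. X n \<in> K" "(\<lambda>n. nm (X n - r)) \<longlonglongrightarrow> 0"
    "\<And>v. v \<in> K \<Longrightarrow> ip r v = l v"
proof -
  define J where "J v = ip v v - 2 * l v" for v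
  have KS: "x \<in> S" if "x \<in> K" for x using K that by auto
  have Kadd: "x + y \<in> K" if "x \<in> K" "y \<in> K" for x y using that K(2) by (simp add: subspace_add)
  have Ksc: "c *\<^sub>R x \<in> K" if "x \<in> K" for x c using that K(2) by (simp add: subspace_scale)
  have lower: "- C\<^sup>2 \<le> J v" if "v \<in> K" for v
  proof -
    have "0 \<le> (nm v - C)\<^sup>2" by simp
    then show ?thesis using bd[OF that] nm_sq[OF KS[OF that]]
      by (simp add: J_def power2_diff algebra_simps abs_le_iff)
  qed
  define m where "m = (INF v\<in>K. J v)"
  have bdd: "bdd_below (J ` K)" using lower by (rule bdd_belowI2)
  have mle: "m \<le> J v" if "v \<in> K" for v unfolding m_def by (rule cINF_lower[OF bdd that])
  have ne: "K \<noteq> {}" using K(2) subspace_0 by auto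
  have "\<exists>v\<in>K. J v < m + 1 / real (Suc n)" for n
    using cINF_less_iff[OF ne bdd, of "m + 1 / real (Suc n)"] by (simp add: m_def)
  then obtain X where X: "\<And>n. X n \<in> K" "\<And>n. J (X n) < m + 1 / real (Suc n)" by metis
  \<comment> \<open>The parallelogram identity at the midpoint: the value of \<open>J\<close> there
    is at least \<open>m\<close>, while both ends exceed \<open>m\<close> by less than the stated
    errors. A minimising sequence is therefore Cauchy.\<close>
  have dist: "(nm (X a - X b))\<^sup>2 \<le> 2 / real (Suc a) + 2 / real (Suc b)" for a b
  proof -
    let ?mid = "(1/2) *\<^sub>R (X a + X b)"
    have S: "X a \<in> S" "X b \<in> S" using X(1) KS by auto
    have "m \<le> J ?mid" by (intro mle Ksc Kadd X)
    moreover have "l ?mid = (1/2) * (l (X a) + l (X b))"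
      using scale[OF Kadd[OF X(1) X(1)], of "1/2" a b] add[OF X(1) X(1), of a b] by simp
    then have "J ?mid = (ip (X a) (X a) + 2 * ip (X a) (X b) + ip (X b) (X b)) / 4 - (l (X a) + l (X b))"
      using S ip_sym[of "X a" "X b"] by (simp add: J_def ip_simps mem_intros field_simps)
    moreover have "2 / real (Suc a) = 2 * (1 / real (Suc a))" "2 / real (Suc b) = 2 * (1 / real (Suc b))"
      by auto
    moreover have "J (X a) = ip (X a) (X a) - 2 * l (X a)" "J (X b) = ip (X b) (X b) - 2 * l (X b)"
      by (auto simp: J_def)
    ultimately show ?thesis using X(2)[of a] X(2)[of b]
      unfolding nm_sq[OF diff_mem[OF S]] ip_diff_expand[OF S] by argo
  qed
  have XS: "X n \<in> S" for n using X KS by auto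
  obtain r where r: "r \<in> S" "(\<lambda>n. nm (X n - r)) \<longlonglongrightarrow> 0"
  proof -
    have "\<exists>M. \<forall>m\<ge>M. \<forall>n\<ge>M. nm (X m - X n) < e" if e: "0 < e" for e
    proof -
      \<comment> \<open>Beyond index \<open>M\<close> the two errors in \<open>dist\<close> add up
        to at most \<open>4 / M\<close>, which is below the square of \<open>e\<close>.\<close>
      obtain M :: nat where M: "4 / e\<^sup>2 < real M" using reals_Archimedean2 by blast
      have "nm (X p - X q) < e" if "p \<ge> M" "q \<ge> M" for p q
      proof -
        have "0 < 4 / e\<^sup>2" using e by simp
        then have M0: "0 < real M" using M by linarith
        have 1: "2 / real (Suc p) \<le> 2 / real M" "2 / real (Suc q) \<le> 2 / real M"
          using that M0 by (auto intro!: divide_left_mono mult_pos_pos)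
        have "4 / real M < e\<^sup>2" using M M0 e by (simp add: field_simps)
        then have "(nm (X p - X q))\<^sup>2 < e\<^sup>2" using dist[of p q] 1 by linarith
        then show ?thesis using e by (simp add: power2_less_imp_less)
      qed
      then show ?thesis by blast
    qed
    then show thesis using complete[of X, OF XS] that by blast
  qed
  have "ip r v = l v" if v: "v \<in> K" for v
  proof -
    have vS: "v \<in> S" using v KS by auto
    have lim: "(\<lambda>n. ip (X n) v) \<longlonglongrightarrow> ip r v"
      by (rule ip_tendsto) (use XS r vS in \<open>auto simp: nm_zero\<close>)
    \<comment> \<open>The first-order condition at the minimum, read off from a quadratic in
      \<open>t\<close> with constant term zero.\<close>
    have "(ip r v - l v)\<^sup>2 \<le> 0 * ip v v"
    proof (rule quadratic_nonneg_imp)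
      fix t :: real
      \<comment> \<open>The variation is made at \<open>X n\<close>, not at the limit
        \<open>r\<close>: \<open>r\<close> may lie outside \<open>K\<close>, where \<open>l\<close>
        is not controlled. The near-minimality of \<open>X n\<close> costs an error that vanishes in
        the limit.\<close>
      have "- (1 / real (Suc n)) \<le> 2 * t * (ip (X n) v - l v) + t\<^sup>2 * ip v v" for n
      proof -
        have "m \<le> J (X n + t *\<^sub>R v)" by (intro mle Kadd Ksc X v)
        moreover have "J (X n + t *\<^sub>R v) = J (X n) + (2 * t * (ip (X n) v - l v) + t\<^sup>2 * ip v v)"
          using XS[of n] vS X(1)[of n] v ip_sym[OF XS vS, of n] unfolding J_def
          by (simp add: ip_sum_expand ip_simps mem_intros add scale Ksc power2_eq_square algebra_simps)
        ultimately show ?thesis using X(2)[of n] by linarith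
      qed
      moreover have "(\<lambda>n. - (1 / real (Suc n))) \<longlonglongrightarrow> 0"
        using tendsto_minus[OF LIMSEQ_inverse_real_of_nat] by (simp add: inverse_eq_divide)
      moreover have "(\<lambda>n. 2 * t * (ip (X n) v - l v) + t\<^sup>2 * ip v v) \<longlonglongrightarrow>
          2 * t * (ip r v - l v) + t\<^sup>2 * ip v v"
        by (intro tendsto_intros lim)
      ultimately have "0 \<le> 2 * t * (ip r v - l v) + t\<^sup>2 * ip v v"
        by (intro LIMSEQ_le) auto
      then show "0 \<le> 0 + 2 * t * (ip r v - l v) + t\<^sup>2 * ip v v" by simp
    qed (simp add: ip_nonneg vS)
    then show ?thesis by simp
  qed
  then show thesis using that r X(1) by blast
qed

lemma riesz:
  assumes "\<And>x y. x \<in> S \<Longrightarrow> y \<in> S \<Longrightarrow> l (x + y) = l x + l y"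
    and "\<And>c x. x \<in> S \<Longrightarrow> l (c *\<^sub>R x) = c * l x"
    and "\<And>x. x \<in> S \<Longrightarrow> \<bar>l x\<bar> \<le> C * nm x"
  obtains r where "r \<in> S" "\<And>v. v \<in> S \<Longrightarrow> ip r v = l v"
  by (rule quadratic_minimization[of S l C, OF order_refl subspace assms]) (use that in auto)

text \<open>Minimisation for the functional \<open>ip f\<close> produces the projection
  \<open>r\<close> of \<open>f\<close> onto the closure of \<open>K\<close>. The remainder
  \<open>f - r\<close> is orthogonal to \<open>K\<close>, hence null by \<open>orth\<close>, so the
  minimising sequence itself approximates \<open>f\<close>.\<close>

lemma density:
  assumes K: "K \<subseteq> S" "subspace K"
    and orth: "\<And>p. p \<in> S \<Longrightarrow> (\<And>k. k \<in> K \<Longrightarrow> ip p k = 0) \<Longrightarrow> nm p = 0"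
    and f: "f \<in> S" and e: "0 < e"
  obtains k where "k \<in> K" "nm (f - k) < e"
proof -
  obtain r X where r: "r \<in> S" "\<And>n. X n \<in> K" "(\<lambda>n. nm (X n - r)) \<longlonglongrightarrow> 0"
    "\<And>v. v \<in> K \<Longrightarrow> ip r v = ip f v"
  proof (rule quadratic_minimization[OF K, of "ip f" "nm f"])
    show "\<bar>ip f x\<bar> \<le> nm f * nm x" if "x \<in> K" for x using that K f by (intro cauchy_schwarz) auto
  qed (use K f in \<open>auto simp: ip_simps subset_iff\<close>)
  have "nm (f - r) = 0"
    using K by (intro orth) (auto simp: r f ip_simps mem_intros subset_iff)
  have "\<forall>\<^sub>F n in sequentially. nm (X n - r) < e" using order_tendstoD(2)[OF r(3) e] .
  then obtain n where n: "nm (X n - r) < e" by (auto simp: eventually_sequentially)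
  have "X n \<in> S" using r K by auto
  then have "nm (f - X n) \<le> nm (f - r) + nm (X n - r)"
    using nm_triangle3[of f r "X n"] nm_commute[of r "X n"] f r(1) by simp
  then show thesis using that[of "X n"] r(2) n \<open>nm (f - r) = 0\<close> by simp
qed

end

subsection \<open>Completeness of \<open>L\<^sup>2\<close>\<close>

text \<open>Weighting the squares by \<open>2^k\<close> keeps the sum of their integrals finite,
  being at most the sum of \<open>(1/32)^k\<close>. Almost everywhere the weighted squares are then
  summable, and Young's inequality with the same weight passes from squares to absolute
  values.\<close>

lemma rapid_summable_AE:
  fixes h :: "nat \<Rightarrow> 'a \<Rightarrow> real"
  assumes [measurable]: "\<And>k. h k \<in> borel_measurable M"
    and int: "\<And>k. integrable M (\<lambda>x. (h k x)\<^sup>2)" and le: "\<And>k. (\<integral>x. (h k x)\<^sup>2 \<partial>M) \<le> (1/64)^k"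
  shows "AE x in M. summable (\<lambda>k. \<bar>h k x\<bar>)"
proof -
  have "(\<integral>\<^sup>+x. (\<Sum>k. ennreal (2^k * (h k x)\<^sup>2)) \<partial>M) = (\<Sum>k. \<integral>\<^sup>+x. ennreal (2^k * (h k x)\<^sup>2) \<partial>M)"
    by (rule nn_integral_suminf) measurable
  also have "\<dots> = (\<Sum>k. ennreal (2^k * (\<integral>x. (h k x)\<^sup>2 \<partial>M)))"
    using int by (intro suminf_cong) (subst nn_integral_eq_integral, auto)
  also have "\<dots> \<le> (\<Sum>k. ennreal ((1/32)^k))"
  proof (intro suminf_le ennreal_leI)
    fix k
    have "2^k * (\<integral>x. (h k x)\<^sup>2 \<partial>M) \<le> 2^k * (1/64)^k" using le by (intro mult_left_mono) auto
    also have "\<dots> = (1/32)^k" by (simp flip: power_mult_distrib)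
    finally show "2^k * (\<integral>x. (h k x)\<^sup>2 \<partial>M) \<le> (1/32)^k" .
  qed auto
  also have "\<dots> = ennreal (\<Sum>k. (1/32)^k)"
    by (intro suminf_ennreal2) (auto intro: summable_geometric)
  also have "\<dots> < \<infinity>" by simp
  finally have "AE x in M. (\<Sum>k. ennreal (2^k * (h k x)\<^sup>2)) \<noteq> \<infinity>"
    by (intro nn_integral_PInf_AE) auto
  then show ?thesis
  proof eventually_elim
    case (elim x)
    have "summable (\<lambda>k. 2^k * (h k x)\<^sup>2)"
      using elim by (intro summable_suminf_not_top) auto
    then have "summable (\<lambda>k. (1/2)^k + 2^k * (h k x)\<^sup>2)"
      by (intro summable_add summable_geometric) auto
    moreover have "norm \<bar>h n x\<bar> \<le> (1/2)^n + 2^n * (h n x)\<^sup>2" for n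
    proof -
      \<comment> \<open>Only the square of \<open>2^n * \<bar>h n x\<bar> - 1\<close> matters here;
        the second summand carries a factor 0.\<close>
      have "0 \<le> (1/2)^n * ((2^n * \<bar>h n x\<bar> - 1)\<^sup>2 + 2^n * (2^n * \<bar>h n x\<bar>\<^sup>2) * 0)" by simp
      also have "\<dots> = ((1/2)^n * 2^n) * (2^n * (h n x)\<^sup>2) - 2 * ((1/2)^n * 2^n) * \<bar>h n x\<bar> + (1/2)^n"
        by (simp add: power2_eq_square algebra_simps)
      also have "(1/2)^n * 2^n = (1::real)" by (simp flip: power_mult_distrib)
      finally have "2 * \<bar>h n x\<bar> \<le> (1/2)^n + 2^n * (h n x)\<^sup>2" by simp
      then show ?thesis by simp
    qed
    ultimately show ?case by (rule summable_comparison_test')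
  qed
qed

text \<open>Fatou's lemma in the form used for completeness: a bound on the distance from one member
  to all later members of a sequence passes to the pointwise limit, and integrability of the limit
  comes with it.\<close>

lemma fatou_bound:
  fixes f :: "nat \<Rightarrow> 'a \<Rightarrow> real"
  assumes int: "\<And>n. integrable M (f n)" and pos: "\<And>n. AE x in M. 0 \<le> f n x"
    and le: "\<And>n. (\<integral>x. f n x \<partial>M) \<le> C" and lim: "AE x in M. (\<lambda>n. f n x) \<longlonglongrightarrow> g x"
    and [measurable]: "g \<in> borel_measurable M"
  shows "integrable M g" and "(\<integral>x. g x \<partial>M) \<le> C"
proof -
  have pos': "AE x in M. \<forall>n. 0 \<le> f n x" using pos by (simp add: AE_all_countable)
  have g0: "AE x in M. 0 \<le> g x"
    using pos' lim by eventually_elim (auto intro: LIMSEQ_le_const)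
  have [measurable]: "f n \<in> borel_measurable M" for n using int by auto
  have C: "0 \<le> C" using le[of 0] integral_nonneg_AE[OF pos[of 0]] by linarith
  have "(\<integral>\<^sup>+x. ennreal (g x) \<partial>M) = (\<integral>\<^sup>+x. liminf (\<lambda>n. ennreal (f n x)) \<partial>M)"
  proof (intro nn_integral_cong_AE, use lim in eventually_elim)
    case (elim x)
    then have "(\<lambda>n. ennreal (f n x)) \<longlonglongrightarrow> ennreal (g x)" by (rule tendsto_ennrealI)
    from lim_imp_Liminf[OF _ this] show ?case by simp
  qed
  also have "\<dots> \<le> liminf (\<lambda>n. \<integral>\<^sup>+x. ennreal (f n x) \<partial>M)" by (rule nn_integral_liminf) measurable
  also have "\<dots> = liminf (\<lambda>n. ennreal (\<integral>x. f n x \<partial>M))"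
    using int pos by (simp add: nn_integral_eq_integral)
  also have "\<dots> \<le> liminf (\<lambda>n. ennreal C)" by (intro Liminf_mono eventuallyI ennreal_leI le)
  also have "\<dots> = ennreal C" by (simp add: Liminf_const)
  finally have fin: "(\<integral>\<^sup>+x. ennreal (g x) \<partial>M) \<le> ennreal C" .
  then show i: "integrable M g" using g0
    by (intro integrableI_nonneg) (auto intro: order.strict_trans1 simp: top.not_eq_extremum)
  show "(\<integral>x. g x \<partial>M) \<le> C" using fin C by (simp add: nn_integral_eq_integral[OF i g0])
qed

definition ip2 :: "'a measure \<Rightarrow> ('a \<Rightarrow> 'b::euclidean_space) \<Rightarrow> ('a \<Rightarrow> 'b) \<Rightarrow> real" where
  "ip2 M f g = (\<integral>x. f x \<bullet> g x \<partial>M)"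

lemma L2_norm_ip2: "L2_norm M f = sqrt (ip2 M f f)"
  by (simp add: L2_norm_def ip2_def power2_norm_eq_inner)

lemma L2_space_measurable [measurable_dest]: "f \<in> L2_space M \<Longrightarrow> f \<in> borel_measurable M"
  by (simp add: L2_space_def)

lemma L2_inner_integrable:
  assumes f: "f \<in> L2_space M" and g: "g \<in> L2_space M"
  shows "integrable M (\<lambda>x. f x \<bullet> g x)"
proof (rule Bochner_Integration.integrable_bound)
  show "integrable M (\<lambda>x. (norm (f x))\<^sup>2 + (norm (g x))\<^sup>2)"
    using assms by (simp add: L2_space_def)
  show "(\<lambda>x. f x \<bullet> g x) \<in> borel_measurable M" using assms by measurable
  have "norm (f x \<bullet> g x) \<le> norm ((norm (f x))\<^sup>2 + (norm (g x))\<^sup>2)" for x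
  proof -
    have "\<bar>f x \<bullet> g x\<bar> \<le> norm (f x) * norm (g x)" by (rule Cauchy_Schwarz_ineq2)
    also have "\<dots> \<le> (norm (f x))\<^sup>2 + (norm (g x))\<^sup>2"
      using zero_le_power2[of "norm (f x) - norm (g x)"]
        mult_nonneg_nonneg[OF norm_ge_zero[of "f x"] norm_ge_zero[of "g x"]]
      unfolding power2_diff mult.assoc by linarith
    finally show ?thesis by simp
  qed
  then show "AE x in M. norm (f x \<bullet> g x) \<le> norm ((norm (f x))\<^sup>2 + (norm (g x))\<^sup>2)" by simp
qed

lemma L2_space_add:
  assumes f: "f \<in> L2_space M" and g: "g \<in> L2_space M"
  shows "f + g \<in> L2_space M"
proof -
  have "integrable M (\<lambda>x. f x \<bullet> f x + 2 * (f x \<bullet> g x) + g x \<bullet> g x)"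
    using assms by (intro Bochner_Integration.integrable_add integrable_mult_right L2_inner_integrable)
  moreover have "f x \<bullet> f x + 2 * (f x \<bullet> g x) + g x \<bullet> g x = (norm ((f + g) x))\<^sup>2" for x
    by (simp add: power2_norm_eq_inner inner_simps inner_commute)
  moreover have "f + g \<in> borel_measurable M"
    using L2_space_measurable[OF f] L2_space_measurable[OF g] by (simp add: plus_fun_def)
  ultimately show ?thesis by (simp add: L2_space_def)
qed

interpretation L2: semi_inner "L2_space M :: ('a \<Rightarrow> 'b::euclidean_space) set" "ip2 M" for M :: "'a measure"
proof
  show "subspace (L2_space M :: ('a \<Rightarrow> 'b) set)"
  proof (rule subspaceI)
    show "c *\<^sub>R f \<in> L2_space M" if "f \<in> L2_space M" for c and f :: "'a \<Rightarrow> 'b"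
      using that borel_measurable_scaleR[of "\<lambda>_. c" M f]
      by (simp add: L2_space_def scaleR_fun_def power_mult_distrib)
  qed (simp_all add: L2_space_add, simp add: zero_fun_def L2_space_def)
  show "ip2 M (x + y) z = ip2 M x z + ip2 M y z"
    if "x \<in> L2_space M" "y \<in> L2_space M" "z \<in> L2_space M" for x y z :: "'a \<Rightarrow> 'b"
    using that by (simp add: ip2_def inner_simps L2_inner_integrable)
qed (auto simp: ip2_def inner_commute)

lemma L2_nm: "L2.nm M = (L2_norm M :: ('a \<Rightarrow> 'b::euclidean_space) \<Rightarrow> real)"
  by (simp add: fun_eq_iff L2.nm_def L2_norm_ip2)

text \<open>The Riesz-Fischer argument: rapidly Cauchy sequences converge pointwise almost
  everywhere, and Fatou's lemma identifies the pointwise limit as the limit in norm.\<close>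

lemma L2_semi_hilbert: "semi_hilbert (L2_space M :: ('a \<Rightarrow> 'b::euclidean_space) set) (ip2 M)"
proof (rule L2.semi_hilbertI)
  fix X :: "nat \<Rightarrow> 'a \<Rightarrow> 'b"
  assume X: "\<And>n. X n \<in> L2_space M" and r: "\<And>n. L2.nm M (X (Suc n) - X n) \<le> (1/8)^n"
  have sq: "L2.nm M f ^ 2 = (\<integral>x. (norm (f x))\<^sup>2 \<partial>M)" if "f \<in> L2_space M" for f :: "'a \<Rightarrow> 'b"
    using L2.nm_sq[OF that] by (simp add: ip2_def power2_norm_eq_inner)
  have D: "X m - X n \<in> L2_space M" for m n using X by (intro L2.diff_mem)
  have I: "integrable M (\<lambda>x. (norm (X m x - X n x))\<^sup>2)" for m n
    using D[of m n] by (simp add: L2_space_def)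
  have Xm: "X n \<in> borel_measurable M" for n using X L2_space_measurable by blast
  note [measurable] = Xm
  have "AE x in M. summable (\<lambda>k. \<bar>norm (X (Suc k) x - X k x)\<bar>)"
  proof (rule rapid_summable_AE)
    fix k
    have "(\<integral>x. (norm (X (Suc k) x - X k x))\<^sup>2 \<partial>M) = (L2.nm M (X (Suc k) - X k))\<^sup>2"
      using sq[OF D] by simp
    also have "\<dots> \<le> ((1/8)^k)\<^sup>2" using r L2.nm_nonneg[OF D] by (intro power_mono)
    also have "\<dots> = (1/64)^k" by (simp add: power2_eq_square flip: power_mult_distrib)
    finally show "(\<integral>x. (norm (X (Suc k) x - X k x))\<^sup>2 \<partial>M) \<le> (1/64)^k" .
  qed (use I in auto)
  then have conv: "AE x in M. convergent (\<lambda>n. X n x)"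
  proof eventually_elim
    case (elim x)
    then have "summable (\<lambda>k. X (Suc k) x - X k x)" by (simp add: summable_norm_cancel)
    then have "convergent (\<lambda>n. \<Sum>k<n. X (Suc k) x - X k x)" by (simp add: summable_iff_convergent)
    moreover have "(\<Sum>k<n. X (Suc k) x - X k x) = X n x - X 0 x" for n
      using sum_lessThan_telescope[of "\<lambda>k. X k x" n] by simp
    ultimately have "convergent (\<lambda>n. (X n x - X 0 x) + X 0 x)"
      by (intro convergent_add convergent_const) simp
    then show ?case by simp
  qed
  \<comment> \<open>Where the sequence diverges this is an arbitrary value, on a null set;
    measurability of \<open>y\<close> holds regardless.\<close>
  define y where "y x = lim (\<lambda>n. X n x)" for x
  have ym [measurable]: "y \<in> borel_measurable M" unfolding y_def by measurable
  have lim: "AE x in M. (\<lambda>n. X n x) \<longlonglongrightarrow> y x"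
    using conv by eventually_elim (simp add: y_def convergent_LIMSEQ_iff)
  \<comment> \<open>Here \<open>n\<close> is fixed and Fatou's lemma is applied along the later
    members \<open>X (n + m)\<close>.\<close>
  have "integrable M (\<lambda>x. (norm (X n x - y x))\<^sup>2) \<and> (\<integral>x. (norm (X n x - y x))\<^sup>2 \<partial>M) \<le> (2 * (1/8)^n)\<^sup>2" for n
  proof (intro conjI)
    have le: "(\<integral>x. (norm (X n x - X (n + m) x))\<^sup>2 \<partial>M) \<le> (2 * (1/8)^n)\<^sup>2" for m
    proof -
      have "(\<integral>x. (norm (X n x - X (n + m) x))\<^sup>2 \<partial>M) = (L2.nm M (X (n + m) - X n))\<^sup>2"
        using sq[OF D] by (simp add: norm_minus_commute)
      also have "\<dots> \<le> (2 * (1/8)^n)\<^sup>2"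
        using L2.rapid_bound[OF X r, of n "n + m"] L2.nm_nonneg[OF D] by (intro power_mono) auto
      finally show ?thesis .
    qed
    have l: "AE x in M. (\<lambda>m. (norm (X n x - X (n + m) x))\<^sup>2) \<longlonglongrightarrow> (norm (X n x - y x))\<^sup>2"
      using lim
    proof eventually_elim
      case (elim x)
      have "(\<lambda>m. X (n + m) x) \<longlonglongrightarrow> y x"
        using LIMSEQ_ignore_initial_segment[OF elim, of n] by (simp add: add.commute)
      then show ?case by (intro tendsto_intros)
    qed
    show "integrable M (\<lambda>x. (norm (X n x - y x))\<^sup>2)" "(\<integral>x. (norm (X n x - y x))\<^sup>2 \<partial>M) \<le> (2 * (1/8)^n)\<^sup>2"
      by (rule fatou_bound[OF I _ le l]; measurable)+
  qed
  note b = this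
  have XyL: "X n - y \<in> L2_space M" for n using b[of n] by (auto simp: L2_space_def fun_diff_def)
  have "X 0 - (X 0 - y) \<in> L2_space M" by (intro L2.diff_mem X XyL)
  then have "y \<in> L2_space M" by (simp only: diff_diff_eq2 add_diff_cancel_left')
  moreover have "(\<lambda>n. L2.nm M (X n - y)) \<longlonglongrightarrow> 0"
  proof (rule Lim_null_comparison)
    have "L2.nm M (X n - y) \<le> 2 * (1/8)^n" for n
    proof (rule power2_le_imp_le)
      show "(L2.nm M (X n - y))\<^sup>2 \<le> (2 * (1/8)^n)\<^sup>2" using b[of n] unfolding sq[OF XyL[of n]] by simp
    qed simp
    then show "\<forall>\<^sub>F n in sequentially. norm (L2.nm M (X n - y)) \<le> 2 * (1/8)^n"
      using L2.nm_nonneg[OF XyL] by simp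
    show "(\<lambda>n. 2 * (1/8)^n) \<longlonglongrightarrow> (0::real)"
      using tendsto_mult_right_zero[OF LIMSEQ_realpow_zero[of "1/8::real"]] by simp
  qed
  ultimately show "\<exists>x\<in>L2_space M. (\<lambda>n. L2.nm M (X n - x)) \<longlonglongrightarrow> 0" by blast
qed

subsection \<open>Square-integrable curves\<close>

abbreviation tm :: "real \<Rightarrow> real measure" where "tm T \<equiv> lebesgue_on {0<..<T}"

lemma finite_measure_tm: "finite_measure (tm T)"
  by (rule finite_measure_lebesgue_on) (simp add: bounded_set_imp_lmeasurable)

lemma integrable_const_tm [simp]: "integrable (tm T) (\<lambda>_. c::real)"
  using finite_measure_tm by (rule finite_measure.integrable_const)

text \<open>This rests on completeness of Lebesgue measure. Bochner curves and their pairings are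
  known only at almost every time, so measurability has to be transported across null sets
  throughout.\<close>

lemma measurable_lebesgue_on_AE:
  fixes f g :: "'a::euclidean_space \<Rightarrow> 'b::euclidean_space"
  assumes f: "f \<in> borel_measurable (lebesgue_on A)" and A: "A \<in> sets lebesgue"
    and eq: "AE x in lebesgue_on A. f x = g x"
  shows "g \<in> borel_measurable (lebesgue_on A)"
proof -
  have "(\<lambda>x. if x \<in> A then g x else 0) \<in> borel_measurable lebesgue"
  proof (rule borel_measurable_AE)
    show "(\<lambda>x. if x \<in> A then f x else 0) \<in> borel_measurable lebesgue"
      using f A by (simp add: borel_measurable_if)
    show "AE x in lebesgue. (if x \<in> A then f x else 0) = (if x \<in> A then g x else 0)"
      using eq A by (subst (asm) AE_restrict_space_iff) (auto elim: eventually_mono)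
  qed
  then show ?thesis using A by (simp add: borel_measurable_if)
qed

lemma measurable_lebesgue_on_lim_AE:
  fixes g :: "'a::euclidean_space \<Rightarrow> real"
  assumes f: "\<And>n. f n \<in> borel_measurable (lebesgue_on A)" and A: "A \<in> sets lebesgue"
    and lim: "AE x in lebesgue_on A. (\<lambda>n. f n x) \<longlonglongrightarrow> g x"
  shows "g \<in> borel_measurable (lebesgue_on A)"
proof (rule measurable_lebesgue_on_AE[OF _ A])
  show "(\<lambda>x. lim (\<lambda>n. f n x)) \<in> borel_measurable (lebesgue_on A)"
    using f by (intro borel_measurable_lim_metric)
  show "AE x in lebesgue_on A. lim (\<lambda>n. f n x) = g x"
    using lim by eventually_elim (rule limI)
qed

lemma AE_tm_iff: "(AE t in tm T. P t) \<longleftrightarrow> (AE t in lebesgue. 0 < t \<longrightarrow> t < T \<longrightarrow> P t)"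
  by (subst AE_restrict_space_iff) auto

lemma AE_tm_mono: "(AE t in tm T. P t) \<Longrightarrow> \<tau> \<le> T \<Longrightarrow> AE t in tm \<tau>. P t"
  unfolding AE_tm_iff by (auto elim: eventually_mono)

lemma AE_tm_space: "AE t in tm T. 0 < t \<and> t < T"
  unfolding AE_tm_iff by simp

lemma simple_function_tm_mono:
  assumes s: "simple_function (tm T) s" and "\<tau> \<le> T"
  shows "simple_function (tm \<tau>) s"
proof -
  have fin: "finite (s ` {0<..<T})" and
    m: "\<And>x. x \<in> s ` {0<..<T} \<Longrightarrow> s -` {x} \<inter> {0<..<T} \<in> sets (tm T)"
    using s by (auto simp: simple_function_def)
  have sub: "{0<..<\<tau>} \<subseteq> {0<..<T}" using \<open>\<tau> \<le> T\<close> by auto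
  have "s -` {x} \<inter> {0<..<\<tau>} \<in> sets (tm \<tau>)" if "x \<in> s ` {0<..<\<tau>}" for x
  proof -
    have "s -` {x} \<inter> {0<..<T} \<in> sets lebesgue"
      using m[of x] that sub by (auto simp: sets_restrict_space_iff)
    then have "(s -` {x} \<inter> {0<..<T}) \<inter> {0<..<\<tau>} \<in> sets lebesgue" by auto
    also have "(s -` {x} \<inter> {0<..<T}) \<inter> {0<..<\<tau>} = s -` {x} \<inter> {0<..<\<tau>}" using sub by auto
    finally show ?thesis by (auto simp: sets_restrict_space_iff)
  qed
  moreover have "finite (s ` {0<..<\<tau>})" using fin sub by (meson finite_subset image_mono)
  ultimately show ?thesis by (simp add: simple_function_def)
qed

lemma strongly_measurable_mem: "strongly_measurable M X N f \<Longrightarrow> AE t in M. f t \<in> X"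
  unfolding strongly_measurable_def by (auto elim: eventually_mono)

lemma bochner_L2_mem: "f \<in> bochner_L2 T X N \<Longrightarrow> AE t in tm T. f t \<in> X"
  unfolding bochner_L2_def using strongly_measurable_mem by auto

lemma strongly_measurable_mono:
  assumes "strongly_measurable (tm T) X N f" "\<tau> \<le> T"
  shows "strongly_measurable (tm \<tau>) X N f"
proof -
  obtain s where s: "\<And>n. simple_function (tm T) (s n)" "\<And>n. s n ` {0<..<T} \<subseteq> X"
      "AE t in tm T. f t \<in> X \<and> (\<lambda>n. N (f t - s n t)) \<longlonglongrightarrow> 0"
    using assms(1) by (auto simp: strongly_measurable_def)
  show ?thesis unfolding strongly_measurable_def
    using simple_function_tm_mono[OF s(1) assms(2)] s(2) AE_tm_mono[OF s(3) assms(2)] assms(2)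
    by (intro exI[of _ s]) (force simp: image_subset_iff)
qed

lemma integrable_tm_mono:
  fixes f :: "real \<Rightarrow> real"
  assumes "integrable (tm T) f" "\<tau> \<le> T"
  shows "integrable (tm \<tau>) f"
proof -
  have "integrable lebesgue (\<lambda>x. indicator {0<..<\<tau>} x *\<^sub>R (indicator {0<..<T} x *\<^sub>R f x))"
    using assms(1) by (intro integrable_mult_indicator[OF _ iffD1[OF integrable_restrict_space]]) auto
  also have "(\<lambda>x. indicator {0<..<\<tau>} x *\<^sub>R (indicator {0<..<T} x *\<^sub>R f x)) = (\<lambda>x. indicator {0<..<\<tau>} x *\<^sub>R f x)"
    using assms(2) by (auto simp: indicator_def)
  finally show ?thesis by (simp add: integrable_restrict_space)
qed

lemma bochner_L2_mono: "f \<in> bochner_L2 T X N \<Longrightarrow> \<tau> \<le> T \<Longrightarrow> f \<in> bochner_L2 \<tau> X N"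
  by (auto simp: bochner_L2_def intro: strongly_measurable_mono integrable_tm_mono)

text \<open>A Lipschitz map sends approximating simple functions to approximating simple functions.
  Nonnegativity of \<open>N'\<close> is part of the hypothesis since a seminorm is controlled only
  on its carrier. Inclusions, Riesz maps and projections are all treated this way.\<close>

lemma strongly_measurable_compose:
  assumes f: "strongly_measurable M X N f" and \<Phi>: "\<And>x. x \<in> X \<Longrightarrow> \<Phi> x \<in> Y"
    and lip: "\<And>x y. x \<in> X \<Longrightarrow> y \<in> X \<Longrightarrow> 0 \<le> N' (\<Phi> x - \<Phi> y) \<and> N' (\<Phi> x - \<Phi> y) \<le> C * N (x - y)"
  shows "strongly_measurable M Y N' (\<lambda>t. \<Phi> (f t))"
proof -
  obtain s where s: "\<And>n. simple_function M (s n)" "\<And>n. s n ` space M \<subseteq> X"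
      "AE t in M. f t \<in> X \<and> (\<lambda>n. N (f t - s n t)) \<longlonglongrightarrow> 0"
    using f by (auto simp: strongly_measurable_def)
  show ?thesis unfolding strongly_measurable_def
  proof (intro exI[of _ "\<lambda>n t. \<Phi> (s n t)"] conjI allI)
    show "simple_function M (\<lambda>t. \<Phi> (s n t))" for n
      using s(1) by (rule simple_function_compose1)
    show "(\<lambda>t. \<Phi> (s n t)) ` space M \<subseteq> Y" for n
      using s(2)[of n] \<Phi> by auto
    show "AE t in M. \<Phi> (f t) \<in> Y \<and> (\<lambda>n. N' (\<Phi> (f t) - \<Phi> (s n t))) \<longlonglongrightarrow> 0"
      using s(3) AE_space
    proof eventually_elim
      case (elim t)
      have "s n t \<in> X" for n using s(2)[of n] elim(2) by auto
      then have b: "0 \<le> N' (\<Phi> (f t) - \<Phi> (s n t)) \<and> N' (\<Phi> (f t) - \<Phi> (s n t)) \<le> C * N (f t - s n t)" for n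
        using elim lip by auto
      have "(\<lambda>n. N' (\<Phi> (f t) - \<Phi> (s n t))) \<longlonglongrightarrow> 0"
      proof (rule Lim_null_comparison)
        show "\<forall>\<^sub>F n in sequentially. norm (N' (\<Phi> (f t) - \<Phi> (s n t))) \<le> C * N (f t - s n t)"
          using b by simp
        show "(\<lambda>n. C * N (f t - s n t)) \<longlonglongrightarrow> 0"
          using elim by (auto intro!: tendsto_eq_intros)
      qed
      then show ?case using elim \<Phi> by simp
    qed
  qed
qed

section \<open>Bochner spaces over a semi-inner product space\<close>

context semi_inner
begin

abbreviation "sm T \<equiv> strongly_measurable (tm T) S nm"

abbreviation "B T \<equiv> bochner_L2 T S nm"

definition bip :: "real \<Rightarrow> (real \<Rightarrow> 'v) \<Rightarrow> (real \<Rightarrow> 'v) \<Rightarrow> real" where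
  "bip T f g = (\<integral>t. ip (f t) (g t) \<partial>tm T)"

lemma smE:
  assumes "sm T f"
  obtains s where "\<And>n. simple_function (tm T) (s n)" "\<And>n t. 0 < t \<Longrightarrow> t < T \<Longrightarrow> s n t \<in> S"
      "AE t in tm T. f t \<in> S \<and> (\<forall>n. s n t \<in> S) \<and> (\<lambda>n. nm (s n t - f t)) \<longlonglongrightarrow> 0"
proof -
  obtain s where s: "\<And>n. simple_function (tm T) (s n)" "\<And>n. s n ` {0<..<T} \<subseteq> S"
      "AE t in tm T. f t \<in> S \<and> (\<lambda>n. nm (f t - s n t)) \<longlonglongrightarrow> 0"
    using assms by (auto simp: strongly_measurable_def)
  have S: "s n t \<in> S" if "0 < t" "t < T" for n t using s(2)[of n] that by auto
  have "AE t in tm T. f t \<in> S \<and> (\<forall>n. s n t \<in> S) \<and> (\<lambda>n. nm (s n t - f t)) \<longlonglongrightarrow> 0"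
    using s(3) AE_tm_space
  proof eventually_elim
    case (elim t)
    then have "nm (s n t - f t) = nm (f t - s n t)" for n using S by (intro nm_commute) auto
    then show ?case using elim S by simp
  qed
  then show thesis using that s(1) S by blast
qed

lemma smI:
  assumes "\<And>n. simple_function (tm T) (s n)" "\<And>n t. 0 < t \<Longrightarrow> t < T \<Longrightarrow> s n t \<in> S"
      "AE t in tm T. f t \<in> S \<and> (\<lambda>n. nm (s n t - f t)) \<longlonglongrightarrow> 0"
  shows "sm T f"
  unfolding strongly_measurable_def
proof (intro exI[of _ s] conjI allI)
  show "AE t in tm T. f t \<in> S \<and> (\<lambda>n. nm (f t - s n t)) \<longlonglongrightarrow> 0"
    using assms(3) AE_tm_space
  proof eventually_elim
    case (elim t)
    then have "nm (s n t - f t) = nm (f t - s n t)" for n using assms(2) by (intro nm_commute) auto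
    then show ?case using elim by simp
  qed
qed (use assms in auto)

lemma sm_simple: "simple_function (tm T) s \<Longrightarrow> (\<And>t. 0 < t \<Longrightarrow> t < T \<Longrightarrow> s t \<in> S) \<Longrightarrow> sm T s"
  using AE_tm_space[of T] by (intro smI[of T "\<lambda>_. s"]) (auto simp: nm_zero elim: eventually_mono)

lemma ip_measurable:
  assumes "sm T f" "sm T g"
  shows "(\<lambda>t. ip (f t) (g t)) \<in> borel_measurable (tm T)"
proof -
  obtain s where s: "\<And>n. simple_function (tm T) (s n)" "\<And>n t. 0 < t \<Longrightarrow> t < T \<Longrightarrow> s n t \<in> S"
      "AE t in tm T. f t \<in> S \<and> (\<forall>n. s n t \<in> S) \<and> (\<lambda>n. nm (s n t - f t)) \<longlonglongrightarrow> 0"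
    by (rule smE[OF assms(1)]) (rule that)
  obtain r where r: "\<And>n. simple_function (tm T) (r n)" "\<And>n t. 0 < t \<Longrightarrow> t < T \<Longrightarrow> r n t \<in> S"
      "AE t in tm T. g t \<in> S \<and> (\<forall>n. r n t \<in> S) \<and> (\<lambda>n. nm (r n t - g t)) \<longlonglongrightarrow> 0"
    by (rule smE[OF assms(2)]) (rule that)
  show ?thesis
  proof (rule measurable_lebesgue_on_lim_AE)
    show "(\<lambda>t. ip (s n t) (r n t)) \<in> borel_measurable (tm T)" for n
      using simple_function_compose2[OF s(1) r(1), of ip n n] by (rule borel_measurable_simple_function)
    show "AE t in tm T. (\<lambda>n. ip (s n t) (r n t)) \<longlonglongrightarrow> ip (f t) (g t)"
      using s(3) r(3) by eventually_elim (rule ip_tendsto; simp)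
  qed simp
qed

lemma nm_measurable: "sm T f \<Longrightarrow> (\<lambda>t. nm (f t)) \<in> borel_measurable (tm T)"
  using measurable_compose[OF ip_measurable borel_measurable_sqrt, of T f f] by (simp only: nm_def)

lemma sm_add:
  assumes "sm T f" "sm T g"
  shows "sm T (f + g)"
proof -
  obtain s where s: "\<And>n. simple_function (tm T) (s n)" "\<And>n t. 0 < t \<Longrightarrow> t < T \<Longrightarrow> s n t \<in> S"
      "AE t in tm T. f t \<in> S \<and> (\<forall>n. s n t \<in> S) \<and> (\<lambda>n. nm (s n t - f t)) \<longlonglongrightarrow> 0"
    by (rule smE[OF assms(1)]) (rule that)
  obtain r where r: "\<And>n. simple_function (tm T) (r n)" "\<And>n t. 0 < t \<Longrightarrow> t < T \<Longrightarrow> r n t \<in> S"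
      "AE t in tm T. g t \<in> S \<and> (\<forall>n. r n t \<in> S) \<and> (\<lambda>n. nm (r n t - g t)) \<longlonglongrightarrow> 0"
    by (rule smE[OF assms(2)]) (rule that)
  show ?thesis
  proof (rule smI)
    show "simple_function (tm T) (\<lambda>t. s n t + r n t)" for n
      using simple_function_compose2[OF s(1) r(1), of "(+)" n n] .
    show "s n t + r n t \<in> S" if "0 < t" "t < T" for n t using that s r by (intro add_mem)
    show "AE t in tm T. (f + g) t \<in> S \<and> (\<lambda>n. nm (s n t + r n t - (f + g) t)) \<longlonglongrightarrow> 0"
      using s(3) r(3)
    proof eventually_elim
      case (elim t)
      have m: "s n t - f t \<in> S" "r n t - g t \<in> S" for n using elim by (auto intro: diff_mem)
      have e: "s n t + r n t - (f + g) t = (s n t - f t) + (r n t - g t)" for n by simp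
      have "(\<lambda>n. nm (s n t + r n t - (f + g) t)) \<longlonglongrightarrow> 0"
      proof (rule Lim_null_comparison)
        show "\<forall>\<^sub>F n in sequentially. norm (nm (s n t + r n t - (f + g) t)) \<le> nm (s n t - f t) + nm (r n t - g t)"
          unfolding e using nm_triangle[OF m] nm_nonneg[OF add_mem[OF m]] by simp
        show "(\<lambda>n. nm (s n t - f t) + nm (r n t - g t)) \<longlonglongrightarrow> 0"
          using elim by (auto intro!: tendsto_eq_intros)
      qed
      then show ?case using elim by (auto intro: add_mem)
    qed
  qed
qed

lemma sm_scale:
  assumes f: "sm T f" and a: "a \<in> borel_measurable (tm T)"
  shows "sm T (\<lambda>t. a t *\<^sub>R f t)"
proof -
  obtain s where s: "\<And>n. simple_function (tm T) (s n)" "\<And>n t. 0 < t \<Longrightarrow> t < T \<Longrightarrow> s n t \<in> S"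
      "AE t in tm T. f t \<in> S \<and> (\<forall>n. s n t \<in> S) \<and> (\<lambda>n. nm (s n t - f t)) \<longlonglongrightarrow> 0"
    by (rule smE[OF f]) (rule that)
  obtain b where b: "\<And>n. simple_function (tm T) (b n)" "\<And>t. t \<in> space (tm T) \<Longrightarrow> (\<lambda>n. b n t) \<longlonglongrightarrow> a t"
    using borel_measurable_implies_sequence_metric[OF a, of 0] by metis
  show ?thesis
  proof (rule smI)
    show "simple_function (tm T) (\<lambda>t. b n t *\<^sub>R s n t)" for n
      using simple_function_compose2[OF b(1) s(1), of "(*\<^sub>R)" n n] .
    show "b n t *\<^sub>R s n t \<in> S" if "0 < t" "t < T" for n t using that s by (intro scale_mem)
    show "AE t in tm T. a t *\<^sub>R f t \<in> S \<and> (\<lambda>n. nm (b n t *\<^sub>R s n t - a t *\<^sub>R f t)) \<longlonglongrightarrow> 0"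
      using s(3) AE_space
    proof eventually_elim
      case (elim t)
      have e: "b n t *\<^sub>R s n t - a t *\<^sub>R f t = b n t *\<^sub>R (s n t - f t) + (b n t - a t) *\<^sub>R f t" for n
        by (simp add: algebra_simps)
      have le: "nm (b n t *\<^sub>R s n t - a t *\<^sub>R f t) \<le> \<bar>b n t\<bar> * nm (s n t - f t) + \<bar>b n t - a t\<bar> * nm (f t)" for n
        using nm_triangle[of "b n t *\<^sub>R (s n t - f t)" "(b n t - a t) *\<^sub>R f t"] elim
        unfolding e by (simp add: nm_scale mem_intros)
      have "(\<lambda>n. nm (b n t *\<^sub>R s n t - a t *\<^sub>R f t)) \<longlonglongrightarrow> 0"
      proof (rule Lim_null_comparison)
        have "0 \<le> nm (b n t *\<^sub>R s n t - a t *\<^sub>R f t)" for n using elim by (intro nm_nonneg mem_intros) auto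
        then show "\<forall>\<^sub>F n in sequentially. norm (nm (b n t *\<^sub>R s n t - a t *\<^sub>R f t))
            \<le> \<bar>b n t\<bar> * nm (s n t - f t) + \<bar>b n t - a t\<bar> * nm (f t)"
          using le by simp
        have "(\<lambda>n. \<bar>b n t\<bar> * nm (s n t - f t) + \<bar>b n t - a t\<bar> * nm (f t)) \<longlonglongrightarrow> \<bar>a t\<bar> * 0 + \<bar>a t - a t\<bar> * nm (f t)"
          using elim b(2)[of t] by (intro tendsto_intros) auto
        then show "(\<lambda>n. \<bar>b n t\<bar> * nm (s n t - f t) + \<bar>b n t - a t\<bar> * nm (f t)) \<longlonglongrightarrow> 0" by simp
      qed
      then show ?case using elim by (auto intro: scale_mem)
    qed
  qed
qed

lemma sm_diff: "sm T f \<Longrightarrow> sm T g \<Longrightarrow> sm T (f - g)"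
  using sm_add[of T f "\<lambda>t. (-1) *\<^sub>R g t"] sm_scale[of T g "\<lambda>_. -1"] by (simp add: fun_diff_def plus_fun_def)

lemma sm_cong:
  assumes "sm T f" "AE t in tm T. g t \<in> S \<and> nm (f t - g t) = 0"
  shows "sm T g"
proof -
  obtain s where s: "\<And>n. simple_function (tm T) (s n)" "\<And>n t. 0 < t \<Longrightarrow> t < T \<Longrightarrow> s n t \<in> S"
      "AE t in tm T. f t \<in> S \<and> (\<forall>n. s n t \<in> S) \<and> (\<lambda>n. nm (s n t - f t)) \<longlonglongrightarrow> 0"
    by (rule smE[OF assms(1)]) (rule that)
  show ?thesis
  proof (rule smI[OF s(1,2)])
    show "AE t in tm T. g t \<in> S \<and> (\<lambda>n. nm (s n t - g t)) \<longlonglongrightarrow> 0"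
      using s(3) assms(2)
    proof eventually_elim
      case (elim t)
      then have le: "nm (s n t - g t) \<le> nm (s n t - f t)" for n
        using nm_triangle3[of "s n t" "f t" "g t"] by simp
      have "(\<lambda>n. nm (s n t - g t)) \<longlonglongrightarrow> 0"
        by (rule Lim_null_comparison[where g = "\<lambda>n. nm (s n t - f t)"])
           (use elim le nm_nonneg in \<open>auto simp: mem_intros\<close>)
      then show ?case using elim by simp
    qed
  qed
qed

lemma B_I:
  assumes "sm T f" "integrable (tm T) h" "AE t in tm T. (nm (f t))\<^sup>2 \<le> h t"
  shows "f \<in> B T"
proof -
  have "integrable (tm T) (\<lambda>t. (nm (f t))\<^sup>2)"
  proof (rule Bochner_Integration.integrable_bound[OF assms(2)])
    show "(\<lambda>t. (nm (f t))\<^sup>2) \<in> borel_measurable (tm T)" using nm_measurable[OF assms(1)] by measurable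
    show "AE t in tm T. norm ((nm (f t))\<^sup>2) \<le> norm (h t)" using assms(3) by eventually_elim auto
  qed
  then show ?thesis using assms(1) by (simp add: bochner_L2_def)
qed

lemma B_sm: "f \<in> B T \<Longrightarrow> sm T f" by (simp add: bochner_L2_def)

lemma B_nm_integrable: "f \<in> B T \<Longrightarrow> integrable (tm T) (\<lambda>t. (nm (f t))\<^sup>2)" by (simp add: bochner_L2_def)

lemma B_mem: "f \<in> B T \<Longrightarrow> AE t in tm T. f t \<in> S"
  by (rule bochner_L2_mem)

lemma B_ip_integrable:
  assumes f: "f \<in> B T" and g: "g \<in> B T"
  shows "integrable (tm T) (\<lambda>t. ip (f t) (g t))"
proof (rule Bochner_Integration.integrable_bound)
  show "integrable (tm T) (\<lambda>t. (nm (f t))\<^sup>2 + (nm (g t))\<^sup>2)"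
    using assms by (intro Bochner_Integration.integrable_add B_nm_integrable)
  show "(\<lambda>t. ip (f t) (g t)) \<in> borel_measurable (tm T)" using f g by (intro ip_measurable B_sm)
  show "AE t in tm T. norm (ip (f t) (g t)) \<le> norm ((nm (f t))\<^sup>2 + (nm (g t))\<^sup>2)"
    using B_mem[OF f] B_mem[OF g]
  proof eventually_elim
    case (elim t)
    have "\<bar>ip (f t) (g t)\<bar> \<le> nm (f t) * nm (g t)" using elim by (intro cauchy_schwarz)
    moreover have "0 \<le> nm (f t) * nm (g t)" using elim by (simp add: nm_nonneg)
    moreover have "0 \<le> (nm (f t) - nm (g t))\<^sup>2" by simp
    ultimately show ?case unfolding power2_diff mult.assoc by simp
  qed
qed

lemma B_add:
  assumes f: "f \<in> B T" and g: "g \<in> B T"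
  shows "f + g \<in> B T"
proof (rule B_I)
  show "sm T (f + g)" using assms by (intro sm_add B_sm)
  show "integrable (tm T) (\<lambda>t. 2 * (nm (f t))\<^sup>2 + 2 * (nm (g t))\<^sup>2)"
    using assms by (intro Bochner_Integration.integrable_add integrable_mult_right B_nm_integrable)
  show "AE t in tm T. (nm ((f + g) t))\<^sup>2 \<le> 2 * (nm (f t))\<^sup>2 + 2 * (nm (g t))\<^sup>2"
    using B_mem[OF f] B_mem[OF g]
  proof eventually_elim
    case (elim t)
    have "(nm ((f + g) t))\<^sup>2 \<le> (nm (f t) + nm (g t))\<^sup>2"
      using nm_triangle[of "f t" "g t"] elim by (intro power_mono nm_nonneg) (auto intro: add_mem)
    also have "\<dots> \<le> 2 * (nm (f t))\<^sup>2 + 2 * (nm (g t))\<^sup>2"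
      using zero_le_power2[of "nm (f t) - nm (g t)"] by (simp add: power2_sum power2_diff)
    finally show ?case .
  qed
qed

lemma B_scale_fun:
  assumes f: "f \<in> B T" and a: "a \<in> borel_measurable (tm T)" and b: "\<And>t. 0 < t \<Longrightarrow> t < T \<Longrightarrow> \<bar>a t\<bar> \<le> c"
  shows "(\<lambda>t. a t *\<^sub>R f t) \<in> B T"
proof (rule B_I)
  show "sm T (\<lambda>t. a t *\<^sub>R f t)" using f a by (intro sm_scale B_sm)
  show "integrable (tm T) (\<lambda>t. c\<^sup>2 * (nm (f t))\<^sup>2)"
    using f by (intro integrable_mult_right B_nm_integrable)
  show "AE t in tm T. (nm (a t *\<^sub>R f t))\<^sup>2 \<le> c\<^sup>2 * (nm (f t))\<^sup>2"
    using B_mem[OF f] AE_tm_space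
  proof eventually_elim
    case (elim t)
    have "\<bar>a t\<bar>\<^sup>2 \<le> c\<^sup>2" using b elim by (intro power_mono) auto
    then show ?case using elim by (simp add: nm_scale power_mult_distrib mult_right_mono)
  qed
qed

lemma B_scale: "f \<in> B T \<Longrightarrow> c *\<^sub>R f \<in> B T"
  using B_scale_fun[of f T "\<lambda>_. c" "\<bar>c\<bar>"] by (simp add: scaleR_fun_def)

lemma B_simple:
  assumes "simple_function (tm T) s" "\<And>t. 0 < t \<Longrightarrow> t < T \<Longrightarrow> s t \<in> S"
  shows "s \<in> B T"
proof (rule B_I[OF sm_simple[OF assms]])
  have fin: "finite (s ` {0<..<T})" using assms(1) by (auto simp: simple_function_def)
  show "integrable (tm T) (\<lambda>_. \<Sum>x\<in>s ` {0<..<T}. (nm x)\<^sup>2)" by simp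
  show "AE t in tm T. (nm (s t))\<^sup>2 \<le> (\<Sum>x\<in>s ` {0<..<T}. (nm x)\<^sup>2)"
    using AE_tm_space by eventually_elim (use fin in \<open>auto intro!: member_le_sum\<close>)
qed

text \<open>Square-integrable curves are again an instance of the locale, so Cauchy-Schwarz,
  minimisation and density become available for them.\<close>

lemma B_semi_inner: "semi_inner (B T) (bip T)"
proof
  show "subspace (B T)"
  proof (rule subspaceI)
    have "(\<lambda>_. 0) \<in> B T" by (rule B_simple) (auto simp: zero_mem)
    then show "0 \<in> B T" by (simp add: zero_fun_def)
  qed (auto intro: B_add B_scale)
  fix x y z :: "real \<Rightarrow> 'v" and c :: real
  assume x: "x \<in> B T"
  show "0 \<le> bip T x x" unfolding bip_def using B_mem[OF x]
    by (intro integral_nonneg_AE) (auto elim: eventually_mono simp: ip_nonneg)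
  assume y: "y \<in> B T"
  have m: "AE t in tm T. x t \<in> S" "AE t in tm T. y t \<in> S" using B_mem x y by auto
  show "bip T x y = bip T y x" unfolding bip_def
    by (rule integral_cong_AE) (use m in \<open>auto intro!: ip_measurable B_sm x y elim: eventually_elim2 simp: ip_sym\<close>)
  have "bip T (c *\<^sub>R x) y = (\<integral>t. c * ip (x t) (y t) \<partial>tm T)" unfolding bip_def
  proof (rule integral_cong_AE)
    show "AE t in tm T. ip ((c *\<^sub>R x) t) (y t) = c * ip (x t) (y t)"
      using m by eventually_elim (simp add: ip_simps)
  qed (intro ip_measurable borel_measurable_times borel_measurable_const B_sm x y B_scale)+
  then show "bip T (c *\<^sub>R x) y = c * bip T x y" by (simp add: bip_def)
  assume z: "z \<in> B T"
  have "bip T (x + y) z = (\<integral>t. ip (x t) (z t) + ip (y t) (z t) \<partial>tm T)" unfolding bip_def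
  proof (rule integral_cong_AE)
    show "AE t in tm T. ip ((x + y) t) (z t) = ip (x t) (z t) + ip (y t) (z t)"
      using m B_mem[OF z] by eventually_elim (simp add: ip_simps)
  qed (intro ip_measurable borel_measurable_add B_sm x y z B_add)+
  also have "\<dots> = bip T x z + bip T y z"
    unfolding bip_def by (intro Bochner_Integration.integral_add B_ip_integrable x y z)
  finally show "bip T (x + y) z = bip T x z + bip T y z" .
qed

lemma bip_nm:
  assumes "f \<in> B T" shows "bip T f f = (\<integral>t. (nm (f t))\<^sup>2 \<partial>tm T)"
  unfolding bip_def
proof (rule integral_cong_AE)
  show "AE t in tm T. ip (f t) (f t) = (nm (f t))\<^sup>2"
    using B_mem[OF assms] by eventually_elim (simp add: nm_sq)
  show "(\<lambda>t. (nm (f t))\<^sup>2) \<in> borel_measurable (tm T)" using B_nm_integrable[OF assms] by auto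
qed (intro ip_measurable B_sm assms)

lemma B_diff: "f \<in> B T \<Longrightarrow> g \<in> B T \<Longrightarrow> f - g \<in> B T"
  using semi_inner.diff_mem[OF B_semi_inner] .

lemma B_cong:
  assumes "f \<in> B T" "AE t in tm T. g t \<in> S \<and> nm (f t - g t) = 0"
  shows "g \<in> B T"
proof (rule B_I[OF sm_cong[OF B_sm[OF assms(1)] assms(2)] B_nm_integrable[OF assms(1)]])
  show "AE t in tm T. (nm (g t))\<^sup>2 \<le> (nm (f t))\<^sup>2"
    using assms(2) B_mem[OF assms(1)]
  proof eventually_elim
    case (elim t)
    then have "nm (g t) = nm (f t)" using nm_abs_diff[of "f t" "g t"] by simp
    then show ?case by simp
  qed
qed

text \<open>The truncation keeps the approximation below \<open>2 * nm (f t)\<close>, so that dominated convergence applies.\<close>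
lemma B_simple_approx:
  assumes f: "f \<in> B T" and e: "0 < e"
  obtains s where "simple_function (tm T) s" "\<And>t. 0 < t \<Longrightarrow> t < T \<Longrightarrow> s t \<in> S" "s \<in> B T"
    "(\<integral>t. (nm (s t - f t))\<^sup>2 \<partial>tm T) < e"
proof -
  obtain s where s: "\<And>n. simple_function (tm T) (s n)" "\<And>n t. 0 < t \<Longrightarrow> t < T \<Longrightarrow> s n t \<in> S"
      "AE t in tm T. f t \<in> S \<and> (\<forall>n. s n t \<in> S) \<and> (\<lambda>n. nm (s n t - f t)) \<longlonglongrightarrow> 0"
    by (rule smE[OF B_sm[OF f]]) (rule that)
  define r where "r n t = (if nm (s n t) \<le> 2 * nm (f t) then s n t else 0)" for n t
  have rs: "simple_function (tm T) (r n)" for n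
    unfolding r_def
  proof (rule simple_function_If[OF s(1) simple_function_const])
    have [measurable]: "(\<lambda>t. nm (s n t)) \<in> borel_measurable (tm T)" "(\<lambda>t. nm (f t)) \<in> borel_measurable (tm T)"
      using nm_measurable[OF sm_simple[OF s(1,2)]] nm_measurable[OF B_sm[OF f]] by auto
    show "{x \<in> space (tm T). nm (s n x) \<le> 2 * nm (f x)} \<in> sets (tm T)" by measurable
  qed
  have rS: "r n t \<in> S" if "0 < t" "t < T" for n t using s(2)[OF that] zero_mem by (simp add: r_def)
  have rB: "r n \<in> B T" for n by (rule B_simple[OF rs rS])
  have "(\<lambda>n. \<integral>t. (nm (r n t - f t))\<^sup>2 \<partial>tm T) \<longlonglongrightarrow> (\<integral>t. 0 \<partial>tm T)"
  proof (rule integral_dominated_convergence[where w = "\<lambda>t. 9 * (nm (f t))\<^sup>2"])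
    show "(\<lambda>t. (nm (r n t - f t))\<^sup>2) \<in> borel_measurable (tm T)" for n
      using B_nm_integrable[OF B_diff[OF rB f]] by auto
    \<comment> \<open>The factor 9 is the square of 1 + 2, from the triangle inequality and the
      truncation at twice the norm of \<open>f t\<close>.\<close>
    show "integrable (tm T) (\<lambda>t. 9 * (nm (f t))\<^sup>2)" using f by (intro integrable_mult_right B_nm_integrable)
    show "AE t in tm T. norm ((nm (r n t - f t))\<^sup>2) \<le> 9 * (nm (f t))\<^sup>2" for n
      using B_mem[OF f] AE_tm_space
    proof eventually_elim
      case (elim t)
      have "nm (r n t) \<le> 2 * nm (f t)" using nm_nonneg elim by (simp add: r_def nm_zero)
      then have "nm (r n t - f t) \<le> 3 * nm (f t)"
        using nm_triangle_diff[of "r n t" "f t"] rS elim by fastforce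
      then have "(nm (r n t - f t))\<^sup>2 \<le> (3 * nm (f t))\<^sup>2"
        using rS elim by (intro power_mono nm_nonneg) (auto intro: diff_mem)
      then show ?case by (simp add: power_mult_distrib)
    qed
    show "AE t in tm T. (\<lambda>n. (nm (r n t - f t))\<^sup>2) \<longlonglongrightarrow> 0"
      using s(3)
    proof eventually_elim
      case (elim t)
      have "(\<lambda>n. nm (r n t - f t)) \<longlonglongrightarrow> 0"
      \<comment> \<open>If \<open>f t\<close> is null, the truncation leaves only null values.
        Otherwise the truncation is eventually inactive, because the norms of \<open>s n t\<close>
        tend to a number strictly below the threshold.\<close>
      proof (cases "nm (f t) = 0")
        case True
        have "nm (r n t - f t) = 0" for n
        proof -
          have "r n t \<in> S" "nm (r n t) \<le> 0" using elim zero_mem True by (auto simp: r_def nm_zero)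
          then show ?thesis using nm_triangle_diff[of "r n t" "f t"] nm_nonneg[of "r n t - f t"] True elim
            by (simp add: diff_mem)
        qed
        then show ?thesis by simp
      next
        case False
        then have "0 < nm (f t)" using nm_nonneg[of "f t"] elim by auto
        moreover have "(\<lambda>n. nm (s n t)) \<longlonglongrightarrow> nm (f t)" using elim by (intro nm_tendsto) auto
        ultimately have "\<forall>\<^sub>F n in sequentially. nm (s n t) < 2 * nm (f t)"
          by (intro order_tendstoD(2)) auto
        then have "\<forall>\<^sub>F n in sequentially. nm (s n t - f t) = nm (r n t - f t)"
          by eventually_elim (simp add: r_def)
        then show ?thesis using elim by (auto intro: Lim_transform_eventually)
      qed
      then show ?case using tendsto_power[of _ 0 sequentially 2] by fastforce
    qed
  qed auto
  then have "(\<lambda>n. \<integral>t. (nm (r n t - f t))\<^sup>2 \<partial>tm T) \<longlonglongrightarrow> 0" by simp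
  from order_tendstoD(2)[OF this e] obtain n where "(\<integral>t. (nm (r n t - f t))\<^sup>2 \<partial>tm T) < e"
    by (auto simp: eventually_sequentially)
  then show thesis using that[OF rs rS rB] by blast
qed

section \<open>Curves that are continuous in the seminorm\<close>

lemma cont_tendsto:
  fixes f :: "real \<Rightarrow> 'v"
  assumes c: "((\<lambda>s. nm (f s - f t)) \<longlongrightarrow> 0) (at t within {0..T})"
    and t: "t \<in> {0..T}" and x: "\<And>n. x n \<in> {0..T}" "x \<longlonglongrightarrow> t"
  shows "(\<lambda>n. nm (f (x n) - f t)) \<longlonglongrightarrow> 0"
proof -

  have "continuous (at t within {0..T}) (\<lambda>s. nm (f s - f t))"
    using c by (simp add: continuous_within nm_zero)
  then show ?thesis using x t by (simp add: continuous_within_sequentially nm_zero o_def)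
qed

lemma cont_nm:
  assumes S: "\<And>t. t \<in> {0..T} \<Longrightarrow> f t \<in> S"
    and c: "\<And>t. t \<in> {0..T} \<Longrightarrow> ((\<lambda>s. nm (f s - f t)) \<longlongrightarrow> 0) (at t within {0..T})"
  shows "continuous_on {0..T} (\<lambda>t. nm (f t))"
  unfolding continuous_on_def
proof
  fix t assume t: "t \<in> {0..T}"
  have "((\<lambda>s. nm (f s) - nm (f t)) \<longlongrightarrow> 0) (at t within {0..T})"
  proof (rule Lim_null_comparison[OF _ c[OF t]])
    show "\<forall>\<^sub>F s in at t within {0..T}. norm (nm (f s) - nm (f t)) \<le> nm (f s - f t)"
      unfolding eventually_at_filter using S t nm_abs_diff by (auto intro!: always_eventually)
  qed
  then show "((\<lambda>s. nm (f s)) \<longlongrightarrow> nm (f t)) (at t within {0..T})" by (rule Lim_null[THEN iffD2])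
qed

lemma cont_ip:
  assumes S: "\<And>t. t \<in> {0..T} \<Longrightarrow> f t \<in> S"
    and c: "\<And>t. t \<in> {0..T} \<Longrightarrow> ((\<lambda>s. nm (f s - f t)) \<longlongrightarrow> 0) (at t within {0..T})" and v: "v \<in> S"
  shows "continuous_on {0..T} (\<lambda>t. ip (f t) v)"
  unfolding continuous_on_def
proof
  fix t assume t: "t \<in> {0..T}"
  have "((\<lambda>s. ip (f s) v - ip (f t) v) \<longlongrightarrow> 0) (at t within {0..T})"
  proof (rule Lim_null_comparison)
    show "((\<lambda>s. nm (f s - f t) * nm v) \<longlongrightarrow> 0) (at t within {0..T})"
      using c[OF t] by (auto intro!: tendsto_eq_intros)
    have "norm (ip (f s) v - ip (f t) v) \<le> nm (f s - f t) * nm v" if "s \<in> {0..T}" for s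
      using cauchy_schwarz[of "f s - f t" v] S[OF that] S[OF t] v by (simp add: ip_simps mem_intros)
    then show "\<forall>\<^sub>F s in at t within {0..T}. norm (ip (f s) v - ip (f t) v) \<le> nm (f s - f t) * nm v"
      unfolding eventually_at_filter by (auto intro!: always_eventually)
  qed
  then show "((\<lambda>s. ip (f s) v) \<longlongrightarrow> ip (f t) v) (at t within {0..T})" by (rule Lim_null[THEN iffD2])
qed

lemma cont_bounded:
  fixes f :: "real \<Rightarrow> 'v"
  assumes S: "\<And>t. t \<in> {0..T} \<Longrightarrow> f t \<in> S"
    and c: "\<And>t. t \<in> {0..T} \<Longrightarrow> ((\<lambda>s. nm (f s - f t)) \<longlongrightarrow> 0) (at t within {0..T})"
  obtains b where "\<And>t. t \<in> {0..T} \<Longrightarrow> nm (f t) \<le> b"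
proof -
  have "compact ((\<lambda>t. nm (f t)) ` {0..T})" by (intro compact_continuous_image cont_nm S c compact_Icc)
  from compact_imp_bounded[OF this] obtain b where "\<forall>x\<in>(\<lambda>t. nm (f t)) ` {0..T}. norm x \<le> b"
    unfolding bounded_iff by blast
  then have b: "norm (nm (f t)) \<le> b" if "t \<in> {0..T}" for t using that by blast
  show thesis by (rule that[of b]) (use b in force)
qed

lemma B_continuous:
  assumes S: "\<And>t. t \<in> {0..T} \<Longrightarrow> f t \<in> S"
    and c: "\<And>t. t \<in> {0..T} \<Longrightarrow> ((\<lambda>s. nm (f s - f t)) \<longlongrightarrow> 0) (at t within {0..T})"
  shows "f \<in> B T"
proof -
  \<comment> \<open>Rounding down to the grid of mesh 1/(n+1). Sampling \<open>f\<close> there takes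
    finitely many values on the interval and never leaves \<open>[0,T]\<close>, the only place where
    continuity is assumed.\<close>
  define x where "x n t = real_of_int \<lfloor>real (Suc n) * t\<rfloor> / real (Suc n)" for n t
  have x1: "x n t \<le> t" for n t
    unfolding x_def by (simp add: pos_divide_le_eq mult.commute)
  have x2: "t - 1 / real (Suc n) \<le> x n t" for n t
  proof -
    have "real (Suc n) * t - 1 \<le> real_of_int \<lfloor>real (Suc n) * t\<rfloor>" by linarith
    then have "(real (Suc n) * t - 1) / real (Suc n) \<le> x n t"
      unfolding x_def by (intro divide_right_mono) auto
    then show ?thesis by (simp add: diff_divide_distrib)
  qed
  have x0: "0 \<le> x n t" if "0 \<le> t" for n t using that by (simp add: x_def)
  have xl: "(\<lambda>n. x n t) \<longlonglongrightarrow> t" for t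
  proof (rule tendsto_sandwich[OF _ _ _ tendsto_const])
    show "(\<lambda>n. t - 1 / real (Suc n)) \<longlonglongrightarrow> t"
      using tendsto_diff[OF tendsto_const LIMSEQ_inverse_real_of_nat, of t] by (simp add: inverse_eq_divide)
  qed (use x1 x2 in auto)
  have "sm T f"
  proof (rule smI)
    show "simple_function (tm T) (\<lambda>t. f (x n t))" for n
    proof -
      have "finite ((\<lambda>t. \<lfloor>real (Suc n) * t\<rfloor>) ` {0<..<T})"
      proof (rule finite_subset)
        show "(\<lambda>t. \<lfloor>real (Suc n) * t\<rfloor>) ` {0<..<T} \<subseteq> {0..\<lfloor>real (Suc n) * T\<rfloor>}"
          by (auto intro!: floor_mono mult_left_mono)
      qed simp
      moreover have "(\<lambda>t. \<lfloor>real (Suc n) * t\<rfloor>) \<in> measurable (tm T) (count_space UNIV)"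
        by (intro measurable_restrict_space1 measurable_completion) measurable
      then have "(\<lambda>t. \<lfloor>real (Suc n) * t\<rfloor>) -` {k} \<inter> space (tm T) \<in> sets (tm T)" for k
        by (rule measurable_sets) simp
      ultimately have "simple_function (tm T) (\<lambda>t. \<lfloor>real (Suc n) * t\<rfloor>)"
        unfolding simple_function_def by simp
      from simple_function_compose1[OF this, of "\<lambda>k. f (real_of_int k / real (Suc n))"]
      show ?thesis by (simp add: x_def)
    qed
    have mem: "x n t \<in> {0..T}" if "0 < t" "t < T" for n t using x0[of t n] x1[of n t] that by auto
    then show "f (x n t) \<in> S" if "0 < t" "t < T" for n t using S that by blast
    show "AE t in tm T. f t \<in> S \<and> (\<lambda>n. nm (f (x n t) - f t)) \<longlonglongrightarrow> 0"
      using AE_tm_space by eventually_elim (auto intro!: S cont_tendsto[where T = T] c mem xl)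
  qed
  obtain b where b: "\<And>t. t \<in> {0..T} \<Longrightarrow> nm (f t) \<le> b"
    using cont_bounded[OF S c] by blast
  show ?thesis
  proof (rule B_I[OF \<open>sm T f\<close>])
    show "AE t in tm T. (nm (f t))\<^sup>2 \<le> b\<^sup>2"
      using AE_tm_space
    proof eventually_elim
      case (elim t)
      then show ?case by (intro power_mono b nm_nonneg S) auto
    qed
  qed simp
qed

end

lemma (in semi_hilbert) summable_limit:
  assumes X: "\<And>n. X n \<in> S" and s: "summable (\<lambda>n. nm (X (Suc n) - X n))"
  shows "\<exists>x\<in>S. (\<lambda>n. nm (X n - x)) \<longlonglongrightarrow> 0"
proof (rule complete[OF X])
  have b: "nm (X (n + k) - X n) \<le> (\<Sum>i=n..<n + k. nm (X (Suc i) - X i))" for n k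
  proof (induction k)
    case 0
    then show ?case by (simp add: nm_zero)
  next
    case (Suc k)
    then show ?case using nm_triangle3[of "X (Suc (n + k))" "X (n + k)" "X n"] X by simp
  qed
  fix e :: real assume "0 < e"
  then obtain N where N: "\<And>m n. m \<ge> N \<Longrightarrow> norm (\<Sum>i=m..<n. nm (X (Suc i) - X i)) < e"
    using s unfolding summable_Cauchy by metis
  have *: "nm (X m - X n) < e" if "n \<ge> N" "n \<le> m" for m n
    using b[of n "m - n"] N[OF that(1), of m] that by simp
  have "nm (X m - X n) < e" if "n \<ge> N" "m \<ge> N" for m n
    using *[of n m] *[of m n] that nm_commute[OF X X, of m n] by (cases "n \<le> m") auto
  then show "\<exists>M. \<forall>m\<ge>M. \<forall>n\<ge>M. nm (X m - X n) < e" by blast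
qed

text \<open>The pattern is that of the scalar case. What is new is strong measurability of the
  limit, which requires simple functions that converge to it at almost every time; these are taken
  along the sequence as a diagonal.\<close>

lemma (in semi_hilbert) B_semi_hilbert: "semi_hilbert (B T) (bip T)"
proof (rule semi_inner.semi_hilbertI[OF B_semi_inner])
  interpret B: semi_inner "B T" "bip T" by (rule B_semi_inner)
  fix X :: "nat \<Rightarrow> real \<Rightarrow> 'a"
  assume X: "\<And>n. X n \<in> B T" and r: "\<And>n. B.nm (X (Suc n) - X n) \<le> (1/8)^n"
  have sq: "(B.nm f)\<^sup>2 = (\<integral>t. (nm (f t))\<^sup>2 \<partial>tm T)" if "f \<in> B T" for f
    using B.nm_sq[OF that] bip_nm[OF that] by simp
  have D: "X m - X n \<in> B T" for m n using X by (intro B_diff)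
  \<comment> \<open>Each \<open>X k\<close> is replaced by a simple curve within squared distance
    \<open>(1/64)^k\<close>. The errors are then summable at almost every time, and the simple
    curves converge to the same limit.\<close>
  have "\<forall>k. \<exists>s. simple_function (tm T) s \<and> (\<forall>t. 0 < t \<longrightarrow> t < T \<longrightarrow> s t \<in> S) \<and> s \<in> B T \<and>
      (\<integral>t. (nm (s t - X k t))\<^sup>2 \<partial>tm T) < (1/64)^k"
  proof
    fix k
    show "\<exists>s. simple_function (tm T) s \<and> (\<forall>t. 0 < t \<longrightarrow> t < T \<longrightarrow> s t \<in> S) \<and> s \<in> B T \<and>
      (\<integral>t. (nm (s t - X k t))\<^sup>2 \<partial>tm T) < (1/64)^k"
      by (rule B_simple_approx[OF X[of k], of "(1/64)^k"]) auto
  qed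
  from choice[OF this] obtain s where "\<forall>k. simple_function (tm T) (s k) \<and> (\<forall>t. 0 < t \<longrightarrow> t < T \<longrightarrow> s k t \<in> S) \<and>
      s k \<in> B T \<and> (\<integral>t. (nm (s k t - X k t))\<^sup>2 \<partial>tm T) < (1/64)^k" by blast
  then have s: "\<And>k. simple_function (tm T) (s k)" "\<And>k t. 0 < t \<Longrightarrow> t < T \<Longrightarrow> s k t \<in> S" "\<And>k. s k \<in> B T"
      "\<And>k. (\<integral>t. (nm (s k t - X k t))\<^sup>2 \<partial>tm T) < (1/64)^k" by auto
  have sX: "s k - X k \<in> B T" for k by (intro B_diff s X)
  have 1: "AE t in tm T. summable (\<lambda>k. \<bar>nm (s k t - X k t)\<bar>)"
  proof (rule rapid_summable_AE)
    show "(\<lambda>t. nm (s k t - X k t)) \<in> borel_measurable (tm T)" for k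
      using nm_measurable[OF B_sm[OF sX[of k]]] by simp
    show "integrable (tm T) (\<lambda>t. (nm (s k t - X k t))\<^sup>2)" for k
      using B_nm_integrable[OF sX[of k]] by simp
  qed (use s(4) in \<open>auto intro: less_imp_le\<close>)
  have 2: "AE t in tm T. summable (\<lambda>k. \<bar>nm (X (Suc k) t - X k t)\<bar>)"
  proof (rule rapid_summable_AE)
    fix k
    show "(\<lambda>t. nm (X (Suc k) t - X k t)) \<in> borel_measurable (tm T)"
      using nm_measurable[OF B_sm[OF D[of "Suc k" k]]] by simp
    show "integrable (tm T) (\<lambda>t. (nm (X (Suc k) t - X k t))\<^sup>2)"
      using B_nm_integrable[OF D[of "Suc k" k]] by simp
    have "(\<integral>t. (nm (X (Suc k) t - X k t))\<^sup>2 \<partial>tm T) = (B.nm (X (Suc k) - X k))\<^sup>2"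
      using sq[OF D] by simp
    also have "\<dots> \<le> ((1/8)^k)\<^sup>2" using r B.nm_nonneg[OF D] by (intro power_mono)
    also have "\<dots> = (1/64)^k" by (simp add: power2_eq_square flip: power_mult_distrib)
    finally show "(\<integral>t. (nm (X (Suc k) t - X k t))\<^sup>2 \<partial>tm T) \<le> (1/64)^k" .
  qed
  have XS: "AE t in tm T. \<forall>k. X k t \<in> S" using B_mem[OF X] by (simp add: AE_all_countable)
  \<comment> \<open>Limits are unique only up to null elements, so one is chosen at each
    time.\<close>
  define x where "x t = (SOME x. x \<in> S \<and> (\<lambda>n. nm (X n t - x)) \<longlonglongrightarrow> 0)" for t
  have x: "AE t in tm T. x t \<in> S \<and> (\<lambda>n. nm (X n t - x t)) \<longlonglongrightarrow> 0"
    using 2 XS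
  proof eventually_elim
    case (elim t)
    then have "summable (\<lambda>k. nm (X (Suc k) t - X k t))" by (simp add: nm_nonneg diff_mem)
    then have "\<exists>x. x \<in> S \<and> (\<lambda>n. nm (X n t - x)) \<longlonglongrightarrow> 0"
      using summable_limit[of "\<lambda>k. X k t"] elim by blast
    then show ?case unfolding x_def by (rule someI_ex)
  qed
  have xsm: "sm T x"
  proof (rule smI[OF s(1,2)])
    show "AE t in tm T. x t \<in> S \<and> (\<lambda>n. nm (s n t - x t)) \<longlonglongrightarrow> 0"
      using x 1 XS AE_tm_space
    proof eventually_elim
      case (elim t)
      have sS: "s k t \<in> S" for k using elim s(2) by auto
      have "(\<lambda>k. \<bar>nm (s k t - X k t)\<bar>) \<longlonglongrightarrow> 0" using elim by (intro summable_LIMSEQ_zero) auto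
      then have l: "(\<lambda>k. nm (s k t - X k t) + nm (X k t - x t)) \<longlonglongrightarrow> 0"
        using elim by (auto intro!: tendsto_eq_intros simp: tendsto_rabs_zero_iff)
      have "(\<lambda>n. nm (s n t - x t)) \<longlonglongrightarrow> 0"
      proof (rule Lim_null_comparison[OF _ l])
        show "\<forall>\<^sub>F k in sequentially. norm (nm (s k t - x t)) \<le> nm (s k t - X k t) + nm (X k t - x t)"
          using nm_triangle3[OF sS] nm_nonneg[OF diff_mem[OF sS]] elim by auto
      qed
      then show ?case using elim by simp
    qed
  qed
  have b: "X n - x \<in> B T \<and> (\<integral>t. (nm (X n t - x t))\<^sup>2 \<partial>tm T) \<le> (2 * (1/8)^n)\<^sup>2" for n
  proof -
    have I: "integrable (tm T) (\<lambda>t. (nm (X n t - X (n + m) t))\<^sup>2)" for m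
      using B_nm_integrable[OF D[of n "n + m"]] by simp
    have le: "(\<integral>t. (nm (X n t - X (n + m) t))\<^sup>2 \<partial>tm T) \<le> (2 * (1/8)^n)\<^sup>2" for m
    proof -
      have "(\<integral>t. (nm (X n t - X (n + m) t))\<^sup>2 \<partial>tm T) = (B.nm (X (n + m) - X n))\<^sup>2"
        using sq[OF D[of n "n + m"]] B.nm_commute[OF X X, of n "n + m"] by simp
      also have "\<dots> \<le> (2 * (1/8)^n)\<^sup>2"
        using B.rapid_bound[OF X r, of n "n + m"] B.nm_nonneg[OF D] by (intro power_mono) auto
      finally show ?thesis .
    qed
    have l: "AE t in tm T. (\<lambda>m. (nm (X n t - X (n + m) t))\<^sup>2) \<longlonglongrightarrow> (nm (X n t - x t))\<^sup>2"
      using x XS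
    proof eventually_elim
      case (elim t)
      have "(\<lambda>m. nm (X (n + m) t - x t)) \<longlonglongrightarrow> 0"
        using LIMSEQ_ignore_initial_segment[of "\<lambda>n. nm (X n t - x t)" 0 n] elim by (simp add: add.commute)
      moreover have "nm ((X n t - X (n + m) t) - (X n t - x t)) = nm (X (n + m) t - x t)" for m
        using nm_commute[of "x t" "X (n + m) t"] elim by simp
      ultimately have "(\<lambda>m. nm (X n t - X (n + m) t)) \<longlonglongrightarrow> nm (X n t - x t)"
        using elim by (intro nm_tendsto) (auto intro: diff_mem)
      then show ?case by (intro tendsto_intros)
    qed
    have m: "(\<lambda>t. (nm (X n t - x t))\<^sup>2) \<in> borel_measurable (tm T)"
      using nm_measurable[OF sm_diff[OF B_sm[OF X[of n]] xsm]] by simp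
    have "integrable (tm T) (\<lambda>t. (nm (X n t - x t))\<^sup>2)" "(\<integral>t. (nm (X n t - x t))\<^sup>2 \<partial>tm T) \<le> (2 * (1/8)^n)\<^sup>2"
      using fatou_bound[OF I _ le l m] by auto
    then show ?thesis using sm_diff[OF B_sm[OF X[of n]] xsm] by (simp add: bochner_L2_def)
  qed
  have "X 0 - (X 0 - x) \<in> B T" by (rule B_diff[OF X conjunct1[OF b]])
  then have xB: "x \<in> B T" by (simp only: diff_diff_eq2 add_diff_cancel_left')
  moreover have "(\<lambda>n. B.nm (X n - x)) \<longlonglongrightarrow> 0"
  proof (rule Lim_null_comparison)
    have XxB: "X n - x \<in> B T" for n using b by auto
    have "B.nm (X n - x) \<le> 2 * (1/8)^n" for n
    proof (rule power2_le_imp_le)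
      show "(B.nm (X n - x))\<^sup>2 \<le> (2 * (1/8)^n)\<^sup>2" using b[of n] unfolding sq[OF XxB] by simp
    qed simp
    then show "\<forall>\<^sub>F n in sequentially. norm (B.nm (X n - x)) \<le> 2 * (1/8)^n"
      using B.nm_nonneg[OF XxB] by simp
    show "(\<lambda>n. 2 * (1/8)^n) \<longlonglongrightarrow> (0::real)"
      using tendsto_mult_right_zero[OF LIMSEQ_realpow_zero[of "1/8::real"]] by simp
  qed
  ultimately show "\<exists>x\<in>B T. (\<lambda>n. B.nm (X n - x)) \<longlonglongrightarrow> 0" by blast
qed

subsection \<open>Integrals over subintervals and the product rule\<close>

text \<open>The horizon \<open>T\<close> stays fixed while \<open>s\<close> and \<open>t\<close>
  vary, so integrability is stated once on the whole interval. Half-open intervals make adjacent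
  pieces add up without overlap.\<close>

definition ti :: "real \<Rightarrow> real \<Rightarrow> real \<Rightarrow> (real \<Rightarrow> real) \<Rightarrow> real" where
  "ti T s t f = (\<integral>r. indicator {s<..t} r * f r \<partial>tm T)"

lemma ti_integrable:
  fixes f :: "real \<Rightarrow> real"
  assumes f: "integrable (tm T) f"
  shows "integrable (tm T) (\<lambda>r. indicator {s<..t} r * f r)"
proof (rule Bochner_Integration.integrable_bound[OF f])
  have "indicat_real {s<..t} \<in> borel_measurable (tm T)"
    by (intro measurable_restrict_space1 borel_measurable_indicator) auto
  then show "(\<lambda>r. indicator {s<..t} r * f r) \<in> borel_measurable (tm T)" using f by measurable
qed (auto simp: indicator_def)

lemma ti_add: "integrable (tm T) f \<Longrightarrow> integrable (tm T) g \<Longrightarrow> ti T s t (\<lambda>r. f r + g r) = ti T s t f + ti T s t g"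
  unfolding ti_def by (simp add: distrib_left ti_integrable)

lemma ti_diff: "integrable (tm T) f \<Longrightarrow> integrable (tm T) g \<Longrightarrow> ti T s t (\<lambda>r. f r - g r) = ti T s t f - ti T s t g"
  unfolding ti_def by (simp add: right_diff_distrib ti_integrable)

lemma ti_cmult: "ti T s t (\<lambda>r. c * f r) = c * ti T s t f"
  unfolding ti_def by (simp add: mult.left_commute)

lemma ti_minus: "ti T s t (\<lambda>r. - f r) = - ti T s t f"
  unfolding ti_def by simp

lemma ti_cong_AE:
  assumes "integrable (tm T) f" "integrable (tm T) g" "AE r in tm T. f r = g r"
  shows "ti T s t f = ti T s t g"
  unfolding ti_def
  by (rule integral_cong_AE)
    (use assms ti_integrable[of T f s t] ti_integrable[of T g s t] in \<open>auto elim: eventually_mono\<close>)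

lemma ti_mono:
  assumes "integrable (tm T) f" "integrable (tm T) g" "AE r in tm T. s < r \<longrightarrow> r \<le> t \<longrightarrow> f r \<le> g r"
  shows "ti T s t f \<le> ti T s t g"
  unfolding ti_def
  by (rule integral_mono_AE)
    (use assms ti_integrable[of T f s t] ti_integrable[of T g s t] in \<open>auto elim: eventually_mono simp: indicator_def\<close>)

lemma ti_abs_le:
  assumes "integrable (tm T) f" "integrable (tm T) g" "AE r in tm T. s < r \<longrightarrow> r \<le> t \<longrightarrow> \<bar>f r\<bar> \<le> g r"
  shows "\<bar>ti T s t f\<bar> \<le> ti T s t g"
proof -
  have "ti T s t f \<le> ti T s t g" by (rule ti_mono[OF assms(1,2)]) (use assms(3) in \<open>auto elim: eventually_mono\<close>)
  moreover have "ti T s t (\<lambda>r. - f r) \<le> ti T s t g"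
    by (rule ti_mono) (use assms in \<open>auto elim: eventually_mono\<close>)
  ultimately show ?thesis by (simp add: ti_minus abs_le_iff)
qed

lemma ti_split:
  assumes "integrable (tm T) f" "s \<le> t" "t \<le> u"
  shows "ti T s u f = ti T s t f + ti T t u f"
proof -
  have "ti T s u f = (\<integral>r. indicator {s<..t} r * f r + indicator {t<..u} r * f r \<partial>tm T)"
    unfolding ti_def using assms by (intro Bochner_Integration.integral_cong) (auto simp: indicator_def)
  then show ?thesis unfolding ti_def using assms(1) by (simp add: ti_integrable)
qed

lemma ti_empty: "t \<le> s \<Longrightarrow> ti T s t f = 0"
  unfolding ti_def by (simp add: indicator_def)

lemma ti_full: "ti T 0 T f = (\<integral>r. f r \<partial>tm T)"
  unfolding ti_def by (intro Bochner_Integration.integral_cong) (auto simp: indicator_def)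

lemma ti_const:
  assumes "0 \<le> s" "s \<le> t" "t \<le> T"
  shows "ti T s t (\<lambda>_. c) = c * (t - s)"
proof -
  have "ti T s t (\<lambda>_. 1) = (\<integral>r. indicator {0<..<T} r *\<^sub>R indicator {s<..t} r \<partial>lebesgue)"
    unfolding ti_def by (subst integral_restrict_space) auto
  also have "\<dots> = (\<integral>r. indicator ({0<..<T} \<inter> {s<..t}) r \<partial>lebesgue)"
    by (intro Bochner_Integration.integral_cong) (auto simp: indicator_def)
  also have "\<dots> = (\<integral>r. indicator {s<..<t} r \<partial>lebesgue)"
  proof (rule integral_cong_AE)
    \<comment> \<open>The two sets can differ only at \<open>t\<close>, and they do so unless
      \<open>t = T\<close> or the interval is empty.\<close>
    have "AE r in lebesgue. r \<noteq> t" by (rule AE_completion) (rule AE_lborel_singleton)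
    then show "AE r in lebesgue. indicator ({0<..<T} \<inter> {s<..t}) r = (indicator {s<..<t} r :: real)"
      by eventually_elim (use assms in \<open>auto simp: indicator_def\<close>)
  qed (auto intro!: borel_measurable_indicator)
  also have "\<dots> = t - s" using assms by (simp add: measure_completion)
  finally show ?thesis using ti_cmult[of T s t c "\<lambda>_. 1"] by simp
qed

lemma ti_partition:
  assumes f: "integrable (tm T) f" and t: "\<And>k. k < n \<Longrightarrow> t k \<le> t (Suc k)"
  shows "ti T (t 0) (t n) f = (\<Sum>k<n. ti T (t k) (t (Suc k)) f) \<and> t 0 \<le> t n"
  using t
proof (induction n)
  case 0
  then show ?case by (simp add: ti_empty)
next
  case (Suc n)
  then have "ti T (t 0) (t n) f = (\<Sum>k<n. ti T (t k) (t (Suc k)) f) \<and> t 0 \<le> t n" "t n \<le> t (Suc n)" by auto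
  then show ?case using ti_split[OF f, of "t 0" "t n" "t (Suc n)"] by auto
qed

text \<open>
  On a partition with small mesh, \<open>P \<tau> \<tau> - P 0 0\<close> telescopes into increments in one variable
  at a time.
\<close>
lemma product_rule:
  fixes P p q :: "real \<Rightarrow> real \<Rightarrow> real"
  assumes \<tau>: "0 < \<tau>" "\<tau> \<le> T"
    and pi: "\<And>s. s \<in> {0..\<tau>} \<Longrightarrow> integrable (tm T) (\<lambda>r. p r s)"
    and qi: "\<And>t. t \<in> {0..\<tau>} \<Longrightarrow> integrable (tm T) (\<lambda>r. q t r)"
    and P1: "\<And>t t' s. 0 \<le> t \<Longrightarrow> t \<le> t' \<Longrightarrow> t' \<le> \<tau> \<Longrightarrow> s \<in> {0..\<tau>} \<Longrightarrow> P t' s - P t s = ti T t t' (\<lambda>r. p r s)"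
    and P2: "\<And>s s' t. 0 \<le> s \<Longrightarrow> s \<le> s' \<Longrightarrow> s' \<le> \<tau> \<Longrightarrow> t \<in> {0..\<tau>} \<Longrightarrow> P t s' - P t s = ti T s s' (\<lambda>r. q t r)"
    and pd: "integrable (tm T) (\<lambda>r. p r r)" and qd: "integrable (tm T) (\<lambda>r. q r r)"
    and m: "integrable (tm T) m"
    and cp: "\<And>e. 0 < e \<Longrightarrow> \<exists>d>0. AE r in tm T. \<forall>s\<in>{0..\<tau>}. r \<le> \<tau> \<longrightarrow> \<bar>s - r\<bar> < d \<longrightarrow> \<bar>p r s - p r r\<bar> \<le> e * m r"
    and cq: "\<And>e. 0 < e \<Longrightarrow> \<exists>d>0. AE r in tm T. \<forall>s\<in>{0..\<tau>}. r \<le> \<tau> \<longrightarrow> \<bar>s - r\<bar> < d \<longrightarrow> \<bar>q s r - q r r\<bar> \<le> e * m r"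
  shows "P \<tau> \<tau> - P 0 0 = ti T 0 \<tau> (\<lambda>r. p r r) + ti T 0 \<tau> (\<lambda>r. q r r)"
proof -
  define D where "D = P \<tau> \<tau> - P 0 0 - (ti T 0 \<tau> (\<lambda>r. p r r) + ti T 0 \<tau> (\<lambda>r. q r r))"
  define C where "C = ti T 0 \<tau> m"
  \<comment> \<open>The partial derivatives are merely integrable in \<open>r\<close>; the common
    majorant \<open>m\<close> makes the modulus of continuity in the other variable summable over
    the cells.\<close>
  have main: "\<bar>D\<bar> \<le> 2 * e * C" if e: "0 < e" for e
  proof -
    obtain d1 where d1: "0 < d1" "AE r in tm T. \<forall>s\<in>{0..\<tau>}. r \<le> \<tau> \<longrightarrow> \<bar>s - r\<bar> < d1 \<longrightarrow> \<bar>p r s - p r r\<bar> \<le> e * m r"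
      using cp[OF e] by blast
    obtain d2 where d2: "0 < d2" "AE r in tm T. \<forall>s\<in>{0..\<tau>}. r \<le> \<tau> \<longrightarrow> \<bar>s - r\<bar> < d2 \<longrightarrow> \<bar>q s r - q r r\<bar> \<le> e * m r"
      using cq[OF e] by blast
    obtain N where N: "\<tau> / min d1 d2 < real N" using reals_Archimedean2 by blast
    have md: "0 < min d1 d2" using d1 d2 by simp
    have N0: "0 < real N" using order.strict_trans[OF divide_pos_pos[OF \<tau>(1) md] N] .
    define t where "t k = real k * \<tau> / real N" for k :: nat
    have t0: "t 0 = 0" and tN: "t N = \<tau>" using N0 by (auto simp: t_def)
    have tS: "t (Suc k) = t k + \<tau> / real N" for k by (simp add: t_def add_divide_distrib distrib_right)
    have "\<tau> < real N * min d1 d2" using N md by (simp only: pos_divide_less_eq)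
    then have step: "\<tau> / real N < min d1 d2" "0 < \<tau> / real N"
      using N0 \<tau> by (simp_all only: pos_divide_less_eq mult.commute divide_pos_pos)
    have tmono: "t k \<le> t (Suc k)" for k using tS step by (simp add: less_imp_le)
    have trange: "t k \<in> {0..\<tau>}" if "k \<le> N" for k
    proof -
      have "real k * \<tau> \<le> real N * \<tau>" using that \<tau> by (intro mult_right_mono) auto
      then have "t k \<le> \<tau>" unfolding t_def using N0 by (simp add: pos_divide_le_eq mult.commute)
      then show ?thesis using \<tau> by (simp add: t_def)
    qed
    have tel: "P \<tau> \<tau> - P 0 0 = (\<Sum>k<N. P (t (Suc k)) (t (Suc k)) - P (t k) (t k))"
      using sum_lessThan_telescope[of "\<lambda>k. P (t k) (t k)" N] by (simp add: t0 tN)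
    \<comment> \<open>The first variable moves while the second rests at the right end of the cell;
      then the second moves while the first rests at the left end. Both frozen times lie within one
      mesh of every \<open>r\<close> in the cell.\<close>
    have incr: "P (t (Suc k)) (t (Suc k)) - P (t k) (t k) =
        ti T (t k) (t (Suc k)) (\<lambda>r. p r (t (Suc k))) + ti T (t k) (t (Suc k)) (\<lambda>r. q (t k) r)" if "k < N" for k
    proof -
      have k: "t k \<in> {0..\<tau>}" "t (Suc k) \<in> {0..\<tau>}" using trange that by auto
      have "P (t (Suc k)) (t (Suc k)) - P (t k) (t (Suc k)) = ti T (t k) (t (Suc k)) (\<lambda>r. p r (t (Suc k)))"
        using k tmono by (intro P1) auto
      moreover have "P (t k) (t (Suc k)) - P (t k) (t k) = ti T (t k) (t (Suc k)) (\<lambda>r. q (t k) r)"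
        using k tmono by (intro P2) auto
      ultimately show ?thesis by simp
    qed
    have ps: "ti T 0 \<tau> f = (\<Sum>k<N. ti T (t k) (t (Suc k)) f)" if "integrable (tm T) f" for f
      using ti_partition[OF that, of N t] tmono by (simp add: t0 tN)
    have D_eq: "D = (\<Sum>k<N. (ti T (t k) (t (Suc k)) (\<lambda>r. p r (t (Suc k))) + ti T (t k) (t (Suc k)) (\<lambda>r. q (t k) r))
          - (ti T (t k) (t (Suc k)) (\<lambda>r. p r r) + ti T (t k) (t (Suc k)) (\<lambda>r. q r r)))"
      unfolding D_def tel ps[OF pd] ps[OF qd] by (simp add: incr sum_subtractf sum.distrib)
    have "\<bar>D\<bar> \<le> (\<Sum>k<N. 2 * e * ti T (t k) (t (Suc k)) m)"
      unfolding D_eq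
    proof (rule order_trans[OF sum_abs], rule sum_mono)
      fix k assume "k \<in> {..<N}"
      then have k: "t k \<in> {0..\<tau>}" "t (Suc k) \<in> {0..\<tau>}" using trange by auto
      have "\<bar>ti T (t k) (t (Suc k)) (\<lambda>r. p r (t (Suc k)) - p r r)\<bar> \<le> ti T (t k) (t (Suc k)) (\<lambda>r. e * m r)"
      proof (rule ti_abs_le)
        show "AE r in tm T. t k < r \<longrightarrow> r \<le> t (Suc k) \<longrightarrow> \<bar>p r (t (Suc k)) - p r r\<bar> \<le> e * m r"
          using d1(2)
        proof eventually_elim
          case (elim r)
          show ?case
          proof (intro impI)
            assume r: "t k < r" "r \<le> t (Suc k)"
            then have "\<bar>t (Suc k) - r\<bar> < d1" "r \<le> \<tau>" using tS[of k] step k by auto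
            then show "\<bar>p r (t (Suc k)) - p r r\<bar> \<le> e * m r" using elim k by blast
          qed
        qed
      qed (use pi[OF k(2)] pd m in auto)
      moreover have "\<bar>ti T (t k) (t (Suc k)) (\<lambda>r. q (t k) r - q r r)\<bar> \<le> ti T (t k) (t (Suc k)) (\<lambda>r. e * m r)"
      proof (rule ti_abs_le)
        show "AE r in tm T. t k < r \<longrightarrow> r \<le> t (Suc k) \<longrightarrow> \<bar>q (t k) r - q r r\<bar> \<le> e * m r"
          using d2(2)
        proof eventually_elim
          case (elim r)
          show ?case
          proof (intro impI)
            assume r: "t k < r" "r \<le> t (Suc k)"
            then have "\<bar>t k - r\<bar> < d2" "r \<le> \<tau>" using tS[of k] step k by auto
            then show "\<bar>q (t k) r - q r r\<bar> \<le> e * m r" using elim k by blast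
          qed
        qed
      qed (use qi[OF k(1)] qd m in auto)
      ultimately show "\<bar>(ti T (t k) (t (Suc k)) (\<lambda>r. p r (t (Suc k))) + ti T (t k) (t (Suc k)) (\<lambda>r. q (t k) r))
          - (ti T (t k) (t (Suc k)) (\<lambda>r. p r r) + ti T (t k) (t (Suc k)) (\<lambda>r. q r r))\<bar>
          \<le> 2 * e * ti T (t k) (t (Suc k)) m"
        unfolding ti_diff[OF pi[OF k(2)] pd] ti_diff[OF qi[OF k(1)] qd] ti_cmult by linarith
    qed
    also have "\<dots> = 2 * e * (\<Sum>k<N. ti T (t k) (t (Suc k)) m)" by (simp only: sum_distrib_left)
    also have "\<dots> = 2 * e * C" using ps[OF m] by (simp only: C_def)
    finally show ?thesis .
  qed
  have "D = 0"
  proof (rule ccontr)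
    assume "D \<noteq> 0"
    \<comment> \<open>With this value the bound \<open>main\<close> gives at most half of
      \<open>\<bar>D\<bar>\<close>; the added 1 covers \<open>C = 0\<close>.\<close>
    define e where "e = \<bar>D\<bar> / (4 * (\<bar>C\<bar> + 1))"
    have "0 < e" using \<open>D \<noteq> 0\<close> by (simp add: e_def)
    have "\<bar>D\<bar> \<le> 2 * e * C" by (rule main) fact
    also have "\<dots> \<le> 2 * e * (\<bar>C\<bar> + 1)" using \<open>0 < e\<close> by (intro mult_left_mono) auto
    also have "\<dots> = \<bar>D\<bar> / 2" unfolding e_def by (simp add: field_simps)
    finally show False using \<open>D \<noteq> 0\<close> by simp
  qed
  then show ?thesis by (simp add: D_def)
qed

text \<open>A set of full measure meets every nondegenerate interval. This carries statements valid
  at almost every time to every time by continuity, in particular to the endpoints.\<close>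

lemma AE_tm_dense:
  assumes P: "AE t in tm T. P t" and T: "0 < T" and t: "t \<in> {0..T}"
  obtains x where "\<And>n. P (x n)" "\<And>n. x n \<in> {0..T}" "x \<longlonglongrightarrow> t"
proof -
  have ex: "\<exists>s\<in>{0..T}. P s \<and> \<bar>s - t\<bar> < e" if e: "0 < e" for e
  proof (rule ccontr)
    assume no: "\<not> ?thesis"
    define a where "a = max 0 (t - e)"
    define b where "b = min T (t + e)"
    have ab: "a < b" using T t e by (auto simp: a_def b_def)
    have "AE r in lebesgue. r \<notin> {a<..<b}"
      using P unfolding AE_tm_iff
    proof (rule eventually_mono)
      fix r assume r: "0 < r \<longrightarrow> r < T \<longrightarrow> P r"
      show "r \<notin> {a<..<b}"
      proof
        assume "r \<in> {a<..<b}"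
        then have "0 < r" "r < T" "\<bar>r - t\<bar> < e" by (auto simp: a_def b_def)
        then show False using no r by auto
      qed
    qed
    then have "{a<..<b} \<in> null_sets lebesgue" by (subst AE_iff_null_sets) auto
    then show False using ab by (auto simp: null_sets_def)
  qed
  have "\<forall>n. \<exists>s. s \<in> {0..T} \<and> P s \<and> \<bar>s - t\<bar> < inverse (real (Suc n))"
    using ex by (meson inverse_positive_iff_positive of_nat_0_less_iff zero_less_Suc)
  from choice[OF this] obtain x where x: "\<forall>n. x n \<in> {0..T} \<and> P (x n) \<and> \<bar>x n - t\<bar> < inverse (real (Suc n))"
    by blast
  have "(\<lambda>n. x n - t) \<longlonglongrightarrow> 0"
    by (rule Lim_null_comparison[OF _ LIMSEQ_inverse_real_of_nat])
      (intro always_eventually allI, use x in \<open>simp add: less_imp_le\<close>)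
  then have "x \<longlonglongrightarrow> t" by (rule Lim_null[THEN iffD2])
  then show thesis using x that by blast
qed

context semi_inner
begin

definition cont_curve :: "real \<Rightarrow> (real \<Rightarrow> 'v) \<Rightarrow> bool" where
  "cont_curve T f \<longleftrightarrow> (\<forall>t\<in>{0..T}. f t \<in> S \<and> ((\<lambda>s. nm (f s - f t)) \<longlongrightarrow> 0) (at t within {0..T}))"

lemma cont_curve_mem: "cont_curve T f \<Longrightarrow> t \<in> {0..T} \<Longrightarrow> f t \<in> S"
  by (simp add: cont_curve_def)

lemma cont_curve_B: "cont_curve T f \<Longrightarrow> f \<in> B T"
  by (rule B_continuous) (auto simp: cont_curve_def)

lemma cont_curve_seq:
  "cont_curve T f \<Longrightarrow> t \<in> {0..T} \<Longrightarrow> (\<And>n. x n \<in> {0..T}) \<Longrightarrow> x \<longlonglongrightarrow> t \<Longrightarrow> (\<lambda>n. nm (f (x n) - f t)) \<longlonglongrightarrow> 0"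
  by (rule cont_tendsto[where T = T]) (auto simp: cont_curve_def)

lemma cont_curve_ip: "cont_curve T f \<Longrightarrow> v \<in> S \<Longrightarrow> continuous_on {0..T} (\<lambda>t. ip (f t) v)"
  by (rule cont_ip) (auto simp: cont_curve_def)

lemma cont_curve_nm_bound:
  assumes "cont_curve T f"
  obtains b where "\<And>t. t \<in> {0..T} \<Longrightarrow> nm (f t) \<le> b"
  using cont_bounded[of T f] assms by (auto simp: cont_curve_def)

lemma cont_curve_mono: "cont_curve T f \<Longrightarrow> \<tau> \<le> T \<Longrightarrow> cont_curve \<tau> f"
  unfolding cont_curve_def by (auto intro: tendsto_within_subset[where S = "{0..T}"])

text \<open>The Heine-Cantor theorem, argued through convergent subsequences of times because the
  seminorm does not come from a metric on the type.\<close>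

lemma cont_curve_uniform:
  assumes f: "cont_curve T f" and e: "0 < e"
  obtains d where "0 < d" "\<And>s t. s \<in> {0..T} \<Longrightarrow> t \<in> {0..T} \<Longrightarrow> \<bar>s - t\<bar> < d \<Longrightarrow> nm (f s - f t) < e"
proof (rule ccontr)
  assume no: "\<not> thesis"
  have "\<exists>s t. s \<in> {0..T} \<and> t \<in> {0..T} \<and> \<bar>s - t\<bar> < inverse (real (Suc n)) \<and> e \<le> nm (f s - f t)" for n
  proof (rule ccontr)
    assume "\<not> ?thesis"
    then have "\<And>s t. s \<in> {0..T} \<Longrightarrow> t \<in> {0..T} \<Longrightarrow> \<bar>s - t\<bar> < inverse (real (Suc n)) \<Longrightarrow> nm (f s - f t) < e"
      by (meson not_le)
    then show False using no that[of "inverse (real (Suc n))"] by simp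
  qed
  then have "\<forall>n. \<exists>x. fst x \<in> {0..T} \<and> snd x \<in> {0..T} \<and> \<bar>fst x - snd x\<bar> < inverse (real (Suc n)) \<and> e \<le> nm (f (fst x) - f (snd x))"
    by (metis fst_conv snd_conv)
  from choice[OF this] obtain x where x: "\<And>n. fst (x n) \<in> {0..T}" "\<And>n. snd (x n) \<in> {0..T}"
    "\<And>n. \<bar>fst (x n) - snd (x n)\<bar> < inverse (real (Suc n))" "\<And>n. e \<le> nm (f (fst (x n)) - f (snd (x n)))" by blast
  have "\<forall>f::nat \<Rightarrow> real. (\<forall>n. f n \<in> {0..T}) \<longrightarrow> (\<exists>l\<in>{0..T}. \<exists>r. strict_mono r \<and> (f \<circ> r) \<longlonglongrightarrow> l)"
    using compact_Icc[of "0::real" T] unfolding compact_def .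
  from this[rule_format, of "\<lambda>n. fst (x n)", OF x(1)]
  obtain l r where l: "l \<in> {0..T}" "strict_mono r" "((\<lambda>n. fst (x n)) \<circ> r) \<longlonglongrightarrow> l" by blast
  have l1: "(\<lambda>n. fst (x (r n))) \<longlonglongrightarrow> l" using l(3) by (simp add: o_def)
  have "(\<lambda>n. fst (x n) - snd (x n)) \<longlonglongrightarrow> 0"
    by (rule Lim_null_comparison[OF _ LIMSEQ_inverse_real_of_nat])
      (intro always_eventually allI, use x(3) in \<open>simp add: less_imp_le\<close>)
  from LIMSEQ_subseq_LIMSEQ[OF this l(2)] have "(\<lambda>n. fst (x (r n)) - snd (x (r n))) \<longlonglongrightarrow> 0" by (simp add: o_def)
  from tendsto_diff[OF l1 this] have l2: "(\<lambda>n. snd (x (r n))) \<longlonglongrightarrow> l" by simp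
  have "(\<lambda>n. nm (f (fst (x (r n))) - f l) + nm (f (snd (x (r n))) - f l)) \<longlonglongrightarrow> 0 + 0"
    by (intro tendsto_add cont_curve_seq[OF f l(1)] x l1 l2)
  moreover have "e \<le> nm (f (fst (x (r n))) - f l) + nm (f (snd (x (r n))) - f l)" for n
  proof -
    have m: "f (fst (x (r n))) \<in> S" "f (snd (x (r n))) \<in> S" "f l \<in> S" using f l x by (auto intro: cont_curve_mem)
    have "e \<le> nm (f (fst (x (r n))) - f (snd (x (r n))))" by (rule x(4))
    also have "\<dots> \<le> nm (f (fst (x (r n))) - f l) + nm (f (snd (x (r n))) - f l)"
      using nm_triangle3[OF m(1) m(3) m(2)] nm_commute[OF m(3) m(2)] by simp
    finally show ?thesis .
  qed
  ultimately have "e \<le> 0 + 0" by (intro LIMSEQ_le_const) auto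
  then show False using e by simp
qed

lemma cont_curve_null_AE:
  assumes f: "cont_curve T f" and T: "0 < T" and ae: "AE t in tm T. nm (f t) = 0" and t: "t \<in> {0..T}"
  shows "nm (f t) = 0"
proof -
  obtain x where x: "\<And>n. nm (f (x n)) = 0" "\<And>n. x n \<in> {0..T}" "x \<longlonglongrightarrow> t"
    using AE_tm_dense[OF ae T t] by blast
  have "(\<lambda>n. nm (f (x n) - f t)) \<longlonglongrightarrow> 0" by (rule cont_curve_seq[OF f t x(2,3)])
  then have "(\<lambda>n. nm (f (x n))) \<longlonglongrightarrow> nm (f t)"
    using f x t by (intro nm_tendsto) (auto intro: cont_curve_mem)
  then have "(\<lambda>n. 0::real) \<longlonglongrightarrow> nm (f t)" using x(1) by simp
  then show ?thesis by (simp add: LIMSEQ_const_iff)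
qed

lemma cont_curve_diff:
  assumes f: "cont_curve T f" and g: "cont_curve T g"
  shows "cont_curve T (\<lambda>t. f t - g t)"
  unfolding cont_curve_def
proof (intro ballI conjI)
  fix t assume t: "t \<in> {0..T}"
  show "f t - g t \<in> S" using f g t by (intro diff_mem cont_curve_mem[where T = T])
  show "((\<lambda>s. nm (f s - g s - (f t - g t))) \<longlongrightarrow> 0) (at t within {0..T})"
  proof (rule Lim_null_comparison)
    have "((\<lambda>s. nm (f s - f t) + nm (g s - g t)) \<longlongrightarrow> 0 + 0) (at t within {0..T})"
      using f g t by (intro tendsto_add) (auto simp: cont_curve_def)
    then show "((\<lambda>s. nm (f s - f t) + nm (g s - g t)) \<longlongrightarrow> 0) (at t within {0..T})" by simp
    have "norm (nm (f s - g s - (f t - g t))) \<le> nm (f s - f t) + nm (g s - g t)" if s: "s \<in> {0..T}" for s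
    proof -
      have m: "f s \<in> S" "g s \<in> S" "f t \<in> S" "g t \<in> S" using f g s t by (auto intro: cont_curve_mem)
      have e: "f s - g s - (f t - g t) = (f s - f t) - (g s - g t)" by simp
      have "nm (f s - g s - (f t - g t)) \<le> nm (f s - f t) + nm (g s - g t)"
        unfolding e using m by (intro nm_triangle_diff diff_mem)
      moreover have "0 \<le> nm (f s - g s - (f t - g t))" using m by (intro nm_nonneg diff_mem)
      ultimately show ?thesis by simp
    qed
    then show "\<forall>\<^sub>F s in at t within {0..T}. norm (nm (f s - g s - (f t - g t))) \<le> nm (f s - f t) + nm (g s - g t)"
      unfolding eventually_at_filter by (auto intro!: always_eventually)
  qed
qed

lemma cont_curve_scale:
  assumes f: "cont_curve T f" and a: "continuous_on {0..T} a"
  shows "cont_curve T (\<lambda>t. a t *\<^sub>R f t)"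
  unfolding cont_curve_def
proof (intro ballI conjI)
  fix t assume t: "t \<in> {0..T}"
  have fS: "f s \<in> S" if "s \<in> {0..T}" for s by (rule cont_curve_mem[OF f that])
  show "a t *\<^sub>R f t \<in> S" by (rule scale_mem[OF fS[OF t]])
  have ft: "((\<lambda>s. nm (f s - f t)) \<longlongrightarrow> 0) (at t within {0..T})" using f t unfolding cont_curve_def by blast
  have at: "(a \<longlongrightarrow> a t) (at t within {0..T})" using a t unfolding continuous_on_def by blast
  have up: "((\<lambda>s. \<bar>a s\<bar> * nm (f s - f t) + \<bar>a s - a t\<bar> * nm (f t)) \<longlongrightarrow> \<bar>a t\<bar> * 0 + \<bar>a t - a t\<bar> * nm (f t)) (at t within {0..T})"
    by (intro tendsto_intros at ft)
  have le: "\<forall>\<^sub>F s in at t within {0..T}. nm (a s *\<^sub>R f s - a t *\<^sub>R f t) \<le> \<bar>a s\<bar> * nm (f s - f t) + \<bar>a s - a t\<bar> * nm (f t)"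
    unfolding eventually_at
  proof (intro exI[of _ 1] conjI ballI impI)
    fix s assume s: "s \<in> {0..T}"
    have "a s *\<^sub>R f s - a t *\<^sub>R f t = a s *\<^sub>R (f s - f t) + (a s - a t) *\<^sub>R f t" by (simp add: algebra_simps)
    then show "nm (a s *\<^sub>R f s - a t *\<^sub>R f t) \<le> \<bar>a s\<bar> * nm (f s - f t) + \<bar>a s - a t\<bar> * nm (f t)"
      using nm_triangle[OF scale_mem[OF diff_mem[OF fS[OF s] fS[OF t]]] scale_mem[OF fS[OF t]], of "a s" "a s - a t"]
      by (simp only: nm_scale[OF diff_mem[OF fS[OF s] fS[OF t]]] nm_scale[OF fS[OF t]])
  qed simp
  have ge: "\<forall>\<^sub>F s in at t within {0..T}. 0 \<le> nm (a s *\<^sub>R f s - a t *\<^sub>R f t)"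
    unfolding eventually_at by (intro exI[of _ 1] conjI ballI impI nm_nonneg diff_mem scale_mem fS t) auto
  show "((\<lambda>s. nm (a s *\<^sub>R f s - a t *\<^sub>R f t)) \<longlongrightarrow> 0) (at t within {0..T})"
    by (rule tendsto_sandwich[OF ge le tendsto_const]) (use up in simp)
qed

text \<open>A primitive in the weak sense: increments are prescribed only through their inner
  products with all of \<open>S\<close>. This replaces the vector-valued integral and fixes
  \<open>Z\<close> up to null elements and its initial value.\<close>

definition prim :: "real \<Rightarrow> (real \<Rightarrow> 'v) \<Rightarrow> (real \<Rightarrow> 'v) \<Rightarrow> bool" where
  "prim T q Z \<longleftrightarrow> (\<forall>t\<in>{0..T}. Z t \<in> S) \<and>
    (\<forall>s t. 0 \<le> s \<longrightarrow> s \<le> t \<longrightarrow> t \<le> T \<longrightarrow> (\<forall>v\<in>S. ip (Z t - Z s) v = ti T s t (\<lambda>r. ip (q r) v)))"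

lemma prim_mem: "prim T q Z \<Longrightarrow> t \<in> {0..T} \<Longrightarrow> Z t \<in> S"
  by (simp add: prim_def)

lemma prim_eq: "prim T q Z \<Longrightarrow> 0 \<le> s \<Longrightarrow> s \<le> t \<Longrightarrow> t \<le> T \<Longrightarrow> v \<in> S \<Longrightarrow>
    ip (Z t - Z s) v = ti T s t (\<lambda>r. ip (q r) v)"
  by (simp add: prim_def)

lemma B_const: "v \<in> S \<Longrightarrow> (\<lambda>_. v) \<in> B T"
  by (rule B_simple) auto

lemma B_ip_const_integrable: "q \<in> B T \<Longrightarrow> v \<in> S \<Longrightarrow> integrable (tm T) (\<lambda>r. ip (q r) v)"
  by (rule B_ip_integrable[OF _ B_const])

lemma B_nm1_integrable:
  assumes "q \<in> B T" shows "integrable (tm T) (\<lambda>r. nm (q r))"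
proof (rule Bochner_Integration.integrable_bound)
  show "integrable (tm T) (\<lambda>r. 1 + (nm (q r))\<^sup>2)"
    using B_nm_integrable[OF assms] by (intro Bochner_Integration.integrable_add) auto
  show "(\<lambda>r. nm (q r)) \<in> borel_measurable (tm T)" by (rule nm_measurable[OF B_sm[OF assms]])
  have "\<bar>nm (q r)\<bar> \<le> 1 + (nm (q r))\<^sup>2" for r
    using zero_le_power2[of "\<bar>nm (q r)\<bar> - 1"] by (simp add: power2_diff)
  then show "AE r in tm T. norm (nm (q r)) \<le> norm (1 + (nm (q r))\<^sup>2)" by simp
qed

lemma prim_add: "prim T q Z \<Longrightarrow> prim T q' Z' \<Longrightarrow> q \<in> B T \<Longrightarrow> q' \<in> B T \<Longrightarrow>
    prim T (q + q') (\<lambda>t. Z t + Z' t)"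
  unfolding prim_def
proof (intro conjI ballI allI impI; (elim conjE)?)
  assume A: "\<forall>t\<in>{0..T}. Z t \<in> S"
    "\<forall>s t. 0 \<le> s \<longrightarrow> s \<le> t \<longrightarrow> t \<le> T \<longrightarrow> (\<forall>v\<in>S. ip (Z t - Z s) v = ti T s t (\<lambda>r. ip (q r) v))"
    "\<forall>t\<in>{0..T}. Z' t \<in> S"
    "\<forall>s t. 0 \<le> s \<longrightarrow> s \<le> t \<longrightarrow> t \<le> T \<longrightarrow> (\<forall>v\<in>S. ip (Z' t - Z' s) v = ti T s t (\<lambda>r. ip (q' r) v))"
  assume q: "q \<in> B T" "q' \<in> B T"
  show "Z t + Z' t \<in> S" if "t \<in> {0..T}" for t using A that by (auto intro: add_mem)
  fix s t v assume st: "0 \<le> s" "s \<le> t" "t \<le> T" and v: "v \<in> S"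
  have m: "Z s \<in> S" "Z t \<in> S" "Z' s \<in> S" "Z' t \<in> S" using A st by auto
  have "ip (Z t + Z' t - (Z s + Z' s)) v = ip (Z t - Z s) v + ip (Z' t - Z' s) v"
    using m v by (simp add: ip_simps mem_intros)
  also have "\<dots> = ti T s t (\<lambda>r. ip (q r) v) + ti T s t (\<lambda>r. ip (q' r) v)" using A st v by simp
  also have "\<dots> = ti T s t (\<lambda>r. ip (q r) v + ip (q' r) v)"
    by (rule ti_add[symmetric]; rule B_ip_const_integrable; fact)
  also have "\<dots> = ti T s t (\<lambda>r. ip ((q + q') r) v)"
  proof (rule ti_cong_AE)
    show "AE r in tm T. ip (q r) v + ip (q' r) v = ip ((q + q') r) v"
      using B_mem[OF q(1)] B_mem[OF q(2)] by eventually_elim (simp add: ip_simps v)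
  qed (intro Bochner_Integration.integrable_add B_ip_const_integrable q v B_add)+
  finally show "ip (Z t + Z' t - (Z s + Z' s)) v = ti T s t (\<lambda>r. ip ((q + q') r) v)" .
qed

lemma prim_scale:
  assumes "prim T q Z" "q \<in> B T"
  shows "prim T (c *\<^sub>R q) (\<lambda>t. c *\<^sub>R Z t)"
  unfolding prim_def
proof (intro conjI ballI allI impI)
  show "c *\<^sub>R Z t \<in> S" if "t \<in> {0..T}" for t using prim_mem[OF assms(1) that] by (rule scale_mem)
  fix s t v assume st: "0 \<le> s" "s \<le> t" "t \<le> T" and v: "v \<in> S"
  have m: "Z s \<in> S" "Z t \<in> S" using prim_mem[OF assms(1)] st by auto
  have "ip (c *\<^sub>R Z t - c *\<^sub>R Z s) v = c * ip (Z t - Z s) v"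
    using m v by (simp add: ip_simps mem_intros right_diff_distrib)
  also have "\<dots> = ti T s t (\<lambda>r. c * ip (q r) v)" using prim_eq[OF assms(1) st v] by (simp add: ti_cmult)
  also have "\<dots> = ti T s t (\<lambda>r. ip ((c *\<^sub>R q) r) v)"
  proof (rule ti_cong_AE)
    show "AE r in tm T. c * ip (q r) v = ip ((c *\<^sub>R q) r) v"
      using B_mem[OF assms(2)] by eventually_elim (simp add: ip_simps v)
  qed (intro integrable_mult_right B_ip_const_integrable assms v B_scale)+
  finally show "ip (c *\<^sub>R Z t - c *\<^sub>R Z s) v = ti T s t (\<lambda>r. ip ((c *\<^sub>R q) r) v)" .
qed

lemma prim_shift:
  assumes "prim T q Z" "z \<in> S"
  shows "prim T q (\<lambda>t. z + Z t)"
  using assms unfolding prim_def by (auto intro: add_mem)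

text \<open>The defining identity is tested with the increment \<open>Z t - Z s\<close> itself, and
  one factor of its norm is cancelled.\<close>

lemma prim_diff_bound:
  assumes Z: "prim T q Z" and q: "q \<in> B T" and st: "0 \<le> s" "s \<le> t" "t \<le> T"
  shows "nm (Z t - Z s) \<le> ti T s t (\<lambda>r. nm (q r))"
proof -
  have m: "Z t - Z s \<in> S" using prim_mem[OF Z] st by (intro diff_mem) auto
  let ?w = "Z t - Z s"
  have "nm ?w * nm ?w = ip ?w ?w" using nm_sq[OF m] by (simp add: power2_eq_square)
  also have "\<dots> = ti T s t (\<lambda>r. ip (q r) ?w)" by (rule prim_eq[OF Z st m])
  also have "\<dots> \<le> ti T s t (\<lambda>r. nm ?w * nm (q r))"
  proof (rule ti_mono)
    show "AE r in tm T. s < r \<longrightarrow> r \<le> t \<longrightarrow> ip (q r) ?w \<le> nm ?w * nm (q r)"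
      using B_mem[OF q]
    proof eventually_elim
      case (elim r)
      then show ?case using cauchy_schwarz'[of "q r" ?w] m by (simp add: mult.commute)
    qed
  qed (intro integrable_mult_right B_nm1_integrable B_ip_const_integrable q m)+
  also have "\<dots> = nm ?w * ti T s t (\<lambda>r. nm (q r))" by (simp add: ti_cmult)
  finally have "nm ?w * nm ?w \<le> nm ?w * ti T s t (\<lambda>r. nm (q r))" .
  moreover have "0 \<le> ti T s t (\<lambda>r. nm (q r))"
  proof -
    have "ti T s t (\<lambda>_. 0) \<le> ti T s t (\<lambda>r. nm (q r))"
    proof (rule ti_mono)
      show "AE r in tm T. s < r \<longrightarrow> r \<le> t \<longrightarrow> 0 \<le> nm (q r)"
        using B_mem[OF q] by eventually_elim (simp add: nm_nonneg)
    qed (auto intro: B_nm1_integrable q)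
    then show ?thesis by (simp add: ti_def)
  qed
  ultimately show ?thesis using nm_nonneg[OF m] by (cases "nm ?w = 0") auto
qed

text \<open>The bound by the integral of the norm is made small through Young's inequality with a
  parameter: the quadratic part is absorbed by a small weight \<open>a\<close>, the constant part by
  a short interval.\<close>

lemma prim_uniform:
  assumes Z: "prim T q Z" and q: "q \<in> B T" and e: "0 < e"
  obtains d where "0 < d" "\<And>s t. s \<in> {0..T} \<Longrightarrow> t \<in> {0..T} \<Longrightarrow> \<bar>s - t\<bar> < d \<Longrightarrow> nm (Z s - Z t) < e"
proof -
  define C where "C = (\<integral>r. (nm (q r))\<^sup>2 \<partial>tm T)"
  have C: "0 \<le> C" unfolding C_def by (intro Bochner_Integration.integral_nonneg) auto
  define a where "a = e / (2 * (C + 1))"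
  have a: "0 < a" using C e by (simp add: a_def)
  have aC: "a * C < e / 2"
  proof -
    have "a * C < a * (C + 1)" using a by simp
    also have "\<dots> = e / 2" using C by (simp add: a_def field_simps)
    finally show ?thesis .
  qed
  \<comment> \<open>Chosen so that \<open>d / (4 * a)\<close> is \<open>e / 2\<close>, complementing
    \<open>aC\<close>.\<close>
  define d where "d = 2 * a * e"
  have d: "0 < d" using a e by (simp add: d_def)
  have pt: "\<bar>x\<bar> \<le> a * x\<^sup>2 + 1 / (4 * a)" for x :: real
  proof -
    have "0 \<le> (2 * a * \<bar>x\<bar> - 1)\<^sup>2 / (4 * a)" using a by simp
    also have "\<dots> = a * x\<^sup>2 - \<bar>x\<bar> + 1 / (4 * a)"
      using a by (simp add: field_simps power2_eq_square)
    finally show ?thesis by simp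
  qed
  have main: "nm (Z t - Z s) < e" if st: "0 \<le> s" "s \<le> t" "t \<le> T" "t - s < d" for s t
  proof -
    have "nm (Z t - Z s) \<le> ti T s t (\<lambda>r. nm (q r))" by (rule prim_diff_bound[OF Z q st(1-3)])
    also have "\<dots> \<le> ti T s t (\<lambda>r. a * (nm (q r))\<^sup>2 + 1 / (4 * a))"
    proof (rule ti_mono)
      show "AE r in tm T. s < r \<longrightarrow> r \<le> t \<longrightarrow> nm (q r) \<le> a * (nm (q r))\<^sup>2 + 1 / (4 * a)"
        using pt by (intro AE_I2 impI) (meson abs_ge_self order_trans)
    qed (intro Bochner_Integration.integrable_add integrable_mult_right B_nm1_integrable B_nm_integrable q integrable_const_tm)+
    also have "\<dots> = a * ti T s t (\<lambda>r. (nm (q r))\<^sup>2) + 1 / (4 * a) * (t - s)"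
      using ti_const[OF st(1-3), of "1 / (4 * a)"]
      by (subst ti_add) (auto intro!: integrable_mult_right B_nm_integrable q simp: ti_cmult)
    also have "ti T s t (\<lambda>r. (nm (q r))\<^sup>2) \<le> C"
      unfolding ti_def C_def
      by (rule integral_mono_AE[OF ti_integrable]) (auto intro!: B_nm_integrable q simp: indicator_def)
    also have "a * C + 1 / (4 * a) * (t - s) \<le> a * C + 1 / (4 * a) * d"
      using a st by (intro add_left_mono mult_left_mono) auto
    also have "\<dots> < e" using aC a by (simp add: d_def)
    finally show ?thesis using a by (simp add: mult_left_mono)
  qed
  show thesis
  proof (rule that[OF d])
    fix s t assume st: "s \<in> {0..T}" "t \<in> {0..T}" "\<bar>s - t\<bar> < d"
    show "nm (Z s - Z t) < e"
    proof (cases "t \<le> s")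
      case True
      then show ?thesis using main[of t s] st by auto
    next
      case False
      then have "nm (Z t - Z s) < e" using main[of s t] st by auto
      then show ?thesis using nm_commute[of "Z s" "Z t"] prim_mem[OF Z] st by simp
    qed
  qed
qed

lemma prim_cont_curve:
  assumes Z: "prim T q Z" and q: "q \<in> B T"
  shows "cont_curve T Z"
  unfolding cont_curve_def
proof (intro ballI conjI)
  fix t assume t: "t \<in> {0..T}"
  show "Z t \<in> S" by (rule prim_mem[OF Z t])
  show "((\<lambda>s. nm (Z s - Z t)) \<longlongrightarrow> 0) (at t within {0..T})"
    unfolding tendsto_iff
  proof (intro allI impI)
    fix e :: real assume "0 < e"
    then obtain d where d: "0 < d" "\<And>s t. s \<in> {0..T} \<Longrightarrow> t \<in> {0..T} \<Longrightarrow> \<bar>s - t\<bar> < d \<Longrightarrow> nm (Z s - Z t) < e"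
      using prim_uniform[OF Z q] by blast
    show "\<forall>\<^sub>F s in at t within {0..T}. dist (nm (Z s - Z t)) 0 < e"
      unfolding eventually_at
    proof (intro exI[of _ d] conjI ballI impI d(1))
      fix s assume s: "s \<in> {0..T}" "s \<noteq> t \<and> dist s t < d"
      have "0 \<le> nm (Z s - Z t)" using prim_mem[OF Z] s t by (intro nm_nonneg diff_mem)
      then show "dist (nm (Z s - Z t)) 0 < e" using d(2)[of s t] s t by (simp add: dist_real_def)
    qed
  qed
qed

text \<open>The product rule applies directly to the inner product of \<open>Z t\<close> and
  \<open>Z s\<close>, because \<open>Z\<close> is continuous in the very norm in which its
  derivative is square-integrable. By symmetry both partial terms coincide, whence the factor
  2.\<close>

lemma prim_energy:
  assumes Z: "prim T q Z" and q: "q \<in> B T" and \<tau>: "0 \<le> \<tau>" "\<tau> \<le> T"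
  shows "ip (Z \<tau>) (Z \<tau>) - ip (Z 0) (Z 0) = 2 * ti T 0 \<tau> (\<lambda>r. ip (q r) (Z r))"
proof (cases "\<tau> = 0")
  case True
  then show ?thesis by (simp add: ti_empty)
next
  case False
  have c: "cont_curve T Z" by (rule prim_cont_curve[OF Z q])
  have ZB: "Z \<in> B T" by (rule cont_curve_B[OF c])
  have mem: "Z s \<in> S" if "s \<in> {0..\<tau>}" for s using prim_mem[OF Z] that \<tau> by auto
  have cc: "\<exists>d>0. AE r in tm T. \<forall>s\<in>{0..\<tau>}. r \<le> \<tau> \<longrightarrow> \<bar>s - r\<bar> < d \<longrightarrow> \<bar>ip (q r) (Z s) - ip (q r) (Z r)\<bar> \<le> e * nm (q r)"
    if e: "0 < e" for e
  proof -
    obtain d where d: "0 < d" "\<And>s t. s \<in> {0..T} \<Longrightarrow> t \<in> {0..T} \<Longrightarrow> \<bar>s - t\<bar> < d \<Longrightarrow> nm (Z s - Z t) < e"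
      using prim_uniform[OF Z q e] by blast
    have "AE r in tm T. \<forall>s\<in>{0..\<tau>}. r \<le> \<tau> \<longrightarrow> \<bar>s - r\<bar> < d \<longrightarrow> \<bar>ip (q r) (Z s) - ip (q r) (Z r)\<bar> \<le> e * nm (q r)"
      using B_mem[OF q] AE_tm_space
    proof eventually_elim
      case (elim r)
      show ?case
      proof (intro ballI impI)
        fix s assume s: "s \<in> {0..\<tau>}" "r \<le> \<tau>" "\<bar>s - r\<bar> < d"
        have m: "Z s \<in> S" "Z r \<in> S" using mem s elim by auto
        have "\<bar>ip (q r) (Z s) - ip (q r) (Z r)\<bar> \<le> nm (q r) * nm (Z s - Z r)"
          using cauchy_schwarz[of "q r" "Z s - Z r"] m elim by (simp add: ip_simps mem_intros)
        also have "\<dots> \<le> nm (q r) * e"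
          using d(2)[of s r] s elim \<tau> by (intro mult_left_mono nm_nonneg) auto
        finally show "\<bar>ip (q r) (Z s) - ip (q r) (Z r)\<bar> \<le> e * nm (q r)" by (simp add: mult.commute)
      qed
    qed
    then show ?thesis using d(1) by blast
  qed
  have "ip (Z \<tau>) (Z \<tau>) - ip (Z 0) (Z 0) = ti T 0 \<tau> (\<lambda>r. ip (q r) (Z r)) + ti T 0 \<tau> (\<lambda>r. ip (q r) (Z r))"
  proof (rule product_rule[where P = "\<lambda>t s. ip (Z t) (Z s)" and p = "\<lambda>r s. ip (q r) (Z s)" and q = "\<lambda>t r. ip (q r) (Z t)"
        and m = "\<lambda>r. nm (q r)"])
    show "ip (Z t') (Z s) - ip (Z t) (Z s) = ti T t t' (\<lambda>r. ip (q r) (Z s))"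
      if "0 \<le> t" "t \<le> t'" "t' \<le> \<tau>" "s \<in> {0..\<tau>}" for t t' s
      using prim_eq[OF Z that(1,2) _ mem[OF that(4)]] that \<tau> mem[of t] mem[of t'] mem[of s] by (simp add: ip_simps)
    show "ip (Z t) (Z s') - ip (Z t) (Z s) = ti T s s' (\<lambda>r. ip (q r) (Z t))"
      if "0 \<le> s" "s \<le> s'" "s' \<le> \<tau>" "t \<in> {0..\<tau>}" for s s' t
      using prim_eq[OF Z that(1,2) _ mem[OF that(4)]] that \<tau> mem[of s] mem[of s'] mem[of t]
      by (simp add: ip_simps ip_sym[of "Z t"])
  qed (use False \<tau> q ZB mem cc in \<open>auto intro: B_ip_const_integrable B_ip_integrable B_nm1_integrable\<close>)
  then show ?thesis by simp
qed

end

text \<open>For each time \<open>t\<close>, testing \<open>q\<close> with \<open>v\<close> and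
  integrating over \<open>(0,t]\<close> gives a bounded functional of \<open>v\<close>; its Riesz
  representative is \<open>Z t\<close>.\<close>

lemma (in semi_hilbert) prim_exists:
  assumes q: "q \<in> B T"
  obtains Z where "prim T q Z" "nm (Z 0) = 0"
proof -
  have "\<exists>z\<in>S. \<forall>v\<in>S. ip z v = ti T 0 t (\<lambda>r. ip (q r) v)" for t
  proof -
    obtain z where "z \<in> S" "\<And>v. v \<in> S \<Longrightarrow> ip z v = ti T 0 t (\<lambda>r. ip (q r) v)"
    proof (rule riesz[of "\<lambda>v. ti T 0 t (\<lambda>r. ip (q r) v)" "\<integral>r. nm (q r) \<partial>tm T"])
      fix x y c assume x: "x \<in> S"
      show "ti T 0 t (\<lambda>r. ip (q r) (c *\<^sub>R x)) = c * ti T 0 t (\<lambda>r. ip (q r) x)"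
        unfolding ti_cmult[symmetric]
      proof (rule ti_cong_AE)
        show "AE r in tm T. ip (q r) (c *\<^sub>R x) = c * ip (q r) x"
          using B_mem[OF q] by eventually_elim (simp add: ip_simps x)
      qed (intro integrable_mult_right B_ip_const_integrable q x scale_mem)+
      have "\<bar>ti T 0 t (\<lambda>r. ip (q r) x)\<bar> \<le> ti T 0 t (\<lambda>r. nm x * nm (q r))"
      proof (rule ti_abs_le)
        show "AE r in tm T. 0 < r \<longrightarrow> r \<le> t \<longrightarrow> \<bar>ip (q r) x\<bar> \<le> nm x * nm (q r)"
          using B_mem[OF q]
        proof eventually_elim
          case (elim r)
          then show ?case using cauchy_schwarz[of "q r" x] x by (simp add: mult.commute)
        qed
      qed (intro integrable_mult_right B_ip_const_integrable B_nm1_integrable q x)+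
      also have "\<dots> \<le> nm x * (\<integral>r. nm (q r) \<partial>tm T)"
        unfolding ti_cmult unfolding ti_def
      proof (intro mult_left_mono nm_nonneg x integral_mono_AE[OF ti_integrable])
        show "AE r in tm T. indicator {0<..t} r * nm (q r) \<le> nm (q r)"
          using B_mem[OF q] by eventually_elim (simp add: indicator_def nm_nonneg)
      qed (intro B_nm1_integrable q)+
      finally show "\<bar>ti T 0 t (\<lambda>r. ip (q r) x)\<bar> \<le> (\<integral>r. nm (q r) \<partial>tm T) * nm x" by (simp add: mult.commute)
      assume y: "y \<in> S"
      have "ti T 0 t (\<lambda>r. ip (q r) (x + y)) = ti T 0 t (\<lambda>r. ip (q r) x + ip (q r) y)"
      proof (rule ti_cong_AE)
        show "AE r in tm T. ip (q r) (x + y) = ip (q r) x + ip (q r) y"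
          using B_mem[OF q] by eventually_elim (simp add: ip_simps x y)
      qed (intro Bochner_Integration.integrable_add B_ip_const_integrable q x y add_mem)+
      then show "ti T 0 t (\<lambda>r. ip (q r) (x + y)) = ti T 0 t (\<lambda>r. ip (q r) x) + ti T 0 t (\<lambda>r. ip (q r) y)"
        by (simp add: ti_add B_ip_const_integrable q x y)
    qed (rule that)
    then show ?thesis by blast
  qed
  then have "\<forall>t. \<exists>z. z \<in> S \<and> (\<forall>v\<in>S. ip z v = ti T 0 t (\<lambda>r. ip (q r) v))" by blast
  from choice[OF this] obtain Z where Z: "\<And>t. Z t \<in> S" "\<And>t v. v \<in> S \<Longrightarrow> ip (Z t) v = ti T 0 t (\<lambda>r. ip (q r) v)"
    by blast
  have "prim T q Z"
    unfolding prim_def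
  proof (intro conjI ballI allI impI Z(1))
    fix s t v assume st: "0 \<le> s" "s \<le> t" "t \<le> T" and v: "v \<in> S"
    show "ip (Z t - Z s) v = ti T s t (\<lambda>r. ip (q r) v)"
      using ti_split[OF B_ip_const_integrable[OF q v] st(1,2)] by (simp add: ip_simps Z v)
  qed
  moreover have "nm (Z 0) = 0" using Z(2)[OF Z(1), of 0] by (simp add: nm_def ti_empty)
  ultimately show thesis by (rule that)
qed

subsection \<open>Abstract parabolic equations\<close>

text \<open>
  The equation \<open>z' + B z = f\<close> is studied for the Riesz isomorphism \<open>B\<close> of \<open>V\<close>, with \<open>f\<close> in
  \<open>L\<^sup>2(0,T;V)\<close> standing for the functional \<open>ipV f\<close>.
\<close>
locale gelfand_pair = V: semi_hilbert V ipV + H: semi_hilbert H ipH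
  for V :: "'v::real_vector set" and ipV and H :: "'v set" and ipH +
  assumes VH: "V \<subseteq> H"
    and ipH_le: "x \<in> V \<Longrightarrow> ipH x x \<le> ipV x x"
    and null: "x \<in> V \<Longrightarrow> y \<in> H \<Longrightarrow> ipH (x - y) (x - y) = 0 \<Longrightarrow> y \<in> V \<and> ipV (x - y) (x - y) = 0"
begin

sublocale VB: semi_hilbert "V.B T" "V.bip T" for T
  by (rule V.B_semi_hilbert)

sublocale HB: semi_hilbert "H.B T" "H.bip T" for T
  by (rule H.B_semi_hilbert)

lemma VH': "x \<in> V \<Longrightarrow> x \<in> H" using VH by auto

lemma nm_le: "x \<in> V \<Longrightarrow> H.nm x \<le> V.nm x"
  unfolding H.nm_def V.nm_def using ipH_le by simp

text \<open>The abstract trace of the fact that a null modification changes neither membership in a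
  Sobolev space nor the gradient almost everywhere. It lets limits in \<open>H\<close> and limits in
  \<open>V\<close> be identified.\<close>

lemma null_nm:
  assumes "x \<in> V" "y \<in> H" "H.nm (x - y) = 0"
  shows "y \<in> V" "V.nm (x - y) = 0"
proof -
  have "ipH (x - y) (x - y) = 0"
    using H.nm_sq[of "x - y"] assms VH' by (simp add: H.diff_mem)
  then show "y \<in> V" "V.nm (x - y) = 0" using null[OF assms(1,2)] by (auto simp: V.nm_def)
qed

lemma null0: "x \<in> V \<Longrightarrow> H.nm x = 0 \<Longrightarrow> V.nm x = 0"
  using null_nm(2)[of x 0] by (simp add: H.zero_mem)

lemma riesz_H_ex: "h \<in> H \<Longrightarrow> \<exists>r\<in>V. \<forall>v\<in>V. ipV r v = ipH h v"
proof -
  assume h: "h \<in> H"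
  obtain r where "r \<in> V" "\<And>v. v \<in> V \<Longrightarrow> ipV r v = ipH h v"
  proof (rule V.riesz[of "ipH h" "H.nm h"])
    fix x assume x: "x \<in> V"
    have "\<bar>ipH h x\<bar> \<le> H.nm h * H.nm x" using h x VH' by (intro H.cauchy_schwarz)
    also have "\<dots> \<le> H.nm h * V.nm x" using h x by (intro mult_left_mono nm_le H.nm_nonneg)
    finally show "\<bar>ipH h x\<bar> \<le> H.nm h * V.nm x" .
  qed (use h VH' in \<open>auto simp: H.ip_simps intro: that\<close>)
  then show ?thesis by blast
qed

text \<open>The inverse of the Riesz isomorphism of \<open>V\<close>, restricted to functionals that
  come from \<open>H\<close>. In the application \<open>R h\<close> is the weak solution of r - div
  Dr = h with zero boundary values.\<close>

definition R where "R h = (SOME r. r \<in> V \<and> (\<forall>v\<in>V. ipV r v = ipH h v))"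

lemma R:
  assumes "h \<in> H"
  shows R_mem: "R h \<in> V" and R_ip: "v \<in> V \<Longrightarrow> ipV (R h) v = ipH h v"
proof -
  have "R h \<in> V \<and> (\<forall>v\<in>V. ipV (R h) v = ipH h v)"
    unfolding R_def by (rule someI_ex) (use riesz_H_ex[OF assms] in blast)
  then show "R h \<in> V" "v \<in> V \<Longrightarrow> ipV (R h) v = ipH h v" by auto
qed

text \<open>The values of \<open>R\<close> are chosen representatives, so \<open>R\<close> is linear
  only up to null elements; continuity is therefore stated for differences. The proof tests with the
  difference and uses that \<open>V\<close> embeds with norm at most 1.\<close>

lemma R_lipschitz:
  assumes h: "h \<in> H" "h' \<in> H"
  shows "V.nm (R h - R h') \<le> H.nm (h - h')"
proof -
  let ?w = "R h - R h'"
  have w: "?w \<in> V" using h by (intro V.diff_mem R_mem)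
  have "V.nm ?w * V.nm ?w = ipV ?w ?w" using V.nm_sq[OF w] by (simp add: power2_eq_square)
  also have "\<dots> = ipH h ?w - ipH h' ?w"
    using V.ip_diff_left[OF R_mem[OF h(1)] R_mem[OF h(2)] w] R_ip[OF h(1) w] R_ip[OF h(2) w] by simp
  also have "\<dots> = ipH (h - h') ?w"
    using h w by (simp add: H.ip_diff_left VH')
  also have "\<dots> \<le> H.nm (h - h') * H.nm ?w" by (intro H.cauchy_schwarz' H.diff_mem h VH'[OF w])
  also have "\<dots> \<le> H.nm (h - h') * V.nm ?w"
    using h w by (intro mult_left_mono nm_le H.nm_nonneg H.diff_mem)
  finally show ?thesis using V.nm_nonneg[OF w] H.nm_nonneg[OF H.diff_mem[OF h]]
    by (cases "V.nm ?w = 0") auto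
qed

lemma R_bound: "h \<in> H \<Longrightarrow> V.nm (R h) \<le> H.nm h"
proof -
  assume h: "h \<in> H"
  \<comment> \<open>The chosen value at 0 need not be the zero function; it is only null.\<close>
  have "V.nm (R 0) = 0"
    using R_ip[OF H.zero_mem R_mem[OF H.zero_mem]] H.ip_zero_left[OF VH'[OF R_mem[OF H.zero_mem]]]
    by (simp add: V.nm_def)
  moreover have "V.nm (R h - R 0) \<le> H.nm h" using R_lipschitz[OF h H.zero_mem] by simp
  moreover have "V.nm (R h) \<le> V.nm (R h - R 0) + V.nm (R 0)"
    using V.nm_triangle[of "R h - R 0" "R 0"] h by (simp add: V.diff_mem R_mem H.zero_mem)
  ultimately show ?thesis by simp
qed

lemma VB_HB: "f \<in> V.B T \<Longrightarrow> f \<in> H.B T"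
proof -
  assume f: "f \<in> V.B T"
  have "H.sm T (\<lambda>t. id (f t))"
  proof (rule strongly_measurable_compose[OF V.B_sm[OF f], where C = 1])
    show "0 \<le> H.nm (id x - id y) \<and> H.nm (id x - id y) \<le> 1 * V.nm (x - y)" if "x \<in> V" "y \<in> V" for x y
      using nm_le[of "x - y"] that VH' by (simp add: V.diff_mem H.diff_mem H.nm_nonneg)
  qed (simp add: VH')
  then have "H.sm T f" by simp
  then show ?thesis
  proof (rule H.B_I[OF _ V.B_nm_integrable[OF f]])
    show "AE t in tm T. (H.nm (f t))\<^sup>2 \<le> (V.nm (f t))\<^sup>2"
      using V.B_mem[OF f] by eventually_elim (intro power_mono nm_le H.nm_nonneg VH')
  qed
qed

lemma R_B: "q \<in> H.B T \<Longrightarrow> (\<lambda>t. R (q t)) \<in> V.B T"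
proof -
  assume q: "q \<in> H.B T"
  have "V.sm T (\<lambda>t. R (q t))"
  proof (rule strongly_measurable_compose[OF H.B_sm[OF q], where C = 1])
    show "0 \<le> V.nm (R x - R y) \<and> V.nm (R x - R y) \<le> 1 * H.nm (x - y)" if "x \<in> H" "y \<in> H" for x y
      using R_lipschitz[OF that] that by (simp add: V.nm_nonneg V.diff_mem R_mem)
  qed (rule R_mem)
  then show ?thesis
  proof (rule V.B_I[OF _ H.B_nm_integrable[OF q]])
    show "AE t in tm T. (V.nm (R (q t)))\<^sup>2 \<le> (H.nm (q t))\<^sup>2"
      using H.B_mem[OF q] by eventually_elim (intro power_mono R_bound V.nm_nonneg R_mem)
  qed
qed

text \<open>An arbitrary test element \<open>v\<close> of \<open>H\<close> is replaced by
  \<open>R v\<close>: the inner product in \<open>H\<close> of an element of \<open>V\<close> with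
  \<open>v\<close> is its inner product in \<open>V\<close> with \<open>R v\<close>.\<close>

lemma prim_VH:
  assumes Z: "V.prim T q Z" and q: "q \<in> V.B T"
  shows "H.prim T q Z"
  unfolding H.prim_def
proof (intro conjI ballI allI impI)
  show "Z t \<in> H" if "t \<in> {0..T}" for t using V.prim_mem[OF Z that] by (rule VH')
  fix s t v assume st: "0 \<le> s" "s \<le> t" "t \<le> T" and v: "v \<in> H"
  have m: "Z t - Z s \<in> V" using V.prim_mem[OF Z] st by (intro V.diff_mem) auto
  have "ipH (Z t - Z s) v = ipV (Z t - Z s) (R v)"
    using R_ip[OF v m] H.ip_sym[OF v VH'[OF m]] V.ip_sym[OF R_mem[OF v] m] by simp
  also have "\<dots> = ti T s t (\<lambda>r. ipV (q r) (R v))" by (rule V.prim_eq[OF Z st R_mem[OF v]])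
  also have "\<dots> = ti T s t (\<lambda>r. ipH (q r) v)"
  proof (rule ti_cong_AE)
    show "AE r in tm T. ipV (q r) (R v) = ipH (q r) v"
      using V.B_mem[OF q]
    proof eventually_elim
      case (elim r)
      show ?case using R_ip[OF v elim] H.ip_sym[OF v VH'[OF elim]] V.ip_sym[OF R_mem[OF v] elim] by simp
    qed
  qed (intro V.B_ip_const_integrable H.B_ip_const_integrable VB_HB q R_mem v)+
  finally show "ipH (Z t - Z s) v = ti T s t (\<lambda>r. ipH (q r) v)" .
qed

text \<open>\<open>z' = q\<close> and \<open>z' + B z = k\<close>.\<close>
definition smooth_solution :: "real \<Rightarrow> (real \<Rightarrow> 'v) \<Rightarrow> (real \<Rightarrow> 'v) \<Rightarrow> (real \<Rightarrow> 'v) \<Rightarrow> bool" where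
  "smooth_solution T q z k \<longleftrightarrow> q \<in> V.B T \<and> V.prim T q z \<and> k \<in> V.B T \<and>
     (AE t in tm T. \<forall>v\<in>V. ipV (k t) v = ipH (q t) v + ipV (z t) v)"

lemma smooth_solution_add:
  assumes "smooth_solution T q z k" "smooth_solution T q' z' k'"
  shows "smooth_solution T (q + q') (\<lambda>t. z t + z' t) (k + k')"
proof -
  have B: "q \<in> V.B T" "q' \<in> V.B T" "k \<in> V.B T" "k' \<in> V.B T" "V.prim T q z" "V.prim T q' z'"
    and e: "AE t in tm T. \<forall>v\<in>V. ipV (k t) v = ipH (q t) v + ipV (z t) v"
      "AE t in tm T. \<forall>v\<in>V. ipV (k' t) v = ipH (q' t) v + ipV (z' t) v"
    using assms by (auto simp: smooth_solution_def)
  have "AE t in tm T. \<forall>v\<in>V. ipV ((k + k') t) v = ipH ((q + q') t) v + ipV (z t + z' t) v"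
    using e V.B_mem[OF B(1)] V.B_mem[OF B(2)] V.B_mem[OF B(3)] V.B_mem[OF B(4)] AE_tm_space
  proof eventually_elim
    case (elim t)
    have z: "z t \<in> V" "z' t \<in> V" using V.prim_mem[OF B(5)] V.prim_mem[OF B(6)] elim by auto
    show ?case using elim z VH' by (auto simp: V.ip_simps H.ip_simps)
  qed
  then show ?thesis unfolding smooth_solution_def using B V.prim_add[OF B(5,6,1,2)] V.B_add by auto
qed

lemma smooth_solution_scale:
  assumes "smooth_solution T q z k"
  shows "smooth_solution T (c *\<^sub>R q) (\<lambda>t. c *\<^sub>R z t) (c *\<^sub>R k)"
proof -
  have B: "q \<in> V.B T" "k \<in> V.B T" "V.prim T q z"
    and e: "AE t in tm T. \<forall>v\<in>V. ipV (k t) v = ipH (q t) v + ipV (z t) v"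
    using assms by (auto simp: smooth_solution_def)
  have "AE t in tm T. \<forall>v\<in>V. ipV ((c *\<^sub>R k) t) v = ipH ((c *\<^sub>R q) t) v + ipV (c *\<^sub>R z t) v"
    using e V.B_mem[OF B(1)] V.B_mem[OF B(2)] AE_tm_space
  proof eventually_elim
    case (elim t)
    have z: "z t \<in> V" using V.prim_mem[OF B(3)] elim by auto
    show ?case using elim z VH' by (auto simp: V.ip_simps H.ip_simps distrib_left)
  qed
  then show ?thesis unfolding smooth_solution_def using B V.prim_scale[OF B(3,1)] V.B_scale by auto
qed

lemma smooth_solution_diff:
  assumes "smooth_solution T q z k" "smooth_solution T q' z' k'"
  shows "smooth_solution T (q - q') (\<lambda>t. z t - z' t) (k - k')"
  using smooth_solution_add[OF assms(1) smooth_solution_scale[OF assms(2), of "-1"]] by simp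

lemma smooth_solution_zB: "smooth_solution T q z k \<Longrightarrow> z \<in> V.B T"
  unfolding smooth_solution_def using V.cont_curve_B V.prim_cont_curve by blast

text \<open>Expanding the square of \<open>k - z\<close> in \<open>V\<close> and inserting the
  equation shows that the squared \<open>V\<close>-norm of \<open>z\<close> plus twice
  \<open>ipH q z\<close> is at most the squared \<open>V\<close>-norm of \<open>k\<close>. The
  integral of the middle term is the increment of the squared \<open>H\<close>-norm, by the energy
  identity for primitives.\<close>

lemma smooth_solution_estimate:
  assumes s: "smooth_solution T q z k" and \<tau>: "0 \<le> \<tau>" "\<tau> \<le> T"
  shows "ipH (z \<tau>) (z \<tau>) + ti T 0 \<tau> (\<lambda>t. ipV (z t) (z t)) \<le> ipH (z 0) (z 0) + ti T 0 \<tau> (\<lambda>t. ipV (k t) (k t))"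
proof -
  have B: "q \<in> V.B T" "k \<in> V.B T" "V.prim T q z"
    and e: "AE t in tm T. \<forall>v\<in>V. ipV (k t) v = ipH (q t) v + ipV (z t) v"
    using s by (auto simp: smooth_solution_def)
  have zB: "z \<in> V.B T" by (rule smooth_solution_zB[OF s])
  have i: "integrable (tm T) (\<lambda>t. ipH (q t) (z t))" by (intro H.B_ip_integrable VB_HB B zB)
  have "ipH (z \<tau>) (z \<tau>) - ipH (z 0) (z 0) = 2 * ti T 0 \<tau> (\<lambda>t. ipH (q t) (z t))"
    by (rule H.prim_energy[OF prim_VH[OF B(3,1)] VB_HB[OF B(1)] \<tau>])
  moreover have "ti T 0 \<tau> (\<lambda>t. ipV (z t) (z t) + 2 * ipH (q t) (z t)) \<le> ti T 0 \<tau> (\<lambda>t. ipV (k t) (k t))"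
  proof (rule ti_mono)
    show "AE r in tm T. 0 < r \<longrightarrow> r \<le> \<tau> \<longrightarrow> ipV (z r) (z r) + 2 * ipH (q r) (z r) \<le> ipV (k r) (k r)"
      using e V.B_mem[OF B(2)] AE_tm_space
    proof eventually_elim
      case (elim t)
      have z: "z t \<in> V" using V.prim_mem[OF B(3)] elim by auto
      have k: "k t \<in> V" using elim by simp
      have "0 \<le> ipV (k t - z t) (k t - z t)" using k z by (intro V.ip_nonneg V.diff_mem)
      also have "\<dots> = ipV (k t) (k t) - 2 * ipV (k t) (z t) + ipV (z t) (z t)" by (rule V.ip_diff_expand[OF k z])
      also have "ipV (k t) (z t) = ipH (q t) (z t) + ipV (z t) (z t)" using elim z by blast
      finally show ?case by simp
    qed
  qed (intro Bochner_Integration.integrable_add integrable_mult_right V.B_ip_integrable i zB B)+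
  moreover have "ti T 0 \<tau> (\<lambda>t. ipV (z t) (z t) + 2 * ipH (q t) (z t))
      = ti T 0 \<tau> (\<lambda>t. ipV (z t) (z t)) + 2 * ti T 0 \<tau> (\<lambda>t. ipH (q t) (z t))"
    using i zB by (simp add: ti_add ti_cmult V.B_ip_integrable)
  ultimately show ?thesis by simp
qed

lemma ti_ipV_le: "k \<in> V.B T \<Longrightarrow> ti T 0 \<tau> (\<lambda>t. ipV (k t) (k t)) \<le> V.bip T k k"
  unfolding ti_def V.bip_def
proof (rule integral_mono_AE[OF ti_integrable])
  assume k: "k \<in> V.B T"
  show "AE t in tm T. indicator {0<..\<tau>} t * ipV (k t) (k t) \<le> ipV (k t) (k t)"
    using V.B_mem[OF k] by eventually_elim (simp add: indicator_def V.ip_nonneg)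
qed (intro V.B_ip_integrable; assumption)+

text \<open>Through linearity these bounds serve as Cauchy estimates, for all times in
  \<open>H\<close> and in the square-integrable curves of \<open>V\<close>.\<close>

lemma smooth_solution_bounds:
  assumes s: "smooth_solution T q z k"
  shows "t \<in> {0..T} \<Longrightarrow> H.nm (z t) \<le> H.nm (z 0) + VB.nm T k" and "0 < T \<Longrightarrow> VB.nm T z \<le> H.nm (z 0) + VB.nm T k"
proof -
  have k: "k \<in> V.B T" using s by (simp add: smooth_solution_def)
  have zB: "z \<in> V.B T" by (rule smooth_solution_zB[OF s])
  have zV: "z t \<in> V" if "t \<in> {0..T}" for t using s V.prim_mem that by (auto simp: smooth_solution_def)
  have sq: "a\<^sup>2 \<le> (b + c)\<^sup>2" if "a\<^sup>2 \<le> b\<^sup>2 + c\<^sup>2" "0 \<le> b" "0 \<le> c" for a b c :: real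
    using that mult_nonneg_nonneg[OF that(2,3)] unfolding power2_sum mult.assoc by linarith
  have est: "(H.nm (z t))\<^sup>2 + ti T 0 t (\<lambda>t. ipV (z t) (z t)) \<le> (H.nm (z 0))\<^sup>2 + (VB.nm T k)\<^sup>2" if t: "t \<in> {0..T}" for t
  proof -
    have "(H.nm (z t))\<^sup>2 = ipH (z t) (z t)" "(H.nm (z 0))\<^sup>2 = ipH (z 0) (z 0)"
      using t zV VH' by (auto intro!: H.nm_sq)
    then show ?thesis
      using smooth_solution_estimate[OF s, of t] ti_ipV_le[OF k, of t] t VB.nm_sq[OF k] by simp
  qed
  have pos: "0 \<le> VB.nm T k" by (rule VB.nm_nonneg[OF k])
  show "H.nm (z t) \<le> H.nm (z 0) + VB.nm T k" if t: "t \<in> {0..T}"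
  proof (rule power2_le_imp_le[OF sq])
    have "ti T 0 t (\<lambda>_. 0) \<le> ti T 0 t (\<lambda>t. ipV (z t) (z t))"
    proof (rule ti_mono)
      show "AE r in tm T. 0 < r \<longrightarrow> r \<le> t \<longrightarrow> 0 \<le> ipV (z r) (z r)"
        using V.B_mem[OF zB] by eventually_elim (simp add: V.ip_nonneg)
    qed (auto intro: V.B_ip_integrable zB)
    then show "(H.nm (z t))\<^sup>2 \<le> (H.nm (z 0))\<^sup>2 + (VB.nm T k)\<^sup>2" using est[OF t] by (simp add: ti_def)
  qed (use t zV VH' pos in \<open>auto intro!: H.nm_nonneg add_nonneg_nonneg\<close>)
  show "VB.nm T z \<le> H.nm (z 0) + VB.nm T k" if T: "0 < T"
  proof (rule power2_le_imp_le[OF sq])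
    have "(VB.nm T z)\<^sup>2 = ti T 0 T (\<lambda>t. ipV (z t) (z t))"
      using VB.nm_sq[OF zB] by (simp add: ti_full V.bip_def)
    then show "(VB.nm T z)\<^sup>2 \<le> (H.nm (z 0))\<^sup>2 + (VB.nm T k)\<^sup>2"
      using est[of T] T zero_le_power2[of "H.nm (z T)"] unfolding atLeastAtMost_iff by linarith
  qed (use T zV VH' pos in \<open>auto intro!: H.nm_nonneg add_nonneg_nonneg\<close>)
qed

text \<open>
  If \<open>p\<close> is orthogonal to all right-hand sides, take \<open>q = p\<close> and \<open>z\<close> the primitive of \<open>p\<close>: then
  \<open>0 = \<integral> |p|\<^sub>H\<^sup>2 + |z(T)|\<^sub>V\<^sup>2 / 2\<close>. No regularity of \<open>p\<close> in time is needed.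
\<close>
lemma smooth_solution_dense:
  assumes T: "0 < T" and f: "f \<in> V.B T" and z0: "z0 \<in> V" and e: "0 < e"
  obtains q z k where "smooth_solution T q z k" "V.nm (z 0 - z0) = 0" "VB.nm T (f - k) < e"
proof -
  \<comment> \<open>Null initial values make \<open>K\<close> a subspace and remove the term at time
    0 from the orthogonality argument; the prescribed initial value is restored by a shift at the
    end.\<close>
  define K where "K = {k. \<exists>q z. smooth_solution T q z k \<and> V.nm (z 0) = 0}"
  have "K \<subseteq> V.B T" by (auto simp: K_def smooth_solution_def)
  moreover have "subspace K"
  proof (rule subspaceI)
    have "(\<lambda>_. 0) \<in> V.B T" by (rule V.B_const[OF V.zero_mem])
    then have "smooth_solution T 0 (\<lambda>_. 0) 0"
      unfolding smooth_solution_def V.prim_def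
      by (auto simp: V.ip_simps H.ip_simps V.zero_mem VH' zero_fun_def ti_def)
    then show "0 \<in> K" unfolding K_def
      by (intro CollectI exI[of _ 0] exI[of _ "\<lambda>_. 0"] conjI) (auto simp: V.nm_zero)
    have z0m: "z 0 \<in> V" if "smooth_solution T q z k" for q z k
      using that V.prim_mem[of T q z 0] T by (auto simp: smooth_solution_def)
    show "x + y \<in> K" if xy: "x \<in> K" "y \<in> K" for x y
    proof -
      obtain q z where 1: "smooth_solution T q z x" "V.nm (z 0) = 0" using xy by (auto simp: K_def)
      obtain q' z' where 2: "smooth_solution T q' z' y" "V.nm (z' 0) = 0" using xy by (auto simp: K_def)
      have "V.nm (z 0 + z' 0) = 0"
        using V.nm_triangle[OF z0m[OF 1(1)] z0m[OF 2(1)]] V.nm_nonneg[OF V.add_mem[OF z0m[OF 1(1)] z0m[OF 2(1)]]] 1 2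
        by simp
      then show ?thesis using smooth_solution_add[OF 1(1) 2(1)] by (auto simp: K_def)
    qed
    show "c *\<^sub>R x \<in> K" if x: "x \<in> K" for c x
    proof -
      obtain q z where 1: "smooth_solution T q z x" "V.nm (z 0) = 0" using x by (auto simp: K_def)
      then show ?thesis using smooth_solution_scale[OF 1(1), of c] V.nm_scale[OF z0m[OF 1(1)], of c] by (auto simp: K_def)
    qed
  qed
  moreover have "VB.nm T p = 0" if p: "p \<in> V.B T" and orth: "\<And>k. k \<in> K \<Longrightarrow> V.bip T p k = 0" for p
  proof -
    obtain z where z: "V.prim T p z" "V.nm (z 0) = 0" using V.prim_exists[OF p] by blast
    have zB: "z \<in> V.B T" using V.cont_curve_B V.prim_cont_curve z(1) p by blast
    have z0V: "z 0 \<in> V" using V.prim_mem[OF z(1)] T by auto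
    \<comment> \<open>\<open>R\<close> converts the derivative \<open>p\<close>, acting through
      \<open>H\<close>, into its representative in \<open>V\<close>; thus \<open>k\<close> is the
      right-hand side belonging to \<open>z\<close>.\<close>
    define k where "k = (\<lambda>t. R (p t)) + z"
    have kB: "k \<in> V.B T" unfolding k_def by (intro V.B_add R_B VB_HB p zB)
    have eq: "AE t in tm T. \<forall>v\<in>V. ipV (k t) v = ipH (p t) v + ipV (z t) v"
      using V.B_mem[OF p] V.B_mem[OF zB]
      by eventually_elim (auto simp: k_def V.ip_simps R_mem VH' R_ip)
    have "smooth_solution T p z k" unfolding smooth_solution_def using p z kB eq by auto
    then have "k \<in> K" using z by (auto simp: K_def)
    then have "0 = V.bip T k p" using orth[of k] VB.ip_sym[OF p kB] by simp
    also have "\<dots> = (\<integral>t. ipH (p t) (p t) + ipV (p t) (z t) \<partial>tm T)"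
      unfolding V.bip_def
    proof (rule integral_cong_AE)
      show "AE t in tm T. ipV (k t) (p t) = ipH (p t) (p t) + ipV (p t) (z t)"
        using V.B_mem[OF p] V.B_mem[OF zB] eq by eventually_elim (simp add: V.ip_sym)
    qed (intro borel_measurable_add V.ip_measurable H.ip_measurable V.B_sm H.B_sm kB p zB VB_HB)+
    also have "\<dots> = (\<integral>t. ipH (p t) (p t) \<partial>tm T) + ti T 0 T (\<lambda>t. ipV (p t) (z t))"
      unfolding ti_full by (intro Bochner_Integration.integral_add V.B_ip_integrable H.B_ip_integrable VB_HB p zB)
    also have "ti T 0 T (\<lambda>t. ipV (p t) (z t)) = ipV (z T) (z T) / 2"
      using V.prim_energy[OF z(1) p, of T] T V.nm_sq[OF z0V] z(2) by simp
    finally have eq0: "(\<integral>t. ipH (p t) (p t) \<partial>tm T) = - (ipV (z T) (z T) / 2)" by simp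
    have "0 \<le> ipV (z T) (z T)" using V.prim_mem[OF z(1)] T by (intro V.ip_nonneg) auto
    then have "(\<integral>t. ipH (p t) (p t) \<partial>tm T) \<le> 0" using eq0 by simp
    moreover have ae: "AE t in tm T. 0 \<le> ipH (p t) (p t)"
      using V.B_mem[OF p] by eventually_elim (intro H.ip_nonneg VH')
    moreover have ip: "integrable (tm T) (\<lambda>t. ipH (p t) (p t))" by (intro H.B_ip_integrable VB_HB p)
    ultimately have "(\<integral>t. ipH (p t) (p t) \<partial>tm T) = 0" using integral_nonneg_AE by fastforce
    then have "AE t in tm T. ipH (p t) (p t) = 0" using integral_nonneg_eq_0_iff_AE[OF ip ae] by simp
    then have "AE t in tm T. ipV (p t) (p t) = 0"
      using V.B_mem[OF p]
    proof eventually_elim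
      case (elim t)
      then show ?case using null[of "p t" 0] by (simp add: H.zero_mem)
    qed
    then have "V.bip T p p = (\<integral>t. 0 \<partial>tm T)" unfolding V.bip_def
      by (intro integral_cong_AE V.ip_measurable V.B_sm p) auto
    then show ?thesis by (simp add: VB.nm_def)
  qed
  \<comment> \<open>The constant curve \<open>z0\<close> has derivative zero and right-hand side
    \<open>z0\<close>. Approximating \<open>f - z0\<close> from \<open>K\<close> and adding this
    curve gives the required initial value.\<close>
  ultimately obtain k where k: "k \<in> K" "VB.nm T ((f - (\<lambda>_. z0)) - k) < e"
    using VB.density[of K T "f - (\<lambda>_. z0)" e] V.B_diff[OF f V.B_const[OF z0]] e by blast
  then obtain q z where qz: "smooth_solution T q z k" "V.nm (z 0) = 0" by (auto simp: K_def)
  then have B: "q \<in> V.B T" "k \<in> V.B T" "V.prim T q z" "AE t in tm T. \<forall>v\<in>V. ipV (k t) v = ipH (q t) v + ipV (z t) v"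
    by (auto simp: smooth_solution_def)
  have "smooth_solution T q (\<lambda>t. z0 + z t) ((\<lambda>_. z0) + k)"
    unfolding smooth_solution_def
  proof (intro conjI B V.prim_shift z0 V.B_add V.B_const)
    show "AE t in tm T. \<forall>v\<in>V. ipV (((\<lambda>_. z0) + k) t) v = ipH (q t) v + ipV (z0 + z t) v"
      using B(4) V.B_mem[OF B(2)] AE_tm_space
    proof eventually_elim
      case (elim t)
      have "z t \<in> V" using V.prim_mem[OF B(3)] elim by auto
      then show ?case using elim z0 by (auto simp: V.ip_simps)
    qed
  qed
  moreover have "V.nm ((z0 + z 0) - z0) = 0" using qz by simp
  moreover have "VB.nm T (f - ((\<lambda>_. z0) + k)) < e" using k(2) by (simp add: diff_diff_eq)
  ultimately show thesis by (rule that)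
qed

text \<open>An integral over a subinterval against a fixed \<open>v\<close> is an inner product with
  a step curve, hence continuous under convergence in the Bochner space.\<close>

lemma ti_ipV_bip:
  assumes "g \<in> V.B T" "v \<in> V"
  shows "ti T s t (\<lambda>r. ipV (g r) v) = V.bip T g (\<lambda>r. indicator {s<..t} r *\<^sub>R v)"
    and "(\<lambda>r. indicat_real {s<..t} r *\<^sub>R v) \<in> V.B T"
proof -
  have m: "indicat_real {s<..t} \<in> borel_measurable (tm T)"
    by (intro measurable_restrict_space1 borel_measurable_indicator) auto
  show B: "(\<lambda>r. indicat_real {s<..t} r *\<^sub>R v) \<in> V.B T"
    using V.B_scale_fun[OF V.B_const[OF assms(2)] m, of 1] by (auto simp: indicator_def)
  show "ti T s t (\<lambda>r. ipV (g r) v) = V.bip T g (\<lambda>r. indicator {s<..t} r *\<^sub>R v)"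
    unfolding ti_def V.bip_def
  proof (rule integral_cong_AE)
    show "AE r in tm T. indicator {s<..t} r * ipV (g r) v = ipV (g r) (indicator {s<..t} r *\<^sub>R v)"
      using V.B_mem[OF assms(1)] by eventually_elim (simp add: V.ip_simps assms)
    show "(\<lambda>r. indicator {s<..t} r * ipV (g r) v) \<in> borel_measurable (tm T)"
      using ti_integrable[OF V.B_ip_const_integrable[OF assms]] by auto
  qed (intro V.ip_measurable V.B_sm assms B)
qed

text \<open>The initial value is only assumed to lie in the closure of \<open>V\<close> in
  \<open>H\<close>. The errors of data and initial value are both taken below 1/(n+1), so the bounds
  for differences give Cauchy rates that are uniform in time.\<close>

lemma solution_exists:
  assumes T: "0 < T" and f: "f \<in> V.B T" and h0: "h0 \<in> H" and dense: "\<And>e. 0 < e \<Longrightarrow> \<exists>v\<in>V. H.nm (h0 - v) < e"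
  obtains z where "H.cont_curve T z" "z \<in> V.B T" "H.nm (z 0 - h0) = 0"
    "\<And>s t v. 0 \<le> s \<Longrightarrow> s \<le> t \<Longrightarrow> t \<le> T \<Longrightarrow> v \<in> V \<Longrightarrow> ipH (z t - z s) v = ti T s t (\<lambda>r. ipV (f r - z r) v)"
    "ipH (z T) (z T) - ipH (z 0) (z 0) = 2 * V.bip T (f - z) z"
proof -
  let ?e = "\<lambda>n. inverse (real (Suc n))"
  have "\<forall>n. \<exists>x. smooth_solution T (fst x) (fst (snd x)) (snd (snd x)) \<and> H.nm (fst (snd x) 0 - h0) < ?e n
      \<and> VB.nm T (f - snd (snd x)) < ?e n"
  proof
    fix n
    obtain v where v: "v \<in> V" "H.nm (h0 - v) < ?e n" using dense[of "?e n"] by auto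
    obtain q z k where s: "smooth_solution T q z k" "V.nm (z 0 - v) = 0" "VB.nm T (f - k) < ?e n"
      using smooth_solution_dense[OF T f v(1), of "?e n"] by auto
    have z0: "z 0 \<in> V" using s(1) V.prim_mem[of T q z 0] T by (auto simp: smooth_solution_def)
    have "H.nm (z 0 - h0) \<le> H.nm (z 0 - v) + H.nm (v - h0)"
      using VH'[OF z0] VH'[OF v(1)] h0 by (rule H.nm_triangle3)
    also have "H.nm (z 0 - v) \<le> V.nm (z 0 - v)" using z0 v by (intro nm_le V.diff_mem)
    also have "H.nm (v - h0) = H.nm (h0 - v)" using VH'[OF v(1)] h0 by (rule H.nm_commute)
    finally have "H.nm (z 0 - h0) < ?e n" using s(2) v(2) by simp
    then show "\<exists>x. smooth_solution T (fst x) (fst (snd x)) (snd (snd x)) \<and> H.nm (fst (snd x) 0 - h0) < ?e n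
        \<and> VB.nm T (f - snd (snd x)) < ?e n"
      using s by (intro exI[of _ "(q, z, k)"]) simp
  qed
  from choice[OF this] obtain x where x: "\<forall>n. smooth_solution T (fst (x n)) (fst (snd (x n))) (snd (snd (x n)))
      \<and> H.nm (fst (snd (x n)) 0 - h0) < ?e n \<and> VB.nm T (f - snd (snd (x n))) < ?e n" by blast
  define q where "q n = fst (x n)" for n
  define Z where "Z n = fst (snd (x n))" for n
  define k where "k n = snd (snd (x n))" for n
  have s: "smooth_solution T (q n) (Z n) (k n)" and Z0: "H.nm (Z n 0 - h0) < ?e n"
    and k: "VB.nm T (f - k n) < ?e n" for n
    using x by (auto simp: q_def Z_def k_def)
  have B: "q n \<in> V.B T" "k n \<in> V.B T" "V.prim T (q n) (Z n)" "Z n \<in> V.B T" for n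
    using s[of n] smooth_solution_zB[OF s[of n]] by (auto simp: smooth_solution_def)
  have eq: "AE t in tm T. \<forall>v\<in>V. ipV (k n t) v = ipH (q n t) v + ipV (Z n t) v" for n
    using s[of n] by (simp add: smooth_solution_def)
  have ZV: "Z n t \<in> V" if "t \<in> {0..T}" for n t using V.prim_mem[OF B(3) that] .
  have ZH: "Z n t \<in> H" if "t \<in> {0..T}" for n t using ZV[OF that] by (rule VH')
  have elim0: "(\<lambda>n. ?e n) \<longlonglongrightarrow> 0" by (rule LIMSEQ_inverse_real_of_nat)
  have c0: "H.nm (Z m 0 - Z n 0) + VB.nm T (k m - k n) \<le> 2 * ?e m + 2 * ?e n" for m n
  proof -
    have "H.nm (Z m 0 - Z n 0) \<le> H.nm (Z m 0 - h0) + H.nm (h0 - Z n 0)"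
      using T h0 by (intro H.nm_triangle3 ZH) auto
    also have "H.nm (h0 - Z n 0) = H.nm (Z n 0 - h0)" using T h0 by (intro H.nm_commute ZH) auto
    finally have 1: "H.nm (Z m 0 - Z n 0) \<le> ?e m + ?e n" using Z0[of m] Z0[of n] by linarith
    have "VB.nm T (k m - k n) \<le> VB.nm T (k m - f) + VB.nm T (f - k n)" by (intro VB.nm_triangle3 B f)
    also have "VB.nm T (k m - f) = VB.nm T (f - k m)" by (intro VB.nm_commute B f)
    finally show ?thesis using 1 k[of m] k[of n] by linarith
  qed
  have cH: "H.nm (Z m t - Z n t) \<le> 2 * ?e m + 2 * ?e n" if t: "t \<in> {0..T}" for m n t
    using smooth_solution_bounds(1)[OF smooth_solution_diff[OF s[of m] s[of n]] t] c0[of m n] by linarith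
  have cV: "VB.nm T (Z m - Z n) \<le> 2 * ?e m + 2 * ?e n" for m n
    using smooth_solution_bounds(2)[OF smooth_solution_diff[OF s[of m] s[of n]] T] c0[of m n]
    by (simp add: fun_diff_def)
  have small: "\<exists>M. \<forall>m\<ge>M. \<forall>n\<ge>M. 2 * ?e m + 2 * ?e n < a" if a: "0 < a" for a
  proof -
    obtain M where M: "?e M < a / 4" using reals_Archimedean[of "a / 4"] a by auto
    have le: "?e m \<le> ?e M" if "M \<le> m" for m using that by (simp add: le_imp_inverse_le)
    have "2 * ?e m + 2 * ?e n < a" if "m \<ge> M" "n \<ge> M" for m n
      using le[OF that(1)] le[OF that(2)] M by linarith
    then show ?thesis by blast
  qed
  obtain y where y: "y \<in> V.B T" "(\<lambda>n. VB.nm T (Z n - y)) \<longlonglongrightarrow> 0"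
  proof -
    have "\<exists>M. \<forall>m\<ge>M. \<forall>n\<ge>M. VB.nm T (Z m - Z n) < a" if a: "0 < a" for a
      using small[OF a] cV by (meson order_le_less_trans)
    then show thesis using VB.complete[of Z T, OF B(4)] that by blast
  qed
  have "\<forall>t. \<exists>h. t \<in> {0..T} \<longrightarrow> h \<in> H \<and> (\<lambda>n. H.nm (Z n t - h)) \<longlonglongrightarrow> 0"
  proof
    fix t
    show "\<exists>h. t \<in> {0..T} \<longrightarrow> h \<in> H \<and> (\<lambda>n. H.nm (Z n t - h)) \<longlonglongrightarrow> 0"
    proof (cases "t \<in> {0..T}")
      case t: True
      have "\<exists>M. \<forall>m\<ge>M. \<forall>n\<ge>M. H.nm (Z m t - Z n t) < a" if a: "0 < a" for a
        using small[OF a] cH[OF t] by (meson order_le_less_trans)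
      then show ?thesis using H.complete[of "\<lambda>n. Z n t", OF ZH[OF t]] by blast
    qed auto
  qed
  from choice[OF this] obtain z where "\<forall>t. t \<in> {0..T} \<longrightarrow> z t \<in> H \<and> (\<lambda>n. H.nm (Z n t - z t)) \<longlonglongrightarrow> 0" by blast
  then have zH: "z t \<in> H" and zl: "(\<lambda>n. H.nm (Z n t - z t)) \<longlonglongrightarrow> 0" if "t \<in> {0..T}" for t using that by auto
  \<comment> \<open>Letting \<open>m\<close> tend to infinity in \<open>cH\<close> turns the Cauchy
    estimate into a rate of convergence independent of \<open>t\<close>; continuity of the limit
    follows from it.\<close>
  have zu: "H.nm (Z n t - z t) \<le> 2 * ?e n" if t: "t \<in> {0..T}" for n t
  proof (rule LIMSEQ_le)
    have "(\<lambda>m. H.nm ((Z n t - Z m t) - (Z n t - z t))) \<longlonglongrightarrow> 0"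
    proof -
      have "H.nm ((Z n t - Z m t) - (Z n t - z t)) = H.nm (Z m t - z t)" for m
        using H.nm_commute[of "z t" "Z m t"] zH[OF t] ZH[OF t] by simp
      then show ?thesis using zl[OF t] by simp
    qed
    then show "(\<lambda>m. H.nm (Z n t - Z m t)) \<longlonglongrightarrow> H.nm (Z n t - z t)"
      by (intro H.nm_tendsto) (auto intro!: H.diff_mem ZH zH t)
    show "(\<lambda>m. 2 * ?e n + 2 * ?e m) \<longlonglongrightarrow> 2 * ?e n"
      using tendsto_add[OF tendsto_const[of "2 * ?e n"] tendsto_mult[OF tendsto_const[of 2] elim0]] by simp
    show "\<exists>N. \<forall>m\<ge>N. H.nm (Z n t - Z m t) \<le> 2 * ?e n + 2 * ?e m" using cH[OF t] by blast
  qed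
  have zc: "H.cont_curve T z"
    unfolding H.cont_curve_def
  proof (intro ballI conjI zH)
    fix t assume t: "t \<in> {0..T}"
    show "((\<lambda>s. H.nm (z s - z t)) \<longlongrightarrow> 0) (at t within {0..T})"
      unfolding tendsto_iff
    proof (intro allI impI)
      fix a :: real assume a: "0 < a"
      obtain n where n: "?e n < a / 8" using reals_Archimedean[of "a / 8"] a by auto
      obtain d where d: "0 < d" "\<And>s t. s \<in> {0..T} \<Longrightarrow> t \<in> {0..T} \<Longrightarrow> \<bar>s - t\<bar> < d \<Longrightarrow> V.nm (Z n s - Z n t) < a / 4"
        using V.prim_uniform[OF B(3)[of n] B(1)[of n], of "a / 4"] a by auto
      show "\<forall>\<^sub>F s in at t within {0..T}. dist (H.nm (z s - z t)) 0 < a"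
        unfolding eventually_at
      proof (intro exI[of _ d] conjI ballI impI d(1))
        fix s assume s: "s \<in> {0..T}" "s \<noteq> t \<and> dist s t < d"
        have "H.nm (z s - z t) \<le> H.nm (z s - Z n s) + H.nm (Z n s - z t)"
          using s t by (intro H.nm_triangle3 zH ZH)
        also have "H.nm (Z n s - z t) \<le> H.nm (Z n s - Z n t) + H.nm (Z n t - z t)"
          using s t by (intro H.nm_triangle3 zH ZH)
        also have "H.nm (Z n s - Z n t) \<le> V.nm (Z n s - Z n t)"
          using s t by (intro nm_le V.diff_mem ZV)
        also have "H.nm (z s - Z n s) = H.nm (Z n s - z s)" using s by (intro H.nm_commute zH ZH)
        finally have "H.nm (z s - z t) \<le> H.nm (Z n s - z s) + (V.nm (Z n s - Z n t) + H.nm (Z n t - z t))" by simp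
        moreover have "V.nm (Z n s - Z n t) < a / 4" using d(2)[of s t] s t by (simp add: dist_real_def)
        ultimately have "H.nm (z s - z t) < a"
          using zu[OF s(1), of n] zu[OF t, of n] n a by linarith
        moreover have "0 \<le> H.nm (z s - z t)" using s t by (intro H.nm_nonneg H.diff_mem zH)
        ultimately show "dist (H.nm (z s - z t)) 0 < a" by (simp add: dist_real_def)
      qed
    qed
  qed
  have zHB: "z \<in> H.B T" by (rule H.cont_curve_B[OF zc])
  \<comment> \<open>Two limits have been produced: \<open>y\<close> among the curves in
    \<open>V\<close>, and \<open>z\<close> at every time in \<open>H\<close>. Both are limits in the
    square-integrable curves of \<open>H\<close>, so they differ by null elements at almost every
    time, and \<open>null_nm\<close> lifts this to \<open>V\<close>.\<close>
  have zy: "AE t in tm T. z t \<in> V \<and> V.nm (y t - z t) = 0"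
  proof -
    have yHB: "y \<in> H.B T" by (rule VB_HB[OF y(1)])
    have ZHB: "Z n \<in> H.B T" for n by (rule VB_HB[OF B(4)])
    have 1: "(\<lambda>n. HB.nm T (Z n - y)) \<longlonglongrightarrow> 0"
    proof (rule Lim_null_comparison[OF _ y(2)], intro always_eventually allI)
      fix n
      have D: "Z n - y \<in> V.B T" by (intro V.B_diff B y)
      have "H.bip T (Z n - y) (Z n - y) \<le> V.bip T (Z n - y) (Z n - y)"
        unfolding H.bip_def V.bip_def
      proof (rule integral_mono_AE)
        show "AE t in tm T. ipH ((Z n - y) t) ((Z n - y) t) \<le> ipV ((Z n - y) t) ((Z n - y) t)"
          using V.B_mem[OF D] by eventually_elim (rule ipH_le)
      qed (intro H.B_ip_integrable V.B_ip_integrable VB_HB D)+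
      then have "HB.nm T (Z n - y) \<le> VB.nm T (Z n - y)" by (simp add: HB.nm_def VB.nm_def)
      then show "norm (HB.nm T (Z n - y)) \<le> VB.nm T (Z n - y)"
        using HB.nm_nonneg[OF VB_HB[OF D]] by simp
    qed
    have 2: "(\<lambda>n. HB.nm T (Z n - z)) \<longlonglongrightarrow> 0"
    proof (rule Lim_null_comparison, intro always_eventually allI)
      fix n
      have D: "Z n - z \<in> H.B T" by (intro H.B_diff ZHB zHB)
      have "H.bip T (Z n - z) (Z n - z) \<le> (\<integral>t. (2 * ?e n)\<^sup>2 \<partial>tm T)"
        unfolding H.bip_def
      proof (rule integral_mono_AE)
        show "AE t in tm T. ipH ((Z n - z) t) ((Z n - z) t) \<le> (2 * ?e n)\<^sup>2"
          using AE_tm_space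
        proof eventually_elim
          case (elim t)
          then have t: "t \<in> {0..T}" by auto
          have D: "Z n t - z t \<in> H" using t by (intro H.diff_mem ZH zH)
          have "(H.nm (Z n t - z t))\<^sup>2 \<le> (2 * ?e n)\<^sup>2" using zu[OF t] H.nm_nonneg[OF D] by (intro power_mono)
          then show ?case using H.nm_sq[OF D] by simp
        qed
      qed (intro H.B_ip_integrable D integrable_const_tm)+
      also have "\<dots> = T * (2 * ?e n)\<^sup>2" using T ti_const[of 0 T T "(2 * ?e n)\<^sup>2"] by (simp add: ti_full mult.commute)
      finally have "HB.nm T (Z n - z) \<le> sqrt (T * (2 * ?e n)\<^sup>2)" by (simp add: HB.nm_def)
      then show "norm (HB.nm T (Z n - z)) \<le> sqrt T * (2 * ?e n)"
        using HB.nm_nonneg[OF D] by (simp add: real_sqrt_mult)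
      show "(\<lambda>n. sqrt T * (2 * ?e n)) \<longlonglongrightarrow> 0"
        using tendsto_mult[OF tendsto_const[of "sqrt T"] tendsto_mult[OF tendsto_const[of 2] elim0]] by simp
    qed
    have "HB.nm T (y - z) \<le> 0"
    proof (rule LIMSEQ_le_const)
      show "(\<lambda>n. HB.nm T (Z n - y) + HB.nm T (Z n - z)) \<longlonglongrightarrow> 0" using tendsto_add[OF 1 2] by simp
      have "HB.nm T (y - z) \<le> HB.nm T (Z n - y) + HB.nm T (Z n - z)" for n
        using HB.nm_triangle3[OF yHB ZHB[of n] zHB] HB.nm_commute[OF yHB ZHB[of n]] by simp
      then show "\<exists>N. \<forall>n\<ge>N. HB.nm T (y - z) \<le> HB.nm T (Z n - y) + HB.nm T (Z n - z)" by blast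
    qed
    have D: "y - z \<in> H.B T" by (intro H.B_diff yHB zHB)
    have "H.bip T (y - z) (y - z) = 0"
      using HB.nm_sq[OF D] HB.nm_nonneg[OF D] \<open>HB.nm T (y - z) \<le> 0\<close> by simp
    then have "AE t in tm T. (H.nm ((y - z) t))\<^sup>2 = 0"
      unfolding H.bip_nm[OF D] by (subst (asm) integral_nonneg_eq_0_iff_AE[OF H.B_nm_integrable[OF D]]) auto
    then show ?thesis
      using V.B_mem[OF y(1)] H.B_mem[OF zHB]
    proof eventually_elim
      case (elim t)
      then show ?case using null_nm[of "y t" "z t"] by simp
    qed
  qed
  have zB: "z \<in> V.B T" by (rule V.B_cong[OF y(1) zy])
  have Zz: "(\<lambda>n. VB.nm T (Z n - z)) \<longlonglongrightarrow> 0"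
  proof -
    have D: "y - z \<in> V.B T" by (intro V.B_diff y zB)
    have "V.bip T (y - z) (y - z) = (\<integral>t. 0 \<partial>tm T)"
      unfolding V.bip_nm[OF D]
    proof (rule integral_cong_AE)
      show "AE t in tm T. (V.nm ((y - z) t))\<^sup>2 = 0" using zy by eventually_elim simp
      show "(\<lambda>t. (V.nm ((y - z) t))\<^sup>2) \<in> borel_measurable (tm T)" using V.B_nm_integrable[OF D] by auto
    qed simp
    then have yz: "VB.nm T (y - z) = 0" by (simp add: VB.nm_def)
    show ?thesis
    proof (rule Lim_null_comparison[OF _ y(2)], intro always_eventually allI)
      fix n
      show "norm (VB.nm T (Z n - z)) \<le> VB.nm T (Z n - y)"
        using VB.nm_triangle3[OF B(4)[of n] y(1) zB] yz VB.nm_nonneg[OF V.B_diff[OF B(4)[of n] zB]] by simp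
    qed
  qed
  have g: "k n - Z n \<in> V.B T" "f - z \<in> V.B T" for n by (auto intro!: V.B_diff B f zB)
  have gl: "(\<lambda>n. VB.nm T ((k n - Z n) - (f - z))) \<longlonglongrightarrow> 0"
  proof (rule Lim_null_comparison, intro always_eventually allI)
    fix n
    have e: "(k n - Z n) - (f - z) = (k n - f) - (Z n - z)" by simp
    have "VB.nm T ((k n - Z n) - (f - z)) \<le> VB.nm T (k n - f) + VB.nm T (Z n - z)"
      unfolding e by (intro VB.nm_triangle_diff V.B_diff B f zB)
    moreover have "VB.nm T (k n - f) = VB.nm T (f - k n)" by (intro VB.nm_commute B f)
    moreover have "0 \<le> VB.nm T ((k n - Z n) - (f - z))" by (intro VB.nm_nonneg V.B_diff g)
    ultimately show "norm (VB.nm T ((k n - Z n) - (f - z))) \<le> ?e n + VB.nm T (Z n - z)"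
      using k[of n] unfolding real_norm_def by linarith
    show "(\<lambda>n. ?e n + VB.nm T (Z n - z)) \<longlonglongrightarrow> 0" using tendsto_add[OF elim0 Zz] by simp
  qed
  \<comment> \<open>\<open>k n - Z n\<close> is the representative in \<open>V\<close> of the
    derivative \<open>q n\<close> as a functional. These representatives converge, and no
    convergence of \<open>q n\<close> itself is required.\<close>
  have gq: "AE t in tm T. (k n - Z n) t \<in> V \<and> (\<forall>v\<in>V. ipV ((k n - Z n) t) v = ipH (q n t) v)" for n
    using eq[of n] V.B_mem[OF B(2)[of n]] AE_tm_space
  proof eventually_elim
    case (elim t)
    then have "Z n t \<in> V" by (intro ZV) auto
    then show ?case using elim by (auto simp: V.ip_simps V.diff_mem)
  qed
  have id1: "ipH (z t - z s) v = ti T s t (\<lambda>r. ipV (f r - z r) v)"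
    if st: "0 \<le> s" "s \<le> t" "t \<le> T" and v: "v \<in> V" for s t v
  proof (rule LIMSEQ_unique)
    have mem: "s \<in> {0..T}" "t \<in> {0..T}" using st by auto
    have "(\<lambda>n. ipH (Z n t) v - ipH (Z n s) v) \<longlonglongrightarrow> ipH (z t) v - ipH (z s) v"
      by (intro tendsto_diff H.ip_tendsto) (use mem ZH zH zl v VH' in \<open>auto simp: H.nm_zero\<close>)
    then show "(\<lambda>n. ipH (Z n t) v - ipH (Z n s) v) \<longlonglongrightarrow> ipH (z t - z s) v"
      using mem zH v VH' by (simp add: H.ip_simps)
    have "ipH (Z n t) v - ipH (Z n s) v = V.bip T (k n - Z n) (\<lambda>r. indicator {s<..t} r *\<^sub>R v)" for n
    proof -
      have "ipH (Z n t) v - ipH (Z n s) v = ipH (Z n t - Z n s) v"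
        using mem ZH v VH' by (simp add: H.ip_simps)
      also have "\<dots> = ti T s t (\<lambda>r. ipH (q n r) v)"
        by (rule H.prim_eq[OF prim_VH[OF B(3)[of n] B(1)[of n]] st VH'[OF v]])
      also have "\<dots> = ti T s t (\<lambda>r. ipV ((k n - Z n) r) v)"
      proof (rule ti_cong_AE)
        show "AE r in tm T. ipH (q n r) v = ipV ((k n - Z n) r) v"
          using gq[of n] by eventually_elim (simp add: v)
      qed (intro V.B_ip_const_integrable H.B_ip_const_integrable VB_HB g B v VH')+
      also have "\<dots> = V.bip T (k n - Z n) (\<lambda>r. indicator {s<..t} r *\<^sub>R v)" by (rule ti_ipV_bip(1)[OF g(1) v])
      finally show ?thesis .
    qed
    moreover have "(\<lambda>n. V.bip T (k n - Z n) (\<lambda>r. indicator {s<..t} r *\<^sub>R v)) \<longlonglongrightarrow> V.bip T (f - z) (\<lambda>r. indicator {s<..t} r *\<^sub>R v)"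
      by (intro VB.ip_tendsto g gl ti_ipV_bip(2)[OF f v]) (simp add: VB.nm_zero)
    ultimately show "(\<lambda>n. ipH (Z n t) v - ipH (Z n s) v) \<longlonglongrightarrow> ti T s t (\<lambda>r. ipV (f r - z r) v)"
      using ti_ipV_bip(1)[OF g(2) v, of s t] by simp
  qed
  have id2: "ipH (z T) (z T) - ipH (z 0) (z 0) = 2 * V.bip T (f - z) z"
  proof (rule LIMSEQ_unique)
    have mem: "0 \<in> {0..T}" "T \<in> {0..T}" using T by auto
    show "(\<lambda>n. ipH (Z n T) (Z n T) - ipH (Z n 0) (Z n 0)) \<longlonglongrightarrow> ipH (z T) (z T) - ipH (z 0) (z 0)"
      by (intro tendsto_diff H.ip_tendsto ZH zH zl mem)
    have "ipH (Z n T) (Z n T) - ipH (Z n 0) (Z n 0) = 2 * V.bip T (k n - Z n) (Z n)" for n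
    proof -
      have "ipH (Z n T) (Z n T) - ipH (Z n 0) (Z n 0) = 2 * (\<integral>r. ipH (q n r) (Z n r) \<partial>tm T)"
        using H.prim_energy[OF prim_VH[OF B(3)[of n] B(1)[of n]] VB_HB[OF B(1)[of n]], of T] T by (simp add: ti_full)
      also have "(\<integral>r. ipH (q n r) (Z n r) \<partial>tm T) = V.bip T (k n - Z n) (Z n)"
        unfolding V.bip_def
      proof (rule integral_cong_AE)
        show "AE r in tm T. ipH (q n r) (Z n r) = ipV ((k n - Z n) r) (Z n r)"
          using gq[of n] V.B_mem[OF B(4)[of n]] by eventually_elim simp
      qed (intro V.ip_measurable H.ip_measurable V.B_sm H.B_sm VB_HB g B)+
      finally show ?thesis .
    qed
    moreover have "(\<lambda>n. 2 * V.bip T (k n - Z n) (Z n)) \<longlonglongrightarrow> 2 * V.bip T (f - z) z"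
      by (intro tendsto_mult tendsto_const VB.ip_tendsto g gl B zB Zz)
    ultimately show "(\<lambda>n. ipH (Z n T) (Z n T) - ipH (Z n 0) (Z n 0)) \<longlonglongrightarrow> 2 * V.bip T (f - z) z" by simp
  qed
  have "H.nm (z 0 - h0) \<le> 0"
  proof (rule LIMSEQ_le_const)
    have m: "0 \<in> {0..T}" using T by simp
    show "(\<lambda>n. H.nm (Z n 0 - z 0) + ?e n) \<longlonglongrightarrow> 0" using tendsto_add[OF zl[OF m] elim0] by simp
    have "H.nm (z 0 - h0) \<le> H.nm (Z n 0 - z 0) + ?e n" for n
      using H.nm_triangle3[OF zH[OF m] ZH[OF m, of n] h0] H.nm_commute[OF zH[OF m] ZH[OF m, of n]] Z0[of n] by simp
    then show "\<exists>N. \<forall>n\<ge>N. H.nm (z 0 - h0) \<le> H.nm (Z n 0 - z 0) + ?e n" by blast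
  qed
  moreover have "0 \<le> H.nm (z 0 - h0)" using T h0 zH by (intro H.nm_nonneg H.diff_mem) auto
  ultimately have "H.nm (z 0 - h0) = 0" by simp
  then show thesis using that[OF zc zB _ id1 id2] by blast
qed

text \<open>
  With \<open>E = R d\<close> the equation gives \<open>(d/dt) |E|\<^sub>V\<^sup>2 = - 2 |d|\<^sub>H\<^sup>2\<close>, which needs no energy identity for \<open>d\<close> itself.
\<close>
lemma homogeneous_unique:
  assumes T: "0 < T" and d: "d \<in> V.B T" and c: "H.cont_curve T d" and d0: "H.nm (d 0) = 0"
    and eq: "\<And>s t v. 0 \<le> s \<Longrightarrow> s \<le> t \<Longrightarrow> t \<le> T \<Longrightarrow> v \<in> V \<Longrightarrow> ipH (d t - d s) v = - ti T s t (\<lambda>r. ipV (d r) v)"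
    and t: "t \<in> {0..T}"
  shows "H.nm (d t) = 0"
proof -
  have dH: "d s \<in> H" if "s \<in> {0..T}" for s using H.cont_curve_mem[OF c that] .
  define E where "E s = R (d s)" for s
  have EV: "E s \<in> V" if "s \<in> {0..T}" for s unfolding E_def using dH[OF that] by (rule R_mem)
  have Eip: "ipV (E s) v = ipH (d s) v" if "s \<in> {0..T}" "v \<in> V" for s v
    unfolding E_def using dH[OF that(1)] that(2) by (rule R_ip)
  have dHB: "d \<in> H.B T" by (rule VB_HB[OF d])
  have i1: "integrable (tm T) (\<lambda>r. - ipH (d r) (d s))" if "s \<in> {0..T}" for s
    using H.B_ip_const_integrable[OF dHB dH[OF that]] by simp
  have i2: "integrable (tm T) (\<lambda>r. - ipH (d r) (d r))"
    using H.B_ip_integrable[OF dHB dHB] by simp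
  have P1: "ipV (E t') (E s) - ipV (E t) (E s) = ti T t t' (\<lambda>r. - ipH (d r) (d s))"
    if tt: "0 \<le> t" "t \<le> t'" "t' \<le> T" and s: "s \<in> {0..T}" for t t' s
  proof -
    have m: "t \<in> {0..T}" "t' \<in> {0..T}" using tt by auto
    have "ipV (E t') (E s) - ipV (E t) (E s) = ipH (d t' - d t) (E s)"
      using Eip[OF m(1) EV[OF s]] Eip[OF m(2) EV[OF s]] dH[OF m(1)] dH[OF m(2)] VH'[OF EV[OF s]] by (simp add: H.ip_simps)
    also have "\<dots> = ti T t t' (\<lambda>r. - ipV (d r) (E s))" using eq[OF tt EV[OF s]] by (simp add: ti_minus)
    \<comment> \<open>Since \<open>E s\<close> is \<open>R (d s)\<close>, the inner product in
      \<open>V\<close> collapses to one in \<open>H\<close>.\<close>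
    also have "\<dots> = ti T t t' (\<lambda>r. - ipH (d r) (d s))"
    proof (rule ti_cong_AE)
      show "AE r in tm T. - ipV (d r) (E s) = - ipH (d r) (d s)"
        using V.B_mem[OF d]
      proof eventually_elim
        case (elim r)
        show ?case using Eip[OF s elim] V.ip_sym[OF EV[OF s] elim] H.ip_sym[OF dH[OF s] VH'[OF elim]] by simp
      qed
    qed (use V.B_ip_const_integrable[OF d EV[OF s]] i1[OF s] in auto)
    finally show ?thesis .
  qed
  \<comment> \<open>After this collapse, continuity of \<open>d\<close> into \<open>H\<close> is
    enough for the hypotheses of the product rule.\<close>
  have cc: "\<exists>b>0. AE r in tm T. \<forall>s\<in>{0..T}. r \<le> T \<longrightarrow> \<bar>s - r\<bar> < b \<longrightarrow> \<bar>- ipH (d r) (d s) - (- ipH (d r) (d r))\<bar> \<le> e * H.nm (d r)"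
    if e: "0 < e" for e
  proof -
    obtain b where b: "0 < b" "\<And>s t. s \<in> {0..T} \<Longrightarrow> t \<in> {0..T} \<Longrightarrow> \<bar>s - t\<bar> < b \<Longrightarrow> H.nm (d s - d t) < e"
      using H.cont_curve_uniform[OF c e] by blast
    have "AE r in tm T. \<forall>s\<in>{0..T}. r \<le> T \<longrightarrow> \<bar>s - r\<bar> < b \<longrightarrow> \<bar>- ipH (d r) (d s) - (- ipH (d r) (d r))\<bar> \<le> e * H.nm (d r)"
      using AE_tm_space
    proof eventually_elim
      case (elim r)
      show ?case
      proof (intro ballI impI)
        fix s assume s: "s \<in> {0..T}" "r \<le> T" "\<bar>s - r\<bar> < b"
        have r: "r \<in> {0..T}" using elim by auto
        have m: "d s \<in> H" "d r \<in> H" using dH s r by auto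
        have "\<bar>- ipH (d r) (d s) - (- ipH (d r) (d r))\<bar> = \<bar>ipH (d r) (d s - d r)\<bar>" using m by (simp add: H.ip_simps abs_minus_commute)
        also have "\<dots> \<le> H.nm (d r) * H.nm (d s - d r)" using m by (intro H.cauchy_schwarz H.diff_mem)
        also have "\<dots> \<le> H.nm (d r) * e" using b(2)[OF s(1) r s(3)] m by (intro mult_left_mono H.nm_nonneg) auto
        finally show "\<bar>- ipH (d r) (d s) - (- ipH (d r) (d r))\<bar> \<le> e * H.nm (d r)" by (simp add: mult.commute)
      qed
    qed
    then show ?thesis using b(1) by blast
  qed
  have "ipV (E T) (E T) - ipV (E 0) (E 0) = ti T 0 T (\<lambda>r. - ipH (d r) (d r)) + ti T 0 T (\<lambda>r. - ipH (d r) (d r))"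
  proof (rule product_rule[where P = "\<lambda>t s. ipV (E t) (E s)" and p = "\<lambda>r s. - ipH (d r) (d s)" and q = "\<lambda>t r. - ipH (d r) (d t)"
        and m = "\<lambda>r. H.nm (d r)"])
    show "ipV (E t) (E s') - ipV (E t) (E s) = ti T s s' (\<lambda>r. - ipH (d r) (d t))"
      if "0 \<le> s" "s \<le> s'" "s' \<le> T" "t \<in> {0..T}" for s s' t
      using P1[OF that] V.ip_sym[OF EV EV, of t s] V.ip_sym[OF EV EV, of t s'] that by simp
  qed (use T i1 i2 P1 cc H.B_nm1_integrable[OF dHB] in auto)
  moreover have "ipV (E 0) (E 0) = 0"
    using Eip[of 0 "E 0"] EV[of 0] H.ip_null[OF dH[of 0] VH'[OF EV[of 0]] d0] T by simp
  moreover have "0 \<le> ipV (E T) (E T)" using EV[of T] T by (intro V.ip_nonneg) auto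
  ultimately have "(\<integral>r. ipH (d r) (d r) \<partial>tm T) \<le> 0" by (simp add: ti_minus ti_full)
  moreover have ae: "AE r in tm T. 0 \<le> ipH (d r) (d r)"
    using H.B_mem[OF dHB] by eventually_elim (rule H.ip_nonneg)
  moreover have ii: "integrable (tm T) (\<lambda>r. ipH (d r) (d r))" using H.B_ip_integrable[OF dHB dHB] .
  ultimately have "(\<integral>r. ipH (d r) (d r) \<partial>tm T) = 0" using integral_nonneg_AE by fastforce
  then have "AE r in tm T. ipH (d r) (d r) = 0" using integral_nonneg_eq_0_iff_AE[OF ii ae] by simp
  then have "AE r in tm T. H.nm (d r) = 0" by eventually_elim (simp add: H.nm_def)
  then show ?thesis by (rule H.cont_curve_null_AE[OF c T _ t])
qed

text \<open>The right-hand side \<open>r + w\<close> is chosen so that \<open>w\<close> itself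
  solves the equation. A second solution \<open>z\<close> is constructed with the same data; it has
  the identity by construction, and the difference of the two is null by uniqueness.\<close>

lemma energy_identity:
  assumes T: "0 < T" and w: "w \<in> V.B T" and c: "H.cont_curve T w" and r: "r \<in> V.B T"
    and eq: "\<And>s t v. 0 \<le> s \<Longrightarrow> s \<le> t \<Longrightarrow> t \<le> T \<Longrightarrow> v \<in> V \<Longrightarrow> ipH (w t - w s) v = ti T s t (\<lambda>a. ipV (r a) v)"
  shows "ipH (w T) (w T) - ipH (w 0) (w 0) = 2 * (\<integral>t. ipV (r t) (w t) \<partial>tm T)"
proof -
  have m: "0 \<in> {0..T}" "T \<in> {0..T}" using T by auto
  have wH: "w s \<in> H" if "s \<in> {0..T}" for s using H.cont_curve_mem[OF c that] .
  \<comment> \<open>\<open>w 0\<close> is a limit in \<open>H\<close> of values of \<open>w\<close>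
    at times where these lie in \<open>V\<close>, so it is admissible as initial value.\<close>
  have dense: "\<exists>v\<in>V. H.nm (w 0 - v) < e" if e: "0 < e" for e
  proof -
    obtain x where x: "\<And>n. w (x n) \<in> V" "\<And>n. x n \<in> {0..T}" "x \<longlonglongrightarrow> 0"
      using AE_tm_dense[OF V.B_mem[OF w] T m(1)] by blast
    from order_tendstoD(2)[OF H.cont_curve_seq[OF c m(1) x(2,3)] e]
    obtain n where "H.nm (w (x n) - w 0) < e" by (auto simp: eventually_sequentially)
    then have "H.nm (w 0 - w (x n)) < e" using H.nm_commute[OF wH[OF m(1)] VH'[OF x(1)[of n]]] by simp
    then show ?thesis using x(1)[of n] by blast
  qed
  obtain z where z: "H.cont_curve T z" "z \<in> V.B T" "H.nm (z 0 - w 0) = 0"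
    "\<And>s t v. 0 \<le> s \<Longrightarrow> s \<le> t \<Longrightarrow> t \<le> T \<Longrightarrow> v \<in> V \<Longrightarrow> ipH (z t - z s) v = ti T s t (\<lambda>a. ipV ((r + w) a - z a) v)"
    "ipH (z T) (z T) - ipH (z 0) (z 0) = 2 * V.bip T ((r + w) - z) z"
    using solution_exists[OF T V.B_add[OF r w] wH[OF m(1)] dense] by blast
  have zH: "z s \<in> H" if "s \<in> {0..T}" for s using H.cont_curve_mem[OF z(1) that] .
  have d0: "H.nm (w t - z t) = 0" if t: "t \<in> {0..T}" for t
  proof (rule homogeneous_unique[OF T _ H.cont_curve_diff[OF c z(1)] _ _ t])
    show wz: "(\<lambda>t. w t - z t) \<in> V.B T" using V.B_diff[OF w z(2)] by (simp add: fun_diff_def)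
    show "H.nm (w 0 - z 0) = 0" using z(3) H.nm_commute[OF wH[OF m(1)] zH[OF m(1)]] by simp
    fix s t v assume st: "0 \<le> s" "s \<le> t" "t \<le> T" and v: "v \<in> V"
    have mm: "s \<in> {0..T}" "t \<in> {0..T}" using st by auto
    have rwz: "(r + w) - z \<in> V.B T" by (intro V.B_diff V.B_add r w z)
    have "ipH (w t - z t - (w s - z s)) v = ipH (w t - w s) v - ipH (z t - z s) v"
      using wH[OF mm(1)] wH[OF mm(2)] zH[OF mm(1)] zH[OF mm(2)] v VH' by (simp add: H.ip_simps H.mem_intros)
    also have "\<dots> = ti T s t (\<lambda>a. ipV (r a) v) - ti T s t (\<lambda>a. ipV (((r + w) - z) a) v)"
      using eq[OF st v] z(4)[OF st v] by simp
    also have "\<dots> = ti T s t (\<lambda>a. ipV (r a) v - ipV (((r + w) - z) a) v)"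
      by (rule ti_diff[symmetric]; rule V.B_ip_const_integrable; fact)
    also have "\<dots> = ti T s t (\<lambda>a. - ipV (w a - z a) v)"
    proof (rule ti_cong_AE)
      show "AE a in tm T. ipV (r a) v - ipV (((r + w) - z) a) v = - ipV (w a - z a) v"
        using V.B_mem[OF r] V.B_mem[OF w] V.B_mem[OF z(2)]
        by eventually_elim (simp add: V.ip_simps v V.mem_intros)
      show "integrable (tm T) (\<lambda>a. - ipV (w a - z a) v)"
        using V.B_ip_const_integrable[OF wz v] by simp
    qed (intro Bochner_Integration.integrable_diff V.B_ip_const_integrable r rwz v)
    finally show "ipH (w t - z t - (w s - z s)) v = - ti T s t (\<lambda>a. ipV (w a - z a) v)" by (simp add: ti_minus)
  qed
  have same: "ipH (w t) (w t) = ipH (z t) (z t)" if t: "t \<in> {0..T}" for t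
    using H.nm_abs_diff[OF wH[OF t] zH[OF t]] d0[OF t] H.nm_sq[OF wH[OF t]] H.nm_sq[OF zH[OF t]] by simp
  have "V.bip T ((r + w) - z) z = (\<integral>t. ipV (r t) (w t) \<partial>tm T)"
    unfolding V.bip_def
  proof (rule integral_cong_AE)
    show "AE t in tm T. ipV (((r + w) - z) t) (z t) = ipV (r t) (w t)"
      using V.B_mem[OF r] V.B_mem[OF w] V.B_mem[OF z(2)] AE_tm_space
    proof eventually_elim
      case (elim t)
      have D: "w t - z t \<in> V" using elim by (intro V.diff_mem)
      have n: "V.nm (w t - z t) = 0" using null0[OF D] d0[of t] elim by simp
      have "ipV (w t - z t) (z t) = 0" "ipV (r t) (w t - z t) = 0"
        using V.ip_null[OF D _ n] V.ip_sym[OF D] elim by auto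
      then show ?case using elim by (simp add: V.ip_simps V.mem_intros)
    qed
  qed (intro V.ip_measurable V.B_sm V.B_diff V.B_add r w z)+
  then show ?thesis using z(5) same[OF m(1)] same[OF m(2)] by simp
qed

end

subsection \<open>Smooth functions\<close>

definition smooth :: "('b::euclidean_space \<Rightarrow> real) \<Rightarrow> bool" where "smooth f \<longleftrightarrow> (\<forall>k. Ck k f)"

lemma frechet_eq: "(f has_derivative F) (at x) \<Longrightarrow> frechet_derivative f (at x) = F"
  by (rule frechet_derivative_at[symmetric])

lemma Ck_SucD: "Ck (Suc k) f \<Longrightarrow> Ck k f"
proof (induction k arbitrary: f)
  case 0
  then show ?case by (simp add: continuous_on_eq_continuous_at differentiable_imp_continuous_within)
next
  case (Suc k)
  then show ?case by (simp only: Ck.simps) blast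
qed

lemma Ck_continuous: "Ck k f \<Longrightarrow> continuous_on UNIV f"
  by (induction k) (use Ck_SucD in \<open>auto simp del: Ck.simps(2)\<close>)

lemma Ck_SucI:
  assumes "\<And>x. (f has_derivative F x) (at x)" "\<And>i. i \<in> Basis \<Longrightarrow> Ck k (\<lambda>x. F x i)"
  shows "Ck (Suc k) f"
  using assms frechet_eq[OF assms(1)] by (auto simp: differentiable_def)

lemma Ck_Suc_deriv: "Ck (Suc k) f \<Longrightarrow> (f has_derivative frechet_derivative f (at x)) (at x)"
  by (simp add: frechet_derivative_works)

lemma Ck_const: "Ck k (\<lambda>_. c)"
proof (induction k arbitrary: c)
  case (Suc k)
  show ?case by (rule Ck_SucI[where F = "\<lambda>_ _. 0"]) (use Suc[of 0] in auto)
qed simp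

lemma Ck_add: "Ck k f \<Longrightarrow> Ck k g \<Longrightarrow> Ck k (\<lambda>x. f x + g x)"
proof (induction k arbitrary: f g)
  case 0
  then show ?case by (simp add: continuous_on_add)
next
  case (Suc k)
  show ?case
  proof (rule Ck_SucI)
    show "((\<lambda>x. f x + g x) has_derivative (\<lambda>h. frechet_derivative f (at x) h + frechet_derivative g (at x) h)) (at x)" for x
      by (intro has_derivative_add Ck_Suc_deriv[OF Suc.prems(1)] Ck_Suc_deriv[OF Suc.prems(2)])
  qed (use Suc in auto)
qed

lemma Ck_mult: "Ck k f \<Longrightarrow> Ck k g \<Longrightarrow> Ck k (\<lambda>x. f x * g x)"
proof (induction k arbitrary: f g)
  case 0
  then show ?case by (simp add: continuous_on_mult)
next
  case (Suc k)
  note fg = Ck_SucD[OF Suc.prems(1)] Ck_SucD[OF Suc.prems(2)]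
  show ?case
  proof (rule Ck_SucI)
    show "((\<lambda>x. f x * g x) has_derivative (\<lambda>h. f x * frechet_derivative g (at x) h + frechet_derivative f (at x) h * g x)) (at x)" for x
      by (intro has_derivative_mult Ck_Suc_deriv[OF Suc.prems(1)] Ck_Suc_deriv[OF Suc.prems(2)])
    show "Ck k (\<lambda>x. f x * frechet_derivative g (at x) i + frechet_derivative f (at x) i * g x)" if "i \<in> Basis" for i
      using Suc.prems that by (intro Ck_add Suc.IH fg) auto
  qed
qed

lemma Ck_sum: "(\<And>a. a \<in> A \<Longrightarrow> Ck k (f a)) \<Longrightarrow> Ck k (\<lambda>x. \<Sum>a\<in>A. f a x)"
  by (induction A rule: infinite_finite_induct) (auto simp: Ck_const intro: Ck_add)

lemma Ck_prod: "(\<And>a. a \<in> A \<Longrightarrow> Ck k (f a)) \<Longrightarrow> Ck k (\<lambda>x. \<Prod>a\<in>A. f a x)"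
  by (induction A rule: infinite_finite_induct) (auto simp: Ck_const intro: Ck_mult)

lemma linear_Basis_expand:
  fixes F :: "'b::euclidean_space \<Rightarrow> real"
  assumes "linear F"
  shows "F v = (\<Sum>j\<in>Basis. (v \<bullet> j) * F j)"
proof -
  have "F v = F (\<Sum>j\<in>Basis. (v \<bullet> j) *\<^sub>R j)" by (simp add: euclidean_representation)
  also have "\<dots> = (\<Sum>j\<in>Basis. (v \<bullet> j) * F j)"
    by (simp add: linear_sum[OF assms] linear_scale[OF assms])
  finally show ?thesis .
qed

text \<open>Affine inner maps cover every composition needed below: scalings of the smooth step,
  coordinate functionals, the two projections of space-time and time slices.\<close>

lemma Ck_affine:
  fixes f :: "'b::euclidean_space \<Rightarrow> real" and L :: "'c::euclidean_space \<Rightarrow> 'b"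
  assumes L: "bounded_linear L"
  shows "Ck k f \<Longrightarrow> Ck k (\<lambda>x. f (L x + c))"
proof (induction k arbitrary: f)
  case 0
  then show ?case
    by (auto intro!: continuous_intros linear_continuous_on[OF L] continuous_on_compose2[of UNIV f])
next
  case (Suc k)
  show ?case
  proof (rule Ck_SucI)
    show "((\<lambda>x. f (L x + c)) has_derivative (\<lambda>h. frechet_derivative f (at (L x + c)) (L h))) (at x)" for x
    proof -
      have "((\<lambda>x. L x + c) has_derivative L) (at x)"
        using bounded_linear_imp_has_derivative[OF L] by (auto intro!: derivative_eq_intros)
      from has_derivative_compose[OF this Ck_Suc_deriv[OF Suc.prems]] show ?thesis .
    qed
    fix i :: 'c
    have "frechet_derivative f (at (L x + c)) (L i) = (\<Sum>j\<in>Basis. (L i \<bullet> j) * frechet_derivative f (at (L x + c)) j)" for x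
      by (intro linear_Basis_expand has_derivative_linear[OF Ck_Suc_deriv[OF Suc.prems]])
    then show "Ck k (\<lambda>x. frechet_derivative f (at (L x + c)) (L i))"
      using Suc.prems by (simp, intro Ck_sum Ck_mult Ck_const Suc.IH) auto
  qed
qed

lemma smooth_Ck: "smooth f \<Longrightarrow> Ck k f" by (simp add: smooth_def)

lemma smooth_deriv: "smooth f \<Longrightarrow> (f has_derivative frechet_derivative f (at x)) (at x)"
  using Ck_Suc_deriv[of 0 f] by (simp add: smooth_def del: Ck.simps)

lemma smooth_linear: "smooth f \<Longrightarrow> linear (frechet_derivative f (at x))"
  using smooth_deriv has_derivative_linear by blast

lemma smooth_continuous: "smooth f \<Longrightarrow> continuous_on UNIV f"
  using smooth_Ck Ck_continuous by blast

lemma smooth_const: "smooth (\<lambda>_. c)"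
  and smooth_add: "smooth f \<Longrightarrow> smooth g \<Longrightarrow> smooth (\<lambda>x. f x + g x)"
  and smooth_mult: "smooth f \<Longrightarrow> smooth g \<Longrightarrow> smooth (\<lambda>x. f x * g x)"
  by (auto simp: smooth_def intro: Ck_const Ck_add Ck_mult)

lemma smooth_sum: "(\<And>a. a \<in> A \<Longrightarrow> smooth (f a)) \<Longrightarrow> smooth (\<lambda>x. \<Sum>a\<in>A. f a x)"
  and smooth_prod: "(\<And>a. a \<in> A \<Longrightarrow> smooth (f a)) \<Longrightarrow> smooth (\<lambda>x. \<Prod>a\<in>A. f a x)"
  by (auto simp: smooth_def intro: Ck_sum Ck_prod)

lemma smooth_affine: "bounded_linear L \<Longrightarrow> smooth f \<Longrightarrow> smooth (\<lambda>x. f (L x + c))"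
  by (auto simp: smooth_def intro: Ck_affine)

lemma smooth_frechet:
  assumes "smooth f" shows "smooth (\<lambda>x. frechet_derivative f (at x) v)"
proof -
  have b: "smooth (\<lambda>x. frechet_derivative f (at x) i)" if "i \<in> Basis" for i
    using assms that Ck.simps(2) unfolding smooth_def by blast
  have "(\<lambda>x. frechet_derivative f (at x) v) = (\<lambda>x. \<Sum>j\<in>Basis. (v \<bullet> j) * frechet_derivative f (at x) j)"
    using linear_Basis_expand[OF smooth_linear[OF assms]] by blast
  then show ?thesis by (simp add: smooth_sum smooth_mult smooth_const b)
qed

lemma test_functions_iff:
  "\<phi> \<in> test_functions U \<longleftrightarrow> smooth \<phi> \<and> compact (closure {x. \<phi> x \<noteq> 0}) \<and> closure {x. \<phi> x \<noteq> 0} \<subseteq> U"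
  by (simp add: test_functions_def smooth_def)

lemma test_functions_smooth: "\<phi> \<in> test_functions U \<Longrightarrow> smooth \<phi>"
  by (simp add: test_functions_iff)

lemma test_functionsI:
  assumes "smooth \<phi>" "compact K" "K \<subseteq> U" "\<And>x. \<phi> x \<noteq> 0 \<Longrightarrow> x \<in> K"
  shows "\<phi> \<in> test_functions U"
proof -
  have c: "closure {x. \<phi> x \<noteq> 0} \<subseteq> K" using assms(2,4) by (intro closure_minimal compact_imp_closed) auto
  then have "compact (closure {x. \<phi> x \<noteq> 0})"
    using assms(2) by (metis closed_closure compact_Int_closed inf.absorb_iff2)
  then show ?thesis using c assms by (auto simp: test_functions_iff)
qed

lemma test_functionsE:
  assumes "\<phi> \<in> test_functions U"
  obtains K where "compact K" "K \<subseteq> U" "\<And>x. x \<notin> K \<Longrightarrow> \<phi> x = 0" "\<And>x v. x \<notin> K \<Longrightarrow> frechet_derivative \<phi> (at x) v = 0"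
proof -
  let ?K = "closure {x. \<phi> x \<noteq> 0}"
  have z: "\<phi> x = 0" if "x \<notin> ?K" for x using that closure_subset[of "{x. \<phi> x \<noteq> 0}"] by auto
  have "frechet_derivative \<phi> (at x) v = 0" if x: "x \<notin> ?K" for x v
  proof -
    have "(\<phi> has_derivative (\<lambda>_. 0)) (at x)"
    proof (rule has_derivative_transform_within_open)
      show "((\<lambda>_. 0) has_derivative (\<lambda>_. 0)) (at x)" by (rule has_derivative_const)
      show "open (- ?K)" by (rule open_Compl[OF closed_closure])
      show "x \<in> - ?K" using x by simp
      show "0 = \<phi> y" if "y \<in> - ?K" for y using z[of y] that by simp
    qed
    then show ?thesis by (simp add: frechet_eq)
  qed
  note d = this
  show thesis
  proof (rule that[of ?K])
    show "compact ?K" "?K \<subseteq> U" using assms by (simp_all add: test_functions_iff)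
  qed (erule z, erule d)
qed

lemma test_functions_add:
  assumes "\<phi> \<in> test_functions U" "\<psi> \<in> test_functions U"
  shows "(\<lambda>x. \<phi> x + \<psi> x) \<in> test_functions U"
proof -
  obtain K where K: "compact K" "K \<subseteq> U" "\<And>x. x \<notin> K \<Longrightarrow> \<phi> x = 0" by (rule test_functionsE[OF assms(1)]) (rule that)
  obtain L where L: "compact L" "L \<subseteq> U" "\<And>x. x \<notin> L \<Longrightarrow> \<psi> x = 0" by (rule test_functionsE[OF assms(2)]) (rule that)
  have "x \<in> K \<union> L" if "\<phi> x + \<psi> x \<noteq> 0" for x
  proof (rule ccontr)
    assume "x \<notin> K \<union> L"
    then have "\<phi> x = 0" "\<psi> x = 0" using K(3) L(3) by simp_all
    then show False using that by simp
  qed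
  note nz = this
  show ?thesis
  proof (rule test_functionsI[of _ "K \<union> L"])
    show "smooth (\<lambda>x. \<phi> x + \<psi> x)" using assms by (intro smooth_add) (auto simp: test_functions_iff)
    show "compact (K \<union> L)" "K \<union> L \<subseteq> U" using K(1,2) L(1,2) by (auto intro: compact_Un)
  qed (erule nz)
qed

lemma test_functions_mult:
  assumes "\<phi> \<in> test_functions U" "smooth \<psi>"
  shows "(\<lambda>x. \<psi> x * \<phi> x) \<in> test_functions U"
proof -
  obtain K where K: "compact K" "K \<subseteq> U" "\<And>x. x \<notin> K \<Longrightarrow> \<phi> x = 0" by (rule test_functionsE[OF assms(1)]) (rule that)
  show ?thesis
    by (rule test_functionsI[of _ K]) (use K assms in \<open>auto intro: smooth_mult test_functions_smooth\<close>)
qed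

lemma test_functions_frechet:
  assumes "\<phi> \<in> test_functions U"
  shows "(\<lambda>x. frechet_derivative \<phi> (at x) v) \<in> test_functions U"
proof -
  obtain K where K: "compact K" "K \<subseteq> U" "\<And>x v. x \<notin> K \<Longrightarrow> frechet_derivative \<phi> (at x) v = 0" by (rule test_functionsE[OF assms]) (rule that)
  show ?thesis
    by (rule test_functionsI[of _ K]) (use K assms in \<open>auto intro: smooth_frechet test_functions_smooth\<close>)
qed

lemma test_functions_bounded:
  assumes "\<phi> \<in> test_functions U"
  obtains C where "\<And>x. \<bar>\<phi> x\<bar> \<le> C"
proof -
  obtain K where K: "compact K" "K \<subseteq> U" "\<And>x. x \<notin> K \<Longrightarrow> \<phi> x = 0" by (rule test_functionsE[OF assms]) (rule that)
  have "compact (\<phi> ` K)" using K smooth_continuous[OF test_functions_smooth[OF assms]]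
    by (intro compact_continuous_image) (auto intro: continuous_on_subset)
  from compact_imp_bounded[OF this] obtain C where C: "\<forall>x\<in>\<phi> ` K. norm x \<le> C" unfolding bounded_iff by blast
  have "\<bar>\<phi> x\<bar> \<le> max C 0" for x using C K(3)[of x] by (cases "x \<in> K") auto
  then show thesis by (rule that)
qed

lemma test_functions_uniform:
  assumes "\<phi> \<in> test_functions U" and e: "0 < e"
  obtains d where "0 < d" "\<And>x y. dist x y < d \<Longrightarrow> \<bar>\<phi> x - \<phi> y\<bar> < e"
proof -
  obtain K where K: "compact K" "K \<subseteq> U" "\<And>x. x \<notin> K \<Longrightarrow> \<phi> x = 0" by (rule test_functionsE[OF assms(1)]) (rule that)
  \<comment> \<open>The support enlarged by the unit ball. Two points closer than 1, one of them in
    \<open>K\<close>, both lie in this compact set; if neither is in \<open>K\<close>, both values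
    vanish.\<close>
  let ?L = "{x + y |x y. x \<in> K \<and> y \<in> cball 0 1}"
  have L: "compact ?L" by (rule compact_sums[OF K(1) compact_cball])
  have "uniformly_continuous_on ?L \<phi>"
    using smooth_continuous[OF test_functions_smooth[OF assms(1)]]
    by (intro compact_uniformly_continuous L) (auto intro: continuous_on_subset)
  from this[unfolded uniformly_continuous_on_def, rule_format, OF e]
  obtain d where "0 < d \<and> (\<forall>x\<in>?L. \<forall>y\<in>?L. dist y x < d \<longrightarrow> dist (\<phi> y) (\<phi> x) < e)" ..
  then have d: "0 < d" "\<And>x y. x \<in> ?L \<Longrightarrow> y \<in> ?L \<Longrightarrow> dist y x < d \<Longrightarrow> dist (\<phi> y) (\<phi> x) < e"
    by simp_all
  have inL: "y \<in> ?L" if "x \<in> K" "dist x y < 1" for x y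
  proof -
    have "y = x + (y - x)" "y - x \<in> cball 0 1" using that by (auto simp: dist_norm norm_minus_commute)
    then show ?thesis using that by blast
  qed
  have "\<bar>\<phi> x - \<phi> y\<bar> < e" if "dist x y < min d 1" for x y
  proof (cases "x \<in> K \<or> y \<in> K")
    case True
    then have "x \<in> ?L" "y \<in> ?L" using inL[of x x] inL[of x y] inL[of y x] inL[of y y] that by (auto simp: dist_commute)
    then show ?thesis using d(2)[of y x] that by (simp add: dist_real_def)
  next
    case False
    then show ?thesis using K(3) e by simp
  qed
  then show thesis using that[of "min d 1"] d(1) by simp
qed

subsection \<open>Smooth cut-off functions\<close>

text \<open>For \<open>n = 0\<close> this is the classical smooth function that is flat at 0. The
  powers of \<open>inverse x\<close> are included so that the span of the family is closed under
  differentiation and smoothness follows by one induction.\<close>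

definition flat :: "nat \<Rightarrow> real \<Rightarrow> real" where
  "flat n x = (if x \<le> 0 then 0 else inverse x ^ n * exp (- inverse x))"

lemma flat_tendsto: "(flat n \<longlongrightarrow> 0) (at 0)"
proof -
  have r: "((\<lambda>x. inverse x ^ n * exp (- inverse x)) \<longlongrightarrow> (0::real)) (at_right 0)"
    using filterlim_compose[OF tendsto_power_div_exp_0 filterlim_inverse_at_top_right, of n]
    by (simp add: exp_minus divide_inverse)
  have "(flat n \<longlongrightarrow> 0) (at_right 0)"
    by (rule Lim_transform_eventually[OF r]) (auto simp: flat_def eventually_at_right_less eventually_at_filter)
  moreover have "(flat n \<longlongrightarrow> 0) (at_left 0)"
    by (rule Lim_transform_eventually[OF tendsto_const]) (auto simp: flat_def eventually_at_filter)
  ultimately show ?thesis by (simp add: filterlim_split_at)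
qed

lemma flat_deriv: "(flat n has_real_derivative (flat (n + 2) x - real n * flat (n + 1) x)) (at x)"
proof -
  consider "x < 0" | "x = 0" | "0 < x" by linarith
  then show ?thesis
  proof cases
    case 1
    have "(flat n has_real_derivative 0) (at x)"
      by (rule DERIV_cong_ev[THEN iffD1, OF refl _ refl DERIV_const[of 0]])
        (use 1 eventually_nhds_in_open[of "{..<0}" x] in \<open>auto simp: flat_def elim!: eventually_mono\<close>)
    then show ?thesis using 1 by (simp add: flat_def)
  next
    case 2
    \<comment> \<open>The difference quotient of \<open>flat n\<close> at 0 is
      \<open>flat (n + 1)\<close>, so a single limit serves all orders.\<close>
    have "((\<lambda>h. (flat n (0 + h) - flat n 0) / h) \<longlongrightarrow> 0) (at 0)"
      by (rule Lim_transform_eventually[OF flat_tendsto[of "n + 1"]])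
        (auto simp: flat_def eventually_at_filter field_simps)
    then show ?thesis using 2 by (simp add: DERIV_def flat_def)
  next
    case 3
    have "((\<lambda>x. inverse x ^ n * exp (- inverse x)) has_real_derivative (flat (n + 2) x - real n * flat (n + 1) x)) (at x)"
      using 3 by (cases n) (auto intro!: derivative_eq_intros simp: flat_def field_simps power2_eq_square,
          metis Suc_pred neq0_conv power_Suc)
    then show ?thesis
      by (rule DERIV_cong_ev[THEN iffD1, OF refl _ refl, rotated])
        (use 3 eventually_nhds_in_open[of "{0<..}" x] in \<open>auto simp: flat_def elim!: eventually_mono\<close>)
  qed
qed

lemma Ck_SucI_real:
  fixes f :: "real \<Rightarrow> real"
  assumes "\<And>x. (f has_real_derivative g x) (at x)" "Ck k g"
  shows "Ck (Suc k) f"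
proof (rule Ck_SucI)
  show "(f has_derivative (\<lambda>h. g x * h)) (at x)" for x
    using assms(1) by (simp add: has_field_derivative_def)
qed (use assms(2) in simp)

lemma smooth_flat: "smooth (flat n)"
proof -
  have "Ck k (flat n)" for k n
  proof (induction k arbitrary: n)
    case 0
    have "isCont (flat n) x" for x using flat_deriv DERIV_isCont by blast
    then show ?case by (simp add: continuous_on_eq_continuous_at)
  next
    case (Suc k)
    have "Ck k (\<lambda>x. flat (n + 2) x + (- real n) * flat (n + 1) x)"
      by (intro Ck_add Ck_mult Ck_const Suc)
    then show ?case by (intro Ck_SucI_real[OF flat_deriv]) simp
  qed
  then show ?thesis by (simp add: smooth_def)
qed

lemma smooth_exp: "smooth (exp :: real \<Rightarrow> real)"
  unfolding smooth_def
proof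
  show "Ck k (exp :: real \<Rightarrow> real)" for k
  proof (induction k)
    case 0
    show ?case by (simp add: continuous_on_exp)
  qed (rule Ck_SucI_real[OF DERIV_exp])
qed

definition hump :: "real \<Rightarrow> real" where "hump x = flat 0 x * flat 0 ((-1) * x + 1)"

lemma smooth_hump: "smooth hump"
  unfolding hump_def[abs_def]
  by (intro smooth_mult smooth_flat smooth_affine[of "\<lambda>x. (-1) * x" "flat 0"] bounded_linear_mult_right)

lemma hump_nonneg: "0 \<le> hump x" and hump_zero: "x \<le> 0 \<or> 1 \<le> x \<Longrightarrow> hump x = 0" and hump_pos: "0 < x \<Longrightarrow> x < 1 \<Longrightarrow> 0 < hump x"
  by (auto simp: hump_def flat_def)

definition hump_mass :: real where "hump_mass = integral {0..1} hump"

lemma hump_integrable: "hump integrable_on {a..b}"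
  by (rule integrable_continuous_interval) (rule continuous_on_subset[OF smooth_continuous[OF smooth_hump]], simp)

lemma hump_mass_pos: "0 < hump_mass"
proof -
  have "hump_mass \<noteq> 0"
  proof
    assume "hump_mass = 0"
    then have "(hump has_integral 0) (cbox 0 1)"
      using integrable_integral[OF hump_integrable[of 0 1]] by (simp add: hump_mass_def)
    then have "\<forall>x\<in>cbox 0 1. hump x = 0"
      using has_integral_0_cbox_imp_0[of 0 1 hump] hump_nonneg
        continuous_on_subset[OF smooth_continuous[OF smooth_hump]] by (auto simp: box_ne_empty)
    then have "hump (1/2) = 0" by simp
    then show False using hump_pos[of "1/2"] by simp
  qed
  moreover have "0 \<le> hump_mass" unfolding hump_mass_def by (intro integral_nonneg hump_integrable hump_nonneg)
  ultimately show ?thesis by simp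
qed

text \<open>The normalised primitive of the bump, a smooth transition from 0 to 1 on the unit
  interval. Starting the integral at -1 makes every \<open>x \<ge> 0\<close> an interior point of an
  interval on which the fundamental theorem applies.\<close>

definition sstep :: "real \<Rightarrow> real" where "sstep x = integral {-1..x} hump / hump_mass"

lemma sstep_zero: "x \<le> 0 \<Longrightarrow> sstep x = 0"
proof -
  assume "x \<le> 0"
  then have "integral {-1..x} hump = integral {-1..x} (\<lambda>_. 0)"
    by (intro Henstock_Kurzweil_Integration.integral_cong hump_zero) auto
  then show ?thesis by (simp add: sstep_def)
qed

lemma sstep_eq: "0 \<le> x \<Longrightarrow> sstep x = integral {0..x} hump / hump_mass"
proof -
  assume "0 \<le> x"
  then have "integral {-1..0} hump + integral {0..x} hump = integral {-1..x} hump"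
    by (intro Henstock_Kurzweil_Integration.integral_combine hump_integrable) auto
  moreover have "integral {-1..0} hump = 0" using sstep_zero[of 0] hump_mass_pos by (simp add: sstep_def)
  ultimately show ?thesis by (simp add: sstep_def)
qed

lemma sstep_one: "1 \<le> x \<Longrightarrow> sstep x = 1"
proof -
  assume x: "1 \<le> x"
  then have "integral {0..1} hump + integral {1..x} hump = integral {0..x} hump"
    by (intro Henstock_Kurzweil_Integration.integral_combine hump_integrable) auto
  moreover have "integral {1..x} hump = integral {1..x} (\<lambda>_. 0)"
    by (intro Henstock_Kurzweil_Integration.integral_cong hump_zero) auto
  ultimately show ?thesis using x hump_mass_pos by (simp add: sstep_eq hump_mass_def)
qed

lemma sstep_deriv: "(sstep has_real_derivative (hump x / hump_mass)) (at x)"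
proof (cases "x < 0")
  case True
  have "(sstep has_real_derivative 0) (at x)"
    by (rule DERIV_cong_ev[THEN iffD1, OF refl _ refl DERIV_const[of 0]])
      (use True eventually_nhds_in_open[of "{..<0}" x] in \<open>auto simp: sstep_zero elim!: eventually_mono\<close>)
  then show ?thesis using True by (simp add: hump_zero)
next
  case False
  have "((\<lambda>x. integral {-1..x} hump) has_real_derivative hump x) (at x within {-1..x+1})"
    by (rule integral_has_real_derivative)
      (use False in \<open>auto intro: continuous_on_subset[OF smooth_continuous[OF smooth_hump]]\<close>)
  then have "((\<lambda>x. integral {-1..x} hump) has_real_derivative hump x) (at x)"
    using False at_within_Icc_at[of "-1" x "x + 1"] by simp
  then show ?thesis unfolding sstep_def[abs_def] by (rule DERIV_cdivide)
qed

lemma smooth_sstep: "smooth sstep"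
proof -
  have "Ck k sstep" for k
  proof (cases k)
    case 0
    have "isCont sstep x" for x using sstep_deriv DERIV_isCont by blast
    then show ?thesis using 0 by (simp add: continuous_on_eq_continuous_at)
  next
    case (Suc k')
    have "Ck k' (\<lambda>x. (1 / hump_mass) * hump x)" by (intro Ck_mult Ck_const smooth_Ck smooth_hump)
    then show ?thesis unfolding Suc by (intro Ck_SucI_real[OF sstep_deriv]) simp
  qed
  then show ?thesis by (simp add: smooth_def)
qed

lemma sstep_mono: "x \<le> y \<Longrightarrow> sstep x \<le> sstep y"
  by (rule DERIV_nonneg_imp_nondecreasing)
    (use sstep_deriv hump_nonneg hump_mass_pos in \<open>auto intro!: exI divide_nonneg_pos\<close>)

lemma sstep_bounds: "0 \<le> sstep x" "sstep x \<le> 1"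
  using sstep_mono[of 0 x] sstep_mono[of x 1] sstep_zero[of x] sstep_zero[of 0] sstep_one[of x] sstep_one[of 1]
  by (cases "x \<le> 0"; cases "1 \<le> x"; auto)+

text \<open>A test function inside the box whose transition layer has width 1/n. As
  \<open>sstep\<close> vanishes at 0, the limit is the indicator of the open box.\<close>

definition box_fun :: "nat \<Rightarrow> 'b::euclidean_space \<Rightarrow> 'b \<Rightarrow> 'b \<Rightarrow> real" where
  "box_fun n a b x = (\<Prod>i\<in>Basis. sstep (real n * ((x - a) \<bullet> i)) * sstep (real n * ((b - x) \<bullet> i)))"

lemma box_fun_bounds: "0 \<le> box_fun n a b x" "box_fun n a b x \<le> 1"
  unfolding box_fun_def by (auto intro!: prod_nonneg prod_le_1 mult_nonneg_nonneg mult_le_one sstep_bounds)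

lemma box_fun_zero: "x \<notin> box a b \<Longrightarrow> box_fun n a b x = 0"
proof -
  assume "x \<notin> box a b"
  then obtain i where i: "i \<in> Basis" "x \<bullet> i \<le> a \<bullet> i \<or> b \<bullet> i \<le> x \<bullet> i" by (auto simp: mem_box not_less)
  then have "sstep (real n * ((x - a) \<bullet> i)) = 0 \<or> sstep (real n * ((b - x) \<bullet> i)) = 0"
    by (auto intro!: sstep_zero mult_nonneg_nonpos simp: inner_diff_left)
  then show ?thesis unfolding box_fun_def using i by (auto intro!: prod_zero)
qed

lemma smooth_box_fun: "smooth (box_fun n a b)"
proof -
  have 1: "smooth (\<lambda>x. sstep (real n * ((x - a) \<bullet> i)))" for i
  proof -
    have "smooth (\<lambda>x. sstep (real n * (x \<bullet> i) + (- real n * (a \<bullet> i))))"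
      by (intro smooth_affine smooth_sstep bounded_linear_const_mult bounded_linear_inner_left)
    then show ?thesis by (simp add: inner_diff_left right_diff_distrib)
  qed
  have 2: "smooth (\<lambda>x. sstep (real n * ((b - x) \<bullet> i)))" for i
  proof -
    have "smooth (\<lambda>x. sstep ((- real n) * (x \<bullet> i) + (real n * (b \<bullet> i))))"
      by (intro smooth_affine smooth_sstep bounded_linear_const_mult bounded_linear_inner_left)
    then show ?thesis by (simp add: inner_diff_left right_diff_distrib)
  qed
  show ?thesis unfolding box_fun_def[abs_def] by (intro smooth_prod smooth_mult 1 2)
qed

lemma box_fun_test: "cbox a b \<subseteq> U \<Longrightarrow> box_fun n a b \<in> test_functions U"
proof (rule test_functionsI[of _ "cbox a b"])
  show "x \<in> cbox a b" if "box_fun n a b x \<noteq> 0" for x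
    using box_fun_zero[of x a b n] that box_subset_cbox[of a b] by blast
qed (auto intro: smooth_box_fun compact_cbox)

lemma sstep_scaled_tendsto: "0 < c \<Longrightarrow> (\<lambda>n. sstep (real n * c)) \<longlonglongrightarrow> 1"
proof -
  assume c: "0 < c"
  obtain N :: nat where "1 / c < real N" using reals_Archimedean2 by blast
  then have "1 \<le> real n * c" if "N \<le> n" for n
  proof -
    have "1 < real N * c" using \<open>1 / c < real N\<close> c by (simp add: field_simps)
    also have "\<dots> \<le> real n * c" using that c by (intro mult_right_mono) auto
    finally show ?thesis by simp
  qed
  then have "\<forall>\<^sub>F n in sequentially. 1 = sstep (real n * c)"
    unfolding eventually_sequentially using sstep_one by metis
  then show ?thesis by (rule Lim_transform_eventually[OF tendsto_const])
qed

lemma box_fun_tendsto: "(\<lambda>n. box_fun n a b x) \<longlonglongrightarrow> indicator (box a b) x"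
proof (cases "x \<in> box a b")
  case True
  have "(\<lambda>n. box_fun n a b x) \<longlonglongrightarrow> (\<Prod>i\<in>(Basis::'a set). 1 * 1)"
    unfolding box_fun_def
    by (intro tendsto_prod tendsto_mult sstep_scaled_tendsto) (use True in \<open>auto simp: mem_box inner_diff_left\<close>)
  then show ?thesis using True by simp
next
  case False
  then show ?thesis by (simp add: box_fun_zero)
qed

subsection \<open>The fundamental lemma of the calculus of variations\<close>

text \<open>Open boxes form an intersection-stable generator of the Borel sets, so vanishing
  integrals extend from boxes to all Borel sets; the sets where \<open>F\<close> is positive or
  negative then finish the argument.\<close>

lemma AE_zero_box_integrals:
  fixes F :: "'a::euclidean_space \<Rightarrow> real"
  assumes F: "integrable lborel F" and z: "\<And>a b. (\<integral>x. indicator (box a b) x * F x \<partial>lborel) = 0"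
  shows "AE x in lborel. F x = 0"
proof -
  have int: "integrable lborel (\<lambda>x. indicator A x * F x)" if "A \<in> sets borel" for A
    using integrable_mult_indicator[OF _ F, of A] that by simp
  \<comment> \<open>The integral over the whole space is needed for complements; it is the limit
    along growing boxes.\<close>
  have tot: "(\<integral>x. F x \<partial>lborel) = 0"
  proof (rule LIMSEQ_unique)
    show "(\<lambda>n. \<integral>x. indicator (box (- real n *\<^sub>R One) (real n *\<^sub>R One)) x * F x \<partial>lborel) \<longlonglongrightarrow> 0"
      by (simp add: z)
    show "(\<lambda>n. \<integral>x. indicator (box (- real n *\<^sub>R One) (real n *\<^sub>R One)) x * F x \<partial>lborel) \<longlonglongrightarrow> (\<integral>x. F x \<partial>lborel)"
    proof (rule integral_dominated_convergence[where w = "\<lambda>x. norm (F x)"])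
      show "AE x in lborel. (\<lambda>n. indicator (box (- real n *\<^sub>R One) (real n *\<^sub>R One)) x * F x) \<longlonglongrightarrow> F x"
      proof (rule AE_I2)
        fix x :: 'a
        obtain N :: nat where N: "norm x < real N" using reals_Archimedean2 by blast
        have "x \<in> box (- real n *\<^sub>R One) (real n *\<^sub>R One)" if "N \<le> n" for n
        proof -
          have "x \<bullet> i < real n \<and> - real n < x \<bullet> i" if "i \<in> Basis" for i
            using Basis_le_norm[OF that, of x] N \<open>N \<le> n\<close> by linarith
          then show ?thesis by (simp add: mem_box inner_sum_left_Basis)
        qed
        then have "\<forall>\<^sub>F n in sequentially. F x = indicator (box (- real n *\<^sub>R One) (real n *\<^sub>R One)) x * F x"
          unfolding eventually_sequentially by (intro exI[of _ N]) simp
        then show "(\<lambda>n. indicator (box (- real n *\<^sub>R One) (real n *\<^sub>R One)) x * F x) \<longlonglongrightarrow> F x"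
          by (rule Lim_transform_eventually[OF tendsto_const])
      qed
    qed (use F int in \<open>auto simp: indicator_def\<close>)
  qed
  have "Int_stable (range (\<lambda>(a, b). box a b :: 'a set))"
    by (auto simp: Int_stable_def box_Int_box)
  moreover have "range (\<lambda>(a, b). box a b :: 'a set) \<subseteq> Pow UNIV" by simp
  ultimately have all: "(\<integral>x. indicator A x * F x \<partial>lborel) = 0"
    if "A \<in> sigma_sets UNIV (range (\<lambda>(a, b). box a b :: 'a set))" for A
    using that
  proof (induction rule: sigma_sets_induct_disjoint)
    case (basic A)
    then show ?case using z by auto
  next
    case (compl A)
    have A: "A \<in> sets borel" using compl(1) unfolding borel_eq_box by (simp add: case_prod_unfold)
    have "(\<integral>x. indicator (UNIV - A) x * F x \<partial>lborel) = (\<integral>x. F x - indicator A x * F x \<partial>lborel)"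
      by (intro Bochner_Integration.integral_cong) (auto simp: indicator_def)
    also have "\<dots> = 0" using F int[OF A] tot compl by simp
    finally show ?case .
  next
    case (union A)
    have A: "A i \<in> sets borel" for i using union(2) unfolding borel_eq_box by (auto simp: case_prod_unfold)
    have "(LINT x:(\<Union>i. A i)|lborel. F x) = (\<Sum>i. (LINT x:(A i)|lborel. F x))"
    proof (rule lebesgue_integral_countable_add)
      show "set_integrable lborel (\<Union>i. A i) F" unfolding set_integrable_def using A int by auto
    qed (use A union(1) in \<open>auto simp: disjoint_family_on_def\<close>)
    then show ?case using union(3) by (simp add: set_lebesgue_integral_def)
  qed auto
  have all': "(\<integral>x. indicator A x * F x \<partial>lborel) = 0" if "A \<in> sets borel" for A
    using all[of A] that unfolding borel_eq_box by (simp add: case_prod_unfold)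
  have Fm [measurable]: "F \<in> borel_measurable borel" using F by auto
  \<comment> \<open>Stated for a general \<open>G\<close> so that it can be used for both
    \<open>F\<close> and \<open>- F\<close>.\<close>
  have P: "AE x in lborel. indicator {x. G x > 0} x * G x = 0"
    if G [measurable]: "G \<in> borel_measurable borel" and Gi: "integrable lborel G"
      and z: "\<And>A. A \<in> sets borel \<Longrightarrow> (\<integral>x. indicator A x * G x \<partial>lborel) = 0" for G :: "'a \<Rightarrow> real"
  proof -
    have S: "{x. G x > 0} \<in> sets borel" by measurable
    have i: "integrable lborel (\<lambda>x. indicator {x. G x > 0} x * G x)"
      using integrable_mult_indicator[OF _ Gi, of "{x. G x > 0}"] S by simp
    have "AE x in lborel. 0 \<le> indicator {x. G x > 0} x * G x" by (auto simp: indicator_def)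
    from integral_nonneg_eq_0_iff_AE[OF i this] z[OF S] show ?thesis by simp
  qed
  have "AE x in lborel. indicator {x. F x > 0} x * F x = 0" by (rule P[OF Fm F all'])
  moreover have "AE x in lborel. indicator {x. - F x > 0} x * - F x = 0"
    by (rule P) (use F all' in auto)
  ultimately show ?thesis by eventually_elim (auto simp: indicator_def split: if_splits)
qed

text \<open>Smooth box functions converge boundedly to indicators of boxes, so \<open>f\<close> has
  zero integral over every box whose closure lies in the domain. Each closed box in the domain is
  then treated separately, and countably many of them cover it.\<close>

lemma fundamental_lemma:
  fixes f :: "'a::euclidean_space \<Rightarrow> real"
  assumes \<Omega>: "open \<Omega>" and f: "locally_integrable \<Omega> f"
    and z: "\<And>\<phi>. \<phi> \<in> test_functions \<Omega> \<Longrightarrow> (\<integral>x. f x * \<phi> x \<partial>lebesgue_on \<Omega>) = 0"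
  shows "AE x in lebesgue_on \<Omega>. f x = 0"
proof -
  have box0: "(\<integral>x. indicator (box p q) x * f x \<partial>lebesgue) = 0" if pq: "cbox p q \<subseteq> \<Omega>" for p q
  proof (rule LIMSEQ_unique)
    have fi: "integrable lebesgue (\<lambda>x. indicator (cbox p q) x * f x)"
      using f pq unfolding locally_integrable_def set_integrable_def by (auto intro: compact_cbox)
    have "(\<integral>x. box_fun n p q x * (indicator (cbox p q) x * f x) \<partial>lebesgue) = 0" for n
    proof -
      have "(\<integral>x. box_fun n p q x * (indicator (cbox p q) x * f x) \<partial>lebesgue) = (\<integral>x. f x * box_fun n p q x \<partial>lebesgue_on \<Omega>)"
      proof (subst integral_restrict_space)
        show "(\<integral>x. box_fun n p q x * (indicator (cbox p q) x * f x) \<partial>lebesgue) = (\<integral>x. indicator \<Omega> x *\<^sub>R (f x * box_fun n p q x) \<partial>lebesgue)"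
        proof (rule Bochner_Integration.integral_cong[OF refl])
          fix x
          show "box_fun n p q x * (indicator (cbox p q) x * f x) = indicator \<Omega> x *\<^sub>R (f x * box_fun n p q x)"
          proof (cases "x \<in> box p q")
            case True
            then have "x \<in> cbox p q" "x \<in> \<Omega>" using box_subset_cbox[of p q] pq by auto
            then show ?thesis by simp
          qed (simp add: box_fun_zero)
        qed
      qed (use \<Omega> in auto)
      then show ?thesis using z[OF box_fun_test[OF pq]] by simp
    qed
    then show "(\<lambda>n. \<integral>x. box_fun n p q x * (indicator (cbox p q) x * f x) \<partial>lebesgue) \<longlonglongrightarrow> 0" by simp
    show "(\<lambda>n. \<integral>x. box_fun n p q x * (indicator (cbox p q) x * f x) \<partial>lebesgue) \<longlonglongrightarrow> (\<integral>x. indicator (box p q) x * f x \<partial>lebesgue)"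
    proof (rule integral_dominated_convergence[where w = "\<lambda>x. norm (indicator (cbox p q) x * f x)"])
      have m: "box_fun n p q \<in> borel_measurable lebesgue" for n
        by (intro measurable_completion) (simp add: borel_measurable_continuous_onI smooth_continuous smooth_box_fun)
      show "(\<lambda>x. box_fun n p q x * (indicator (cbox p q) x * f x)) \<in> borel_measurable lebesgue" for n
        by (rule borel_measurable_times[OF m borel_measurable_integrable[OF fi]])
      have "(\<lambda>x. indicator (box p q) x * (indicator (cbox p q) x * f x)) \<in> borel_measurable lebesgue"
        by (rule borel_measurable_times[OF borel_measurable_indicator borel_measurable_integrable[OF fi]]) auto
      also have "(\<lambda>x. indicator (box p q) x * (indicator (cbox p q) x * f x)) = (\<lambda>x. indicator (box p q) x * f x)"
        using box_subset_cbox[of p q] by (auto simp: indicator_def fun_eq_iff)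
      finally show "(\<lambda>x. indicator (box p q) x * f x) \<in> borel_measurable lebesgue" .
      show "AE x in lebesgue. (\<lambda>n. box_fun n p q x * (indicator (cbox p q) x * f x)) \<longlonglongrightarrow> indicator (box p q) x * f x"
      proof (rule AE_I2)
        fix x
        have "(\<lambda>n. box_fun n p q x * (indicator (cbox p q) x * f x)) \<longlonglongrightarrow> indicator (box p q) x * (indicator (cbox p q) x * f x)"
          by (intro tendsto_mult box_fun_tendsto tendsto_const)
        also have "indicator (box p q) x * (indicator (cbox p q) x * f x) = indicator (box p q) x * f x"
          using box_subset_cbox[of p q] by (auto simp: indicator_def)
        finally show "(\<lambda>n. box_fun n p q x * (indicator (cbox p q) x * f x)) \<longlonglongrightarrow> indicator (box p q) x * f x" .
      qed
      show "AE x in lebesgue. norm (box_fun n p q x * (indicator (cbox p q) x * f x)) \<le> norm (indicator (cbox p q) x * f x)" for n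
        using box_fun_bounds[of n p q] by (intro AE_I2) (auto simp: abs_mult mult_left_le_one_le)
    qed (use fi in simp)
  qed
  have cb: "AE x in lebesgue. x \<in> cbox c d \<longrightarrow> f x = 0" if cd: "cbox c d \<subseteq> \<Omega>" for c d
  proof -
    have fi0: "integrable lebesgue (\<lambda>x. indicator (cbox c d) x * f x)"
      using f cd unfolding locally_integrable_def set_integrable_def by (auto intro: compact_cbox)
    have "integrable lebesgue (\<lambda>x. indicator (box c d) x *\<^sub>R (indicator (cbox c d) x * f x))"
      using fi0 by (intro integrable_mult_indicator) auto
    also have "(\<lambda>x. indicator (box c d) x *\<^sub>R (indicator (cbox c d) x * f x)) = (\<lambda>x. indicator (box c d) x * f x)"
      using box_subset_cbox[of c d] by (auto simp: indicator_def fun_eq_iff)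
    finally have fi: "integrable lebesgue (\<lambda>x. indicator (box c d) x * f x)" .
    \<comment> \<open>\<open>f\<close> is only Lebesgue measurable, whereas the criterion on boxes
      is about Borel measure; \<open>g\<close> is a Borel version of \<open>f\<close> on the
      box.\<close>
    then obtain g where g: "g \<in> borel_measurable lborel" "AE x in lborel. indicator (box c d) x * f x = g x"
      using completion_ex_borel_measurable_real[of "\<lambda>x. indicator (box c d) x * f x" lborel] by auto
    have g': "AE x in lebesgue. indicator (box c d) x * f x = g x" using g(2) by (rule AE_completion)
    have gc: "g \<in> borel_measurable lebesgue" using g(1) by (rule measurable_completion)
    have "integrable lebesgue g" using integrable_cong_AE_imp[OF fi gc] g' by (auto elim: eventually_mono)
    then have gi: "integrable lborel g" using integrable_completion[OF g(1)] by simp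
    have "AE x in lborel. g x = 0"
    proof (rule AE_zero_box_integrals[OF gi])
      fix a b
      \<comment> \<open>An arbitrary box is intersected with the fixed one. The result is again a
        box, and unless it is empty its closure stays inside \<open>cbox c d\<close>, where
        \<open>box0\<close> applies.\<close>
      obtain p q where pq: "box a b \<inter> box c d = box p q" unfolding box_Int_box by blast
      have "(\<integral>x. indicator (box a b) x * g x \<partial>lborel) = (\<integral>x. indicator (box a b) x * g x \<partial>lebesgue)"
        by (rule integral_completion[symmetric], rule borel_measurable_times[OF borel_measurable_indicator g(1)]) auto
      also have "\<dots> = (\<integral>x. indicator (box p q) x * f x \<partial>lebesgue)"
      proof (rule integral_cong_AE)
        show "(\<lambda>x. indicator (box a b) x * g x) \<in> borel_measurable lebesgue"
          by (rule borel_measurable_times[OF borel_measurable_indicator gc]) auto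
        have e: "(\<lambda>x. indicator (box p q) x * f x) = (\<lambda>x. indicator (box a b) x * (indicator (box c d) x * f x))"
          unfolding pq[symmetric] by (auto simp: indicator_def fun_eq_iff)
        show "(\<lambda>x. indicator (box p q) x * f x) \<in> borel_measurable lebesgue"
          unfolding e by (rule borel_measurable_times[OF borel_measurable_indicator borel_measurable_integrable[OF fi]]) auto
        show "AE x in lebesgue. indicator (box a b) x * g x = indicator (box p q) x * f x"
          using g' by eventually_elim (simp add: fun_cong[OF e])
      qed
      also have "\<dots> = 0"
      proof (cases "box p q = {}")
        case False
        have "cbox p q = closure (box p q)" using False by (simp add: closure_box)
        also have "\<dots> \<subseteq> closure (box c d)" using pq by (intro closure_mono) auto
        also have "\<dots> \<subseteq> cbox c d" by (intro closure_minimal box_subset_cbox closed_cbox)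
        finally show ?thesis using box0 cd by blast
      qed simp
      finally show "(\<integral>x. indicator (box a b) x * g x \<partial>lborel) = 0" .
    qed
    then have "AE x in lebesgue. g x = 0" by (rule AE_completion)
    \<comment> \<open>The criterion controlled the open box only; the boundary faces are
      null.\<close>
    moreover have "AE x in lebesgue. x \<notin> cbox c d - box c d"
      using negligible_frontier_interval[of c d] AE_not_in[of "cbox c d - box c d" lebesgue]
      unfolding negligible_iff_null_sets by blast
    ultimately show ?thesis using g' by eventually_elim (auto simp: indicator_def)
  qed
  obtain \<D> where D: "countable \<D>" "\<D> \<subseteq> Pow \<Omega>" "\<And>X. X \<in> \<D> \<Longrightarrow> \<exists>a b. X = cbox a b" "\<Union>\<D> = \<Omega>"
    using open_countable_Union_open_cbox[OF \<Omega>] by blast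
  have "AE x in lebesgue. \<forall>X\<in>\<D>. x \<in> X \<longrightarrow> f x = 0"
    unfolding AE_ball_countable[OF D(1)] using D(2,3) cb by blast
  then have "AE x in lebesgue. x \<in> \<Omega> \<longrightarrow> f x = 0" by eventually_elim (use D(4) in blast)
  then show ?thesis using \<Omega> by (subst AE_restrict_space_iff) auto
qed

subsection \<open>Integration by parts\<close>

text \<open>By translation invariance each difference quotient has integral zero, and the quotients
  converge to the derivative under a common majorant.\<close>

lemma integral_derivative_zero:
  fixes f :: "'a::euclidean_space \<Rightarrow> real"
  assumes f: "f \<in> test_functions UNIV" and i: "i \<in> Basis"
  shows "(\<integral>x. frechet_derivative f (at x) i \<partial>lborel) = 0"
proof -
  obtain K where K: "compact K" "\<And>x. x \<notin> K \<Longrightarrow> f x = 0" by (rule test_functionsE[OF f]) (rule that)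
  obtain C where C: "\<And>x. \<bar>frechet_derivative f (at x) i\<bar> \<le> C"
    by (rule test_functions_bounded[OF test_functions_frechet[OF f, of i]]) (rule that)
  obtain r where r: "\<And>x. x \<in> K \<Longrightarrow> norm x \<le> r" using compact_imp_bounded[OF K(1)] unfolding bounded_iff by blast
  let ?e = "\<lambda>n. inverse (real (Suc n))"
  have cont: "continuous_on UNIV f" by (rule smooth_continuous[OF test_functions_smooth[OF f]])
  have m [measurable]: "f \<in> borel_measurable borel" using cont by (rule borel_measurable_continuous_onI)
  have int: "integrable lborel f"
  proof -
    obtain D where D: "\<And>x. \<bar>f x\<bar> \<le> D" by (rule test_functions_bounded[OF f]) (rule that)
    show ?thesis
    proof (rule Bochner_Integration.integrable_bound)
      show "integrable lborel (\<lambda>x. D * indicator K x)"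
        using K(1) emeasure_compact_finite[OF K(1)] by (intro integrable_mult_right integrable_real_indicator) (auto simp: borel_compact)
      show "AE x in lborel. norm (f x) \<le> norm (D * indicator K x)"
      proof (rule AE_I2)
        fix x
        have "\<bar>f x\<bar> \<le> \<bar>D\<bar>" using D[of x] by linarith
        then show "norm (f x) \<le> norm (D * indicator K x)" using K(2)[of x] by (cases "x \<in> K") simp_all
      qed
    qed simp
  qed
  have tr: "(\<integral>x. f (c + x) \<partial>lborel) = (\<integral>x. f x \<partial>lborel)" "integrable lborel (\<lambda>x. f (c + x))" for c
  proof -
    show "(\<integral>x. f (c + x) \<partial>lborel) = (\<integral>x. f x \<partial>lborel)"
      using integral_distr[of "(+) c" lborel borel f] by (simp add: lborel_distr_plus)
    show "integrable lborel (\<lambda>x. f (c + x))"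
      using integrable_distr_eq[of "(+) c" lborel borel f] int by (simp add: lborel_distr_plus)
  qed
  \<comment> \<open>Shifts have length at most 1. Outside the ball of radius \<open>r + 1\<close>
    both points therefore miss the support; inside, the mean value theorem gives the bound
    \<open>C\<close>.\<close>
  have dq: "\<bar>(f (?e n *\<^sub>R i + x) - f x) / ?e n\<bar> \<le> C * indicator (cball 0 (r + 1)) x" for n x
  proof (cases "x \<in> cball 0 (r + 1)")
    case True
    have "((\<lambda>s. f (s *\<^sub>R i + x)) has_real_derivative frechet_derivative f (at (s *\<^sub>R i + x)) i) (at s)" for s
    proof -
      have l: "linear (frechet_derivative f (at (s *\<^sub>R i + x)))" by (rule smooth_linear[OF test_functions_smooth[OF f]])
      have "((\<lambda>s. s *\<^sub>R i + x) has_derivative (\<lambda>h. h *\<^sub>R i)) (at s)" by (auto intro!: derivative_eq_intros)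
      from has_derivative_compose[OF this smooth_deriv[OF test_functions_smooth[OF f]]]
      show ?thesis by (simp add: has_field_derivative_def linear_scale[OF l] mult_commute_abs)
    qed
    then obtain z where "f (?e n *\<^sub>R i + x) - f (0 *\<^sub>R i + x) = (?e n - 0) * frechet_derivative f (at (z *\<^sub>R i + x)) i"
      using MVT2[of 0 "?e n" "\<lambda>s. f (s *\<^sub>R i + x)"] by fastforce
    then show ?thesis using C True by simp
  next
    case False
    then have "x \<notin> K" "?e n *\<^sub>R i + x \<notin> K"
    proof -
      have "norm x > r + 1" using False by simp
      moreover have "norm x \<le> norm (?e n *\<^sub>R i + x) + norm (?e n *\<^sub>R i)"
        using norm_triangle_ineq4[of "?e n *\<^sub>R i + x" "?e n *\<^sub>R i"] by simp
      moreover have "norm (?e n *\<^sub>R i) \<le> 1" using i by (simp add: inverse_le_1_iff)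
      ultimately show "x \<notin> K" "?e n *\<^sub>R i + x \<notin> K" using r[of x] r[of "?e n *\<^sub>R i + x"] by auto
    qed
    then show ?thesis using K(2) False by simp
  qed
  have "(\<lambda>n. \<integral>x. (f (?e n *\<^sub>R i + x) - f x) / ?e n \<partial>lborel) \<longlonglongrightarrow> (\<integral>x. frechet_derivative f (at x) i \<partial>lborel)"
  proof (rule integral_dominated_convergence[where w = "\<lambda>x. C * indicator (cball 0 (r + 1)) x"])
    show "(\<lambda>x. frechet_derivative f (at x) i) \<in> borel_measurable lborel"
      using smooth_continuous[OF smooth_frechet[OF test_functions_smooth[OF f]]] by (simp add: borel_measurable_continuous_onI)
    show "integrable lborel (\<lambda>x. C * indicator (cball (0::'a) (r + 1)) x)"
      using emeasure_compact_finite[OF compact_cball[of "0::'a" "r + 1"]]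
      by (intro integrable_mult_right integrable_real_indicator) auto
    show "AE x in lborel. (\<lambda>n. (f (?e n *\<^sub>R i + x) - f x) / ?e n) \<longlonglongrightarrow> frechet_derivative f (at x) i"
    proof (rule AE_I2)
      fix x
      have l: "linear (frechet_derivative f (at x))" by (rule smooth_linear[OF test_functions_smooth[OF f]])
      have "((\<lambda>s. s *\<^sub>R i + x) has_derivative (\<lambda>h. h *\<^sub>R i)) (at 0)" by (auto intro!: derivative_eq_intros)
      moreover have "(f has_derivative frechet_derivative f (at x)) (at (0 *\<^sub>R i + x))"
        using smooth_deriv[OF test_functions_smooth[OF f]] by simp
      ultimately have "((\<lambda>s. f (s *\<^sub>R i + x)) has_derivative (\<lambda>h. frechet_derivative f (at x) (h *\<^sub>R i))) (at 0)"
        by (rule has_derivative_compose)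
      then have "((\<lambda>s. f (s *\<^sub>R i + x)) has_real_derivative frechet_derivative f (at x) i) (at 0)"
        by (simp add: has_field_derivative_def linear_scale[OF l] mult_commute_abs)
      then have "((\<lambda>h. (f (h *\<^sub>R i + x) - f x) / h) \<longlongrightarrow> frechet_derivative f (at x) i) (at 0)"
        by (simp add: DERIV_def)
      moreover have "filterlim ?e (at 0) sequentially"
        using LIMSEQ_inverse_real_of_nat by (auto simp: filterlim_at)
      ultimately show "(\<lambda>n. (f (?e n *\<^sub>R i + x) - f x) / ?e n) \<longlonglongrightarrow> frechet_derivative f (at x) i"
        by (rule filterlim_compose)
    qed
  qed (use dq in \<open>auto intro!: AE_I2\<close>)
  moreover have "(\<integral>x. (f (?e n *\<^sub>R i + x) - f x) / ?e n \<partial>lborel) = 0" for n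
    using tr[of "?e n *\<^sub>R i"] int by simp
  ultimately have "(\<lambda>n. 0) \<longlonglongrightarrow> (\<integral>x. frechet_derivative f (at x) i \<partial>lborel)" by simp
  then show ?thesis by (simp add: LIMSEQ_const_iff)
qed

lemma integration_by_parts:
  fixes \<phi> \<psi> :: "'a::euclidean_space \<Rightarrow> real"
  assumes \<Omega>: "open \<Omega>" and \<phi>: "\<phi> \<in> test_functions \<Omega>" and \<psi>: "smooth \<psi>" and i: "i \<in> Basis"
  shows "(\<integral>x. \<psi> x * frechet_derivative \<phi> (at x) i \<partial>lebesgue_on \<Omega>) = - (\<integral>x. frechet_derivative \<psi> (at x) i * \<phi> x \<partial>lebesgue_on \<Omega>)"
proof -
  obtain K where K: "compact K" "K \<subseteq> \<Omega>" "\<And>x. x \<notin> K \<Longrightarrow> \<phi> x = 0" "\<And>x v. x \<notin> K \<Longrightarrow> frechet_derivative \<phi> (at x) v = 0"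
    by (rule test_functionsE[OF \<phi>]) (rule that)
  note \<phi>s = test_functions_smooth[OF \<phi>]
  have \<phi>U: "\<phi> \<in> test_functions UNIV" using \<phi> by (simp add: test_functions_iff)
  have ci: "integrable lborel g" if c: "continuous_on UNIV g" and z: "\<And>x. x \<notin> K \<Longrightarrow> g x = 0" for g :: "'a \<Rightarrow> real"
  proof -
    have "integrable lborel (\<lambda>x. indicator K x *\<^sub>R g x)"
      by (rule borel_integrable_compact[OF K(1)]) (use c in \<open>auto intro: continuous_on_subset\<close>)
    also have "(\<lambda>x. indicator K x *\<^sub>R g x) = g" using z by (auto simp: indicator_def fun_eq_iff)
    finally show ?thesis .
  qed
  have eq: "(\<integral>x. g x \<partial>lebesgue_on \<Omega>) = (\<integral>x. g x \<partial>lborel)" if c: "continuous_on UNIV g" and z: "\<And>x. x \<notin> K \<Longrightarrow> g x = 0" for g :: "'a \<Rightarrow> real"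
  proof -
    have "(\<integral>x. g x \<partial>lebesgue_on \<Omega>) = (\<integral>x. indicator \<Omega> x *\<^sub>R g x \<partial>lebesgue)"
      using \<Omega> by (intro integral_restrict_space) auto
    also have "\<dots> = (\<integral>x. g x \<partial>lebesgue)"
    proof (rule Bochner_Integration.integral_cong[OF refl])
      fix x show "indicator \<Omega> x *\<^sub>R g x = g x" using z[of x] K(2) by (cases "x \<in> K") (auto simp: indicator_def)
    qed
    also have "\<dots> = (\<integral>x. g x \<partial>lborel)"
      using c by (intro integral_completion) (simp add: borel_measurable_continuous_onI)
    finally show ?thesis .
  qed
  have d: "((\<lambda>x. \<psi> x * \<phi> x) has_derivative (\<lambda>h. \<psi> x * frechet_derivative \<phi> (at x) h + frechet_derivative \<psi> (at x) h * \<phi> x)) (at x)" for x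
    by (intro has_derivative_mult smooth_deriv \<psi> \<phi>s)
  have c: "continuous_on UNIV (\<lambda>x. \<psi> x * frechet_derivative \<phi> (at x) i)"
     "continuous_on UNIV (\<lambda>x. frechet_derivative \<psi> (at x) i * \<phi> x)"
    by (intro continuous_on_mult smooth_continuous smooth_frechet \<phi>s \<psi>)+
  have "(\<integral>x. \<psi> x * frechet_derivative \<phi> (at x) i + frechet_derivative \<psi> (at x) i * \<phi> x \<partial>lborel) = 0"
    using integral_derivative_zero[OF test_functions_mult[OF \<phi>U \<psi>] i] by (simp add: frechet_eq[OF d])
  moreover have "(\<integral>x. \<psi> x * frechet_derivative \<phi> (at x) i + frechet_derivative \<psi> (at x) i * \<phi> x \<partial>lborel)
     = (\<integral>x. \<psi> x * frechet_derivative \<phi> (at x) i \<partial>lborel) + (\<integral>x. frechet_derivative \<psi> (at x) i * \<phi> x \<partial>lborel)"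
    by (intro Bochner_Integration.integral_add ci c) (use K in auto)
  ultimately show ?thesis using eq[OF c(1)] eq[OF c(2)] K by auto
qed

subsection \<open>Gaussian Sobolev spaces on bounded domains\<close>

definition gauss_density :: "'a::euclidean_space \<Rightarrow> real" where
  "gauss_density x = (2 * pi) powr (- real DIM('a) / 2) * exp (- (norm x)\<^sup>2 / 2)"

lemma gauss_density_pos: "0 < gauss_density x"
  by (simp add: gauss_density_def)

lemma gauss_density_nonzero [simp]: "gauss_density x \<noteq> 0"
  using gauss_density_pos[of x] by simp

lemma gauss_density_continuous: "continuous_on S gauss_density"
  unfolding gauss_density_def[abs_def] by (intro continuous_intros) auto

lemma gauss_density_measurable: "gauss_density \<in> borel_measurable (lebesgue_on S)"
  by (intro measurable_restrict_space1 measurable_completion)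
    (simp add: borel_measurable_continuous_onI gauss_density_continuous)

lemma gauss_density_measurable_ennreal: "(\<lambda>x. ennreal (gauss_density x)) \<in> borel_measurable (lebesgue_on S)"
  using measurable_compose[OF gauss_density_measurable measurable_ennreal] .

locale bounded_domain =
  fixes \<Omega> :: "'a::euclidean_space set"
  assumes open_domain: "open \<Omega>" and bounded_domain: "bounded \<Omega>"
begin

abbreviation "leb \<equiv> lebesgue_on \<Omega>"

abbreviation "\<mu> \<equiv> gaussian_on \<Omega>"

abbreviation "D \<equiv> weak_gradient \<Omega>"

lemma domain_lebesgue [simp]: "\<Omega> \<in> sets lebesgue"
  using open_domain by simp

lemma gaussian_on_eq: "\<mu> = density leb (\<lambda>x. ennreal (gauss_density x))"
proof (rule measure_eqI)
  have g: "gaussian = density lebesgue (\<lambda>x. ennreal (gauss_density x :: real))"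
    by (simp add: gaussian_def gauss_density_def)
  have m: "(\<lambda>x. ennreal (gauss_density x)) \<in> borel_measurable lebesgue"
    using gauss_density_measurable_ennreal[of UNIV] by (simp add: lebesgue_on_UNIV_eq)
  show s: "sets \<mu> = sets (density leb (\<lambda>x. ennreal (gauss_density x)))"
    unfolding gaussian_on_def g by (simp add: sets_restrict_space)
  fix A assume "A \<in> sets \<mu>"
  then have A: "A \<in> sets leb" using s by simp
  then have A': "A \<subseteq> \<Omega>" "A \<in> sets lebesgue" by (auto simp: sets_restrict_space_iff)
  have "emeasure \<mu> A = emeasure (density lebesgue (\<lambda>x. ennreal (gauss_density x))) A"
    unfolding gaussian_on_def g using A' by (intro emeasure_restrict_space) auto
  also have "\<dots> = (\<integral>\<^sup>+x. ennreal (gauss_density x) * indicator A x \<partial>lebesgue)"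
    using A' m by (intro emeasure_density)
  also have "\<dots> = (\<integral>\<^sup>+x. ennreal (gauss_density x) * indicator A x * indicator \<Omega> x \<partial>lebesgue)"
    using A' by (intro nn_integral_cong) (auto simp: indicator_def)
  also have "\<dots> = (\<integral>\<^sup>+x. ennreal (gauss_density x) * indicator A x \<partial>leb)"
    by (rule nn_integral_restrict_space[symmetric]) simp
  also have "\<dots> = emeasure (density leb (\<lambda>x. ennreal (gauss_density x))) A"
    using A gauss_density_measurable_ennreal by (intro emeasure_density[symmetric]) auto
  finally show "emeasure \<mu> A = emeasure (density leb (\<lambda>x. ennreal (gauss_density x))) A" .
qed

lemma measurable_\<mu>: "f \<in> borel_measurable \<mu> \<longleftrightarrow> f \<in> borel_measurable leb"
  unfolding gaussian_on_eq by simp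

lemma AE_\<mu>: "(AE x in \<mu>. P x) \<longleftrightarrow> (AE x in leb. P x)"
  unfolding gaussian_on_eq by (subst AE_density[OF gauss_density_measurable_ennreal]) (simp add: gauss_density_pos)

text \<open>On a bounded set the weight lies between two positive constants. Integrability with
  respect to the Gaussian and to Lebesgue measure then coincide, which links the weighted spaces to
  gradients taken with Lebesgue measure.\<close>

lemma gauss_density_bounds:
  obtains c C :: real where "0 < c" "\<And>x. x \<in> \<Omega> \<Longrightarrow> c \<le> gauss_density x" "\<And>x::'a. gauss_density x \<le> C"
proof -
  obtain r where r: "\<And>x. x \<in> \<Omega> \<Longrightarrow> norm x \<le> r" using bounded_domain unfolding bounded_iff by blast
  let ?c = "(2 * pi) powr (- real DIM('a) / 2)"
  show thesis
  proof (rule that[of "?c * exp (- r\<^sup>2 / 2)" ?c])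
    show "?c * exp (- r\<^sup>2 / 2) \<le> gauss_density x" if "x \<in> \<Omega>" for x
    proof -
      have "(norm x)\<^sup>2 \<le> r\<^sup>2" using r[OF that] by (intro power_mono) auto
      then show ?thesis by (simp add: gauss_density_def)
    qed
    show "gauss_density x \<le> ?c" for x :: 'a by (simp add: gauss_density_def)
  qed simp
qed

lemma integrable_\<mu>:
  fixes f :: "'a \<Rightarrow> 'b::euclidean_space"
  shows "integrable \<mu> f \<longleftrightarrow> integrable leb f"
proof -
  obtain c C :: real where c: "0 < c" "\<And>x. x \<in> \<Omega> \<Longrightarrow> c \<le> gauss_density x" "\<And>x::'a. gauss_density x \<le> C"
    by (rule gauss_density_bounds) (rule that)
  have d: "integrable \<mu> f \<longleftrightarrow> integrable leb (\<lambda>x. gauss_density x *\<^sub>R f x)" if "f \<in> borel_measurable leb"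
    unfolding gaussian_on_eq using that gauss_density_measurable
    by (intro integrable_density) (auto simp: gauss_density_pos less_imp_le)
  show ?thesis
  proof
    assume f: "integrable \<mu> f"
    then have m: "f \<in> borel_measurable leb" using borel_measurable_integrable[OF f] unfolding measurable_\<mu> by simp
    have i: "integrable leb (\<lambda>x. (1 / c) *\<^sub>R (gauss_density x *\<^sub>R f x))"
      using f d[OF m] by (intro integrable_scaleR_right) auto
    show "integrable leb f"
    proof (rule Bochner_Integration.integrable_bound[OF i m], rule AE_I2)
      fix x assume "x \<in> space leb"
      then have "1 \<le> gauss_density x / c" using c by simp
      then have "1 * norm (f x) \<le> (gauss_density x / c) * norm (f x)" by (intro mult_right_mono) auto
      then show "norm (f x) \<le> norm ((1 / c) *\<^sub>R (gauss_density x *\<^sub>R f x))"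
        using c gauss_density_pos[of x] by (simp add: less_imp_le)
    qed
  next
    assume f: "integrable leb f"
    then have m: "f \<in> borel_measurable leb" by auto
    have i: "integrable leb (\<lambda>x. C *\<^sub>R f x)" using f by (rule integrable_scaleR_right)
    have "integrable leb (\<lambda>x. gauss_density x *\<^sub>R f x)"
    proof (rule Bochner_Integration.integrable_bound[OF i], goal_cases)
      case 1
      show ?case using m gauss_density_measurable by (intro borel_measurable_scaleR)
    next
      case 2
      have "norm (gauss_density x *\<^sub>R f x) \<le> norm (C *\<^sub>R f x)" for x
        using c(3)[of x] gauss_density_pos[of x] by (simp add: mult_right_mono)
      then show ?case by simp
    qed
    then show "integrable \<mu> f" using d[OF m] by simp
  qed
qed

lemma finite_measure_\<mu>: "finite_measure \<mu>"
proof -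
  have "finite_measure leb"
    using bounded_domain by (intro finite_measure_lebesgue_on bounded_set_imp_lmeasurable) auto
  then have "integrable \<mu> (\<lambda>_. 1::real)" unfolding integrable_\<mu> by (rule finite_measure.integrable_const)
  then show ?thesis by (intro finite_measureI) (simp add: integrable_iff_bounded)
qed

lemma integrable_const_\<mu>: "integrable \<mu> (\<lambda>_. c::'b::euclidean_space)"
  using finite_measure.integrable_const[OF finite_measure_\<mu>] .

lemma measurable_cong_AE_\<mu>:
  fixes f g :: "'a \<Rightarrow> 'b::euclidean_space"
  assumes "f \<in> borel_measurable \<mu>" "AE x in \<mu>. f x = g x"
  shows "g \<in> borel_measurable \<mu>"
  using assms measurable_lebesgue_on_AE[of f \<Omega> g] unfolding measurable_\<mu> AE_\<mu> by simp

lemma L2_cong_AE: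
  assumes f: "f \<in> L2_space \<mu>" and e: "AE x in \<mu>. f x = g x"
  shows "g \<in> L2_space \<mu>"
proof -
  have g: "g \<in> borel_measurable \<mu>" using measurable_cong_AE_\<mu>[OF _ e] f by (simp add: L2_space_def)
  have "integrable \<mu> (\<lambda>x. (norm (g x))\<^sup>2)"
    by (rule integrable_cong_AE_imp[of \<mu> "\<lambda>x. (norm (f x))\<^sup>2"])
      (use f g e in \<open>auto simp: L2_space_def elim!: eventually_mono\<close>)
  then show ?thesis using g by (simp add: L2_space_def)
qed

lemma L2_bounded:
  fixes f :: "'a \<Rightarrow> 'b::euclidean_space"
  assumes m: "f \<in> borel_measurable leb" and b: "\<And>x. x \<in> \<Omega> \<Longrightarrow> norm (f x) \<le> C"
  shows "f \<in> L2_space \<mu>"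
proof -
  have "integrable \<mu> (\<lambda>x. (norm (f x))\<^sup>2)"
  proof (rule Bochner_Integration.integrable_bound[OF integrable_const_\<mu>[of "C\<^sup>2"]])
    have "(\<lambda>x. (norm (f x))\<^sup>2) \<in> borel_measurable leb" using m by measurable
    then show "(\<lambda>x. (norm (f x))\<^sup>2) \<in> borel_measurable \<mu>" by (simp add: measurable_\<mu>)
    show "AE x in \<mu>. norm ((norm (f x))\<^sup>2) \<le> norm (C\<^sup>2)"
    proof (rule AE_I2)
      fix x assume "x \<in> space \<mu>"
      then have "x \<in> \<Omega>" by (simp add: gaussian_on_eq)
      then have "(norm (f x))\<^sup>2 \<le> C\<^sup>2" by (intro power_mono b) auto
      then show "norm ((norm (f x))\<^sup>2) \<le> norm (C\<^sup>2)" by simp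
    qed
  qed
  then show ?thesis using m by (simp add: L2_space_def measurable_\<mu>)
qed

lemma continuous_measurable_leb: "continuous_on UNIV f \<Longrightarrow> f \<in> borel_measurable leb"
  by (intro measurable_restrict_space1 measurable_completion) (simp add: borel_measurable_continuous_onI)

lemma L2_test: "\<phi> \<in> test_functions U \<Longrightarrow> \<phi> \<in> L2_space \<mu>"
proof -
  assume \<phi>: "\<phi> \<in> test_functions U"
  obtain C where "\<And>x. \<bar>\<phi> x\<bar> \<le> C" by (rule test_functions_bounded[OF \<phi>]) (rule that)
  then show ?thesis
    by (rule L2_bounded[OF continuous_measurable_leb[OF smooth_continuous[OF test_functions_smooth[OF \<phi>]]], unfolded real_norm_def])
qed

lemma L2_integrable_leb:
  fixes f :: "'a \<Rightarrow> 'b::euclidean_space"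
  assumes f: "f \<in> L2_space \<mu>"
  shows "integrable leb f"
proof -
  have "integrable \<mu> f"
  proof (rule Bochner_Integration.integrable_bound)
    show "integrable \<mu> (\<lambda>x. 1 + (norm (f x))\<^sup>2)"
      using f by (intro Bochner_Integration.integrable_add integrable_const_\<mu>) (simp add: L2_space_def)
    show "f \<in> borel_measurable \<mu>" using f by (simp add: L2_space_def)
    have "norm (f x) \<le> norm (1 + (norm (f x))\<^sup>2)" for x
    proof -
      have "0 \<le> (norm (f x) - 1)\<^sup>2" by simp
      then have "2 * norm (f x) \<le> (norm (f x))\<^sup>2 + 1" by (simp add: power2_diff)
      then have "norm (f x) \<le> 1 + (norm (f x))\<^sup>2" using norm_ge_zero[of "f x"] by linarith
      then show ?thesis by simp
    qed
    then show "AE x in \<mu>. norm (f x) \<le> norm (1 + (norm (f x))\<^sup>2)" by simp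
  qed
  then show ?thesis by (simp add: integrable_\<mu>)
qed

lemma locally_integrableI:
  fixes f :: "'a \<Rightarrow> 'b::euclidean_space"
  assumes "integrable leb f" shows "locally_integrable \<Omega> f"
  unfolding locally_integrable_def set_integrable_def
proof (intro allI impI, elim conjE)
  fix K :: "'a set" assume K: "compact K" "K \<subseteq> \<Omega>"
  have "integrable lebesgue (\<lambda>x. indicator K x *\<^sub>R (indicator \<Omega> x *\<^sub>R f x))"
    using assms K(1) by (intro integrable_mult_indicator[OF _ iffD1[OF integrable_restrict_space]]) (auto simp: borel_compact)
  also have "(\<lambda>x. indicator K x *\<^sub>R (indicator \<Omega> x *\<^sub>R f x)) = (\<lambda>x. indicator K x *\<^sub>R f x)"
    using K(2) by (auto simp: indicator_def fun_eq_iff)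
  finally show "integrable lebesgue (\<lambda>x. indicator K x *\<^sub>R f x)" .
qed

lemma locally_integrable_L2: "f \<in> L2_space \<mu> \<Longrightarrow> locally_integrable \<Omega> f"
  by (intro locally_integrableI L2_integrable_leb)

lemma locally_integrable_test:
  fixes f :: "'a \<Rightarrow> real"
  assumes f: "locally_integrable \<Omega> f" and \<phi>: "\<phi> \<in> test_functions \<Omega>"
  shows "integrable leb (\<lambda>x. f x * \<phi> x)"
proof -
  obtain K where K: "compact K" "K \<subseteq> \<Omega>" "\<And>x. x \<notin> K \<Longrightarrow> \<phi> x = 0" by (rule test_functionsE[OF \<phi>]) (rule that)
  obtain C where C: "\<And>x. \<bar>\<phi> x\<bar> \<le> C" by (rule test_functions_bounded[OF \<phi>]) (rule that)
  have fK: "integrable lebesgue (\<lambda>x. indicator K x * f x)"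
    using f K unfolding locally_integrable_def set_integrable_def by auto
  have "integrable lebesgue (\<lambda>x. \<phi> x * (indicator K x * f x))"
  proof (rule Bochner_Integration.integrable_bound)
    show "integrable lebesgue (\<lambda>x. C * (indicator K x * f x))" using fK by (rule integrable_mult_right)
    have "\<phi> \<in> borel_measurable lebesgue"
      by (intro measurable_completion) (simp add: borel_measurable_continuous_onI smooth_continuous test_functions_smooth[OF \<phi>])
    then show "(\<lambda>x. \<phi> x * (indicator K x * f x)) \<in> borel_measurable lebesgue"
      by (rule borel_measurable_times[OF _ borel_measurable_integrable[OF fK]])
    have "norm (\<phi> x * (indicator K x * f x)) \<le> norm (C * (indicator K x * f x))" for x
      using C[of x] by (simp add: abs_mult mult_right_mono)
    then show "AE x in lebesgue. norm (\<phi> x * (indicator K x * f x)) \<le> norm (C * (indicator K x * f x))" by simp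
  qed
  also have "(\<lambda>x. \<phi> x * (indicator K x * f x)) = (\<lambda>x. indicator \<Omega> x *\<^sub>R (f x * \<phi> x))"
  proof
    fix x show "\<phi> x * (indicator K x * f x) = indicator \<Omega> x *\<^sub>R (f x * \<phi> x)"
      using K(2) K(3)[of x] by (cases "x \<in> K") auto
  qed
  finally show ?thesis by (subst integrable_restrict_space) auto
qed

lemma locally_integrable_inner:
  fixes G :: "'a \<Rightarrow> 'b::euclidean_space"
  assumes "locally_integrable \<Omega> G"
  shows "locally_integrable \<Omega> (\<lambda>x. G x \<bullet> i)"
  unfolding locally_integrable_def set_integrable_def
proof (intro allI impI)
  fix K assume "compact K \<and> K \<subseteq> \<Omega>"
  then have "integrable lebesgue (\<lambda>x. (indicat_real K x *\<^sub>R G x) \<bullet> i)"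
    using assms unfolding locally_integrable_def set_integrable_def by (intro integrable_inner_left) auto
  then show "integrable lebesgue (\<lambda>x. indicat_real K x *\<^sub>R (G x \<bullet> i))" by simp
qed

lemma locally_integrable_diff:
  fixes f g :: "'a \<Rightarrow> 'b::euclidean_space"
  assumes "locally_integrable \<Omega> f" "locally_integrable \<Omega> g"
  shows "locally_integrable \<Omega> (\<lambda>x. f x - g x)"
  using assms unfolding locally_integrable_def by (auto intro: set_integral_diff)

lemma weak_gradient_test_integrable:
  assumes w: "is_weak_gradient \<Omega> u G" and \<phi>: "\<phi> \<in> test_functions \<Omega>"
  shows "integrable leb (\<lambda>x. u x * frechet_derivative \<phi> (at x) i)" "integrable leb (\<lambda>x. (G x \<bullet> i) * \<phi> x)"
  using w unfolding is_weak_gradient_def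
  by (auto intro!: locally_integrable_test locally_integrable_inner \<phi> test_functions_frechet)

lemma weak_gradient_unique:
  assumes w: "is_weak_gradient \<Omega> u G" "is_weak_gradient \<Omega> v G'" and e: "AE x in leb. u x = v x"
  shows "AE x in leb. G x = G' x"
proof -
  have "AE x in leb. G x \<bullet> i - G' x \<bullet> i = 0" if i: "i \<in> Basis" for i
  proof (rule fundamental_lemma[OF open_domain])
    show "locally_integrable \<Omega> (\<lambda>x. G x \<bullet> i - G' x \<bullet> i)"
      using w unfolding is_weak_gradient_def by (intro locally_integrable_diff locally_integrable_inner) auto
    fix \<phi> assume \<phi>: "\<phi> \<in> test_functions \<Omega>"
    have "(\<integral>x. (G x \<bullet> i - G' x \<bullet> i) * \<phi> x \<partial>leb) = (\<integral>x. (G x \<bullet> i) * \<phi> x - (G' x \<bullet> i) * \<phi> x \<partial>leb)"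
      by (simp add: left_diff_distrib)
    also have "\<dots> = (\<integral>x. (G x \<bullet> i) * \<phi> x \<partial>leb) - (\<integral>x. (G' x \<bullet> i) * \<phi> x \<partial>leb)"
      by (intro Bochner_Integration.integral_diff weak_gradient_test_integrable[OF w(1) \<phi>] weak_gradient_test_integrable[OF w(2) \<phi>])
    also have "\<dots> = - (\<integral>x. u x * frechet_derivative \<phi> (at x) i \<partial>leb) + (\<integral>x. v x * frechet_derivative \<phi> (at x) i \<partial>leb)"
      using w \<phi> i unfolding is_weak_gradient_def by auto
    also have "(\<integral>x. u x * frechet_derivative \<phi> (at x) i \<partial>leb) = (\<integral>x. v x * frechet_derivative \<phi> (at x) i \<partial>leb)"
      by (rule integral_cong_AE)
        (use e weak_gradient_test_integrable[OF w(1) \<phi>] weak_gradient_test_integrable[OF w(2) \<phi>] in \<open>auto elim!: eventually_mono\<close>)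
    finally show "(\<integral>x. (G x \<bullet> i - G' x \<bullet> i) * \<phi> x \<partial>leb) = 0" by simp
  qed
  then have "AE x in leb. \<forall>i\<in>Basis. G x \<bullet> i - G' x \<bullet> i = 0"
    by (subst AE_ball_countable) (auto simp: countable_finite)
  then show ?thesis by eventually_elim (auto intro: euclidean_eqI)
qed

lemma is_weak_gradient_add:
  assumes w: "is_weak_gradient \<Omega> u G" "is_weak_gradient \<Omega> v G'"
    and L2: "u \<in> L2_space \<mu>" "v \<in> L2_space \<mu>" "G \<in> L2_space \<mu>" "G' \<in> L2_space \<mu>"
  shows "is_weak_gradient \<Omega> (u + v) (G + G')"
  unfolding is_weak_gradient_def
proof (intro conjI ballI locally_integrable_L2 L2_space_add L2)
  fix \<phi> :: "'a \<Rightarrow> real" and i :: 'a assume \<phi>: "\<phi> \<in> test_functions \<Omega>" and i: "i \<in> Basis"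
  show "(\<integral>x. (u + v) x * frechet_derivative \<phi> (at x) i \<partial>leb) = - (\<integral>x. ((G + G') x \<bullet> i) * \<phi> x \<partial>leb)"
    using w \<phi> i weak_gradient_test_integrable[OF w(1) \<phi>] weak_gradient_test_integrable[OF w(2) \<phi>]
    unfolding is_weak_gradient_def by (simp add: distrib_right inner_add_left)
qed

lemma is_weak_gradient_scale:
  assumes w: "is_weak_gradient \<Omega> u G" and L2: "u \<in> L2_space \<mu>" "G \<in> L2_space \<mu>"
  shows "is_weak_gradient \<Omega> (c *\<^sub>R u) (c *\<^sub>R G)"
  unfolding is_weak_gradient_def
proof (intro conjI ballI locally_integrable_L2 L2.scale_mem L2)
  fix \<phi> :: "'a \<Rightarrow> real" and i :: 'a assume \<phi>: "\<phi> \<in> test_functions \<Omega>" and i: "i \<in> Basis"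
  show "(\<integral>x. (c *\<^sub>R u) x * frechet_derivative \<phi> (at x) i \<partial>leb) = - (\<integral>x. ((c *\<^sub>R G) x \<bullet> i) * \<phi> x \<partial>leb)"
    using w \<phi> i unfolding is_weak_gradient_def by (simp add: mult.assoc)
qed

section \<open>The Gaussian space H1\<close>

lemma H1_L2: "u \<in> H1_space \<Omega> \<Longrightarrow> u \<in> L2_space \<mu>"
  by (simp add: H1_space_def)

lemma H1_weak_gradient: "u \<in> H1_space \<Omega> \<Longrightarrow> is_weak_gradient \<Omega> u (D u)"
  unfolding weak_gradient_def by (rule someI_ex[of "is_weak_gradient \<Omega> u"]) (auto simp: H1_space_def)

text \<open>\<open>weak_gradient\<close> selects some weak gradient, not necessarily the
  square-integrable one provided by membership; uniqueness makes the two agree almost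
  everywhere.\<close>

lemma H1_D: "u \<in> H1_space \<Omega> \<Longrightarrow> D u \<in> L2_space \<mu>"
proof -
  assume u: "u \<in> H1_space \<Omega>"
  then obtain G where G: "G \<in> L2_space \<mu>" "is_weak_gradient \<Omega> u G" by (auto simp: H1_space_def)
  have "AE x in leb. G x = D u x" by (rule weak_gradient_unique[OF G(2) H1_weak_gradient[OF u]]) simp
  then show ?thesis using L2_cong_AE[OF G(1)] by (simp add: AE_\<mu>)
qed

lemma H1_I:
  assumes "u \<in> L2_space \<mu>" "G \<in> L2_space \<mu>" "is_weak_gradient \<Omega> u G"
  shows "u \<in> H1_space \<Omega>" and "AE x in \<mu>. D u x = G x"
proof -
  show u: "u \<in> H1_space \<Omega>" using assms by (auto simp: H1_space_def)
  show "AE x in \<mu>. D u x = G x"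
    unfolding AE_\<mu> by (rule weak_gradient_unique[OF H1_weak_gradient[OF u] assms(3)]) simp
qed

lemma H1_add:
  assumes "u \<in> H1_space \<Omega>" "v \<in> H1_space \<Omega>"
  shows "u + v \<in> H1_space \<Omega>" and "AE x in \<mu>. D (u + v) x = (D u + D v) x"
  by (rule H1_I[OF L2_space_add[OF H1_L2[OF assms(1)] H1_L2[OF assms(2)]] L2_space_add[OF H1_D[OF assms(1)] H1_D[OF assms(2)]]
        is_weak_gradient_add[OF H1_weak_gradient[OF assms(1)] H1_weak_gradient[OF assms(2)]
          H1_L2[OF assms(1)] H1_L2[OF assms(2)] H1_D[OF assms(1)] H1_D[OF assms(2)]]])+

lemma H1_scale:
  assumes "u \<in> H1_space \<Omega>"
  shows "c *\<^sub>R u \<in> H1_space \<Omega>" and "AE x in \<mu>. D (c *\<^sub>R u) x = (c *\<^sub>R D u) x"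
  by (rule H1_I[OF L2.scale_mem[OF H1_L2[OF assms]] L2.scale_mem[OF H1_D[OF assms]]
        is_weak_gradient_scale[OF H1_weak_gradient[OF assms] H1_L2[OF assms] H1_D[OF assms]]])+

lemma H1_diff:
  assumes "u \<in> H1_space \<Omega>" "v \<in> H1_space \<Omega>"
  shows "u - v \<in> H1_space \<Omega>" and "AE x in \<mu>. D (u - v) x = D u x - D v x"
proof -
  have e: "u - v = u + (-1) *\<^sub>R v" by simp
  show "u - v \<in> H1_space \<Omega>" unfolding e by (intro H1_add H1_scale assms)
  show "AE x in \<mu>. D (u - v) x = D u x - D v x"
    unfolding e using H1_add(2)[OF assms(1) H1_scale(1)[OF assms(2)], of "-1"] H1_scale(2)[OF assms(2), of "-1"]
    by eventually_elim simp
qed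

lemma H1_cong_AE:
  assumes u: "u \<in> H1_space \<Omega>" and e: "AE x in \<mu>. u x = v x"
  shows "v \<in> H1_space \<Omega>" and "AE x in \<mu>. D u x = D v x"
proof -
  have v: "v \<in> L2_space \<mu>" by (rule L2_cong_AE[OF H1_L2[OF u] e])
  have "is_weak_gradient \<Omega> v (D u)"
    unfolding is_weak_gradient_def
  proof (intro conjI ballI locally_integrable_L2 v H1_D u)
    fix \<phi> :: "'a \<Rightarrow> real" and i :: 'a assume \<phi>: "\<phi> \<in> test_functions \<Omega>" and i: "i \<in> Basis"
    have "(\<integral>x. v x * frechet_derivative \<phi> (at x) i \<partial>leb) = (\<integral>x. u x * frechet_derivative \<phi> (at x) i \<partial>leb)"
    proof (rule integral_cong_AE)
      show "AE x in leb. v x * frechet_derivative \<phi> (at x) i = u x * frechet_derivative \<phi> (at x) i"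
        using e unfolding AE_\<mu> by eventually_elim simp
      show "(\<lambda>x. v x * frechet_derivative \<phi> (at x) i) \<in> borel_measurable leb"
        using locally_integrable_test[OF locally_integrable_L2[OF v] test_functions_frechet[OF \<phi>]] by auto
      show "(\<lambda>x. u x * frechet_derivative \<phi> (at x) i) \<in> borel_measurable leb"
        using locally_integrable_test[OF locally_integrable_L2[OF H1_L2[OF u]] test_functions_frechet[OF \<phi>]] by auto
    qed
    then show "(\<integral>x. v x * frechet_derivative \<phi> (at x) i \<partial>leb) = - (\<integral>x. (D u x \<bullet> i) * \<phi> x \<partial>leb)"
      using H1_weak_gradient[OF u] \<phi> i unfolding is_weak_gradient_def by simp
  qed
  from H1_I[OF v H1_D[OF u] this] show "v \<in> H1_space \<Omega>" "AE x in \<mu>. D u x = D v x"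
    by (auto elim: eventually_mono)
qed

definition grad :: "('a \<Rightarrow> real) \<Rightarrow> 'a \<Rightarrow> 'a" where
  "grad \<phi> x = (\<Sum>i\<in>Basis. frechet_derivative \<phi> (at x) i *\<^sub>R i)"

lemma grad_inner: "i \<in> Basis \<Longrightarrow> grad \<phi> x \<bullet> i = frechet_derivative \<phi> (at x) i"
  by (simp add: grad_def)

lemma grad_L2:
  assumes \<phi>: "\<phi> \<in> test_functions U"
  shows "grad \<phi> \<in> L2_space \<mu>"
proof -
  have "\<forall>i. \<exists>C. \<forall>x. \<bar>frechet_derivative \<phi> (at x) i\<bar> \<le> C"
    using test_functions_bounded[OF test_functions_frechet[OF \<phi>]] by metis
  from choice[OF this] obtain C where C: "\<And>i x. \<bar>frechet_derivative \<phi> (at x) i\<bar> \<le> C i" by blast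
  have "continuous_on UNIV (grad \<phi>)"
    unfolding grad_def[abs_def]
    by (intro continuous_intros smooth_continuous smooth_frechet test_functions_smooth[OF \<phi>])
  moreover have "norm (grad \<phi> x) \<le> (\<Sum>i\<in>Basis. C i)" for x
    unfolding grad_def by (rule order_trans[OF norm_sum]) (auto intro!: sum_mono C)
  ultimately show ?thesis by (intro L2_bounded continuous_measurable_leb)
qed

lemma H1_test:
  assumes \<phi>: "\<phi> \<in> test_functions \<Omega>"
  shows "\<phi> \<in> H1_space \<Omega>" and "AE x in \<mu>. D \<phi> x = grad \<phi> x"
proof -
  have "is_weak_gradient \<Omega> \<phi> (grad \<phi>)"
    unfolding is_weak_gradient_def
  proof (intro conjI ballI locally_integrable_L2 L2_test[OF \<phi>] grad_L2[OF \<phi>])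
    fix \<psi> :: "'a \<Rightarrow> real" and i :: 'a assume \<psi>: "\<psi> \<in> test_functions \<Omega>" and i: "i \<in> Basis"
    show "(\<integral>x. \<phi> x * frechet_derivative \<psi> (at x) i \<partial>leb) = - (\<integral>x. (grad \<phi> x \<bullet> i) * \<psi> x \<partial>leb)"
      using integration_by_parts[OF open_domain \<psi> test_functions_smooth[OF \<phi>] i] by (simp add: grad_inner i)
  qed
  then show "\<phi> \<in> H1_space \<Omega>" "AE x in \<mu>. D \<phi> x = grad \<phi> x"
    using H1_I[OF L2_test[OF \<phi>] grad_L2[OF \<phi>]] by auto
qed

definition ipE :: "('a \<Rightarrow> real) \<Rightarrow> ('a \<Rightarrow> real) \<Rightarrow> real" where
  "ipE u v = ip2 \<mu> u v + ip2 \<mu> (D u) (D v)"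

lemma ip2_cong_AE:
  assumes f: "f \<in> L2_space \<mu>" "g \<in> L2_space \<mu>" "AE x in \<mu>. f x = f' x" "AE x in \<mu>. g x = g' x"
  shows "ip2 \<mu> f' g' = ip2 \<mu> f g"
  unfolding ip2_def
proof (rule integral_cong_AE)
  show "AE x in \<mu>. f' x \<bullet> g' x = f x \<bullet> g x" using assms(3,4) by eventually_elim simp
  show "(\<lambda>x. f' x \<bullet> g' x) \<in> borel_measurable \<mu>"
    using L2_inner_integrable[OF L2_cong_AE[OF assms(1,3)] L2_cong_AE[OF assms(2,4)]] by auto
qed (use L2_inner_integrable[OF assms(1,2)] in auto)

text \<open>The chosen gradient is linear only almost everywhere, so the algebraic laws are obtained
  inside the integral.\<close>

sublocale E: semi_inner "H1_space \<Omega>" ipE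
proof
  show "subspace (H1_space \<Omega>)"
  proof (rule subspaceI)
    have "(\<lambda>_. 0) \<in> test_functions \<Omega>" by (rule test_functionsI[of _ "{}"]) (auto simp: smooth_const)
    then show "0 \<in> H1_space \<Omega>" using H1_test(1) by (simp add: zero_fun_def)
  qed (auto intro: H1_add H1_scale)
  fix x y z :: "'a \<Rightarrow> real" and c :: real
  assume x: "x \<in> H1_space \<Omega>"
  show "0 \<le> ipE x x" unfolding ipE_def using x by (intro add_nonneg_nonneg L2.ip_nonneg H1_L2 H1_D)
  assume y: "y \<in> H1_space \<Omega>"
  show "ipE x y = ipE y x" unfolding ipE_def using x y by (simp add: L2.ip_sym H1_L2 H1_D)
  have "ip2 \<mu> (D (c *\<^sub>R x)) (D y) = ip2 \<mu> (c *\<^sub>R D x) (D y)"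
    by (rule ip2_cong_AE)
      (use H1_scale(2)[OF x, of c] x y in \<open>auto intro: L2.scale_mem H1_D elim!: eventually_mono\<close>)
  then show "ipE (c *\<^sub>R x) y = c * ipE x y"
    unfolding ipE_def using x y by (simp add: L2.ip_simps H1_L2 H1_D distrib_left)
  assume z: "z \<in> H1_space \<Omega>"
  have "ip2 \<mu> (D (x + y)) (D z) = ip2 \<mu> (D x + D y) (D z)"
    by (rule ip2_cong_AE)
      (use H1_add(2)[OF x y] x y z in \<open>auto intro: L2_space_add H1_D elim!: eventually_mono\<close>)
  then show "ipE (x + y) z = ipE x z + ipE y z"
    unfolding ipE_def using x y z by (simp add: L2.ip_simps H1_L2 H1_D)
qed

lemma H1_norm_eq: "H1_norm \<Omega> = E.nm"
proof
  fix u
  have "0 \<le> (\<integral>x. (norm (u x))\<^sup>2 \<partial>\<mu>)" "0 \<le> (\<integral>x. (norm (D u x))\<^sup>2 \<partial>\<mu>)" by simp_all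
  then show "H1_norm \<Omega> u = E.nm u"
    by (simp add: H1_norm_def E.nm_def ipE_def L2_norm_def ip2_def power2_norm_eq_inner[symmetric] power2_eq_square[of "u _"])
qed

lemma L2_nm_le: "u \<in> H1_space \<Omega> \<Longrightarrow> L2.nm \<mu> u \<le> E.nm u" "u \<in> H1_space \<Omega> \<Longrightarrow> L2.nm \<mu> (D u) \<le> E.nm u"
  unfolding L2.nm_def E.nm_def ipE_def using L2.ip_nonneg[OF H1_L2] L2.ip_nonneg[OF H1_D] by auto

lemma D_diff_nm:
  assumes "u \<in> H1_space \<Omega>" "v \<in> H1_space \<Omega>"
  shows "L2.nm \<mu> (D u - D v) = L2.nm \<mu> (D (u - v))"
proof -
  have "ip2 \<mu> (D u - D v) (D u - D v) = ip2 \<mu> (D (u - v)) (D (u - v))"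
    using H1_diff(2)[OF assms] H1_D[OF H1_diff(1)[OF assms]] by (intro ip2_cong_AE) auto
  then show ?thesis by (simp add: L2.nm_def)
qed

lemma E_nm_eq:
  assumes "u \<in> H1_space \<Omega>" "v \<in> H1_space \<Omega>"
  shows "E.nm (u - v) = sqrt ((L2.nm \<mu> (u - v))\<^sup>2 + (L2.nm \<mu> (D u - D v))\<^sup>2)"
  unfolding D_diff_nm[OF assms] E.nm_def ipE_def
  by (simp add: L2.nm_sq[OF H1_L2] L2.nm_sq[OF H1_D] H1_diff(1)[OF assms])

text \<open>Dividing by the density rewrites a Lebesgue pairing with a test function as a Gaussian
  inner product with a square-integrable function. Distributional identities thereby become
  continuous in the norm.\<close>

lemma test_quotient_L2:
  assumes \<phi>: "\<phi> \<in> test_functions U"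
  shows "(\<lambda>x. (\<phi> x / gauss_density x) *\<^sub>R (w :: 'b::euclidean_space)) \<in> L2_space \<mu>"
proof -
  obtain c C :: real where c: "0 < c" "\<And>x. x \<in> \<Omega> \<Longrightarrow> c \<le> gauss_density x" "\<And>x::'a. gauss_density x \<le> C"
    by (rule gauss_density_bounds) (rule that)
  obtain B where B: "\<And>x. \<bar>\<phi> x\<bar> \<le> B" by (rule test_functions_bounded[OF \<phi>]) (rule that)
  show ?thesis
  proof (rule L2_bounded[of _ "B / c * norm w"])
    have "continuous_on UNIV (\<lambda>x. (\<phi> x / gauss_density x) *\<^sub>R w)"
      by (intro continuous_intros gauss_density_continuous smooth_continuous test_functions_smooth[OF \<phi>]) auto
    then show "(\<lambda>x. (\<phi> x / gauss_density x) *\<^sub>R w) \<in> borel_measurable leb" by (rule continuous_measurable_leb)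
    fix x assume "x \<in> \<Omega>"
    then have "\<bar>\<phi> x\<bar> / gauss_density x \<le> B / c" using c B[of x] gauss_density_pos[of x] by (intro frac_le) auto
    then have "\<bar>\<phi> x\<bar> / gauss_density x * norm w \<le> B / c * norm w" by (rule mult_right_mono) simp
    then show "norm ((\<phi> x / gauss_density x) *\<^sub>R w) \<le> B / c * norm w"
      using gauss_density_pos[of x] by simp
  qed
qed

lemma ip2_test:
  fixes G :: "'a \<Rightarrow> 'b::euclidean_space"
  assumes \<phi>: "\<phi> \<in> test_functions U" and G: "G \<in> L2_space \<mu>"
  shows "ip2 \<mu> G (\<lambda>x. (\<phi> x / gauss_density x) *\<^sub>R w) = (\<integral>x. (G x \<bullet> w) * \<phi> x \<partial>leb)"
proof -
  have "ip2 \<mu> G (\<lambda>x. (\<phi> x / gauss_density x) *\<^sub>R w) = (\<integral>x. gauss_density x *\<^sub>R (G x \<bullet> ((\<phi> x / gauss_density x) *\<^sub>R w)) \<partial>leb)"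
  proof -
    have m: "(\<lambda>x. G x \<bullet> ((\<phi> x / gauss_density x) *\<^sub>R w)) \<in> borel_measurable leb"
      using borel_measurable_integrable[OF L2_inner_integrable[OF G test_quotient_L2[OF \<phi>], of w]] by (simp only: measurable_\<mu>)
    show ?thesis unfolding ip2_def unfolding gaussian_on_eq
      by (rule integral_density[OF m gauss_density_measurable]) (simp add: gauss_density_pos less_imp_le)
  qed
  also have "\<dots> = (\<integral>x. (G x \<bullet> w) * \<phi> x \<partial>leb)"
    by (intro Bochner_Integration.integral_cong) auto
  finally show ?thesis .
qed

text \<open>The weak gradient is a closed operator: both sides of its defining identity are Gaussian
  inner products with fixed square-integrable functions.\<close>

lemma H1_limit:
  fixes X :: "nat \<Rightarrow> 'a \<Rightarrow> real"
  assumes X: "\<And>n. X n \<in> H1_space \<Omega>" and u: "u \<in> L2_space \<mu>" "(\<lambda>n. L2.nm \<mu> (X n - u)) \<longlonglongrightarrow> 0"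
    and G: "G \<in> L2_space \<mu>" "(\<lambda>n. L2.nm \<mu> (D (X n) - G)) \<longlonglongrightarrow> 0"
  shows "u \<in> H1_space \<Omega>" and "(\<lambda>n. E.nm (X n - u)) \<longlonglongrightarrow> 0"
proof -
  have w: "is_weak_gradient \<Omega> u G"
    unfolding is_weak_gradient_def
  proof (intro conjI ballI locally_integrable_L2 u G)
    fix \<phi> :: "'a \<Rightarrow> real" and i :: 'a assume \<phi>: "\<phi> \<in> test_functions \<Omega>" and i: "i \<in> Basis"
    let ?d = "\<lambda>x. frechet_derivative \<phi> (at x) i"
    note d = test_functions_frechet[OF \<phi>, of i]
    show "(\<integral>x. u x * ?d x \<partial>leb) = - (\<integral>x. (G x \<bullet> i) * \<phi> x \<partial>leb)"
    proof (rule LIMSEQ_unique)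
      have "(\<lambda>n. ip2 \<mu> (X n) (\<lambda>x. (?d x / gauss_density x) *\<^sub>R 1)) \<longlonglongrightarrow> ip2 \<mu> u (\<lambda>x. (?d x / gauss_density x) *\<^sub>R 1)"
        using test_quotient_L2[OF d, of "1::real"] X u by (intro L2.ip_tendsto) (auto intro: H1_L2 simp: L2.nm_zero)
      then show "(\<lambda>n. \<integral>x. X n x * ?d x \<partial>leb) \<longlonglongrightarrow> (\<integral>x. u x * ?d x \<partial>leb)"
        unfolding ip2_test[OF d H1_L2[OF X]] ip2_test[OF d u(1)] by simp
      have "(\<lambda>n. - ip2 \<mu> (D (X n)) (\<lambda>x. (\<phi> x / gauss_density x) *\<^sub>R i)) \<longlonglongrightarrow> - ip2 \<mu> G (\<lambda>x. (\<phi> x / gauss_density x) *\<^sub>R i)"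
        using test_quotient_L2[OF \<phi>, of i] X G by (intro tendsto_minus L2.ip_tendsto) (auto intro: H1_D simp: L2.nm_zero)
      moreover have "- ip2 \<mu> (D (X n)) (\<lambda>x. (\<phi> x / gauss_density x) *\<^sub>R i) = (\<integral>x. X n x * ?d x \<partial>leb)" for n
        unfolding ip2_test[OF \<phi> H1_D[OF X]] using H1_weak_gradient[OF X[of n]] \<phi> i by (simp add: is_weak_gradient_def)
      ultimately show "(\<lambda>n. \<integral>x. X n x * ?d x \<partial>leb) \<longlonglongrightarrow> - (\<integral>x. (G x \<bullet> i) * \<phi> x \<partial>leb)"
        unfolding ip2_test[OF \<phi> G(1)] by simp
    qed
  qed
  show uH: "u \<in> H1_space \<Omega>" by (rule H1_I(1)[OF u(1) G(1) w])
  have DG: "AE x in \<mu>. D u x = G x" by (rule H1_I(2)[OF u(1) G(1) w])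
  have "L2.nm \<mu> (D (X n) - D u) = L2.nm \<mu> (D (X n) - G)" for n
  proof -
    have "ip2 \<mu> (D (X n) - D u) (D (X n) - D u) = ip2 \<mu> (D (X n) - G) (D (X n) - G)"
      by (rule ip2_cong_AE) (use DG X G in \<open>auto intro!: L2.diff_mem H1_D elim: eventually_mono\<close>)
    then show ?thesis by (simp add: L2.nm_def)
  qed
  then have "E.nm (X n - u) = sqrt ((L2.nm \<mu> (X n - u))\<^sup>2 + (L2.nm \<mu> (D (X n) - G))\<^sup>2)" for n
    using E_nm_eq[OF X[of n] uH] by simp
  moreover have "(\<lambda>n. sqrt ((L2.nm \<mu> (X n - u))\<^sup>2 + (L2.nm \<mu> (D (X n) - G))\<^sup>2)) \<longlonglongrightarrow> sqrt (0\<^sup>2 + 0\<^sup>2)"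
    by (intro tendsto_real_sqrt tendsto_add tendsto_power u G)
  ultimately show "(\<lambda>n. E.nm (X n - u)) \<longlonglongrightarrow> 0" by simp
qed

lemma H1_complete: "semi_hilbert (H1_space \<Omega>) ipE"
proof
  interpret L: semi_hilbert "L2_space \<mu> :: ('a \<Rightarrow> real) set" "ip2 \<mu>" by (rule L2_semi_hilbert)
  interpret LD: semi_hilbert "L2_space \<mu> :: ('a \<Rightarrow> 'a) set" "ip2 \<mu>" by (rule L2_semi_hilbert)
  fix X :: "nat \<Rightarrow> 'a \<Rightarrow> real" assume X: "\<And>n. X n \<in> H1_space \<Omega>" and c: "\<And>e. 0 < e \<Longrightarrow> \<exists>M. \<forall>m\<ge>M. \<forall>n\<ge>M. E.nm (X m - X n) < e"
  have "\<exists>M. \<forall>m\<ge>M. \<forall>n\<ge>M. L2.nm \<mu> (X m - X n) < e" if "0 < e" for e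
    using c[OF that] L2_nm_le(1)[OF H1_diff(1)[OF X X]] by (meson order_le_less_trans)
  then obtain u where u: "u \<in> L2_space \<mu>" "(\<lambda>n. L2.nm \<mu> (X n - u)) \<longlonglongrightarrow> 0"
    using L.complete[of X] H1_L2[OF X] by blast
  have "\<exists>M. \<forall>m\<ge>M. \<forall>n\<ge>M. L2.nm \<mu> (D (X m) - D (X n)) < e" if "0 < e" for e
    using c[OF that] L2_nm_le(2)[OF H1_diff(1)[OF X X]] unfolding D_diff_nm[OF X X] by (meson order_le_less_trans)
  then obtain G where G: "G \<in> L2_space \<mu>" "(\<lambda>n. L2.nm \<mu> (D (X n) - G)) \<longlonglongrightarrow> 0"
    using LD.complete[of "\<lambda>n. D (X n)"] H1_D[OF X] by blast
  show "\<exists>x\<in>H1_space \<Omega>. (\<lambda>n. E.nm (X n - x)) \<longlonglongrightarrow> 0"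
    using H1_limit[OF X u G] by blast
qed

section \<open>The closure of the test functions\<close>

lemma H10_H1: "u \<in> H10_space \<Omega> \<Longrightarrow> u \<in> H1_space \<Omega>"
  by (simp add: H10_space_def)

lemma H10_approx:
  assumes "u \<in> H10_space \<Omega>" "0 < e"
  obtains \<phi> where "\<phi> \<in> test_functions \<Omega>" "E.nm (u - \<phi>) < e"
  using assms by (auto simp: H10_space_def H1_norm_eq)

lemma H10_I:
  assumes "u \<in> H1_space \<Omega>" "\<And>e. 0 < e \<Longrightarrow> \<exists>\<phi>\<in>test_functions \<Omega>. E.nm (u - \<phi>) < e"
  shows "u \<in> H10_space \<Omega>"
  using assms by (auto simp: H10_space_def H1_norm_eq)

lemma H10_test: "\<phi> \<in> test_functions \<Omega> \<Longrightarrow> \<phi> \<in> H10_space \<Omega>"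
  by (rule H10_I) (auto simp: H1_test E.nm_zero intro!: bexI[of _ \<phi>])

lemma H10_subspace: "subspace (H10_space \<Omega>)"
proof (rule subspaceI)
  have "(\<lambda>_. 0) \<in> test_functions \<Omega>" by (rule test_functionsI[of _ "{}"]) (auto simp: smooth_const)
  then show "0 \<in> H10_space \<Omega>" using H10_test by (simp add: zero_fun_def)
  show "u + v \<in> H10_space \<Omega>" if uv: "u \<in> H10_space \<Omega>" "v \<in> H10_space \<Omega>" for u v
  proof (rule H10_I)
    show "u + v \<in> H1_space \<Omega>" by (intro H1_add H10_H1 uv)
    fix e :: real assume e: "0 < e"
    obtain \<phi> where \<phi>: "\<phi> \<in> test_functions \<Omega>" "E.nm (u - \<phi>) < e / 2" using H10_approx[OF uv(1), of "e / 2"] e by auto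
    obtain \<psi> where \<psi>: "\<psi> \<in> test_functions \<Omega>" "E.nm (v - \<psi>) < e / 2" using H10_approx[OF uv(2), of "e / 2"] e by auto
    have t: "\<phi> + \<psi> \<in> test_functions \<Omega>" using test_functions_add[OF \<phi>(1) \<psi>(1)] by (simp add: plus_fun_def)
    have eq: "(u + v) - (\<phi> + \<psi>) = (u - \<phi>) + (v - \<psi>)" by simp
    have "E.nm ((u + v) - (\<phi> + \<psi>)) \<le> E.nm (u - \<phi>) + E.nm (v - \<psi>)"
      unfolding eq by (intro E.nm_triangle E.diff_mem H10_H1 uv H1_test \<phi> \<psi>)
    then show "\<exists>\<phi>\<in>test_functions \<Omega>. E.nm ((u + v) - \<phi>) < e" using t \<phi>(2) \<psi>(2) by (intro bexI[OF _ t]) linarith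
  qed
  show "c *\<^sub>R u \<in> H10_space \<Omega>" if u: "u \<in> H10_space \<Omega>" for c u
  proof (rule H10_I)
    show "c *\<^sub>R u \<in> H1_space \<Omega>" by (intro H1_scale H10_H1 u)
    fix e :: real assume e: "0 < e"
    obtain \<phi> where \<phi>: "\<phi> \<in> test_functions \<Omega>" "E.nm (u - \<phi>) < e / (\<bar>c\<bar> + 1)"
      using H10_approx[OF u, of "e / (\<bar>c\<bar> + 1)"] e by (auto simp: divide_pos_pos)
    have t: "c *\<^sub>R \<phi> \<in> test_functions \<Omega>"
      using test_functions_mult[OF \<phi>(1) smooth_const[of c]] by (simp add: scaleR_fun_def)
    have "E.nm (c *\<^sub>R u - c *\<^sub>R \<phi>) = \<bar>c\<bar> * E.nm (u - \<phi>)"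
      unfolding scaleR_diff_right[symmetric] by (intro E.nm_scale E.diff_mem H10_H1 u H1_test \<phi>)
    also have "\<dots> \<le> (\<bar>c\<bar> + 1) * E.nm (u - \<phi>)"
      by (intro mult_right_mono E.nm_nonneg E.diff_mem H10_H1 u H1_test \<phi>) auto
    also have "\<dots> < e" using \<phi>(2) by (simp add: pos_less_divide_eq mult.commute)
    finally show "\<exists>\<phi>\<in>test_functions \<Omega>. E.nm (c *\<^sub>R u - \<phi>) < e" using t by blast
  qed
qed

lemma H10_closed:
  fixes X :: "nat \<Rightarrow> 'a \<Rightarrow> real"
  assumes X: "\<And>n. X n \<in> H10_space \<Omega>" and u: "u \<in> H1_space \<Omega>" "(\<lambda>n. E.nm (X n - u)) \<longlonglongrightarrow> 0"
  shows "u \<in> H10_space \<Omega>"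
proof (rule H10_I[OF u(1)])
  fix e :: real assume e: "0 < e"
  then have "0 < e / 2" by simp
  from order_tendstoD(2)[OF u(2) this] obtain n where n: "E.nm (X n - u) < e / 2" by (auto simp: eventually_sequentially)
  obtain \<phi> where \<phi>: "\<phi> \<in> test_functions \<Omega>" "E.nm (X n - \<phi>) < e / 2" using H10_approx[OF X[of n], of "e / 2"] e by auto
  have "E.nm (u - \<phi>) \<le> E.nm (u - X n) + E.nm (X n - \<phi>)" by (intro E.nm_triangle3 u H10_H1 X H1_test \<phi>)
  also have "E.nm (u - X n) = E.nm (X n - u)" by (intro E.nm_commute u H10_H1 X)
  finally show "\<exists>\<phi>\<in>test_functions \<Omega>. E.nm (u - \<phi>) < e" using n \<phi> by (intro bexI[OF _ \<phi>(1)]) linarith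
qed

lemma H10_semi_inner: "semi_inner (H10_space \<Omega>) ipE"
  using H10_subspace E.ip_sym E.ip_add_left E.ip_scale_left E.ip_nonneg H10_H1
  by (unfold_locales) auto

lemma H10_semi_hilbert: "semi_hilbert (H10_space \<Omega>) ipE"
proof -
  interpret V: semi_inner "H10_space \<Omega>" ipE by (rule H10_semi_inner)
  interpret H: semi_hilbert "H1_space \<Omega>" ipE by (rule H1_complete)
  show ?thesis
  proof
    fix X :: "nat \<Rightarrow> 'a \<Rightarrow> real" assume X: "\<And>n. X n \<in> H10_space \<Omega>" and c: "\<And>e. 0 < e \<Longrightarrow> \<exists>M. \<forall>m\<ge>M. \<forall>n\<ge>M. E.nm (X m - X n) < e"
    obtain u where "u \<in> H1_space \<Omega>" "(\<lambda>n. E.nm (X n - u)) \<longlonglongrightarrow> 0"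
      using H.complete[of X, OF H10_H1[OF X] c] by blast
    then show "\<exists>x\<in>H10_space \<Omega>. (\<lambda>n. E.nm (X n - x)) \<longlonglongrightarrow> 0"
      using H10_closed[of X, OF X] by blast
  qed
qed

lemma L2_null_AE:
  fixes f :: "'a \<Rightarrow> 'b::euclidean_space"
  assumes "f \<in> L2_space \<mu>" "ip2 \<mu> f f = 0" shows "AE x in \<mu>. f x = 0"
  using assms integral_nonneg_eq_0_iff_AE[OF L2_inner_integrable[OF assms(1,1)]]
  by (simp add: ip2_def)

lemma null_sobolev:
  assumes x: "x \<in> H1_space \<Omega>" and e: "AE t in \<mu>. x t = y t"
  shows "y \<in> H1_space \<Omega>" "E.nm (x - y) = 0"
proof -
  show y: "y \<in> H1_space \<Omega>" by (rule H1_cong_AE(1)[OF x e])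
  have "ip2 \<mu> (x - y) (x - y) = ip2 \<mu> (0::'a \<Rightarrow> real) 0"
    by (rule ip2_cong_AE) (use e in \<open>auto simp: L2.zero_mem elim: eventually_mono\<close>)
  moreover have "ip2 \<mu> (D (x - y)) (D (x - y)) = ip2 \<mu> (0::'a \<Rightarrow> 'a) 0"
  proof (rule ip2_cong_AE)
    show "AE t in \<mu>. 0 t = D (x - y) t" "AE t in \<mu>. 0 t = D (x - y) t"
      using H1_diff(2)[OF x y] H1_cong_AE(2)[OF x e] by (eventually_elim; simp)+
  qed (auto simp: L2.zero_mem)
  ultimately show "E.nm (x - y) = 0" by (simp add: E.nm_def ipE_def ip2_def)
qed

text \<open>The abstract parabolic theory becomes available here. The compatibility of null elements
  holds because equality almost everywhere forces equal weak gradients and the closure of the test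
  functions is closed under such changes.\<close>

sublocale G: gelfand_pair "H10_space \<Omega>" ipE "L2_space \<mu>" "ip2 \<mu>"
proof -
  interpret V: semi_hilbert "H10_space \<Omega>" ipE by (rule H10_semi_hilbert)
  interpret H: semi_hilbert "L2_space \<mu> :: ('a \<Rightarrow> real) set" "ip2 \<mu>" by (rule L2_semi_hilbert)
  show "gelfand_pair (H10_space \<Omega>) ipE (L2_space \<mu>) (ip2 \<mu>)"
  proof
    show "H10_space \<Omega> \<subseteq> L2_space \<mu>" using H10_H1 H1_L2 by blast
    show "ip2 \<mu> x x \<le> ipE x x" if "x \<in> H10_space \<Omega>" for x
      unfolding ipE_def using L2.ip_nonneg[OF H1_D[OF H10_H1[OF that]]] by simp
    fix x y :: "'a \<Rightarrow> real" assume x: "x \<in> H10_space \<Omega>" and y: "y \<in> L2_space \<mu>" and z: "ip2 \<mu> (x - y) (x - y) = 0"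
    have "x - y \<in> L2_space \<mu>" using H10_H1[OF x] H1_L2 y by (intro L2.diff_mem) auto
    then have e: "AE t in \<mu>. x t = y t" using L2_null_AE[OF _ z] by (auto elim: eventually_mono)
    have n: "y \<in> H1_space \<Omega>" "E.nm (x - y) = 0" using null_sobolev[OF H10_H1[OF x] e] by auto
    have "y \<in> H10_space \<Omega>" by (rule H10_closed[of "\<lambda>_. x"]) (use x n in auto)
    moreover have "ipE (x - y) (x - y) = 0" using E.nm_sq[OF E.diff_mem[OF H10_H1[OF x] n(1)]] n(2) by simp
    ultimately show "y \<in> H10_space \<Omega> \<and> ipE (x - y) (x - y) = 0" by simp
  qed
qed

end

subsection \<open>Weak derivatives in time\<close>

lemma tm_cong_AE:
  fixes f g :: "real \<Rightarrow> real"
  assumes f: "f \<in> borel_measurable (tm T)" and e: "AE t in tm T. f t = g t"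
  shows "g \<in> borel_measurable (tm T)" "(\<integral>t. f t \<partial>tm T) = (\<integral>t. g t \<partial>tm T)"
    "integrable (tm T) f \<Longrightarrow> integrable (tm T) g"
proof -
  show g: "g \<in> borel_measurable (tm T)" by (rule measurable_lebesgue_on_AE[OF f _ e]) simp
  show "(\<integral>t. f t \<partial>tm T) = (\<integral>t. g t \<partial>tm T)" by (rule integral_cong_AE[OF f g e])
  show "integrable (tm T) g" if "integrable (tm T) f"
    by (rule integrable_cong_AE_imp[OF that g]) (use e in \<open>auto elim: eventually_mono\<close>)
qed

lemma tm_continuous_integrable:
  fixes f :: "real \<Rightarrow> real"
  assumes "continuous_on {0..T} f" shows "integrable (tm T) f"
proof -
  have "integrable lebesgue (\<lambda>x. indicator {0..T} x *\<^sub>R f x)"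
    using continuous_imp_integrable_real[OF assms] by (subst (asm) integrable_restrict_space) auto
  then have "integrable lebesgue (\<lambda>x. indicator {0<..<T} x *\<^sub>R (indicator {0..T} x *\<^sub>R f x))"
    by (rule integrable_mult_indicator[rotated]) simp
  also have "(\<lambda>x. indicator {0<..<T} x *\<^sub>R (indicator {0..T} x *\<^sub>R f x)) = (\<lambda>x. indicator {0<..<T} x *\<^sub>R f x)"
    by (rule ext) (simp add: indicator_def)
  finally have i: "integrable lebesgue (\<lambda>x. indicator {0<..<T} x *\<^sub>R f x)" .
  show ?thesis by (rule integrable_restrict_space[THEN iffD2, OF _ i]) simp
qed

lemma AE_lebesgue_neq: "AE x in lebesgue. x \<noteq> (c::real)"
  by (rule AE_completion) (rule AE_lborel_singleton)

lemma ti_FTC: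
  assumes st: "0 \<le> s" "s \<le> t" "t \<le> T" and F: "\<And>x. (F has_real_derivative f x) (at x)" and c: "continuous_on UNIV f"
  shows "ti T s t f = F t - F s"
proof -
  have m: "f \<in> borel_measurable lborel" using c by (simp add: borel_measurable_continuous_onI)
  have ml: "f \<in> borel_measurable lebesgue" using m by (rule measurable_completion)
  have "ti T s t f = (\<integral>r. indicator {0<..<T} r *\<^sub>R (indicator {s<..t} r * f r) \<partial>lebesgue)"
    unfolding ti_def by (rule integral_restrict_space) simp
  also have "\<dots> = (\<integral>r. f r * indicator {s..t} r \<partial>lebesgue)"
  proof (rule integral_cong_AE)
    show "(\<lambda>r. indicator {0<..<T} r *\<^sub>R (indicator {s<..t} r * f r)) \<in> borel_measurable lebesgue"
      by (intro borel_measurable_scaleR borel_measurable_times borel_measurable_indicator ml) auto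
    show "(\<lambda>r. f r * indicator {s..t} r) \<in> borel_measurable lebesgue"
      by (intro borel_measurable_times borel_measurable_indicator ml) auto
    show "AE r in lebesgue. indicator {0<..<T} r *\<^sub>R (indicator {s<..t} r * f r) = f r * indicator {s..t} r"
      using AE_lebesgue_neq[of s] AE_lebesgue_neq[of t] by eventually_elim (use st in \<open>auto simp: indicator_def\<close>)
  qed
  also have "\<dots> = (\<integral>r. f r * indicator {s..t} r \<partial>lborel)"
    by (rule integral_completion) (intro borel_measurable_times borel_measurable_indicator m, simp)
  also have "\<dots> = F t - F s"
    by (rule integral_FTC_Icc_real[OF st(2) F]) (use c in \<open>simp add: continuous_on_eq_continuous_at\<close>)
  finally show ?thesis .
qed

text \<open>Restriction of solutions to a shorter time interval relies on this.\<close>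

lemma ti_horizon:
  assumes "t \<le> \<tau>" "\<tau> \<le> T" and f: "f \<in> borel_measurable (tm T)"
  shows "ti T s t f = ti \<tau> s t f"
proof -
  have "ti T s t f = (\<integral>r. indicator {0<..<T} r *\<^sub>R (indicator {s<..t} r * f r) \<partial>lebesgue)"
    unfolding ti_def by (rule integral_restrict_space) simp
  also have "\<dots> = (\<integral>r. indicator {0<..<\<tau>} r *\<^sub>R (indicator {s<..t} r * f r) \<partial>lebesgue)"
  proof (rule integral_cong_AE)
    show m: "(\<lambda>r. indicator {0<..<T} r *\<^sub>R (indicator {s<..t} r * f r)) \<in> borel_measurable lebesgue"
    proof -
      have "(\<lambda>r. f r * indicator {0<..<T} r) \<in> borel_measurable lebesgue"
        using f by (subst (asm) borel_measurable_restrict_space_iff) (simp_all add: mult.commute)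
      moreover have "(indicator {s<..t} :: real \<Rightarrow> real) \<in> borel_measurable lebesgue" by (rule borel_measurable_indicator) simp
      ultimately have "(\<lambda>r. indicator {s<..t} r * (f r * indicator {0<..<T} r)) \<in> borel_measurable lebesgue"
        by (rule borel_measurable_times[rotated])
      then show ?thesis by (simp add: mult.commute mult.left_commute)
    qed
    have "(\<lambda>r. indicator {0<..<\<tau>} r *\<^sub>R (indicator {0<..<T} r *\<^sub>R (indicator {s<..t} r * f r))) \<in> borel_measurable lebesgue"
      by (rule borel_measurable_scaleR[OF borel_measurable_indicator m]) simp
    also have "(\<lambda>r. indicator {0<..<\<tau>} r *\<^sub>R (indicator {0<..<T} r *\<^sub>R (indicator {s<..t} r * f r))) =
        (\<lambda>r. indicator {0<..<\<tau>} r *\<^sub>R (indicator {s<..t} r * f r))"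
      using assms(2) by (intro ext) (simp add: indicator_def)
    finally show "(\<lambda>r. indicator {0<..<\<tau>} r *\<^sub>R (indicator {s<..t} r * f r)) \<in> borel_measurable lebesgue" .
    show "AE r in lebesgue. indicator {0<..<T} r *\<^sub>R (indicator {s<..t} r * f r) = indicator {0<..<\<tau>} r *\<^sub>R (indicator {s<..t} r * f r)"
      \<comment> \<open>For \<open>t = \<tau>\<close> the point \<open>t\<close> is cut off by the
        shorter horizon only, hence it is excluded.\<close>
      using AE_lebesgue_neq[of t] by eventually_elim (use assms in \<open>simp add: indicator_def\<close>)
  qed
  also have "\<dots> = ti \<tau> s t f"
    unfolding ti_def by (rule integral_restrict_space[symmetric]) simp
  finally show ?thesis .
qed

lemma smooth_real_deriv:
  fixes f :: "real \<Rightarrow> real"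
  assumes "smooth f"
  shows "(f has_real_derivative deriv f x) (at x)" and "deriv f x = frechet_derivative f (at x) 1"
    and "smooth (deriv f)"
proof -
  have d: "(f has_derivative frechet_derivative f (at x)) (at x)" for x by (rule smooth_deriv[OF assms])
  have "(f has_real_derivative frechet_derivative f (at x) 1) (at x)" for x
  proof -
    have "frechet_derivative f (at x) = (\<lambda>h. frechet_derivative f (at x) 1 * h)"
    proof
      fix h
      show "frechet_derivative f (at x) h = frechet_derivative f (at x) 1 * h"
        using linear_scale[OF has_derivative_linear[OF d[of x]], of h 1] by (simp add: mult.commute)
    qed
    then show ?thesis using d[of x] unfolding has_field_derivative_def by metis
  qed
  then have e: "(f has_real_derivative frechet_derivative f (at x) 1) (at x)" for x .
  show e2: "deriv f x = frechet_derivative f (at x) 1" for x by (rule DERIV_imp_deriv[OF e])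
  show "(f has_real_derivative deriv f x) (at x)" using e e2 by simp
  have "deriv f = (\<lambda>x. frechet_derivative f (at x) 1)" by (rule ext) (rule e2)
  then show "smooth (deriv f)" using smooth_frechet[OF assms, of 1] by simp
qed

lemma tm_mult_integrable:
  fixes \<theta> b :: "real \<Rightarrow> real"
  assumes c: "continuous_on {0..T} \<theta>" and b: "integrable (tm T) b"
  shows "integrable (tm T) (\<lambda>r. \<theta> r * b r)"
proof -
  obtain C where C: "\<And>r. r \<in> {0..T} \<Longrightarrow> \<bar>\<theta> r\<bar> \<le> C"
    using compact_imp_bounded[OF compact_continuous_image[OF c compact_Icc]]
    unfolding bounded_iff by (auto simp only: ball_simps real_norm_def)
  have bm: "(\<lambda>r. \<theta> r * b r) \<in> borel_measurable (tm T)"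
    using b tm_continuous_integrable[OF c] by (intro borel_measurable_times) auto
  show ?thesis
  proof (rule Bochner_Integration.integrable_bound[OF _ bm])
    show "integrable (tm T) (\<lambda>r. C * b r)" using b by (rule integrable_mult_right)
    show "AE r in tm T. norm (\<theta> r * b r) \<le> norm (C * b r)"
      using AE_tm_space
    proof eventually_elim
      case (elim r)
      then have "\<bar>\<theta> r\<bar> \<le> \<bar>C\<bar>" using C[of r] by auto
      then show ?case by (simp add: abs_mult mult_right_mono)
    qed
  qed
qed

text \<open>The discrete product rule for \<open>a t * \<theta> s\<close>; the boundary terms vanish
  by the end values of \<open>\<theta>\<close>. As \<open>b\<close> is only integrable,
  \<open>a\<close> need not be differentiable at every time.\<close>

lemma parts_scalar:
  assumes T: "0 < T" and a: "continuous_on {0..T} a" and b: "integrable (tm T) b"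
    and ab: "\<And>s t. 0 \<le> s \<Longrightarrow> s \<le> t \<Longrightarrow> t \<le> T \<Longrightarrow> a t - a s = ti T s t b"
    and \<theta>: "smooth \<theta>" "\<theta> 0 = 0" "\<theta> T = 0"
  shows "(\<integral>t. deriv \<theta> t * a t \<partial>tm T) = - (\<integral>t. \<theta> t * b t \<partial>tm T)"
proof -
  note d = smooth_real_deriv[OF \<theta>(1)]
  have c: "continuous_on S \<theta>" "continuous_on S (deriv \<theta>)" for S
    using smooth_continuous[OF \<theta>(1)] smooth_continuous[OF d(3)] by (auto intro: continuous_on_subset)
  have uc: "\<exists>\<delta>>0. \<forall>s\<in>{0..T}. \<forall>r\<in>{0..T}. \<bar>s - r\<bar> < \<delta> \<longrightarrow> \<bar>f s - f r\<bar> \<le> e"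
    if f: "continuous_on {0..T} f" and e: "0 < e" for f :: "real \<Rightarrow> real" and e
  proof -
    from compact_uniformly_continuous[OF f compact_Icc, unfolded uniformly_continuous_on_def, rule_format, OF e]
    obtain \<delta> where d: "0 < \<delta> \<and> (\<forall>x\<in>{0..T}. \<forall>y\<in>{0..T}. dist y x < \<delta> \<longrightarrow> dist (f y) (f x) < e)" ..
    then show ?thesis unfolding dist_real_def by (intro exI[of _ \<delta>]) (auto intro: less_imp_le)
  qed
  have dint: "integrable (tm T) (deriv \<theta>)" by (rule tm_continuous_integrable[OF c(2)])
  have pd: "integrable (tm T) (\<lambda>r. b r * \<theta> r)"
    using tm_mult_integrable[OF c(1) b] by (simp add: mult.commute)
  have qd: "integrable (tm T) (\<lambda>r. a r * deriv \<theta> r)"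
    by (intro tm_continuous_integrable continuous_on_mult a c)
  have "a T * \<theta> T - a 0 * \<theta> 0 = ti T 0 T (\<lambda>r. b r * \<theta> r) + ti T 0 T (\<lambda>r. a r * deriv \<theta> r)"
  proof (rule product_rule[where P = "\<lambda>t s. a t * \<theta> s" and p = "\<lambda>r s. b r * \<theta> s" and q = "\<lambda>t r. a t * deriv \<theta> r"
        and m = "\<lambda>r. \<bar>b r\<bar> + \<bar>deriv \<theta> r\<bar>"])
    show "a t' * \<theta> s - a t * \<theta> s = ti T t t' (\<lambda>r. b r * \<theta> s)"
      if "0 \<le> t" "t \<le> t'" "t' \<le> T" "s \<in> {0..T}" for t t' s
      using ab[OF that(1-3)] ti_cmult[of T t t' "\<theta> s" b] by (simp only: mult.commute[of _ "\<theta> s"] right_diff_distrib[symmetric])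
    show "a t * \<theta> s' - a t * \<theta> s = ti T s s' (\<lambda>r. a t * deriv \<theta> r)"
      if "0 \<le> s" "s \<le> s'" "s' \<le> T" "t \<in> {0..T}" for s s' t
      using ti_FTC[OF that(1-3) d(1) c(2)] by (simp add: ti_cmult right_diff_distrib[symmetric])
    show "\<exists>\<delta>>0. AE r in tm T. \<forall>s\<in>{0..T}. r \<le> T \<longrightarrow> \<bar>s - r\<bar> < \<delta> \<longrightarrow> \<bar>b r * \<theta> s - b r * \<theta> r\<bar> \<le> e * (\<bar>b r\<bar> + \<bar>deriv \<theta> r\<bar>)"
      if e: "0 < e" for e
    proof -
      obtain \<delta> where \<delta>: "0 < \<delta>" "\<forall>s\<in>{0..T}. \<forall>r\<in>{0..T}. \<bar>s - r\<bar> < \<delta> \<longrightarrow> \<bar>\<theta> s - \<theta> r\<bar> \<le> e" using uc[OF c(1) e] by blast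
      have "AE r in tm T. \<forall>s\<in>{0..T}. r \<le> T \<longrightarrow> \<bar>s - r\<bar> < \<delta> \<longrightarrow> \<bar>b r * \<theta> s - b r * \<theta> r\<bar> \<le> e * (\<bar>b r\<bar> + \<bar>deriv \<theta> r\<bar>)"
        using AE_tm_space
      proof eventually_elim
        case (elim r)
        show ?case
        proof (intro ballI impI)
          fix s assume "s \<in> {0..T}" "r \<le> T" "\<bar>s - r\<bar> < \<delta>"
          then have "\<bar>\<theta> s - \<theta> r\<bar> \<le> e" using \<delta>(2) elim by auto
          then have "\<bar>b r\<bar> * \<bar>\<theta> s - \<theta> r\<bar> \<le> \<bar>b r\<bar> * e" by (intro mult_left_mono) auto
          also have "\<dots> \<le> e * (\<bar>b r\<bar> + \<bar>deriv \<theta> r\<bar>)" using e by (simp add: distrib_left mult.commute)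
          finally show "\<bar>b r * \<theta> s - b r * \<theta> r\<bar> \<le> e * (\<bar>b r\<bar> + \<bar>deriv \<theta> r\<bar>)"
            by (simp add: right_diff_distrib[symmetric] abs_mult)
        qed
      qed
      then show ?thesis using \<delta>(1) by blast
    qed
    show "\<exists>\<delta>>0. AE r in tm T. \<forall>s\<in>{0..T}. r \<le> T \<longrightarrow> \<bar>s - r\<bar> < \<delta> \<longrightarrow> \<bar>a s * deriv \<theta> r - a r * deriv \<theta> r\<bar> \<le> e * (\<bar>b r\<bar> + \<bar>deriv \<theta> r\<bar>)"
      if e: "0 < e" for e
    proof -
      obtain \<delta> where \<delta>: "0 < \<delta>" "\<forall>s\<in>{0..T}. \<forall>r\<in>{0..T}. \<bar>s - r\<bar> < \<delta> \<longrightarrow> \<bar>a s - a r\<bar> \<le> e" using uc[OF a e] by blast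
      have "AE r in tm T. \<forall>s\<in>{0..T}. r \<le> T \<longrightarrow> \<bar>s - r\<bar> < \<delta> \<longrightarrow> \<bar>a s * deriv \<theta> r - a r * deriv \<theta> r\<bar> \<le> e * (\<bar>b r\<bar> + \<bar>deriv \<theta> r\<bar>)"
        using AE_tm_space
      proof eventually_elim
        case (elim r)
        show ?case
        proof (intro ballI impI)
          fix s assume "s \<in> {0..T}" "r \<le> T" "\<bar>s - r\<bar> < \<delta>"
          then have "\<bar>a s - a r\<bar> \<le> e" using \<delta>(2) elim by auto
          then have "\<bar>a s - a r\<bar> * \<bar>deriv \<theta> r\<bar> \<le> e * \<bar>deriv \<theta> r\<bar>" by (intro mult_right_mono) auto
          also have "\<dots> \<le> e * (\<bar>b r\<bar> + \<bar>deriv \<theta> r\<bar>)" using e by (simp add: distrib_left)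
          finally show "\<bar>a s * deriv \<theta> r - a r * deriv \<theta> r\<bar> \<le> e * (\<bar>b r\<bar> + \<bar>deriv \<theta> r\<bar>)"
            by (simp add: left_diff_distrib[symmetric] abs_mult)
        qed
      qed
      then show ?thesis using \<delta>(1) by blast
    qed
    show "integrable (tm T) (\<lambda>r. \<bar>b r\<bar> + \<bar>deriv \<theta> r\<bar>)"
      using b dint by (intro Bochner_Integration.integrable_add integrable_abs)
  qed (use T b dint pd qd in auto)
  then show ?thesis using \<theta> by (simp add: ti_full mult.commute)
qed

text \<open>The kernel is the derivative of a rescaled \<open>sstep\<close>, so its mass follows
  from the fundamental theorem. It is concentrated to the right of \<open>s\<close>, on a length
  1/(n + n0), and \<open>n0\<close> keeps this inside the time interval.\<close>

lemma mollifier_tendsto: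
  assumes a: "continuous_on {0..T} a" and s: "0 < s" "s < T" and n0: "1 / (T - s) < real n0"
  shows "(\<lambda>n. \<integral>x. real (n + n0) * hump (real (n + n0) * (x - s)) / hump_mass * a x \<partial>tm T) \<longlonglongrightarrow> a s"
proof (rule LIMSEQ_I)
  fix e :: real assume e: "0 < e"
  define k where "k n x = real (n + n0) * hump (real (n + n0) * (x - s)) / hump_mass" for n x
  have N0: "0 < n0" using n0 s by (cases n0) (auto simp: field_simps)
  have kc: "continuous_on S (k n)" for S n
    unfolding k_def using hump_mass_pos
    by (intro continuous_intros continuous_on_compose2[OF smooth_continuous[OF smooth_hump]]) auto
  have kd: "((\<lambda>x. sstep (real (n + n0) * (x - s))) has_real_derivative k n x) (at x)" for n x
  proof -
    have "((\<lambda>x. real (n + n0) * (x - s)) has_real_derivative real (n + n0)) (at x)"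
      by (auto intro!: derivative_eq_intros)
    from DERIV_chain2[OF sstep_deriv this] show ?thesis by (simp add: k_def mult.commute)
  qed
  have k0: "0 \<le> k n x" for n x unfolding k_def using hump_nonneg hump_mass_pos by (intro divide_nonneg_pos mult_nonneg_nonneg) auto
  have kz: "k n x = 0" if "x \<le> s \<or> s + 1 / real (n + n0) \<le> x" for n x
  proof -
    have "real (n + n0) * (x - s) \<le> 0 \<or> 1 \<le> real (n + n0) * (x - s)"
    proof (cases "x \<le> s")
      case True
      then show ?thesis by (intro disjI1 mult_nonneg_nonpos) auto
    next
      case False
      then show ?thesis using that N0 by (simp add: field_simps)
    qed
    then show ?thesis unfolding k_def by (simp only: hump_zero mult_zero_right div_0)
  qed
  have mass: "(\<integral>x. k n x \<partial>tm T) = 1" for n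
  proof -
    have "ti T 0 T (k n) = sstep (real (n + n0) * (T - s)) - sstep (real (n + n0) * (0 - s))"
      by (rule ti_FTC[OF _ _ _ kd kc]) (use s in auto)
    moreover have "1 \<le> real (n + n0) * (T - s)"
    proof -
      have "1 < real n0 * (T - s)" using n0 s by (simp add: field_simps)
      also have "\<dots> \<le> real (n + n0) * (T - s)" using s by (intro mult_right_mono) auto
      finally show ?thesis by simp
    qed
    moreover have "real (n + n0) * (0 - s) \<le> 0" using s by (intro mult_nonneg_nonpos) auto
    ultimately show ?thesis using sstep_one sstep_zero by (simp add: ti_full)
  qed
  from a[unfolded continuous_on_iff, rule_format, of s "e / 2"] s e
  obtain d where d: "0 < d" "\<And>x. x \<in> {0..T} \<Longrightarrow> dist x s < d \<Longrightarrow> dist (a x) (a s) < e / 2" by auto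
  obtain M :: nat where M: "1 / d < real M" using reals_Archimedean2 by blast
  have "norm ((\<integral>x. k n x * a x \<partial>tm T) - a s) < e" if n: "M \<le> n" for n
  proof -
    have ki: "integrable (tm T) (k n)" by (rule tm_continuous_integrable[OF kc])
    have kai: "integrable (tm T) (\<lambda>x. k n x * a x)" by (intro tm_continuous_integrable continuous_on_mult kc a)
    have "real M \<le> real (n + n0)" using n by simp
    then have "1 / d < real (n + n0)" using M by simp
    then have nd: "1 / real (n + n0) < d" using d(1) N0 by (simp only: pos_divide_less_eq of_nat_0_less_iff add_pos_pos) (simp only: mult.commute pos_divide_less_eq of_nat_0_less_iff add_nonneg_pos zero_le)
    have "(\<integral>x. k n x * a x \<partial>tm T) - a s = (\<integral>x. k n x * a x \<partial>tm T) - (\<integral>x. k n x * a s \<partial>tm T)" using mass by simp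
    also have "\<dots> = (\<integral>x. k n x * a x - k n x * a s \<partial>tm T)"
      using kai ki by (intro Bochner_Integration.integral_diff[symmetric] integrable_mult_left)
    finally have eq: "(\<integral>x. k n x * a x \<partial>tm T) - a s = (\<integral>x. k n x * a x - k n x * a s \<partial>tm T)" .
    have "norm (\<integral>x. k n x * a x - k n x * a s \<partial>tm T) \<le> (\<integral>x. k n x * (e / 2) \<partial>tm T)"
    proof (rule Bochner_Integration.integral_norm_bound_integral)
      show "norm (k n x * a x - k n x * a s) \<le> k n x * (e / 2)" if "x \<in> space (tm T)" for x
      proof (cases "x \<le> s \<or> s + 1 / real (n + n0) \<le> x")
        case False
        then have "dist (a x) (a s) < e / 2" using that nd by (intro d(2)) (auto simp: dist_real_def)
        then have "k n x * \<bar>a x - a s\<bar> \<le> k n x * (e / 2)" using k0 by (intro mult_left_mono) (auto simp: dist_real_def)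
        then show ?thesis using k0[of n x] by (simp add: right_diff_distrib[symmetric] abs_mult)
      qed (use kz[of x n] in simp)
    qed (use kai ki in \<open>auto intro!: Bochner_Integration.integrable_diff integrable_mult_left\<close>)
    also have "\<dots> = e / 2" using mass by simp
    finally show ?thesis unfolding eq using e by simp
  qed
  then show "\<exists>no. \<forall>n\<ge>no. norm ((\<integral>x. real (n + n0) * hump (real (n + n0) * (x - s)) / hump_mass * a x \<partial>tm T) - a s) < e"
    unfolding k_def by blast
qed

text \<open>A du Bois-Reymond argument. The test functions switch on at \<open>s\<close> and off at
  \<open>t\<close>: their derivatives concentrate at the two times, and they converge to the
  indicator of the interval between. This settles interior times; \<open>Z\<close>, a continuous
  primitive of \<open>b\<close>, carries the result to the endpoints.\<close>

lemma distributional_derivative: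
  assumes T: "0 < T" and a: "continuous_on {0..T} a" and b: "integrable (tm T) b"
    and Z: "continuous_on {0..T} Z" "\<And>s t. 0 \<le> s \<Longrightarrow> s \<le> t \<Longrightarrow> t \<le> T \<Longrightarrow> Z t - Z s = ti T s t b"
    and test: "\<And>\<phi>. \<phi> \<in> test_functions {0<..<T} \<Longrightarrow> (\<integral>t. deriv \<phi> t * a t \<partial>tm T) = - (\<integral>t. \<phi> t * b t \<partial>tm T)"
    and st: "0 \<le> s" "s \<le> t" "t \<le> T"
  shows "a t - a s = ti T s t b"
proof -
  have inner: "a t - a s = ti T s t b" if st: "0 < s" "s < t" "t < T" for s t
  proof -
    obtain n0 :: nat where n0: "1 / (T - t) < real n0" using reals_Archimedean2 by blast
    have n0s: "1 / (T - s) < real n0"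
    proof -
      have "1 / (T - s) \<le> 1 / (T - t)" using st by (intro divide_left_mono) auto
      then show ?thesis using n0 by simp
    qed
    have N0: "0 < n0" using n0 st by (cases n0) (auto simp: field_simps)
    let ?k = "\<lambda>n c x. real (n + n0) * hump (real (n + n0) * (x - c)) / hump_mass"
    define \<phi> where "\<phi> n x = sstep (real (n + n0) * (x - s)) - sstep (real (n + n0) * (x - t))" for n x
    have \<phi>s: "smooth (\<phi> n)" for n
    proof -
      have 1: "smooth (\<lambda>x. sstep (real (n + n0) * x + (- real (n + n0) * c)))" for c
        by (intro smooth_affine smooth_sstep bounded_linear_mult_right)
      have "smooth (\<lambda>x. sstep (real (n + n0) * x + (- real (n + n0) * s)) + (-1) * sstep (real (n + n0) * x + (- real (n + n0) * t)))"
        by (intro smooth_add smooth_mult smooth_const 1)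
      moreover have "(\<lambda>x. sstep (real (n + n0) * x + (- real (n + n0) * s)) + (-1) * sstep (real (n + n0) * x + (- real (n + n0) * t))) = \<phi> n"
        unfolding \<phi>_def[abs_def] by (rule ext) (simp only: right_diff_distrib mult_minus_left mult_1_left diff_conv_add_uminus distrib_left mult_minus_right)
      ultimately show ?thesis by (simp only:)
    qed
    have \<phi>d: "deriv (\<phi> n) x = ?k n s x - ?k n t x" for n x
    proof (rule DERIV_imp_deriv)
      show "(\<phi> n has_real_derivative ?k n s x - ?k n t x) (at x)"
      proof -
        have l: "((\<lambda>x. real (n + n0) * (x - c)) has_real_derivative real (n + n0)) (at x)" for c
          by (auto intro!: derivative_eq_intros)
        show ?thesis
          using DERIV_diff[OF DERIV_chain2[OF sstep_deriv l[of s]] DERIV_chain2[OF sstep_deriv l[of t]]]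
          by (simp add: \<phi>_def[abs_def] mult.commute)
      qed
    qed
    have end_le: "t + 1 / real (n + n0) < T" for n
    proof -
      have "1 < real n0 * (T - t)" using n0 st by (simp add: field_simps)
      also have "\<dots> \<le> real (n + n0) * (T - t)" using st by (intro mult_right_mono) auto
      finally show ?thesis using N0 by (simp add: field_simps)
    qed
    have \<phi>z: "\<phi> n x = 0" if "x \<notin> {s..t + 1 / real (n + n0)}" for n x
    proof (cases "x < s")
      case True
      then have "real (n + n0) * (x - s) \<le> 0" "real (n + n0) * (x - t) \<le> 0"
        using st by (auto intro!: mult_nonneg_nonpos)
      then show ?thesis by (simp add: \<phi>_def sstep_zero)
    next
      case False
      then have x: "t + 1 / real (n + n0) < x" using that by auto
      then have "1 \<le> real (n + n0) * (x - t)" using N0 by (simp add: field_simps)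
      moreover have "real (n + n0) * (x - t) \<le> real (n + n0) * (x - s)" using st by (intro mult_left_mono) auto
      ultimately show ?thesis by (simp add: \<phi>_def sstep_one)
    qed
    have \<phi>t: "\<phi> n \<in> test_functions {0<..<T}" for n
      by (rule test_functionsI[of _ "{s..t + 1 / real (n + n0)}"])
        (use \<phi>s \<phi>z end_le[of n] st in auto)
    have \<phi>b: "\<bar>\<phi> n x\<bar> \<le> 1" for n x
      using sstep_bounds[of "real (n + n0) * (x - s)"] sstep_bounds[of "real (n + n0) * (x - t)"] by (simp add: \<phi>_def)
    have kai: "integrable (tm T) (\<lambda>x. ?k n c x * a x)" for n c
      using hump_mass_pos
      by (intro tm_continuous_integrable continuous_intros a continuous_on_compose2[OF smooth_continuous[OF smooth_hump]]) auto
    have "(\<lambda>n. (\<integral>x. ?k n s x * a x \<partial>tm T) - (\<integral>x. ?k n t x * a x \<partial>tm T)) \<longlonglongrightarrow> a s - a t"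
      by (intro tendsto_diff mollifier_tendsto a n0 n0s) (use st in auto)
    moreover have "(\<integral>x. ?k n s x * a x \<partial>tm T) - (\<integral>x. ?k n t x * a x \<partial>tm T) = - (\<integral>x. \<phi> n x * b x \<partial>tm T)" for n
    proof -
      have "(\<integral>x. ?k n s x * a x \<partial>tm T) - (\<integral>x. ?k n t x * a x \<partial>tm T) = (\<integral>x. deriv (\<phi> n) x * a x \<partial>tm T)"
        unfolding \<phi>d using kai by (simp add: left_diff_distrib)
      then show ?thesis using test[OF \<phi>t] by simp
    qed
    moreover have "(\<lambda>n. \<integral>x. \<phi> n x * b x \<partial>tm T) \<longlonglongrightarrow> ti T s t b"
      unfolding ti_def
    proof (rule integral_dominated_convergence[where w = "\<lambda>x. \<bar>b x\<bar>"])
      show "AE x in tm T. (\<lambda>n. \<phi> n x * b x) \<longlonglongrightarrow> indicator {s<..t} x * b x"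
      proof (rule AE_I2, intro tendsto_mult tendsto_const)
        fix x
        have l: "(\<lambda>n. sstep (real (n + n0) * c)) \<longlonglongrightarrow> (if 0 < c then 1 else 0)" for c
        proof (cases "0 < c")
          case True
          then show ?thesis using LIMSEQ_ignore_initial_segment[OF sstep_scaled_tendsto[OF True], of n0] by simp
        next
          case False
          then have "sstep (real (n + n0) * c) = 0" for n by (intro sstep_zero mult_nonneg_nonpos) auto
          then show ?thesis using False by simp
        qed
        \<comment> \<open>A step has value 0 at its own starting point, so \<open>x = s\<close> is
          excluded and \<open>x = t\<close> included: exactly the half-open interval of
          \<open>ti\<close>.\<close>
        have "(\<lambda>n. \<phi> n x) \<longlonglongrightarrow> (if 0 < x - s then 1 else 0) - (if 0 < x - t then 1 else 0)"
          unfolding \<phi>_def by (intro tendsto_diff l)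
        moreover have "(if 0 < x - s then 1 else 0) - (if 0 < x - t then 1 else (0::real)) = indicator {s<..t} x"
          using st by (auto simp: indicator_def)
        ultimately show "(\<lambda>n. \<phi> n x) \<longlonglongrightarrow> indicator {s<..t} x" by simp
      qed
      show "AE x in tm T. norm (\<phi> n x * b x) \<le> \<bar>b x\<bar>" for n
        using \<phi>b by (intro AE_I2) (simp add: abs_mult mult_left_le_one_le)
      show "(\<lambda>x. \<phi> n x * b x) \<in> borel_measurable (tm T)" for n
        using b smooth_continuous[OF \<phi>s[of n]] tm_continuous_integrable[of T "\<phi> n"]
        by (intro borel_measurable_times) (auto intro: continuous_on_subset)
    qed (use b ti_integrable[OF b, of s t] in auto)
    then have "(\<lambda>n. - (\<integral>x. \<phi> n x * b x \<partial>tm T)) \<longlonglongrightarrow> - ti T s t b" by (rule tendsto_minus)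
    ultimately have "a s - a t = - ti T s t b" using LIMSEQ_unique by simp
    then show ?thesis by simp
  qed
  \<comment> \<open>Comparison with the midpoint shows that \<open>a - Z\<close> is constant on the
    open interval, and by continuity also on the closed one.\<close>
  have const: "a t - Z t = a (T / 2) - Z (T / 2)" if t: "t \<in> {0..T}" for t
  proof (rule continuous_constant_on_closure[where S = "{0<..<T}" and f = "\<lambda>t. a t - Z t"])
    show "continuous_on (closure {0<..<T}) (\<lambda>t. a t - Z t)"
      using T a Z(1) by (simp add: continuous_on_diff)
    show "t \<in> closure {0<..<T}" using T t by simp
    fix x assume x: "x \<in> {0<..<T}"
    consider "x < T / 2" | "x = T / 2" | "T / 2 < x" by linarith
    then show "a x - Z x = a (T / 2) - Z (T / 2)"
    proof cases
      case 1
      then show ?thesis using inner[of x "T / 2"] Z(2)[of x "T / 2"] x by auto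
    next
      case 3
      then show ?thesis using inner[of "T / 2" x] Z(2)[of "T / 2" x] x by auto
    next
      case 2
      show ?thesis unfolding 2 ..
    qed
  qed
  show ?thesis using const[of s] const[of t] Z(2)[OF st] st by auto
qed

subsection \<open>The dual space and time derivatives\<close>

context bounded_domain
begin

abbreviation "V \<equiv> H10_space \<Omega>"

abbreviation "X \<equiv> H1_space \<Omega>"

lemma L2_V_eq: "L2_V \<Omega> T = G.V.B T"
  by (simp add: L2_V_def H1_norm_eq)

lemma L2_H1_eq: "L2_H1 \<Omega> T = E.B T"
  by (simp add: L2_H1_def H1_norm_eq)

lemma C_H_iff: "u \<in> C_H \<Omega> T \<longleftrightarrow> G.H.cont_curve T u"
  by (simp add: C_H_def G.H.cont_curve_def L2_nm)

text \<open>The supremum is attained at the normalised representative, or at 0 if the representative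
  is null; Cauchy-Schwarz bounds all other values.\<close>

lemma dual_norm_riesz:
  assumes r: "r \<in> V" and \<xi>: "\<And>v. v \<in> V \<Longrightarrow> \<xi> v = ipE r v"
  shows "dual_norm \<Omega> \<xi> = E.nm r"
  unfolding dual_norm_def H1_norm_eq
proof (rule cSup_eq_maximum)
  have rX: "r \<in> X" using r by (rule H10_H1)
  show "E.nm r \<in> (\<lambda>v. \<bar>\<xi> v\<bar>) ` {v \<in> V. E.nm v \<le> 1}"
  proof (cases "E.nm r = 0")
    case True
    then have "\<bar>\<xi> 0\<bar> = E.nm r" using \<xi>[OF G.V.zero_mem] rX by (simp add: E.ip_zero_right)
    then show ?thesis by (intro image_eqI[of _ _ 0]) (simp_all add: G.V.zero_mem E.nm_zero)
  next
    case False
    then have p: "0 < E.nm r" using E.nm_nonneg[OF rX] by simp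
    let ?v = "(1 / E.nm r) *\<^sub>R r"
    have v: "?v \<in> V" using r by (rule G.V.scale_mem)
    have n: "E.nm ?v = 1" using E.nm_scale[OF rX, of "1 / E.nm r"] p by simp
    have "\<xi> ?v = (1 / E.nm r) * ipE r r" using \<xi>[OF v] by (simp only: E.ip_scale_right[OF rX rX])
    also have "\<dots> = E.nm r" using p by (simp add: E.nm_sq[OF rX, symmetric] power2_eq_square)
    finally have "E.nm r = \<bar>\<xi> ?v\<bar>" using p by simp
    then show ?thesis using v n by (intro image_eqI[of _ _ ?v]) auto
  qed
  fix y assume "y \<in> (\<lambda>v. \<bar>\<xi> v\<bar>) ` {v \<in> V. E.nm v \<le> 1}"
  then obtain v where v: "v \<in> V" "E.nm v \<le> 1" and y: "y = \<bar>\<xi> v\<bar>" by auto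
  have "\<bar>ipE r v\<bar> \<le> E.nm r * E.nm v" by (rule E.cauchy_schwarz[OF rX H10_H1[OF v(1)]])
  also have "\<dots> \<le> E.nm r" using v(2) E.nm_nonneg[OF rX] by (rule mult_left_le)
  finally show "y \<le> E.nm r" using \<xi>[OF v(1)] y by simp
qed

lemma dual_I:
  assumes r: "r \<in> V" and \<xi>: "\<And>v. v \<in> V \<Longrightarrow> \<xi> v = ipE r v"
  shows "\<xi> \<in> dual_space \<Omega>"
  unfolding dual_space_def H1_norm_eq
proof (intro CollectI conjI ballI allI)
  fix v w assume vw: "v \<in> V" "w \<in> V"
  have "(\<lambda>x. v x + w x) = v + w" by (simp add: plus_fun_def)
  then show "\<xi> (\<lambda>x. v x + w x) = \<xi> v + \<xi> w"
    using \<xi>[OF G.V.add_mem[OF vw]] \<xi>[OF vw(1)] \<xi>[OF vw(2)] r vw by (simp add: G.V.ip_add_right)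
next
  fix c v assume v: "v \<in> V"
  have "(\<lambda>x. c * v x) = c *\<^sub>R v" by (simp add: fun_eq_iff)
  then show "\<xi> (\<lambda>x. c * v x) = c * \<xi> v"
    using \<xi>[OF G.V.scale_mem[OF v]] \<xi>[OF v] r v by (simp add: G.V.ip_scale_right)
next
  show "\<exists>C. \<forall>v\<in>V. \<bar>\<xi> v\<bar> \<le> C * E.nm v"
    using \<xi> G.V.cauchy_schwarz[OF r] by (intro exI[of _ "E.nm r"]) simp
qed

lemma dual_riesz:
  assumes \<xi>: "\<xi> \<in> dual_space \<Omega>"
  shows "\<exists>r\<in>V. \<forall>v\<in>V. ipE r v = \<xi> v"
proof -
  obtain C where C: "\<forall>v\<in>V. \<bar>\<xi> v\<bar> \<le> C * E.nm v"
    using \<xi> unfolding dual_space_def H1_norm_eq by blast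
  have add: "\<forall>v\<in>V. \<forall>w\<in>V. \<xi> (\<lambda>x. v x + w x) = \<xi> v + \<xi> w"
    and scale: "\<forall>c. \<forall>v\<in>V. \<xi> (\<lambda>x. c * v x) = c * \<xi> v"
    using \<xi> unfolding dual_space_def by blast+
  show ?thesis
  proof (rule G.V.riesz[of \<xi> C])
    show "\<xi> (x + y) = \<xi> x + \<xi> y" if "x \<in> V" "y \<in> V" for x y
      using add[rule_format, OF that] by (simp add: plus_fun_def)
    show "\<xi> (c *\<^sub>R x) = c * \<xi> x" if "x \<in> V" for c x
    proof -
      have "c *\<^sub>R x = (\<lambda>y. c * x y)" by (simp add: fun_eq_iff)
      then show ?thesis using scale[rule_format, OF that, of c] by simp
    qed
    show "\<bar>\<xi> x\<bar> \<le> C * E.nm x" if "x \<in> V" for x using C that by blast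
  qed blast
qed

text \<open>The Riesz map from the dual to \<open>V\<close>. Being an isometry, it moves dual-valued
  Bochner curves into \<open>V\<close>, where the abstract theory applies.\<close>

definition J :: "(('a \<Rightarrow> real) \<Rightarrow> real) \<Rightarrow> 'a \<Rightarrow> real" where
  "J \<xi> = (SOME r. r \<in> V \<and> (\<forall>v\<in>V. ipE r v = \<xi> v))"

lemma J:
  assumes "\<xi> \<in> dual_space \<Omega>"
  shows "J \<xi> \<in> V" and "v \<in> V \<Longrightarrow> ipE (J \<xi>) v = \<xi> v"
proof -
  have "\<exists>r. r \<in> V \<and> (\<forall>v\<in>V. ipE r v = \<xi> v)" using dual_riesz[OF assms] by blast
  from someI_ex[OF this] show "J \<xi> \<in> V" "v \<in> V \<Longrightarrow> ipE (J \<xi>) v = \<xi> v" unfolding J_def by blast+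
qed

lemma J_isometry:
  assumes \<xi>: "\<xi> \<in> dual_space \<Omega>" "\<eta> \<in> dual_space \<Omega>"
  shows "dual_norm \<Omega> (\<xi> - \<eta>) = E.nm (J \<xi> - J \<eta>)"
  by (rule dual_norm_riesz) (use J[OF \<xi>(1)] J[OF \<xi>(2)] in \<open>simp_all add: G.V.diff_mem G.V.ip_diff_left\<close>)

lemma J_B:
  assumes \<xi>: "\<xi> \<in> L2_Vdual \<Omega> T"
  shows "(\<lambda>t. J (\<xi> t)) \<in> G.V.B T"
proof (rule G.V.B_I)
  have s: "strongly_measurable (tm T) (dual_space \<Omega>) (dual_norm \<Omega>) \<xi>"
    and i: "integrable (tm T) (\<lambda>t. (dual_norm \<Omega> (\<xi> t))\<^sup>2)"
    using \<xi> unfolding L2_Vdual_def bochner_L2_def by blast+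
  show "G.V.sm T (\<lambda>t. J (\<xi> t))"
  proof (rule strongly_measurable_compose[OF s, where C = 1])
    show "J x \<in> V" if "x \<in> dual_space \<Omega>" for x using J(1)[OF that] .
    show "0 \<le> E.nm (J x - J y) \<and> E.nm (J x - J y) \<le> 1 * dual_norm \<Omega> (x - y)"
      if "x \<in> dual_space \<Omega>" "y \<in> dual_space \<Omega>" for x y
      using J_isometry[OF that] J(1)[OF that(1)] J(1)[OF that(2)] by (simp add: G.V.diff_mem G.V.nm_nonneg)
  qed
  show "integrable (tm T) (\<lambda>t. (dual_norm \<Omega> (\<xi> t))\<^sup>2)" by (rule i)
  show "AE t in tm T. (E.nm (J (\<xi> t)))\<^sup>2 \<le> (dual_norm \<Omega> (\<xi> t))\<^sup>2"
    using strongly_measurable_mem[OF s]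
  proof eventually_elim
    case (elim t)
    have "dual_norm \<Omega> (\<xi> t) = E.nm (J (\<xi> t))" by (rule dual_norm_riesz) (use J[OF elim] in auto)
    then show ?case by simp
  qed
qed

text \<open>The converse passage to \<open>J_B\<close>: simple curves that approximate the
  representatives induce simple dual-valued curves, and distances are preserved.\<close>

lemma L2_VdualI:
  assumes r: "r \<in> G.V.B T" and \<xi>: "AE t in tm T. \<forall>v\<in>V. \<xi> t v = ipE (r t) v"
  shows "\<xi> \<in> L2_Vdual \<Omega> T"
proof -
  obtain s where s: "\<And>n. simple_function (tm T) (s n)" "\<And>n t. 0 < t \<Longrightarrow> t < T \<Longrightarrow> s n t \<in> V"
    "AE t in tm T. r t \<in> V \<and> (\<forall>n. s n t \<in> V) \<and> (\<lambda>n. E.nm (s n t - r t)) \<longlonglongrightarrow> 0"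
    by (rule G.V.smE[OF G.V.B_sm[OF r]]) (rule that)
  have "strongly_measurable (tm T) (dual_space \<Omega>) (dual_norm \<Omega>) \<xi>"
    unfolding strongly_measurable_def
  proof (intro exI[of _ "\<lambda>n t. ipE (s n t)"] conjI allI)
    show "simple_function (tm T) (\<lambda>t. ipE (s n t))" for n
      using simple_function_compose[OF s(1)[of n], of ipE] by (simp add: comp_def)
    show "(\<lambda>t. ipE (s n t)) ` space (tm T) \<subseteq> dual_space \<Omega>" for n
      using s(2)[of _ n] by (auto intro!: dual_I)
    show "AE t in tm T. \<xi> t \<in> dual_space \<Omega> \<and> (\<lambda>n. dual_norm \<Omega> (\<xi> t - ipE (s n t))) \<longlonglongrightarrow> 0"
      using s(3) \<xi>
    proof eventually_elim
      case (elim t)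
      have "dual_norm \<Omega> (\<xi> t - ipE (s n t)) = E.nm (r t - s n t)" for n
        by (rule dual_norm_riesz) (use elim in \<open>simp_all add: G.V.diff_mem G.V.ip_diff_left\<close>)
      moreover have "E.nm (r t - s n t) = E.nm (s n t - r t)" for n
        by (rule G.V.nm_commute) (use elim in auto)
      ultimately show ?case using elim by (auto intro!: dual_I[of "r t"])
    qed
  qed
  moreover have "integrable (tm T) (\<lambda>t. (dual_norm \<Omega> (\<xi> t))\<^sup>2)"
  proof (rule tm_cong_AE(3)[OF _ _ G.V.B_nm_integrable[OF r]])
    show "AE t in tm T. (E.nm (r t))\<^sup>2 = (dual_norm \<Omega> (\<xi> t))\<^sup>2"
      using \<xi> G.V.B_mem[OF r] by eventually_elim (simp add: dual_norm_riesz)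
  qed (use G.V.B_nm_integrable[OF r] in simp)
  ultimately show ?thesis unfolding L2_Vdual_def bochner_L2_def by blast
qed

text \<open>The Riesz representative \<open>q\<close> supplies the absolutely continuous primitive of \<open>b\<close>.\<close>
lemma test_identity:
  assumes T: "0 < T" and u: "G.H.cont_curve T u" and q: "q \<in> G.V.B T" and v: "v \<in> V"
    and b: "AE t in tm T. ipE (q t) v = b t"
    and test: "\<And>\<phi>. \<phi> \<in> test_functions {0<..<T} \<Longrightarrow>
      (\<integral>t. deriv \<phi> t * ip2 \<mu> (u t) v \<partial>tm T) = - (\<integral>t. \<phi> t * b t \<partial>tm T)"
    and st: "0 \<le> s" "s \<le> t" "t \<le> T"
  shows "integrable (tm T) b" and "ip2 \<mu> (u t - u s) v = ti T s t b"
proof -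
  have vH: "v \<in> L2_space \<mu>" using v by (rule G.VH')
  have qi: "integrable (tm T) (\<lambda>t. ipE (q t) v)" by (rule G.V.B_ip_const_integrable[OF q v])
  show bi: "integrable (tm T) b" by (rule tm_cong_AE(3)[OF _ b qi]) (use qi in simp)
  obtain Z where Z: "G.V.prim T q Z" "E.nm (Z 0) = 0" by (rule G.V.prim_exists[OF q]) (rule that)
  have "ip2 \<mu> (u t) v - ip2 \<mu> (u s) v = ti T s t b"
  proof (rule distributional_derivative[OF T _ bi _ _ test st, where Z = "\<lambda>t. ipE (Z t) v"])
    show "continuous_on {0..T} (\<lambda>t. ip2 \<mu> (u t) v)" by (rule G.H.cont_curve_ip[OF u vH])
    show "continuous_on {0..T} (\<lambda>t. ipE (Z t) v)"
      by (rule G.V.cont_curve_ip[OF G.V.prim_cont_curve[OF Z(1) q] v])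
    show "ipE (Z t) v - ipE (Z s) v = ti T s t b" if "0 \<le> s" "s \<le> t" "t \<le> T" for s t
      using G.V.prim_eq[OF Z(1) that v] G.V.prim_mem[OF Z(1)] that v ti_cong_AE[OF qi bi b]
      by (simp add: G.V.ip_diff_left)
  qed
  then show "ip2 \<mu> (u t - u s) v = ti T s t b"
    using G.H.cont_curve_mem[OF u] st vH by (simp add: G.H.ip_diff_left)
qed

lemma Vdual_AE:
  assumes "\<xi> \<in> L2_Vdual \<Omega> T"
  shows "AE t in tm T. \<xi> t \<in> dual_space \<Omega>"
  using assms unfolding L2_Vdual_def by (rule bochner_L2_mem)

lemma ip2_real: "ip2 M f (g :: 'a \<Rightarrow> real) = (\<integral>x. f x * g x \<partial>M)"
  by (simp add: ip2_def)

text \<open>This bridges the distributional definition and the integrated identities of the abstract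
  theory, with \<open>J\<close> providing the curve in \<open>V\<close>.\<close>

lemma time_derivative:
  assumes T: "0 < T" and u: "G.H.cont_curve T u" and d: "has_time_derivative \<Omega> T u \<xi>" and v: "v \<in> V"
    and st: "0 \<le> s" "s \<le> t" "t \<le> T"
  shows "ip2 \<mu> (u t - u s) v = ti T s t (\<lambda>a. ipE (J (\<xi> a)) v)"
proof (rule test_identity(2)[OF T u J_B v _ _ st])
  show \<xi>: "\<xi> \<in> L2_Vdual \<Omega> T" using d unfolding has_time_derivative_def by blast
  show "AE t in tm T. ipE (J (\<xi> t)) v = ipE (J (\<xi> t)) v" by simp
  fix \<phi> assume \<phi>: "\<phi> \<in> test_functions {0<..<T}"
  have "(\<integral>t. deriv \<phi> t * ip2 \<mu> (u t) v \<partial>tm T) = - (\<integral>t. \<phi> t * \<xi> t v \<partial>tm T)"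
    using d \<phi> v unfolding has_time_derivative_def ip2_real by blast
  also have "(\<integral>t. \<phi> t * \<xi> t v \<partial>tm T) = (\<integral>t. \<phi> t * ipE (J (\<xi> t)) v \<partial>tm T)"
  proof (rule tm_cong_AE(2)[symmetric])
    have "\<phi> \<in> borel_measurable (tm T)"
      using tm_continuous_integrable[of T \<phi>] smooth_continuous[OF test_functions_smooth[OF \<phi>]] by (auto intro: continuous_on_subset)
    moreover have "(\<lambda>t. ipE (J (\<xi> t)) v) \<in> borel_measurable (tm T)"
      using G.V.B_ip_const_integrable[OF J_B[OF \<xi>] v] by simp
    ultimately show "(\<lambda>t. \<phi> t * ipE (J (\<xi> t)) v) \<in> borel_measurable (tm T)" by (rule borel_measurable_times)
    show "AE t in tm T. \<phi> t * ipE (J (\<xi> t)) v = \<phi> t * \<xi> t v"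
      using Vdual_AE[OF \<xi>] by eventually_elim (simp add: J(2) v)
  qed
  finally show "(\<integral>t. deriv \<phi> t * ip2 \<mu> (u t) v \<partial>tm T) = - (\<integral>t. \<phi> t * ipE (J (\<xi> t)) v \<partial>tm T)" .
qed

subsection \<open>The elliptic operator\<close>

lemma proj_ex: "w \<in> X \<Longrightarrow> \<exists>r. r \<in> V \<and> (\<forall>v\<in>V. ipE r v = ipE w v)"
proof (rule G.V.riesz[of "ipE w" "E.nm w"])
  assume w: "w \<in> X"
  show "ipE w (x + y) = ipE w x + ipE w y" if "x \<in> V" "y \<in> V" for x y
    using w that by (simp add: H10_H1 E.ip_add_right)
  show "ipE w (c *\<^sub>R x) = c * ipE w x" if "x \<in> V" for c x
    using w that by (simp add: H10_H1 E.ip_scale_right)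
  show "\<bar>ipE w x\<bar> \<le> E.nm w * E.nm x" if "x \<in> V" for x
    by (rule E.cauchy_schwarz[OF w H10_H1[OF that]])
qed blast

text \<open>The orthogonal projection of H1 onto the closure of the test functions, obtained as the
  representative of the functional \<open>ipE w\<close> on \<open>V\<close>.\<close>

definition proj :: "('a \<Rightarrow> real) \<Rightarrow> 'a \<Rightarrow> real" where
  "proj w = (SOME r. r \<in> V \<and> (\<forall>v\<in>V. ipE r v = ipE w v))"

lemma proj:
  assumes "w \<in> X"
  shows proj_mem: "proj w \<in> V" and proj_ip: "v \<in> V \<Longrightarrow> ipE (proj w) v = ipE w v"
  using someI_ex[OF proj_ex[OF assms]] unfolding proj_def by blast+

lemma proj_lipschitz:
  assumes w: "w \<in> X" "w' \<in> X"
  shows "E.nm (proj w - proj w') \<le> E.nm (w - w')"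
proof -
  let ?d = "proj w - proj w'"
  have d: "?d \<in> V" using proj_mem[OF w(1)] proj_mem[OF w(2)] by (rule G.V.diff_mem)
  have dX: "?d \<in> X" "w - w' \<in> X" using d w by (simp_all add: H10_H1 E.diff_mem)
  have "(E.nm ?d)\<^sup>2 = ipE (w - w') ?d"
    using proj_ip[OF w(1) d] proj_ip[OF w(2) d] proj_mem[OF w(1)] proj_mem[OF w(2)] d w
    by (simp add: E.nm_sq dX E.ip_diff_left H10_H1)
  also have "\<dots> \<le> E.nm (w - w') * E.nm ?d" by (rule E.cauchy_schwarz'[OF dX(2,1)])
  finally have "E.nm ?d * E.nm ?d \<le> E.nm (w - w') * E.nm ?d" by (simp add: power2_eq_square)
  then show ?thesis using E.nm_nonneg[OF dX(1)] E.nm_nonneg[OF dX(2)]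
    by (cases "E.nm ?d = 0") (auto simp: mult_le_cancel_right)
qed

lemma proj_id:
  assumes w: "w \<in> V" shows "E.nm (proj w - w) = 0"
proof -
  have wX: "w \<in> X" using w by (rule H10_H1)
  have d: "proj w - w \<in> V" by (rule G.V.diff_mem[OF proj_mem[OF wX] w])
  have "ipE (proj w - w) (proj w - w) = 0"
    using proj_ip[OF wX d] proj_mem[OF wX] w d by (simp add: G.V.ip_diff_left)
  then show ?thesis by (simp add: E.nm_def)
qed

lemma proj_B:
  assumes f: "f \<in> E.B T" shows "(\<lambda>t. proj (f t)) \<in> G.V.B T"
proof (rule G.V.B_I[OF _ E.B_nm_integrable[OF f]])
  show "G.V.sm T (\<lambda>t. proj (f t))"
    by (rule strongly_measurable_compose[OF E.B_sm[OF f], where C = 1])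
      (auto simp: proj_mem proj_lipschitz E.nm_nonneg E.diff_mem H10_H1)
  show "AE t in tm T. (E.nm (proj (f t)))\<^sup>2 \<le> (E.nm (f t))\<^sup>2"
    using E.B_mem[OF f]
  proof eventually_elim
    case (elim t)
    let ?p = "proj (f t)"
    have p: "?p \<in> V" "?p \<in> X" using proj_mem[OF elim] H10_H1 by auto
    have "E.nm ?p * E.nm ?p \<le> E.nm (f t) * E.nm ?p"
      using E.cauchy_schwarz'[OF elim p(2)] proj_ip[OF elim p(1)] E.nm_sq[OF p(2)] by (simp add: power2_eq_square)
    then have "E.nm ?p \<le> E.nm (f t)" using E.nm_nonneg[OF p(2)] E.nm_nonneg[OF elim]
      by (cases "E.nm ?p = 0") (auto simp: mult_le_cancel_right)
    then show ?case using E.nm_nonneg[OF p(2)] by (intro power_mono)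
  qed
qed

text \<open>The simple functions approximating a curve in H1 may take values outside
  \<open>V\<close> even if the curve does not. Projecting them repairs this, and the projected curve
  differs from \<open>f\<close> by null elements.\<close>

lemma VB_I:
  assumes f: "f \<in> E.B T" and V: "AE t in tm T. f t \<in> V"
  shows "f \<in> G.V.B T"
  by (rule G.V.B_cong[OF proj_B[OF f]]) (use V in eventually_elim, simp add: proj_id)

lemma VB_EB:
  assumes f: "f \<in> G.V.B T" shows "f \<in> E.B T"
proof (rule E.B_I[OF _ G.V.B_nm_integrable[OF f]])
  show "E.sm T f"
    by (rule strongly_measurable_compose[OF G.V.B_sm[OF f], where C = 1 and \<Phi> = "\<lambda>x. x"])
      (auto simp: H10_H1 E.nm_nonneg E.diff_mem)
qed simp

lemma EB_HB:
  assumes f: "f \<in> E.B T" shows "f \<in> G.H.B T"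
proof (rule G.H.B_I[OF _ E.B_nm_integrable[OF f]])
  show "G.H.sm T f"
    by (rule strongly_measurable_compose[OF E.B_sm[OF f], where C = 1 and \<Phi> = "\<lambda>x. x"])
      (auto simp: H1_L2 L2_nm_le L2.nm_nonneg L2.diff_mem E.diff_mem)
  show "AE t in tm T. (L2.nm \<mu> (f t))\<^sup>2 \<le> (E.nm (f t))\<^sup>2"
    using E.B_mem[OF f] by eventually_elim (simp add: power_mono L2_nm_le L2.nm_nonneg H1_L2)
qed

abbreviation DD :: "('a \<Rightarrow> real) \<Rightarrow> ('a \<Rightarrow> real) \<Rightarrow> real" where
  "DD u v \<equiv> ip2 \<mu> (D u) (D v)"

lemma DD_eq: "DD u v = ipE u v - ip2 \<mu> u v"
  by (simp add: ipE_def)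

lemma DD_integrable:
  assumes "f \<in> E.B T" "g \<in> E.B T"
  shows "integrable (tm T) (\<lambda>t. DD (f t) (g t))"
  unfolding DD_eq
  by (intro Bochner_Integration.integrable_diff E.B_ip_integrable G.H.B_ip_integrable EB_HB assms)

lemma DD_bound: "u \<in> X \<Longrightarrow> v \<in> X \<Longrightarrow> \<bar>DD u v\<bar> \<le> E.nm u * E.nm v"
  using L2.cauchy_schwarz[OF H1_D H1_D, of u v] mult_mono[OF L2_nm_le(2)[of u] L2_nm_le(2)[of v]]
  by (simp add: L2.nm_nonneg H1_D E.nm_nonneg)

text \<open>The representative in \<open>V\<close> of the Dirichlet form of \<open>w\<close>, that
  is of the functional - div Dw. The form is the full inner product minus that of \<open>H\<close>;
  \<open>proj\<close> represents the former and \<open>G.R\<close> the latter.\<close>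

definition A :: "('a \<Rightarrow> real) \<Rightarrow> 'a \<Rightarrow> real" where "A w = proj w - G.R w"

lemma A:
  assumes w: "w \<in> X"
  shows A_mem: "A w \<in> V" and A_ip: "v \<in> V \<Longrightarrow> ipE (A w) v = DD w v"
  using proj_mem[OF w] proj_ip[OF w] G.R_mem[OF H1_L2[OF w]] G.R_ip[OF H1_L2[OF w]]
  by (simp_all add: A_def G.V.diff_mem G.V.ip_diff_left DD_eq)

lemma A_B:
  assumes f: "f \<in> E.B T" shows "(\<lambda>t. A (f t)) \<in> G.V.B T"
  using G.V.B_diff[OF proj_B[OF f] G.R_B[OF EB_HB[OF f]]] by (simp add: A_def fun_diff_def)

subsection \<open>The weak formulation in integrated form\<close>

definition weak_form :: "real \<Rightarrow> (real \<Rightarrow> 'a \<Rightarrow> real) \<Rightarrow> bool" where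
  "weak_form T u \<longleftrightarrow> (\<forall>v\<in>V. \<forall>s t. 0 \<le> s \<longrightarrow> s \<le> t \<longrightarrow> t \<le> T \<longrightarrow>
     ip2 \<mu> (u t - u s) v = ti T s t (\<lambda>a. - DD (u a) v))"

lemma weak_formD: "weak_form T u \<Longrightarrow> v \<in> V \<Longrightarrow> 0 \<le> s \<Longrightarrow> s \<le> t \<Longrightarrow> t \<le> T \<Longrightarrow>
    ip2 \<mu> (u t - u s) v = ti T s t (\<lambda>a. - DD (u a) v)"
  unfolding weak_form_def by blast

lemma DD_const_integrable: "u \<in> E.B T \<Longrightarrow> v \<in> X \<Longrightarrow> integrable (tm T) (\<lambda>a. - DD (u a) v)"
  by (intro Bochner_Integration.integrable_minus DD_integrable[of u T "\<lambda>_. v"] E.B_const)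

text \<open>
  For fixed times the identity reads \<open>(y, v) = 0\<close> in \<open>V\<close> for a fixed \<open>y \<in> V\<close>, so density of the
  test functions suffices.
\<close>
lemma weak_formI:
  assumes T: "0 < T" and uE: "u \<in> E.B T" and u: "G.H.cont_curve T u"
    and test: "\<And>\<phi> w. \<phi> \<in> test_functions {0<..<T} \<Longrightarrow> w \<in> test_functions \<Omega> \<Longrightarrow>
      (\<integral>t. deriv \<phi> t * ip2 \<mu> (u t) w \<partial>tm T) = (\<integral>t. \<phi> t * DD (u t) w \<partial>tm T)"
  shows "weak_form T u"
  unfolding weak_form_def
proof (intro ballI allI impI)
  fix v s t assume v: "v \<in> V" and st: "0 \<le> s" "s \<le> t" "t \<le> T"
  define q where "q = (-1) *\<^sub>R (\<lambda>t. A (u t))"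
  have q: "q \<in> G.V.B T" unfolding q_def by (rule G.V.B_scale[OF A_B[OF uE]])
  have qb: "AE t in tm T. ipE (q t) w = - DD (u t) w" if "w \<in> V" for w
    using E.B_mem[OF uE]
  proof eventually_elim
    case (elim t)
    then show ?case using G.V.ip_scale_left[OF A_mem[OF elim] that, of "-1"] A_ip[OF elim that] by (simp add: q_def)
  qed
  obtain Z where Z: "G.V.prim T q Z" "E.nm (Z 0) = 0" by (rule G.V.prim_exists[OF q]) (rule that)
  have Zt: "ipE (Z t - Z s) w = ti T s t (\<lambda>a. - DD (u a) w)" if "w \<in> V" for w
    using G.V.prim_eq[OF Z(1) st that]
      ti_cong_AE[OF G.V.B_ip_const_integrable[OF q that] DD_const_integrable[OF uE H10_H1[OF that]] qb[OF that]]
    by simp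
  define h where "h = u t - u s"
  have h: "h \<in> L2_space \<mu>" unfolding h_def using G.H.cont_curve_mem[OF u] st by (intro G.H.diff_mem) auto
  define y where "y = G.R h - (Z t - Z s)"
  have zV: "Z t - Z s \<in> V" using G.V.prim_mem[OF Z(1)] st by (intro G.V.diff_mem) auto
  have y: "y \<in> V" unfolding y_def by (rule G.V.diff_mem[OF G.R_mem[OF h] zV])
  have yw: "ipE y w = ip2 \<mu> h w - ti T s t (\<lambda>a. - DD (u a) w)" if "w \<in> V" for w
    unfolding y_def using G.V.ip_diff_left[OF G.R_mem[OF h] zV that] G.R_ip[OF h that] Zt[OF that] by simp
  have y0: "ipE y w = 0" if w: "w \<in> test_functions \<Omega>" for w
  proof -
    have wV: "w \<in> V" using w by (rule H10_test)
    have "ip2 \<mu> (u t - u s) w = ti T s t (\<lambda>a. - DD (u a) w)"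
    proof (rule test_identity(2)[OF T u q wV qb[OF wV] _ st])
      show "(\<integral>t. deriv \<phi> t * ip2 \<mu> (u t) w \<partial>tm T) = - (\<integral>t. \<phi> t * - DD (u t) w \<partial>tm T)"
        if "\<phi> \<in> test_functions {0<..<T}" for \<phi> using test[OF that w] by simp
    qed
    then show ?thesis using yw[OF wV] by (simp add: h_def)
  qed
  have "\<bar>ipE y v\<bar> \<le> 0 + e" if e: "0 < e" for e
  proof -
    have n: "0 \<le> E.nm y" by (rule G.V.nm_nonneg[OF y])
    \<comment> \<open>The tolerance is divided by the norm of \<open>y\<close>; the added 1 covers a
      null \<open>y\<close>.\<close>
    obtain w where w: "w \<in> test_functions \<Omega>" "E.nm (v - w) < e / (E.nm y + 1)"
      by (rule H10_approx[OF v, of "e / (E.nm y + 1)"]) (use e n in \<open>auto intro: that\<close>)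
    have wV: "w \<in> V" using w(1) by (rule H10_test)
    have "ipE y v = ipE y (v - w)" using G.V.ip_diff_right[OF v wV y] y0[OF w(1)] by simp
    then have "\<bar>ipE y v\<bar> \<le> E.nm y * E.nm (v - w)" using G.V.cauchy_schwarz[OF y G.V.diff_mem[OF v wV]] by simp
    also have "\<dots> \<le> (E.nm y + 1) * (e / (E.nm y + 1))"
      using w(2) n G.V.nm_nonneg[OF G.V.diff_mem[OF v wV]] by (intro mult_mono) auto
    also have "\<dots> = e" using n by simp
    finally show ?thesis by simp
  qed
  then have "\<bar>ipE y v\<bar> \<le> 0" by (rule field_le_epsilon)
  then show "ip2 \<mu> (u t - u s) v = ti T s t (\<lambda>a. - DD (u a) v)" using yw[OF v] by (simp add: h_def)
qed

lemma weak_form_mono: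
  assumes w: "weak_form T u" and u: "u \<in> E.B T" and \<tau>: "\<tau> \<le> T"
  shows "weak_form \<tau> u"
  unfolding weak_form_def
proof (intro ballI allI impI)
  fix v s t assume v: "v \<in> V" and st: "0 \<le> s" "s \<le> t" "t \<le> \<tau>"
  have "(\<lambda>a. - DD (u a) v) \<in> borel_measurable (tm T)" using DD_const_integrable[OF u H10_H1[OF v]] by simp
  from ti_horizon[OF st(3) \<tau> this, of s] weak_formD[OF w v st(1,2)] st \<tau>
  show "ip2 \<mu> (u t - u s) v = ti \<tau> s t (\<lambda>a. - DD (u a) v)" by simp
qed

text \<open>The curve \<open>- A (u t)\<close> represents the functional, which gives membership in
  the dual Bochner space; the distributional identity then follows by parts at each fixed
  \<open>v\<close>.\<close>

lemma weak_form_time_derivative: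
  assumes T: "0 < T" and uE: "u \<in> E.B T" and u: "G.H.cont_curve T u" and w: "weak_form T u"
  shows "has_time_derivative \<Omega> T u (\<lambda>t v. - DD (u t) v)"
  unfolding has_time_derivative_def
proof (intro conjI ballI)
  define q where "q = (-1) *\<^sub>R (\<lambda>t. A (u t))"
  have q: "q \<in> G.V.B T" unfolding q_def by (rule G.V.B_scale[OF A_B[OF uE]])
  have "AE t in tm T. \<forall>v\<in>V. - DD (u t) v = ipE (q t) v"
    using E.B_mem[OF uE]
  proof eventually_elim
    case (elim t)
    show ?case using G.V.ip_scale_left[OF A_mem[OF elim], of _ "-1"] A_ip[OF elim] by (simp add: q_def)
  qed
  then show "(\<lambda>t v. - DD (u t) v) \<in> L2_Vdual \<Omega> T" by (rule L2_VdualI[OF q])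
  fix \<phi> v assume \<phi>: "\<phi> \<in> test_functions {0<..<T}" and v: "v \<in> V"
  have vH: "v \<in> L2_space \<mu>" using v by (rule G.VH')
  obtain K where K: "K \<subseteq> {0<..<T}" "\<And>x. x \<notin> K \<Longrightarrow> \<phi> x = 0" by (rule test_functionsE[OF \<phi>]) (rule that)
  have "(\<integral>t. deriv \<phi> t * ip2 \<mu> (u t) v \<partial>tm T) = - (\<integral>t. \<phi> t * - DD (u t) v \<partial>tm T)"
  proof (rule parts_scalar[OF T G.H.cont_curve_ip[OF u vH] DD_const_integrable[OF uE H10_H1[OF v]] _ test_functions_smooth[OF \<phi>]])
    show "ip2 \<mu> (u t) v - ip2 \<mu> (u s) v = ti T s t (\<lambda>a. - DD (u a) v)" if "0 \<le> s" "s \<le> t" "t \<le> T" for s t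
      using weak_formD[OF w v that] G.H.cont_curve_mem[OF u] that vH by (simp add: G.H.ip_diff_left)
    have "0 \<notin> K" "T \<notin> K" using K(1) by auto
    then show "\<phi> 0 = 0" "\<phi> T = 0" using K(2) by auto
  qed
  then show "(\<integral>t. deriv \<phi> t * (\<integral>x. u t x * v x \<partial>\<mu>) \<partial>tm T) = - (\<integral>t. \<phi> t * - DD (u t) v \<partial>tm T)"
    unfolding ip2_real .
qed

lemma energy_classD:
  assumes "u \<in> energy_class \<Omega> T g"
  shows "u \<in> E.B T" "AE t in tm T. u t - g t \<in> V" "G.H.cont_curve T u" "AE x in \<mu>. u 0 x = g 0 x"
  using assms unfolding energy_class_def L2_H1g_def L2_H1_eq by (auto simp only: C_H_iff mem_Collect_eq Int_iff)

text \<open>With the derivative taken to be the negative Dirichlet form itself, the tested equation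
  holds identically.\<close>

lemma weak_form_energy:
  assumes T: "0 < T" and c: "u \<in> energy_class \<Omega> T g" and w: "weak_form T u"
  shows "energy_weak_solution \<Omega> T g u"
proof -
  note u = energy_classD[OF c]
  show ?thesis
    unfolding energy_weak_solution_def
    by (intro conjI c exI[of _ "\<lambda>t v. - DD (u t) v"] weak_form_time_derivative T u w)
      (simp add: ip2_def)
qed

text \<open>The step curve equal to \<open>v\<close> on \<open>(s,t]\<close> and 0 elsewhere is an
  admissible test, and it localises the equation to that interval.\<close>

lemma energy_weak_form:
  assumes T: "0 < T" and e: "energy_weak_solution \<Omega> T g u"
  shows "weak_form T u"
  unfolding weak_form_def
proof (intro ballI allI impI)
  fix v s t assume v: "v \<in> V" and st: "0 \<le> s" "s \<le> t" "t \<le> T"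
  have c: "u \<in> energy_class \<Omega> T g" using e unfolding energy_weak_solution_def by blast
  note u = energy_classD[OF c]
  obtain \<xi> where d: "has_time_derivative \<Omega> T u \<xi>"
    and eq: "\<forall>\<phi>\<in>L2_V \<Omega> T. (\<integral>t. \<xi> t (\<phi> t) \<partial>tm T) + (\<integral>t. DD (u t) (\<phi> t) \<partial>tm T) = 0"
    using e unfolding energy_weak_solution_def ip2_def by blast
  have \<xi>: "\<xi> \<in> L2_Vdual \<Omega> T" using d unfolding has_time_derivative_def by blast
  define \<phi> where "\<phi> a = indicat_real {s<..t} a *\<^sub>R v" for a
  have \<phi>: "\<phi> \<in> G.V.B T" unfolding \<phi>_def[abs_def] by (rule G.ti_ipV_bip(2)[OF G.V.B_const[OF v] v])
  have vX: "v \<in> X" "v \<in> L2_space \<mu>" using v H10_H1 G.VH' by auto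
  have Ji: "integrable (tm T) (\<lambda>a. ipE (J (\<xi> a)) v)" by (rule G.V.B_ip_const_integrable[OF J_B[OF \<xi>] v])
  have 1: "ti T s t (\<lambda>a. ipE (J (\<xi> a)) v) = (\<integral>a. \<xi> a (\<phi> a) \<partial>tm T)"
    unfolding ti_def
  proof (rule tm_cong_AE(2))
    show "(\<lambda>a. indicat_real {s<..t} a * ipE (J (\<xi> a)) v) \<in> borel_measurable (tm T)"
      using ti_integrable[OF Ji, of s t] by simp
    show "AE a in tm T. indicat_real {s<..t} a * ipE (J (\<xi> a)) v = \<xi> a (\<phi> a)"
      using Vdual_AE[OF \<xi>]
    proof eventually_elim
      case (elim a)
      have "\<xi> a (\<phi> a) = ipE (J (\<xi> a)) (\<phi> a)" using J(2)[OF elim] G.V.scale_mem[OF v] by (simp add: \<phi>_def)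
      then show ?case unfolding \<phi>_def G.V.ip_scale_right[OF v J(1)[OF elim]] by simp
    qed
  qed
  have Di: "integrable (tm T) (\<lambda>a. DD (u a) v)" by (rule DD_integrable[OF u(1) E.B_const[OF vX(1)]])
  have 2: "ti T s t (\<lambda>a. DD (u a) v) = (\<integral>a. DD (u a) (\<phi> a) \<partial>tm T)"
    unfolding ti_def
  proof (rule tm_cong_AE(2))
    show "(\<lambda>a. indicat_real {s<..t} a * DD (u a) v) \<in> borel_measurable (tm T)"
      using ti_integrable[OF Di, of s t] by simp
    show "AE a in tm T. indicat_real {s<..t} a * DD (u a) v = DD (u a) (\<phi> a)"
      using E.B_mem[OF u(1)]
      by eventually_elim (simp add: DD_eq \<phi>_def E.ip_scale_right[OF vX(1)] G.H.ip_scale_right[OF vX(2)] H1_L2 right_diff_distrib)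
  qed
  show "ip2 \<mu> (u t - u s) v = ti T s t (\<lambda>a. - DD (u a) v)"
    using time_derivative[OF T u(3) d v st] eq[unfolded L2_V_eq, rule_format, OF \<phi>] 1 2 by (simp add: ti_minus)
qed

end

subsection \<open>Time slices of test functions\<close>

lemma smooth_slice:
  fixes \<phi> :: "'a::euclidean_space \<times> real \<Rightarrow> real"
  assumes "smooth \<phi>" shows "smooth (\<lambda>x. \<phi> (x, s))"
proof -
  have "bounded_linear (\<lambda>x::'a. (x, 0::real))" by (intro bounded_linear_intros)
  from smooth_affine[OF this assms, of "(0, s)"] show ?thesis by simp
qed

lemma slice_frechet:
  fixes \<phi> :: "'a::euclidean_space \<times> real \<Rightarrow> real"
  assumes \<phi>: "smooth \<phi>"
  shows "frechet_derivative (\<lambda>x. \<phi> (x, s)) (at x) i = frechet_derivative \<phi> (at (x, s)) (i, 0)"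
proof -
  have "((\<lambda>x::'a. (x, s)) has_derivative (\<lambda>h. (h, 0))) (at x)"
    by (intro has_derivative_Pair has_derivative_ident has_derivative_const)
  from frechet_eq[OF has_derivative_compose[OF this smooth_deriv[OF \<phi>]]] show ?thesis by simp
qed

lemma slice_time_deriv:
  fixes \<phi> :: "'a::euclidean_space \<times> real \<Rightarrow> real"
  assumes \<phi>: "smooth \<phi>"
  shows "((\<lambda>s. \<phi> (x, s)) has_real_derivative frechet_derivative \<phi> (at (x, s)) (0, 1)) (at s)"
proof -
  have "((\<lambda>s::real. (x, s)) has_derivative (\<lambda>h. (0, h))) (at s)"
    by (intro has_derivative_Pair has_derivative_ident has_derivative_const)
  from has_derivative_compose[OF this smooth_deriv[OF \<phi>]]
  have d: "((\<lambda>s. \<phi> (x, s)) has_derivative (\<lambda>h. frechet_derivative \<phi> (at (x, s)) (0, h))) (at s)" .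
  have "(\<lambda>h. frechet_derivative \<phi> (at (x, s)) (0, h)) = (\<lambda>h. frechet_derivative \<phi> (at (x, s)) (0, 1) * h)"
  proof
    fix h
    show "frechet_derivative \<phi> (at (x, s)) (0, h) = frechet_derivative \<phi> (at (x, s)) (0, 1) * h"
      using linear_scale[OF smooth_linear[OF \<phi>], of "(x, s)" h "(0, 1)"] by (simp add: mult.commute)
  qed
  then show ?thesis using d unfolding has_field_derivative_def by metis
qed

lemma slice_MVT:
  fixes \<phi> :: "'a::euclidean_space \<times> real \<Rightarrow> real"
  assumes \<phi>: "smooth \<phi>"
  shows "\<exists>\<zeta>. \<bar>\<zeta> - s\<bar> \<le> \<bar>k\<bar> \<and> \<phi> (x, s + k) - \<phi> (x, s) = k * frechet_derivative \<phi> (at (x, \<zeta>)) (0, 1)"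
proof -
  consider "k = 0" | "0 < k" | "k < 0" by linarith
  then show ?thesis
  proof cases
    case 1
    then show ?thesis by (intro exI[of _ s]) simp
  next
    case 2
    then have "s < s + k" by simp
    from MVT2[OF this slice_time_deriv[OF \<phi>]]
    obtain z where z: "s < z \<and> z < s + k \<and>
      \<phi> (x, s + k) - \<phi> (x, s) = (s + k - s) * frechet_derivative \<phi> (at (x, z)) (0, 1)" ..
    then show ?thesis by (intro exI[of _ z]) simp
  next
    case 3
    then have "s + k < s" by simp
    from MVT2[OF this slice_time_deriv[OF \<phi>]]
    obtain z where z: "s + k < z \<and> z < s \<and>
      \<phi> (x, s) - \<phi> (x, s + k) = (s - (s + k)) * frechet_derivative \<phi> (at (x, z)) (0, 1)" ..
    then show ?thesis by (intro exI[of _ z] conjI) (linarith, simp add: algebra_simps)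
  qed
qed

lemma slice_test:
  fixes \<phi> :: "'a::euclidean_space \<times> real \<Rightarrow> real"
  assumes \<phi>: "\<phi> \<in> test_functions (\<Omega> \<times> {0<..<T})"
  shows "(\<lambda>x. \<phi> (x, s)) \<in> test_functions \<Omega>" and "s \<notin> {0<..<T} \<Longrightarrow> \<phi> (x, s) = 0"
proof -
  obtain K where K: "compact K" "K \<subseteq> \<Omega> \<times> {0<..<T}" "\<And>x. x \<notin> K \<Longrightarrow> \<phi> x = 0"
    by (rule test_functionsE[OF \<phi>]) (rule that)
  show "(\<lambda>x. \<phi> (x, s)) \<in> test_functions \<Omega>"
  proof (rule test_functionsI[OF smooth_slice[OF test_functions_smooth[OF \<phi>]]])
    show "compact (fst ` K)" by (rule compact_continuous_image[OF _ K(1)]) (intro continuous_intros)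
    show "fst ` K \<subseteq> \<Omega>" using K(2) by auto
    show "x \<in> fst ` K" if "\<phi> (x, s) \<noteq> 0" for x using K(3)[of "(x, s)"] that by (force simp: image_iff)
  qed
  show "\<phi> (x, s) = 0" if "s \<notin> {0<..<T}" using K(2) K(3)[of "(x, s)"] that by blast
qed

lemma slice_uniform:
  fixes \<phi> :: "'a::euclidean_space \<times> real \<Rightarrow> real"
  assumes \<phi>: "\<phi> \<in> test_functions U" and e: "0 < e"
  shows "\<forall>\<^sub>F s in at t within S. \<forall>x. \<bar>\<phi> (x, s) - \<phi> (x, t)\<bar> < e"
proof -
  obtain d where d: "0 < d" "\<And>p q. dist p q < d \<Longrightarrow> \<bar>\<phi> p - \<phi> q\<bar> < e" by (rule test_functions_uniform[OF \<phi> e]) (rule that)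
  have "\<bar>\<phi> (x, s) - \<phi> (x, t)\<bar> < e" if "dist s t < d" for s x
    by (rule d(2)) (use that in \<open>simp add: dist_Pair_Pair\<close>)
  then show ?thesis unfolding eventually_at using d(1) by blast
qed

section \<open>Time slices as curves in the Gaussian spaces\<close>

context bounded_domain
begin

definition M0 :: real where "M0 = sqrt (measure \<mu> (space \<mu>))"

lemma M0_nonneg: "0 \<le> M0" by (simp add: M0_def)

lemma L2_nm_bounded:
  fixes f :: "'a \<Rightarrow> 'b::euclidean_space"
  assumes f: "f \<in> L2_space \<mu>" and b: "AE x in \<mu>. norm (f x) \<le> c" and c: "0 \<le> c"
  shows "L2.nm \<mu> f \<le> M0 * c"
proof -
  have i: "integrable \<mu> (\<lambda>x. (norm (f x))\<^sup>2)" using f by (simp add: L2_space_def)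
  have "(\<integral>x. (norm (f x))\<^sup>2 \<partial>\<mu>) \<le> (\<integral>x. c\<^sup>2 \<partial>\<mu>)"
    by (rule integral_mono_AE[OF i integrable_const_\<mu>]) (use b in eventually_elim, simp add: power_mono)
  also have "\<dots> = measure \<mu> (space \<mu>) * c\<^sup>2" by simp
  finally have "sqrt (\<integral>x. (norm (f x))\<^sup>2 \<partial>\<mu>) \<le> sqrt (measure \<mu> (space \<mu>) * c\<^sup>2)" by (rule real_sqrt_le_mono)
  then show ?thesis using c by (simp add: L2_nm L2_norm_def M0_def real_sqrt_mult)
qed

lemma E_nm_le: "u \<in> X \<Longrightarrow> E.nm u \<le> L2.nm \<mu> u + L2.nm \<mu> (D u)"
  using sqrt_sum_squares_le_sum[of "L2.nm \<mu> u" "L2.nm \<mu> (D u)"] E_nm_eq[OF _ E.zero_mem, of u]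
  by (simp add: E.nm_def ipE_def L2.nm_sq[symmetric] H1_L2 H1_D L2.nm_nonneg)

text \<open>A test function and its spatial derivatives are uniformly continuous, so slices at
  nearby times are uniformly close; the finite mass of the measure turns this into closeness in
  H1.\<close>

lemma slice_cont_curve:
  assumes \<phi>: "\<phi> \<in> test_functions (\<Omega> \<times> {0<..<T})"
  shows "E.cont_curve T (\<lambda>s x. \<phi> (x, s))"
  unfolding E.cont_curve_def
proof (intro ballI conjI)
  fix t :: real assume t: "t \<in> {0..T}"
  let ?f = "\<lambda>s x. \<phi> (x, s)"
  have f: "?f s \<in> test_functions \<Omega>" for s by (rule slice_test(1)[OF \<phi>])
  have fX: "?f s \<in> X" for s by (rule H1_test(1)[OF f])
  show "?f t \<in> X" by (rule fX)
  show "((\<lambda>s. E.nm (?f s - ?f t)) \<longlongrightarrow> 0) (at t within {0..T})"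
  proof (rule tendstoI)
    fix e :: real assume e: "0 < e"
    define n where "n = real DIM('a)"
    \<comment> \<open>The function contributes \<open>M0 * c\<close> and its gradient
      \<open>M0 * n * c\<close>, together at most \<open>e / 2\<close>; the added ones prevent
      division by zero.\<close>
    define c where "c = e / (2 * (M0 + 1) * (n + 1))"
    have n0: "0 \<le> n" by (simp add: n_def)
    have c: "0 < c" unfolding c_def using e M0_nonneg n0 by (intro divide_pos_pos mult_pos_pos) auto
    have "\<forall>\<^sub>F s in at t within {0..T}. \<forall>i\<in>Basis. \<forall>x::'a. \<bar>frechet_derivative \<phi> (at (x, s)) (i, 0) - frechet_derivative \<phi> (at (x, t)) (i, 0)\<bar> < c"
      by (rule eventually_ball_finite[OF finite_Basis]) (intro ballI slice_uniform[OF test_functions_frechet[OF \<phi>]] c)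
    moreover have "\<forall>\<^sub>F s in at t within {0..T}. \<forall>x. \<bar>\<phi> (x, s) - \<phi> (x, t)\<bar> < c"
      by (rule slice_uniform[OF \<phi> c])
    ultimately show "\<forall>\<^sub>F s in at t within {0..T}. dist (E.nm (?f s - ?f t)) 0 < e"
    proof eventually_elim
      case (elim s)
      note es = elim
      have dX: "?f s - ?f t \<in> X" by (rule E.diff_mem[OF fX fX])
      have 1: "L2.nm \<mu> (?f s - ?f t) \<le> M0 * c"
        by (rule L2_nm_bounded[OF H1_L2[OF dX] AE_I2]) (use elim c in \<open>simp_all add: less_imp_le\<close>)
      have 2: "L2.nm \<mu> (D (?f s - ?f t)) \<le> M0 * (n * c)"
      proof (rule L2_nm_bounded[OF H1_D[OF dX]])
        show "AE x in \<mu>. norm (D (?f s - ?f t) x) \<le> n * c"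
          using H1_diff(2)[OF fX fX, of s t] H1_test(2)[OF f, of s] H1_test(2)[OF f, of t]
        proof eventually_elim
          case (elim x)
          note ex = elim
          have "norm (D (?f s - ?f t) x) \<le> (\<Sum>i\<in>Basis. \<bar>D (?f s - ?f t) x \<bullet> i\<bar>)" by (rule norm_le_l1)
          also have "\<dots> \<le> (\<Sum>i\<in>(Basis :: 'a set). c)"
          proof (rule sum_mono)
            fix i :: 'a assume i: "i \<in> Basis"
            have "D (?f s - ?f t) x \<bullet> i = frechet_derivative \<phi> (at (x, s)) (i, 0) - frechet_derivative \<phi> (at (x, t)) (i, 0)"
              unfolding ex inner_diff_left grad_inner[OF i] slice_frechet[OF test_functions_smooth[OF \<phi>]] ..
            then show "\<bar>D (?f s - ?f t) x \<bullet> i\<bar> \<le> c"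
              using es(1)[rule_format, OF i, of x] by (simp only: less_imp_le)
          qed
          finally show ?case by (simp add: n_def)
        qed
      qed (use c n0 in simp)
      have "E.nm (?f s - ?f t) \<le> M0 * ((n + 1) * c)" using E_nm_le[OF dX] 1 2 by (simp add: distrib_left distrib_right)
      also have "\<dots> \<le> (M0 + 1) * ((n + 1) * c)" using c n0 by (intro mult_right_mono) auto
      also have "\<dots> = e / 2"
      proof -
        have "c * (2 * (M0 + 1) * (n + 1)) = e" unfolding c_def using n0 M0_nonneg by (intro nonzero_eq_divide_eq[THEN iffD1, OF _ refl]) simp
        then show ?thesis by (simp add: algebra_simps)
      qed
      also have "\<dots> < e" using e by simp
      finally show ?case using E.nm_nonneg[OF dX] by (simp add: dist_real_def)
    qed
  qed
qed

text \<open>By the mean value theorem the difference quotient is the time derivative at an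
  intermediate time, hence uniformly close to the derivative at \<open>s\<close>; Cauchy-Schwarz
  transfers this to the pairing with \<open>h\<close>.\<close>

lemma slice_ip_deriv:
  assumes \<phi>: "\<phi> \<in> test_functions (\<Omega> \<times> {0<..<T})" and h: "h \<in> L2_space \<mu>"
  shows "((\<lambda>s. ip2 \<mu> h (\<lambda>x. \<phi> (x, s))) has_real_derivative
      ip2 \<mu> h (\<lambda>x. frechet_derivative \<phi> (at (x, s)) (0, 1))) (at s)"
  unfolding DERIV_def
proof (rule tendstoI)
  fix e :: real assume e: "0 < e"
  let ?f = "\<lambda>s x. \<phi> (x, s)" and ?g = "\<lambda>s x. frechet_derivative \<phi> (at (x, s)) (0, 1)"
  note sm = test_functions_smooth[OF \<phi>]
  have \<psi>: "(\<lambda>p. frechet_derivative \<phi> (at p) (0, 1)) \<in> test_functions (\<Omega> \<times> {0<..<T})" by (rule test_functions_frechet[OF \<phi>])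
  have fL: "?f s \<in> L2_space \<mu>" "?g s \<in> L2_space \<mu>" for s
    using L2_test[OF slice_test(1)[OF \<phi>]] L2_test[OF slice_test(1)[OF \<psi>]] by auto
  define c where "c = e / (2 * (L2.nm \<mu> h + 1) * (M0 + 1))"
  have hn: "0 \<le> L2.nm \<mu> h" by (rule L2.nm_nonneg[OF h])
  have c: "0 < c" unfolding c_def using e M0_nonneg hn by (intro divide_pos_pos mult_pos_pos) auto
  obtain d where d: "0 < d" "\<And>p q. dist p q < d \<Longrightarrow> \<bar>frechet_derivative \<phi> (at p) (0, 1) - frechet_derivative \<phi> (at q) (0, 1)\<bar> < c"
    by (rule test_functions_uniform[OF \<psi> c]) (rule that)
  show "\<forall>\<^sub>F k in at 0. dist ((ip2 \<mu> h (?f (s + k)) - ip2 \<mu> h (?f s)) / k) (ip2 \<mu> h (?g s)) < e"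
    unfolding eventually_at
  proof (intro exI[of _ d] conjI ballI impI d(1))
    fix k :: real assume k: "k \<noteq> 0 \<and> dist k 0 < d"
    define w where "w = (1 / k) *\<^sub>R (?f (s + k) - ?f s) - ?g s"
    have wL: "w \<in> L2_space \<mu>" unfolding w_def by (intro L2.mem_intros fL)
    have "(ip2 \<mu> h (?f (s + k)) - ip2 \<mu> h (?f s)) / k - ip2 \<mu> h (?g s) = ip2 \<mu> h w"
      unfolding w_def using h by (simp add: L2.ip_simps L2.mem_intros fL)
    moreover have "L2.nm \<mu> w \<le> M0 * c"
    proof (rule L2_nm_bounded[OF wL AE_I2])
      fix x
      obtain z where z: "\<bar>z - s\<bar> \<le> \<bar>k\<bar>" "\<phi> (x, s + k) - \<phi> (x, s) = k * frechet_derivative \<phi> (at (x, z)) (0, 1)"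
        using slice_MVT[OF sm] by blast
      have "w x = frechet_derivative \<phi> (at (x, z)) (0, 1) - frechet_derivative \<phi> (at (x, s)) (0, 1)"
        unfolding w_def using z(2) k by simp
      moreover have "dist (x, z) (x, s) < d" using z(1) k by (simp add: dist_Pair_Pair dist_real_def)
      ultimately show "norm (w x) \<le> c" using d(2)[of "(x, z)" "(x, s)"] by (simp add: less_imp_le)
    qed (use c in simp)
    then have "\<bar>ip2 \<mu> h w\<bar> \<le> L2.nm \<mu> h * (M0 * c)"
      using L2.cauchy_schwarz[OF h wL] mult_left_mono[OF _ hn, of "L2.nm \<mu> w" "M0 * c"] by simp
    moreover have "L2.nm \<mu> h * (M0 * c) \<le> (L2.nm \<mu> h + 1) * ((M0 + 1) * c)"
      using hn M0_nonneg c by (intro mult_mono) auto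
    moreover have "(L2.nm \<mu> h + 1) * ((M0 + 1) * c) = e / 2"
    proof -
      have "c * (2 * (L2.nm \<mu> h + 1) * (M0 + 1)) = e" unfolding c_def using hn M0_nonneg by (intro nonzero_eq_divide_eq[THEN iffD1, OF _ refl]) simp
      then show ?thesis by (simp add: algebra_simps)
    qed
    ultimately show "dist ((ip2 \<mu> h (?f (s + k)) - ip2 \<mu> h (?f s)) / k) (ip2 \<mu> h (?g s)) < e"
      unfolding dist_real_def using e by simp
  qed
qed

lemma spatial_gradient_slice:
  assumes \<phi>: "\<phi> \<in> test_functions (\<Omega> \<times> {0<..<T})"
  shows "spatial_gradient \<phi> x s = grad (\<lambda>x. \<phi> (x, s)) x"
  unfolding spatial_gradient_def grad_def slice_frechet[OF test_functions_smooth[OF \<phi>]] ..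

lemma DD_slice:
  assumes \<phi>: "\<phi> \<in> test_functions (\<Omega> \<times> {0<..<T})" and u: "u \<in> X"
  shows "(\<integral>x. D u x \<bullet> spatial_gradient \<phi> x s \<partial>\<mu>) = DD u (\<lambda>x. \<phi> (x, s))"
proof -
  note f = slice_test(1)[OF \<phi>, of s]
  show ?thesis
    unfolding spatial_gradient_slice[OF \<phi>] using ip2_cong_AE[OF H1_D[OF u] H1_D[OF H1_test(1)[OF f]] _ H1_test(2)[OF f], of "D u"]
    by (simp add: ip2_def)
qed

subsection \<open>Distributional solutions\<close>

text \<open>The product rule for the pairing of \<open>u t\<close> with the slice at
  \<open>s\<close>: the weak form gives the derivative in \<open>t\<close>, the time derivative of
  the test function the one in \<open>s\<close>.\<close>

lemma weak_form_distributional: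
  assumes T: "0 < T" and c: "u \<in> energy_class \<Omega> T g" and w: "weak_form T u"
  shows "distributional_weak_solution \<Omega> T g u"
  unfolding distributional_weak_solution_def
proof (intro conjI c ballI)
  note uE = energy_classD(1)[OF c] and u = energy_classD(3)[OF c]
  fix \<phi> assume \<phi>: "\<phi> \<in> test_functions (\<Omega> \<times> {0<..<T})"
  let ?f = "\<lambda>s x. \<phi> (x, s)" and ?g = "\<lambda>s x. frechet_derivative \<phi> (at (x, s)) (0, 1)"
  have \<psi>: "(\<lambda>p. frechet_derivative \<phi> (at p) (0, 1)) \<in> test_functions (\<Omega> \<times> {0<..<T})" by (rule test_functions_frechet[OF \<phi>])
  have fc: "E.cont_curve T ?f" by (rule slice_cont_curve[OF \<phi>])
  have gc: "E.cont_curve T ?g" by (rule slice_cont_curve[OF \<psi>])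
  have fX: "?f s \<in> X" "?f s \<in> V" for s using H1_test(1) H10_test slice_test(1)[OF \<phi>] by auto
  have gX: "?g s \<in> X" "?g s \<in> L2_space \<mu>" for s using H1_test(1)[OF slice_test(1)[OF \<psi>]] H1_L2 by auto
  obtain C where C: "\<And>t. t \<in> {0..T} \<Longrightarrow> E.nm (?g t) \<le> C" by (rule E.cont_curve_nm_bound[OF gc]) (rule that)
  have C0: "0 \<le> C" using C[of 0] E.nm_nonneg[OF gX(1), of 0] T by simp
  \<comment> \<open>One majorant for both increments: the first summand controls the Dirichlet form
    against differences of slices, the constant controls differences of \<open>u\<close> against the
    time derivative of the slice.\<close>
  define m where "m r = E.nm (u r) + C" for r
  have uL: "u t \<in> L2_space \<mu>" if "t \<in> {0..T}" for t using G.H.cont_curve_mem[OF u that] .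
  have pd: "integrable (tm T) (\<lambda>r. - DD (u r) (?f r))"
    by (intro Bochner_Integration.integrable_minus DD_integrable[OF uE E.cont_curve_B[OF fc]])
  have qd: "integrable (tm T) (\<lambda>r. ip2 \<mu> (u r) (?g r))"
    by (rule G.H.B_ip_integrable[OF G.H.cont_curve_B[OF u] EB_HB[OF E.cont_curve_B[OF gc]]])
  have qc: "continuous_on UNIV (\<lambda>r. ip2 \<mu> h (?g r))" if "h \<in> L2_space \<mu>" for h
    using DERIV_isCont[OF slice_ip_deriv[OF \<psi> that]] by (simp add: continuous_on_eq_continuous_at)
  have "ip2 \<mu> (u T) (?f T) - ip2 \<mu> (u 0) (?f 0) =
      ti T 0 T (\<lambda>r. - DD (u r) (?f r)) + ti T 0 T (\<lambda>r. ip2 \<mu> (u r) (?g r))"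
  proof (rule product_rule[where P = "\<lambda>t s. ip2 \<mu> (u t) (?f s)" and p = "\<lambda>r s. - DD (u r) (?f s)" and q = "\<lambda>t r. ip2 \<mu> (u t) (?g r)" and m = m])
    show "integrable (tm T) (\<lambda>r. - DD (u r) (?f s))" for s by (rule DD_const_integrable[OF uE fX(1)])
    show "integrable (tm T) (\<lambda>r. ip2 \<mu> (u t) (?g r))" if "t \<in> {0..T}" for t
      using qc[OF uL[OF that]] by (intro tm_continuous_integrable) (rule continuous_on_subset, auto)
    show "ip2 \<mu> (u t') (?f s) - ip2 \<mu> (u t) (?f s) = ti T t t' (\<lambda>r. - DD (u r) (?f s))"
      if "0 \<le> t" "t \<le> t'" "t' \<le> T" for t t' s
      using weak_formD[OF w fX(2) that, of s] uL[of t] uL[of t'] that fX(1)[of s] by (simp add: G.H.ip_diff_left H1_L2)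
    show "ip2 \<mu> (u t) (?f s') - ip2 \<mu> (u t) (?f s) = ti T s s' (\<lambda>r. ip2 \<mu> (u t) (?g r))"
      if "0 \<le> s" "s \<le> s'" "s' \<le> T" "t \<in> {0..T}" for s s' t
      using ti_FTC[OF that(1-3) slice_ip_deriv[OF \<phi> uL[OF that(4)]] qc[OF uL[OF that(4)]]] by simp
    show "integrable (tm T) m" unfolding m_def using E.B_nm1_integrable[OF uE] by (intro Bochner_Integration.integrable_add integrable_const_tm)
    show "\<exists>d>0. AE r in tm T. \<forall>s\<in>{0..T}. r \<le> T \<longrightarrow> \<bar>s - r\<bar> < d \<longrightarrow> \<bar>- DD (u r) (?f s) - - DD (u r) (?f r)\<bar> \<le> e * m r"
      if e: "0 < e" for e
    proof -
      obtain d where d: "0 < d" "\<And>s t. s \<in> {0..T} \<Longrightarrow> t \<in> {0..T} \<Longrightarrow> \<bar>s - t\<bar> < d \<Longrightarrow> E.nm (?f s - ?f t) < e"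
        by (rule E.cont_curve_uniform[OF fc e]) (rule that)
      have "AE r in tm T. \<forall>s\<in>{0..T}. r \<le> T \<longrightarrow> \<bar>s - r\<bar> < d \<longrightarrow> \<bar>- DD (u r) (?f s) - - DD (u r) (?f r)\<bar> \<le> e * m r"
        using E.B_mem[OF uE] AE_tm_space
      proof eventually_elim
        case (elim r)
        show ?case
        proof (intro ballI impI)
          fix s assume s: "s \<in> {0..T}" "\<bar>s - r\<bar> < d"
          have n: "E.nm (?f s - ?f r) < e" by (rule d(2)) (use s elim in auto)
          have "\<bar>- DD (u r) (?f s) - - DD (u r) (?f r)\<bar> = \<bar>DD (u r) (?f s - ?f r)\<bar>"
            using elim(1) fX(1) by (simp add: DD_eq E.ip_diff_right G.H.ip_diff_right H1_L2 abs_minus_commute)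
          also have "\<dots> \<le> E.nm (u r) * E.nm (?f s - ?f r)" by (rule DD_bound[OF elim(1) E.diff_mem[OF fX(1) fX(1)]])
          also have "\<dots> \<le> m r * e" unfolding m_def using n C0 E.nm_nonneg[OF elim(1)] E.nm_nonneg[OF E.diff_mem[OF fX(1)[of s] fX(1)[of r]]]
            by (intro mult_mono) auto
          finally show "\<bar>- DD (u r) (?f s) - - DD (u r) (?f r)\<bar> \<le> e * m r" by (simp only: mult.commute)
        qed
      qed
      then show ?thesis using d(1) by blast
    qed
    show "\<exists>d>0. AE r in tm T. \<forall>s\<in>{0..T}. r \<le> T \<longrightarrow> \<bar>s - r\<bar> < d \<longrightarrow> \<bar>ip2 \<mu> (u s) (?g r) - ip2 \<mu> (u r) (?g r)\<bar> \<le> e * m r"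
      if e: "0 < e" for e
    proof -
      obtain d where d: "0 < d" "\<And>s t. s \<in> {0..T} \<Longrightarrow> t \<in> {0..T} \<Longrightarrow> \<bar>s - t\<bar> < d \<Longrightarrow> L2.nm \<mu> (u s - u t) < e"
        by (rule G.H.cont_curve_uniform[OF u e]) (rule that)
      have "AE r in tm T. \<forall>s\<in>{0..T}. r \<le> T \<longrightarrow> \<bar>s - r\<bar> < d \<longrightarrow> \<bar>ip2 \<mu> (u s) (?g r) - ip2 \<mu> (u r) (?g r)\<bar> \<le> e * m r"
        using E.B_mem[OF uE] AE_tm_space
      proof eventually_elim
        case (elim r)
        show ?case
        proof (intro ballI impI)
          fix s assume s: "s \<in> {0..T}" "\<bar>s - r\<bar> < d"
          have r: "r \<in> {0..T}" using elim by simp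
          have n: "L2.nm \<mu> (u s - u r) < e" by (rule d(2)) (use s r in auto)
          have dL: "u s - u r \<in> L2_space \<mu>" by (rule L2.diff_mem[OF uL[OF s(1)] uL[OF r]])
          have "L2.nm \<mu> (?g r) \<le> m r" using C[OF r] L2_nm_le(1)[OF gX(1), of r] E.nm_nonneg[OF elim(1)] by (simp add: m_def)
          then have "L2.nm \<mu> (u s - u r) * L2.nm \<mu> (?g r) \<le> e * m r"
            using n e L2.nm_nonneg[OF dL] L2.nm_nonneg[OF gX(2)[of r]] by (intro mult_mono) auto
          then show "\<bar>ip2 \<mu> (u s) (?g r) - ip2 \<mu> (u r) (?g r)\<bar> \<le> e * m r"
            using L2.cauchy_schwarz[OF dL gX(2)[of r]] L2.ip_diff_left[OF uL[OF s(1)] uL[OF r] gX(2)[of r]] by simp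
        qed
      qed
      then show ?thesis using d(1) by blast
    qed
  qed (use T pd qd in auto)
  \<comment> \<open>The support lies strictly inside the time interval, so the slices at both ends
    vanish.\<close>
  moreover have "ip2 \<mu> (u t) (?f t) = 0" if "t = 0 \<or> t = T" for t
  proof -
    have "\<phi> (x, t) = 0" for x by (rule slice_test(2)[OF \<phi>]) (use that in auto)
    then show ?thesis by (simp add: ip2_def)
  qed
  ultimately have "(\<integral>r. ip2 \<mu> (u r) (?g r) \<partial>tm T) - (\<integral>r. DD (u r) (?f r) \<partial>tm T) = 0" by (simp add: ti_full)
  moreover have "(\<integral>r. DD (u r) (?f r) \<partial>tm T) = (\<integral>r. (\<integral>x. D (u r) x \<bullet> spatial_gradient \<phi> x r \<partial>\<mu>) \<partial>tm T)"
  proof (rule tm_cong_AE(2))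
    show "(\<lambda>r. DD (u r) (?f r)) \<in> borel_measurable (tm T)" using DD_integrable[OF uE E.cont_curve_B[OF fc]] by simp
    show "AE r in tm T. DD (u r) (?f r) = (\<integral>x. D (u r) x \<bullet> spatial_gradient \<phi> x r \<partial>\<mu>)"
      using E.B_mem[OF uE] by eventually_elim (simp add: DD_slice[OF \<phi>])
  qed
  ultimately show "(\<integral>t. (\<integral>x. u t x * frechet_derivative \<phi> (at (x, t)) (0, 1) \<partial>\<mu>) \<partial>tm T)
      - (\<integral>t. (\<integral>x. D (u t) x \<bullet> spatial_gradient \<phi> x t \<partial>\<mu>) \<partial>tm T) = 0"
    unfolding ip2_real by simp
qed

lemma distributional_weak_form:
  assumes T: "0 < T" and d: "distributional_weak_solution \<Omega> T g u"
  shows "weak_form T u"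
proof -
  have c: "u \<in> energy_class \<Omega> T g" using d unfolding distributional_weak_solution_def by blast
  note uE = energy_classD(1)[OF c] and u = energy_classD(3)[OF c]
  show ?thesis
  proof (rule weak_formI[OF T uE u])
    fix \<theta> w assume \<theta>: "\<theta> \<in> test_functions {0<..<T}" and w: "w \<in> test_functions \<Omega>"
    note s\<theta> = test_functions_smooth[OF \<theta>] and sw = test_functions_smooth[OF w]
    define \<phi> where "\<phi> p = \<theta> (snd p) * w (fst p)" for p
    have \<phi>: "\<phi> \<in> test_functions (\<Omega> \<times> {0<..<T})"
    proof -
      obtain K1 where K1: "compact K1" "K1 \<subseteq> {0<..<T}" "\<And>x. x \<notin> K1 \<Longrightarrow> \<theta> x = 0" by (rule test_functionsE[OF \<theta>]) (rule that)
      obtain K2 where K2: "compact K2" "K2 \<subseteq> \<Omega>" "\<And>x. x \<notin> K2 \<Longrightarrow> w x = 0" by (rule test_functionsE[OF w]) (rule that)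
      show ?thesis
      proof (rule test_functionsI)
        show "smooth \<phi>" unfolding \<phi>_def[abs_def]
          using smooth_mult[OF smooth_affine[OF bounded_linear_snd s\<theta>, of 0] smooth_affine[OF bounded_linear_fst sw, of 0]] by simp
        show "compact (K2 \<times> K1)" by (rule compact_Times[OF K2(1) K1(1)])
        show "K2 \<times> K1 \<subseteq> \<Omega> \<times> {0<..<T}" using K1(2) K2(2) by blast
        show "p \<in> K2 \<times> K1" if "\<phi> p \<noteq> 0" for p
          using that K1(3)[of "snd p"] K2(3)[of "fst p"] by (cases p) (auto simp: \<phi>_def)
      qed
    qed
    \<comment> \<open>The total derivative in the time direction is identified through uniqueness of
      the one-variable derivative along the slice.\<close>
    have dt: "frechet_derivative \<phi> (at (x, t)) (0, 1) = deriv \<theta> t * w x" for x t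
    proof (rule DERIV_unique[OF slice_time_deriv[OF test_functions_smooth[OF \<phi>]]])
      show "((\<lambda>s. \<phi> (x, s)) has_real_derivative deriv \<theta> t * w x) (at t)"
        unfolding \<phi>_def using DERIV_cmult_right[OF smooth_real_deriv(1)[OF s\<theta>]] by simp
    qed
    have wX: "w \<in> X" by (rule H1_test(1)[OF w])
    have Di: "integrable (tm T) (\<lambda>t. DD (u t) w)" by (rule DD_integrable[OF uE E.B_const[OF wX]])
    have "(\<integral>t. \<theta> t * DD (u t) w \<partial>tm T) = (\<integral>t. (\<integral>x. D (u t) x \<bullet> spatial_gradient \<phi> x t \<partial>\<mu>) \<partial>tm T)"
    proof (rule tm_cong_AE(2))
      have "\<theta> \<in> borel_measurable (tm T)"
        using tm_continuous_integrable[of T \<theta>] smooth_continuous[OF s\<theta>] by (auto intro: continuous_on_subset)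
      moreover have "(\<lambda>t. DD (u t) w) \<in> borel_measurable (tm T)" using Di by simp
      ultimately show "(\<lambda>t. \<theta> t * DD (u t) w) \<in> borel_measurable (tm T)" by (rule borel_measurable_times)
      show "AE t in tm T. \<theta> t * DD (u t) w = (\<integral>x. D (u t) x \<bullet> spatial_gradient \<phi> x t \<partial>\<mu>)"
        using E.B_mem[OF uE]
      proof eventually_elim
        case (elim t)
        have "(\<lambda>x. \<phi> (x, t)) = \<theta> t *\<^sub>R w" by (simp add: \<phi>_def fun_eq_iff)
        then show ?case unfolding DD_slice[OF \<phi> elim]
          using elim wX by (simp add: DD_eq E.ip_scale_right G.H.ip_scale_right H1_L2 right_diff_distrib)
      qed
    qed
    moreover have "(\<integral>t. (\<integral>x. u t x * frechet_derivative \<phi> (at (x, t)) (0, 1) \<partial>\<mu>) \<partial>tm T) = (\<integral>t. deriv \<theta> t * ip2 \<mu> (u t) w \<partial>tm T)"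
      unfolding dt ip2_real by (simp add: mult.left_commute)
    ultimately show "(\<integral>t. deriv \<theta> t * ip2 \<mu> (u t) w \<partial>tm T) = (\<integral>t. \<theta> t * DD (u t) w \<partial>tm T)"
      using d \<phi> unfolding distributional_weak_solution_def by fastforce
  qed
qed

end

context bounded_domain
begin

subsection \<open>Variational solutions\<close>

text \<open>Equality almost everywhere in space at each time carries over to the gradients. This
  transfers the weak form from the constructed solution to any variational solution.\<close>

lemma weak_form_cong:
  assumes c: "u \<in> energy_class \<Omega> T g" "w \<in> energy_class \<Omega> T g" and wf: "weak_form T w"
    and eq: "\<And>t. t \<in> {0..T} \<Longrightarrow> AE x in \<mu>. w t x = u t x"
  shows "weak_form T u"
  unfolding weak_form_def
proof (intro ballI allI impI)
  fix v s t assume v: "v \<in> V" and st: "0 \<le> s" "s \<le> t" "t \<le> T"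
  note u = energy_classD(1)[OF c(1)] and w = wf energy_classD(1,3)[OF c(2)]
  have vX: "v \<in> X" using v by (rule H10_H1)
  have wd: "w t - w s \<in> L2_space \<mu>" using G.H.cont_curve_mem[OF w(3)] st by (intro G.H.diff_mem) auto
  have "AE x in \<mu>. (w t - w s) x = (u t - u s) x"
    using eq[of t] eq[of s] st by (auto elim: eventually_elim2)
  then have "ip2 \<mu> (u t - u s) v = ip2 \<mu> (w t - w s) v"
    by (intro ip2_cong_AE[OF wd G.VH'[OF v]]) auto
  also have "\<dots> = ti T s t (\<lambda>a. - DD (w a) v)" by (rule weak_formD[OF w(1) v st])
  also have "\<dots> = ti T s t (\<lambda>a. - DD (u a) v)"
  proof (rule ti_cong_AE[OF DD_const_integrable[OF w(2) vX] DD_const_integrable[OF u vX]])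
    show "AE a in tm T. - DD (w a) v = - DD (u a) v"
      using E.B_mem[OF w(2)] AE_tm_space
    proof eventually_elim
      case (elim a)
      have "AE x in \<mu>. w a x = u a x" by (rule eq) (use elim in auto)
      from H1_cong_AE(2)[OF elim(1) this] show ?case
        using ip2_cong_AE[OF H1_D[OF elim(1)] H1_D[OF vX], of "D (u a)" "D v"] by simp
    qed
  qed
  finally show "ip2 \<mu> (u t - u s) v = ti T s t (\<lambda>a. - DD (u a) v)" .
qed

lemma DD_norm:
  assumes "v \<in> X" "u \<in> X"
  shows "(\<integral>x. (norm (D v x))\<^sup>2 - (norm (D u x))\<^sup>2 \<partial>\<mu>) = DD v v - DD u u"
proof -
  have "integrable \<mu> (\<lambda>x. (norm (D w x))\<^sup>2)" if "w \<in> X" for w using H1_D[OF that] by (simp add: L2_space_def)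
  then show ?thesis using assms by (simp add: ip2_def power2_norm_eq_inner)
qed

lemma DD_norm_integral:
  assumes v: "v \<in> E.B T" and u: "u \<in> E.B T"
  shows "(\<integral>t. (\<integral>x. (norm (D (v t) x))\<^sup>2 - (norm (D (u t) x))\<^sup>2 \<partial>\<mu>) \<partial>tm T) = (\<integral>t. DD (v t) (v t) - DD (u t) (u t) \<partial>tm T)"
proof (rule tm_cong_AE(2)[symmetric])
  show "(\<lambda>t. DD (v t) (v t) - DD (u t) (u t)) \<in> borel_measurable (tm T)"
    using Bochner_Integration.integrable_diff[OF DD_integrable[OF v v] DD_integrable[OF u u]] by simp
  show "AE t in tm T. DD (v t) (v t) - DD (u t) (u t) = (\<integral>x. (norm (D (v t) x))\<^sup>2 - (norm (D (u t) x))\<^sup>2 \<partial>\<mu>)"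
    using E.B_mem[OF v] E.B_mem[OF u] by eventually_elim (simp add: DD_norm)
qed

lemma DD_nonneg: "u \<in> X \<Longrightarrow> 0 \<le> DD u u"
  by (rule L2.ip_nonneg[OF H1_D])

lemma DD_diff_expand:
  assumes "v \<in> X" "u \<in> X"
  shows "DD v v - DD u u = 2 * DD u (v - u) + DD (v - u) (v - u)"
  using assms by (simp add: DD_eq E.ip_simps G.H.ip_simps E.diff_mem G.H.diff_mem H1_L2 E.ip_sym[of u v] G.H.ip_sym[of u v])

text \<open>The difference of \<open>v\<close> and \<open>u\<close> lies in \<open>V\<close> and has
  derivative \<open>\<xi>\<close> plus the Dirichlet functional of \<open>u\<close>, so the energy
  identity applies to it. Twice the cross term of \<open>D u\<close> with the difference, which
  appears when the two Dirichlet energies are compared, is exactly what that functional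
  contributes.\<close>

lemma energy_gap:
  assumes \<tau>: "0 < \<tau>" and u: "u \<in> E.B \<tau>" "G.H.cont_curve \<tau> u" "weak_form \<tau> u"
    and v: "v \<in> E.B \<tau>" "G.H.cont_curve \<tau> v" and dV: "AE t in tm \<tau>. v t - u t \<in> V"
    and \<xi>: "has_time_derivative \<Omega> \<tau> v \<xi>"
  shows "(\<integral>t. \<xi> t (v t - u t) \<partial>tm \<tau>) + 1 / 2 * (\<integral>t. DD (v t) (v t) - DD (u t) (u t) \<partial>tm \<tau>) =
    1 / 2 * (L2.nm \<mu> (v \<tau> - u \<tau>))\<^sup>2 - 1 / 2 * (L2.nm \<mu> (v 0 - u 0))\<^sup>2 +
    1 / 2 * (\<integral>t. DD (v t - u t) (v t - u t) \<partial>tm \<tau>)"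
proof -
  let ?d = "\<lambda>t. v t - u t"
  have \<xi>': "\<xi> \<in> L2_Vdual \<Omega> \<tau>" using \<xi> unfolding has_time_derivative_def by blast
  have dE: "?d \<in> E.B \<tau>" using E.B_diff[OF v(1) u(1)] by (simp add: fun_diff_def)
  have dB: "?d \<in> G.V.B \<tau>" by (rule VB_I[OF dE dV])
  have dc: "G.H.cont_curve \<tau> ?d" by (rule G.H.cont_curve_diff[OF v(2) u(2)])
  define r where "r = (\<lambda>t. J (\<xi> t)) + (\<lambda>t. A (u t))"
  have r: "r \<in> G.V.B \<tau>" unfolding r_def by (rule G.V.B_add[OF J_B[OF \<xi>'] A_B[OF u(1)]])
  have id: "ip2 \<mu> (?d \<tau>) (?d \<tau>) - ip2 \<mu> (?d 0) (?d 0) = 2 * (\<integral>t. ipE (r t) (?d t) \<partial>tm \<tau>)"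
  proof (rule G.energy_identity[OF \<tau> dB dc r])
    fix s t w assume st: "0 \<le> s" "s \<le> t" "t \<le> \<tau>" and w: "w \<in> V"
    have m: "u s \<in> L2_space \<mu>" "u t \<in> L2_space \<mu>" "v s \<in> L2_space \<mu>" "v t \<in> L2_space \<mu>" "w \<in> L2_space \<mu>"
      using G.H.cont_curve_mem[OF u(2)] G.H.cont_curve_mem[OF v(2)] st G.VH'[OF w] by auto
    have "ip2 \<mu> (?d t - ?d s) w = ip2 \<mu> (v t - v s) w - ip2 \<mu> (u t - u s) w"
      using m by (simp add: G.H.ip_diff_left G.H.diff_mem)
    also have "\<dots> = ti \<tau> s t (\<lambda>a. ipE (J (\<xi> a)) w) - ti \<tau> s t (\<lambda>a. - DD (u a) w)"
      using time_derivative[OF \<tau> v(2) \<xi> w st] weak_formD[OF u(3) w st] by simp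
    also have "\<dots> = ti \<tau> s t (\<lambda>a. ipE (J (\<xi> a)) w - - DD (u a) w)"
      by (rule ti_diff[OF G.V.B_ip_const_integrable[OF J_B[OF \<xi>'] w] DD_const_integrable[OF u(1) H10_H1[OF w]], symmetric])
    also have "\<dots> = ti \<tau> s t (\<lambda>a. ipE (r a) w)"
    proof (rule ti_cong_AE[OF _ G.V.B_ip_const_integrable[OF r w]])
      show "integrable (tm \<tau>) (\<lambda>a. ipE (J (\<xi> a)) w - - DD (u a) w)"
        by (rule Bochner_Integration.integrable_diff[OF G.V.B_ip_const_integrable[OF J_B[OF \<xi>'] w] DD_const_integrable[OF u(1) H10_H1[OF w]]])
      show "AE a in tm \<tau>. ipE (J (\<xi> a)) w - - DD (u a) w = ipE (r a) w"
        using Vdual_AE[OF \<xi>'] E.B_mem[OF u(1)]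
        by eventually_elim (simp add: r_def G.V.ip_add_left J A_mem A_ip w)
    qed
    finally show "ip2 \<mu> (?d t - ?d s) w = ti \<tau> s t (\<lambda>a. ipE (r a) w)" .
  qed
  have rd: "integrable (tm \<tau>) (\<lambda>t. ipE (r t) (?d t))" by (rule G.V.B_ip_integrable[OF r dB])
  have ud: "integrable (tm \<tau>) (\<lambda>t. DD (u t) (?d t))" by (rule DD_integrable[OF u(1) dE])
  have dd: "integrable (tm \<tau>) (\<lambda>t. DD (?d t) (?d t))" by (rule DD_integrable[OF dE dE])
  have "(\<integral>t. ipE (r t) (?d t) - DD (u t) (?d t) \<partial>tm \<tau>) = (\<integral>t. \<xi> t (?d t) \<partial>tm \<tau>)"
  proof (rule tm_cong_AE(2))
    show "(\<lambda>t. ipE (r t) (?d t) - DD (u t) (?d t)) \<in> borel_measurable (tm \<tau>)"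
      using Bochner_Integration.integrable_diff[OF rd ud] by simp
    show "AE t in tm \<tau>. ipE (r t) (?d t) - DD (u t) (?d t) = \<xi> t (?d t)"
      using Vdual_AE[OF \<xi>'] E.B_mem[OF u(1)] dV
      by eventually_elim (simp add: r_def G.V.ip_add_left J A_mem A_ip)
  qed
  moreover have "(\<integral>t. DD (v t) (v t) - DD (u t) (u t) \<partial>tm \<tau>) = (\<integral>t. 2 * DD (u t) (?d t) + DD (?d t) (?d t) \<partial>tm \<tau>)"
  proof (rule tm_cong_AE(2))
    show "(\<lambda>t. DD (v t) (v t) - DD (u t) (u t)) \<in> borel_measurable (tm \<tau>)"
      using Bochner_Integration.integrable_diff[OF DD_integrable[OF v(1) v(1)] DD_integrable[OF u(1) u(1)]] by simp
    show "AE t in tm \<tau>. DD (v t) (v t) - DD (u t) (u t) = 2 * DD (u t) (?d t) + DD (?d t) (?d t)"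
      using E.B_mem[OF v(1)] E.B_mem[OF u(1)] by eventually_elim (rule DD_diff_expand)
  qed
  moreover have "(L2.nm \<mu> (?d t))\<^sup>2 = ip2 \<mu> (?d t) (?d t)" if "t \<in> {0..\<tau>}" for t
    by (rule L2.nm_sq[OF G.H.cont_curve_mem[OF dc that]])
  ultimately show ?thesis using id rd ud dd \<tau> by (simp add: field_simps)
qed

lemma weak_form_variational:
  assumes T: "0 < T" and c: "u \<in> energy_class \<Omega> T g" and w: "weak_form T u"
  shows "variational_solution \<Omega> T g u"
  unfolding variational_solution_def
proof (intro conjI c ballI allI impI)
  fix \<tau> v \<xi> assume \<tau>: "\<tau> \<in> {0<..T}" and v: "v \<in> L2_H1g \<Omega> \<tau> g \<inter> C_H \<Omega> \<tau>" and \<xi>: "has_time_derivative \<Omega> \<tau> v \<xi>"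
  note u = energy_classD[OF c]
  have \<tau>': "0 < \<tau>" "\<tau> \<le> T" using \<tau> by auto
  have vE: "v \<in> E.B \<tau>" and vg: "AE t in tm \<tau>. v t - g t \<in> V" and vc: "G.H.cont_curve \<tau> v"
    using v unfolding L2_H1g_def L2_H1_eq by (auto simp only: C_H_iff mem_Collect_eq Int_iff)
  have uE: "u \<in> E.B \<tau>" by (rule bochner_L2_mono[OF u(1) \<tau>'(2)])
  have uc: "G.H.cont_curve \<tau> u" by (rule G.H.cont_curve_mono[OF u(3) \<tau>'(2)])
  have dV: "AE t in tm \<tau>. v t - u t \<in> V"
    using vg AE_tm_mono[OF u(2) \<tau>'(2)]
  proof eventually_elim
    case (elim t)
    \<comment> \<open>Sharing the boundary data \<open>g\<close> is what places the difference in
      \<open>V\<close>.\<close>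
    have "v t - u t = (v t - g t) - (u t - g t)" by simp
    then show ?case using G.V.diff_mem[OF elim] by simp
  qed
  have dE: "(\<lambda>t. v t - u t) \<in> E.B \<tau>" using E.B_diff[OF vE uE] by (simp add: fun_diff_def)
  have pos: "0 \<le> (\<integral>t. DD (v t - u t) (v t - u t) \<partial>tm \<tau>)"
    by (rule integral_nonneg_AE) (use E.B_mem[OF dE] in eventually_elim, rule DD_nonneg)
  have d0: "v 0 - u 0 \<in> L2_space \<mu>"
    using G.H.cont_curve_mem[OF vc] G.H.cont_curve_mem[OF uc] \<tau>' by (intro G.H.diff_mem) auto
  have "AE x in \<mu>. (v 0 - u 0) x = (v 0 - g 0) x" using u(4) by eventually_elim simp
  then have "L2.nm \<mu> (v 0 - u 0) = L2.nm \<mu> (v 0 - g 0)"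
    unfolding L2.nm_def using ip2_cong_AE[OF d0 d0, of "v 0 - g 0" "v 0 - g 0"] by simp
  then show "(\<integral>t. \<xi> t (v t - u t) \<partial>tm \<tau>)
      + 1 / 2 * (\<integral>t. (\<integral>x. (norm (D (v t) x))\<^sup>2 - (norm (D (u t) x))\<^sup>2 \<partial>\<mu>) \<partial>tm \<tau>)
      \<ge> 1 / 2 * (L2_norm \<mu> (v \<tau> - u \<tau>))\<^sup>2 - 1 / 2 * (L2_norm \<mu> (v 0 - g 0))\<^sup>2"
    using energy_gap[OF \<tau>'(1) uE uc weak_form_mono[OF w u(1) \<tau>'(2)] vE vc dV \<xi>] pos
    unfolding DD_norm_integral[OF vE uE] by (simp add: L2_nm)
qed

text \<open>
  For the comparison map \<open>w\<close> the left-hand side of the variational inequality is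
  \<open>- \<integral> |D(w - u)|\<^sup>2 / 2\<close>.
\<close>
lemma variational_unique:
  assumes T: "0 < T" and u: "variational_solution \<Omega> T g u" and c: "w \<in> energy_class \<Omega> T g" and w: "weak_form T w"
    and t: "t \<in> {0..T}"
  shows "AE x in \<mu>. w t x = u t x"
proof -
  have cu: "u \<in> energy_class \<Omega> T g" using u unfolding variational_solution_def by blast
  note u' = energy_classD[OF cu] and w' = energy_classD[OF c]
  show ?thesis
  proof (cases "t = 0")
    \<comment> \<open>The variational inequality is posed only for positive final times, so time 0
      is settled by the initial condition.\<close>
    case True
    show ?thesis unfolding True using u'(4) w'(4) by eventually_elim simp
  next
    case False
    then have \<tau>: "t \<in> {0<..T}" "0 < t" "t \<le> T" using t by auto
    have uE: "u \<in> E.B t" by (rule bochner_L2_mono[OF u'(1) \<tau>(3)])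
    have wE: "w \<in> E.B t" by (rule bochner_L2_mono[OF w'(1) \<tau>(3)])
    have wc: "G.H.cont_curve t w" by (rule G.H.cont_curve_mono[OF w'(3) \<tau>(3)])
    have wm: "w \<in> L2_H1g \<Omega> t g \<inter> C_H \<Omega> t"
      unfolding L2_H1g_def L2_H1_eq using wE wc AE_tm_mono[OF w'(2) \<tau>(3)] by (simp add: C_H_iff)
    have wd: "has_time_derivative \<Omega> t w (\<lambda>t v. - DD (w t) v)"
      by (rule weak_form_time_derivative[OF \<tau>(2) wE wc weak_form_mono[OF w w'(1) \<tau>(3)]])
    \<comment> \<open>The final time is taken to be \<open>t\<close>, so that the endpoint term
      measures the distance at the time under consideration.\<close>
    have ineq: "(\<integral>s. - DD (w s) (w s - u s) \<partial>tm t) + 1 / 2 * (\<integral>s. DD (w s) (w s) - DD (u s) (u s) \<partial>tm t)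
        \<ge> 1 / 2 * (L2.nm \<mu> (w t - u t))\<^sup>2 - 1 / 2 * (L2.nm \<mu> (w 0 - g 0))\<^sup>2"
      using u[unfolded variational_solution_def, THEN conjunct2, rule_format, OF \<tau>(1) wm wd]
      unfolding DD_norm_integral[OF wE uE] L2_nm .
    let ?d = "\<lambda>s. w s - u s"
    have dE: "?d \<in> E.B t" using E.B_diff[OF wE uE] by (simp add: fun_diff_def)
    have i: "integrable (tm t) (\<lambda>s. - DD (w s) (?d s))" "integrable (tm t) (\<lambda>s. DD (w s) (w s) - DD (u s) (u s))"
      by (intro Bochner_Integration.integrable_minus Bochner_Integration.integrable_diff DD_integrable wE uE dE)+
    have "(\<integral>s. - DD (w s) (?d s) + 1 / 2 * (DD (w s) (w s) - DD (u s) (u s)) \<partial>tm t) \<le> (\<integral>s. 0 \<partial>tm t)"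
    proof (rule integral_mono_AE[OF Bochner_Integration.integrable_add[OF i(1) integrable_mult_right[OF i(2)]] integrable_zero])
      show "AE s in tm t. - DD (w s) (?d s) + 1 / 2 * (DD (w s) (w s) - DD (u s) (u s)) \<le> 0"
        using E.B_mem[OF wE] E.B_mem[OF uE]
      proof eventually_elim
        case (elim s)
        have "DD (w s) (?d s) = DD (u s) (?d s) + DD (?d s) (?d s)"
          using elim by (simp add: DD_eq E.ip_simps G.H.ip_simps E.diff_mem G.H.diff_mem H1_L2)
        then show ?case using DD_diff_expand[OF elim] DD_nonneg[OF E.diff_mem[OF elim]] by (simp add: field_simps)
      qed
    qed
    also have "(\<integral>s. - DD (w s) (?d s) + 1 / 2 * (DD (w s) (w s) - DD (u s) (u s)) \<partial>tm t) =
        (\<integral>s. - DD (w s) (?d s) \<partial>tm t) + 1 / 2 * (\<integral>s. DD (w s) (w s) - DD (u s) (u s) \<partial>tm t)"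
      by (subst Bochner_Integration.integral_add[OF i(1) integrable_mult_right[OF i(2)]]) (simp only: integral_mult_right_zero)
    finally have le: "1 / 2 * (L2.nm \<mu> (w t - u t))\<^sup>2 - 1 / 2 * (L2.nm \<mu> (w 0 - g 0))\<^sup>2 \<le> 0" using ineq by simp
    have "AE x in \<mu>. (w 0 - g 0) x = 0" using w'(4) by eventually_elim simp
    then have "ip2 \<mu> (w 0 - g 0) (w 0 - g 0) = 0" unfolding ip2_def by (intro integral_eq_zero_AE) (auto elim: eventually_mono)
    then have n0: "L2.nm \<mu> (w 0 - g 0) = 0" by (simp add: L2.nm_def)
    have dL: "w t - u t \<in> L2_space \<mu>"
      using G.H.cont_curve_mem[OF w'(3) t] G.H.cont_curve_mem[OF u'(3) t] by (rule G.H.diff_mem)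
    have "(L2.nm \<mu> (w t - u t))\<^sup>2 \<le> 0" using le n0 by simp
    then have "ip2 \<mu> (w t - u t) (w t - u t) = 0" using L2.nm_sq[OF dL] L2.ip_nonneg[OF dL] by simp
    from L2_null_AE[OF dL this] show ?thesis by eventually_elim simp
  qed
qed

subsection \<open>Existence\<close>

text \<open>
  With \<open>u = g + e\<^sup>t y\<close> the unknown \<open>y\<close> satisfies \<open>y' + y - div\<^sub>\<gamma> D y = f\<close> with zero initial and
  boundary values, and \<open>y \<mapsto> y - div\<^sub>\<gamma> D y\<close> is the Riesz isomorphism of \<open>V\<close>.
\<close>
lemma solution_exists:
  assumes T: "0 < T" and g: "g \<in> L2_H1 \<Omega> T \<inter> C_H \<Omega> T" and \<xi>: "has_time_derivative \<Omega> T g \<xi>"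
  obtains u where "u \<in> energy_class \<Omega> T g" "weak_form T u"
proof -
  have gE: "g \<in> E.B T" and gc: "G.H.cont_curve T g" using g by (simp_all add: L2_H1_eq C_H_iff)
  have \<xi>': "\<xi> \<in> L2_Vdual \<Omega> T" using \<xi> unfolding has_time_derivative_def by blast
  define r where "r = (\<lambda>t. J (\<xi> t)) + (\<lambda>t. A (g t))"
  have r: "r \<in> G.V.B T" unfolding r_def by (rule G.V.B_add[OF J_B[OF \<xi>'] A_B[OF gE]])
  \<comment> \<open>\<open>r\<close> represents the residual of \<open>g\<close>, its time
    derivative minus div Dg. Inserting the ansatz and dividing by the exponential leaves this
    right-hand side.\<close>
  define f where "f t = (- exp (- t)) *\<^sub>R r t" for t
  have ce: "continuous_on S (\<lambda>t. - exp (- t))" "continuous_on S (\<lambda>t. - exp t)" for S :: "real set"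
    by (intro continuous_intros)+
  have f: "f \<in> G.V.B T" unfolding f_def[abs_def]
    by (rule G.V.B_scale_fun[OF r _, where c = 1]) (use tm_continuous_integrable[OF ce(1), of T] in auto)
  obtain y where y: "G.H.cont_curve T y" "y \<in> G.V.B T" "L2.nm \<mu> (y 0 - 0) = 0"
    "\<And>s t v. 0 \<le> s \<Longrightarrow> s \<le> t \<Longrightarrow> t \<le> T \<Longrightarrow> v \<in> V \<Longrightarrow> ip2 \<mu> (y t - y s) v = ti T s t (\<lambda>r. ipE (f r - y r) v)"
  proof (rule G.solution_exists[OF T f G.H.zero_mem])
    show "\<exists>v\<in>V. L2.nm \<mu> (0 - v) < e" if "0 < e" for e
      by (rule bexI[OF _ G.V.zero_mem]) (use that in \<open>simp add: L2.nm_zero\<close>)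
  qed (rule that)
  \<comment> \<open>The sign lets \<open>u\<close> be written as a difference, to which the closure
    properties of curves apply.\<close>
  define z where "z t = (- exp t) *\<^sub>R y t" for t
  define u where "u t = g t - z t" for t
  have zV: "z \<in> G.V.B T" unfolding z_def[abs_def]
    by (rule G.V.B_scale_fun[OF y(2) _, where c = "exp T"]) (use tm_continuous_integrable[OF ce(2), of T] in auto)
  have zc: "G.H.cont_curve T z" unfolding z_def[abs_def] by (rule G.H.cont_curve_scale[OF y(1) ce(2)])
  have uE: "u \<in> E.B T" using E.B_diff[OF gE VB_EB[OF zV]] by (simp add: u_def[abs_def] fun_diff_def)
  have uc: "G.H.cont_curve T u" unfolding u_def[abs_def] by (rule G.H.cont_curve_diff[OF gc zc])
  have y0L: "y 0 \<in> L2_space \<mu>" using G.H.cont_curve_mem[OF y(1)] T by simp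
  have "ip2 \<mu> (y 0) (y 0) = 0" using y(3) L2.nm_sq[OF y0L] by simp
  from L2_null_AE[OF y0L this] have u0: "AE x in \<mu>. u 0 x = g 0 x" by eventually_elim (simp add: u_def z_def)
  have ug: "AE t in tm T. u t - g t \<in> V"
    using G.V.B_mem[OF zV] by eventually_elim (use G.V.minus_mem in \<open>simp add: u_def\<close>)
  have cl: "u \<in> energy_class \<Omega> T g"
    unfolding energy_class_def L2_H1g_def L2_H1_eq using uE ug uc u0 by (simp add: C_H_iff)
  have "weak_form T u"
  proof (rule weak_formI[OF T uE uc])
    fix \<phi> w assume \<phi>: "\<phi> \<in> test_functions {0<..<T}" and wt: "w \<in> test_functions \<Omega>"
    note s\<phi> = test_functions_smooth[OF \<phi>]
    note d\<phi> = smooth_real_deriv[OF s\<phi>]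
    have w: "w \<in> V" "w \<in> X" "w \<in> L2_space \<mu>" using H10_test[OF wt] H10_H1 G.VH' by auto
    obtain K where K: "K \<subseteq> {0<..<T}" "\<And>x. x \<notin> K \<Longrightarrow> \<phi> x = 0" by (rule test_functionsE[OF \<phi>]) (rule that)
    have "0 \<notin> K" "T \<notin> K" using K(1) by auto
    then have \<phi>0: "\<phi> 0 = 0" "\<phi> T = 0" using K(2) by auto
    \<comment> \<open>The exponential is moved from \<open>y\<close> to the test function. Its
      product rule yields the extra term \<open>\<eta>\<close>, which cancels the zero-order part of
      the equation for \<open>y\<close>.\<close>
    define \<eta> where "\<eta> t = \<phi> t * exp t" for t
    have s\<eta>: "smooth \<eta>" unfolding \<eta>_def[abs_def] by (rule smooth_mult[OF s\<phi> smooth_exp])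
    have \<eta>0: "\<eta> 0 = 0" "\<eta> T = 0" using \<phi>0 by (simp_all add: \<eta>_def)
    have d\<eta>: "deriv \<eta> t = deriv \<phi> t * exp t + \<eta> t" for t
      by (rule DERIV_imp_deriv) (use DERIV_mult[OF d\<phi>(1) DERIV_exp, of t] in \<open>simp add: \<eta>_def[abs_def] mult.commute\<close>)
    have cont: "continuous_on {0..T} \<phi>" "continuous_on {0..T} (deriv \<phi>)" "continuous_on {0..T} \<eta>" "continuous_on {0..T} (deriv \<eta>)"
      using smooth_continuous[OF s\<phi>] smooth_continuous[OF d\<phi>(3)] smooth_continuous[OF s\<eta>]
        smooth_continuous[OF smooth_real_deriv(3)[OF s\<eta>]] by (auto intro: continuous_on_subset)
    have fy: "f - y \<in> G.V.B T" by (rule G.V.B_diff[OF f y(2)])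
    have ij: "integrable (tm T) (\<lambda>t. ipE (J (\<xi> t)) w)" by (rule G.V.B_ip_const_integrable[OF J_B[OF \<xi>'] w(1)])
    have iy: "integrable (tm T) (\<lambda>t. ipE (f t - y t) w)" using G.V.B_ip_const_integrable[OF fy w(1)] by simp
    have cg: "continuous_on {0..T} (\<lambda>t. ip2 \<mu> (g t) w)" by (rule G.H.cont_curve_ip[OF gc w(3)])
    have cy: "continuous_on {0..T} (\<lambda>t. ip2 \<mu> (y t) w)" by (rule G.H.cont_curve_ip[OF y(1) w(3)])
    have g1: "(\<integral>t. deriv \<phi> t * ip2 \<mu> (g t) w \<partial>tm T) = - (\<integral>t. \<phi> t * ipE (J (\<xi> t)) w \<partial>tm T)"
    proof (rule parts_scalar[OF T cg ij _ s\<phi> \<phi>0])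
      show "ip2 \<mu> (g t) w - ip2 \<mu> (g s) w = ti T s t (\<lambda>t. ipE (J (\<xi> t)) w)" if "0 \<le> s" "s \<le> t" "t \<le> T" for s t
        using time_derivative[OF T gc \<xi> w(1) that] G.H.cont_curve_mem[OF gc] that w(3) by (simp add: G.H.ip_diff_left)
    qed
    have y1: "(\<integral>t. deriv \<eta> t * ip2 \<mu> (y t) w \<partial>tm T) = - (\<integral>t. \<eta> t * ipE (f t - y t) w \<partial>tm T)"
    proof (rule parts_scalar[OF T cy iy _ s\<eta> \<eta>0])
      show "ip2 \<mu> (y t) w - ip2 \<mu> (y s) w = ti T s t (\<lambda>t. ipE (f t - y t) w)" if "0 \<le> s" "s \<le> t" "t \<le> T" for s t
        using y(4)[OF that w(1)] G.H.cont_curve_mem[OF y(1)] that w(3) by (simp add: G.H.ip_diff_left)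
    qed
    have I: "integrable (tm T) (\<lambda>t. deriv \<phi> t * ip2 \<mu> (g t) w)" "integrable (tm T) (\<lambda>t. deriv \<eta> t * ip2 \<mu> (y t) w)"
      "integrable (tm T) (\<lambda>t. \<eta> t * ip2 \<mu> (y t) w)" "integrable (tm T) (\<lambda>t. \<phi> t * ipE (J (\<xi> t)) w)"
      "integrable (tm T) (\<lambda>t. \<eta> t * ipE (f t - y t) w)"
      by (intro tm_mult_integrable cont tm_continuous_integrable cg cy ij iy)+
    have "(\<integral>t. deriv \<phi> t * ip2 \<mu> (u t) w \<partial>tm T) =
        (\<integral>t. deriv \<phi> t * ip2 \<mu> (g t) w + (deriv \<eta> t * ip2 \<mu> (y t) w - \<eta> t * ip2 \<mu> (y t) w) \<partial>tm T)"
    proof (rule tm_cong_AE(2)[symmetric])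
      show "(\<lambda>t. deriv \<phi> t * ip2 \<mu> (g t) w + (deriv \<eta> t * ip2 \<mu> (y t) w - \<eta> t * ip2 \<mu> (y t) w)) \<in> borel_measurable (tm T)"
        using Bochner_Integration.integrable_add[OF I(1) Bochner_Integration.integrable_diff[OF I(2,3)]] by simp
      show "AE t in tm T. deriv \<phi> t * ip2 \<mu> (g t) w + (deriv \<eta> t * ip2 \<mu> (y t) w - \<eta> t * ip2 \<mu> (y t) w) = deriv \<phi> t * ip2 \<mu> (u t) w"
        using AE_tm_space
      proof eventually_elim
        case (elim t)
        have m: "g t \<in> L2_space \<mu>" "y t \<in> L2_space \<mu>" using G.H.cont_curve_mem[OF gc] G.H.cont_curve_mem[OF y(1)] elim by auto
        have "ip2 \<mu> (u t) w = ip2 \<mu> (g t) w + exp t * ip2 \<mu> (y t) w"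
          unfolding u_def z_def G.H.ip_diff_left[OF m(1) G.H.scale_mem[OF m(2)] w(3)] G.H.ip_scale_left[OF m(2) w(3)] by simp
        then show ?case by (simp add: d\<eta> algebra_simps)
      qed
    qed
    also have "\<dots> = (\<integral>t. deriv \<phi> t * ip2 \<mu> (g t) w \<partial>tm T) + ((\<integral>t. deriv \<eta> t * ip2 \<mu> (y t) w \<partial>tm T) - (\<integral>t. \<eta> t * ip2 \<mu> (y t) w \<partial>tm T))"
      using I(1-3) by simp
    also have "\<dots> = - (\<integral>t. \<phi> t * ipE (J (\<xi> t)) w \<partial>tm T) + (- (\<integral>t. \<eta> t * ipE (f t - y t) w \<partial>tm T) - (\<integral>t. \<eta> t * ip2 \<mu> (y t) w \<partial>tm T))"
      unfolding g1 y1 ..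
    also have "\<dots> = (\<integral>t. - (\<phi> t * ipE (J (\<xi> t)) w) + (- (\<eta> t * ipE (f t - y t) w) - \<eta> t * ip2 \<mu> (y t) w) \<partial>tm T)"
      using I(3-5) by simp
    also have "\<dots> = (\<integral>t. \<phi> t * DD (u t) w \<partial>tm T)"
    proof (rule tm_cong_AE(2))
      show "(\<lambda>t. - (\<phi> t * ipE (J (\<xi> t)) w) + (- (\<eta> t * ipE (f t - y t) w) - \<eta> t * ip2 \<mu> (y t) w)) \<in> borel_measurable (tm T)"
        using Bochner_Integration.integrable_add[OF Bochner_Integration.integrable_minus[OF I(4)]
          Bochner_Integration.integrable_diff[OF Bochner_Integration.integrable_minus[OF I(5)] I(3)]] by simp
      show "AE t in tm T. - (\<phi> t * ipE (J (\<xi> t)) w) + (- (\<eta> t * ipE (f t - y t) w) - \<eta> t * ip2 \<mu> (y t) w) = \<phi> t * DD (u t) w"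
        using Vdual_AE[OF \<xi>'] E.B_mem[OF gE] G.V.B_mem[OF y(2)]
      proof eventually_elim
        case (elim t)
        note jm = J(1)[OF elim(1)] and am = A_mem[OF elim(2)]
        have yX: "y t \<in> X" using elim(3) by (rule H10_H1)
        have rt: "r t = J (\<xi> t) + A (g t)" by (simp add: r_def)
        have ra: "ipE (r t) w = ipE (J (\<xi> t)) w + DD (g t) w"
          unfolding rt G.V.ip_add_left[OF jm am w(1)] A_ip[OF elim(2) w(1)] ..
        have rm: "r t \<in> V" unfolding rt by (rule G.V.add_mem[OF jm am])
        have "ipE (f t - y t) w = - exp (- t) * (ipE (J (\<xi> t)) w + DD (g t) w) - ipE (y t) w"
          unfolding f_def G.V.ip_diff_left[OF G.V.scale_mem[OF rm] elim(3) w(1)] G.V.ip_scale_left[OF rm w(1)] ra ..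
        then have 1: "\<eta> t * ipE (f t - y t) w = - \<phi> t * (ipE (J (\<xi> t)) w + DD (g t) w) - \<eta> t * ipE (y t) w"
          by (simp add: \<eta>_def right_diff_distrib exp_minus)
        have 2: "DD (u t) w = DD (g t) w + exp t * (ipE (y t) w - ip2 \<mu> (y t) w)"
          unfolding DD_eq u_def z_def E.ip_diff_left[OF elim(2) E.scale_mem[OF yX] w(2)] E.ip_scale_left[OF yX w(2)]
            G.H.ip_diff_left[OF H1_L2[OF elim(2)] G.H.scale_mem[OF H1_L2[OF yX]] w(3)] G.H.ip_scale_left[OF H1_L2[OF yX] w(3)]
          by (simp add: algebra_simps)
        show ?case unfolding 1 2 by (simp add: \<eta>_def algebra_simps)
      qed
    qed
    finally show "(\<integral>t. deriv \<phi> t * ip2 \<mu> (u t) w \<partial>tm T) = (\<integral>t. \<phi> t * DD (u t) w \<partial>tm T)" .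
  qed
  then show thesis by (rule that[OF cl])
qed

end

theorem corollary1p4:
  fixes \<Omega> :: "'a::euclidean_space set" and T :: real and g :: "real \<Rightarrow> 'a \<Rightarrow> real"
  assumes "lipschitz_domain \<Omega>" and "bounded \<Omega>" and "0 < T"
    and "g \<in> L2_H1 \<Omega> T \<inter> C_H \<Omega> T"
    and "\<exists>\<xi>. has_time_derivative \<Omega> T g \<xi>"
  shows
    "(\<exists>u. variational_solution \<Omega> T g u \<and>
        (\<forall>w. variational_solution \<Omega> T g w \<longrightarrow> eq_C_H \<Omega> T w u)) \<and>
     (\<exists>u. energy_weak_solution \<Omega> T g u \<and>
        (\<forall>w. energy_weak_solution \<Omega> T g w \<longrightarrow> eq_C_H \<Omega> T w u)) \<and>
     (\<forall>u w. variational_solution \<Omega> T g u \<and> energy_weak_solution \<Omega> T g w \<longrightarrow> eq_C_H \<Omega> T u w) \<and>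
     (\<forall>u. distributional_weak_solution \<Omega> T g u \<longrightarrow> energy_weak_solution \<Omega> T g u) \<and>
     (\<forall>u. (distributional_weak_solution \<Omega> T g u \<longleftrightarrow> energy_weak_solution \<Omega> T g u) \<and>
          (energy_weak_solution \<Omega> T g u \<longleftrightarrow> variational_solution \<Omega> T g u))"
proof -
  interpret bounded_domain \<Omega>
    using assms(1,2) by unfold_locales (auto simp: lipschitz_domain_def)
  note T = \<open>0 < T\<close>

  obtain \<xi> where \<xi>: "has_time_derivative \<Omega> T g \<xi>" using assms(5) by blast
  obtain u where c: "u \<in> energy_class \<Omega> T g" and w: "weak_form T u"
    by (rule solution_exists[OF T assms(4) \<xi>]) (rule that)
  have energy_iff: "energy_weak_solution \<Omega> T g v \<longleftrightarrow> v \<in> energy_class \<Omega> T g \<and> weak_form T v" for v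
    using weak_form_energy[OF T] energy_weak_form[OF T] unfolding energy_weak_solution_def by blast
  have dist_iff: "distributional_weak_solution \<Omega> T g v \<longleftrightarrow> v \<in> energy_class \<Omega> T g \<and> weak_form T v" for v
    using weak_form_distributional[OF T] distributional_weak_form[OF T] unfolding distributional_weak_solution_def by blast
  \<comment> \<open>A variational solution does not come with an equation. It is first identified
    with the constructed \<open>u\<close>, from which it then inherits the weak form.\<close>
  have var_iff: "variational_solution \<Omega> T g v \<longleftrightarrow> v \<in> energy_class \<Omega> T g \<and> weak_form T v" for v
  proof
    assume v: "variational_solution \<Omega> T g v"
    then have cv: "v \<in> energy_class \<Omega> T g" unfolding variational_solution_def by blast
    show "v \<in> energy_class \<Omega> T g \<and> weak_form T v"
      using weak_form_cong[OF cv c w variational_unique[OF T v c w]] cv by blast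
  qed (use weak_form_variational[OF T] in blast)
  \<comment> \<open>Both solutions are compared with the constructed \<open>u\<close> at every
    time.\<close>
  have unique: "eq_C_H \<Omega> T v v'" if "variational_solution \<Omega> T g v" "variational_solution \<Omega> T g v'" for v v'
    unfolding eq_C_H_def
  proof
    fix t assume "t \<in> {0..T}"
    from variational_unique[OF T that(1) c w this] variational_unique[OF T that(2) c w this]
    show "AE x in \<mu>. v t x = v' t x" by eventually_elim simp
  qed
  have e: "energy_weak_solution \<Omega> T g v \<longleftrightarrow> variational_solution \<Omega> T g v"
    and d: "distributional_weak_solution \<Omega> T g v \<longleftrightarrow> variational_solution \<Omega> T g v" for v
    by (simp_all only: energy_iff dist_iff var_iff)
  have u: "variational_solution \<Omega> T g u" using c w by (simp add: var_iff)
  show ?thesis unfolding e d using u unique by blast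
qed

end
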